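(* Suppose that the correlation length condition (CL) holds. If we define $\xi^*(\beta)= \chi(\beta)^{1/\alpha}$ for each $0<\beta < \beta_c$ then \[\mathbb{P}_{\beta}(x \leftrightarrow y) \asymp \|x-y\|^{-d+\alpha} \left(1 \vee \frac{\|x-y\|}{\xi^*(\beta)}\right)^{-2\alpha}\] for every $\beta_c/2\leq \beta< \beta_c$ and distinct $x,y \in \mathbb{Z}^d$. As a consequence, $\xi_p(\beta) \asymp_p \xi^*(\beta)$ for all $0<p<\alpha$ and $\beta_c/2\leq \beta<\beta_c$.
   Context: Setting: fix an integer $d\geq 1$, a real $\alpha>0$, a norm $\|\cdot\|$ on $\mathbb{R}^d$, and a kernel of the form $J(x,y)=\mathbf{1}(x\neq y)J(\|x-y\|)$ for $x,y\in\mathbb{Z}^d$, where $J:(0,\infty)\to(0,\infty)$ is decreasing and differentiable, tends to $0$ at infinity (so that $J(x,y)\sim \mathrm{const.}\,\|x-y\|^{-d-\alpha}$), and satisfies $|J'(r)|=C(1+\delta_r)r^{-d-\alpha-1}$ for some constant $C>0$ and some measurable error function $r\mapsto\delta_r$ with $\delta_r\to0$ as $r\to\infty$ and $\int_{r_0}^\infty \frac{|\delta_r|}{r}\,dr<\infty$ for some $r_0<\infty$. Long-range percolation with parameter $\beta\ge 0$ is the random graph on $\mathbb{Z}^d$ in which each pair of distinct vertices $x,y$ is joined by an (open) edge independently with probability $1-e^{-\beta J(x,y)}$; $\mathbb{P}_\beta,\mathbb{E}_\beta$ denote its law and expectation. The critical point is $\beta_c=\inf\{\beta\ge0:\mathbb{P}_\beta(\text{there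 is an infinite cluster})>0\}$, where clusters are connected components. $K$ denotes the cluster of the origin, $\{x\leftrightarrow y\}$ is the event that $x$ and $y$ are in the same cluster, and $\chi(\beta)=\mathbb{E}_\beta|K|$. Cut-off measures: for $0<r<\infty$ let $J_r(x,y)=\mathbf{1}(x\neq y,\|x-y\|\le r)\int_{\|x-y\|}^r|J'(s)|\,ds$, and let $\mathbb{P}_{\beta,r},\mathbb{E}_{\beta,r}$ denote the law and expectation of long-range percolation with kernel $J_r$ at parameter $\beta$; for $r=\infty$, $\mathbb{P}_{\beta,\infty}=\mathbb{P}_\beta$. $\beta_c$ always denotes the critical point of the original kernel $J$. For $p>0$ define the $L^p$ radius of gyration $\xi_p(\beta,r)=\left[\mathbb{E}_{\beta,r}\left[\sum_{x\in K}\|x\|_2^p\right]/\mathbb{E}_{\beta,r}|K|\right]^{1/p}$, and $\xi_p(\beta)=\xi_p(\beta,\infty)$. Condition (CL): $\beta_c<\infty$ and for each $p>0$ there exists a constant $C_p<\infty$ such that $\xi_p(\beta_c,r)\le C_p r$ for every $r\ge1$. The notation $\asymp$ means equality up to positive multiplicative constants depending only on $d$, $\alpha$, and the kernel $J$ (including the norm), and in particular not on $\beta,x,y$; $\asymp_p$ means that the constants may additionally depend on $p$. $a\vee b=\max\{a,b\}$. *)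

theory Defs
  imports "HOL-Probability.Probability"
begin

section \<open>Kernels on the integer lattice\<close>

text \<open>The dimension is \<open>d = CARD('n)\<close>; lattice points have type \<open>int ^ 'n\<close>.\<close>

definition of_lattice :: "int ^ 'n \<Rightarrow> real ^ 'n" where
  "of_lattice x = (\<chi> i. real_of_int (x $ i))"

definition is_norm :: "(real ^ 'n \<Rightarrow> real) \<Rightarrow> bool" where
  "is_norm N \<longleftrightarrow>
     (\<forall>v. 0 \<le> N v) \<and> (\<forall>v. N v = 0 \<longleftrightarrow> v = 0) \<and>
     (\<forall>c v. N (c *\<^sub>R v) = \<bar>c\<bar> * N v) \<and> (\<forall>v w. N (v + w) \<le> N v + N w)"

definition lattice_dist :: "(real ^ 'n \<Rightarrow> real) \<Rightarrow> int ^ 'n \<Rightarrow> int ^ 'n \<Rightarrow> real" where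
  "lattice_dist N x y = N (of_lattice x - of_lattice y)"

text \<open>Only the values of \<open>J\<close> and \<open>\<delta>\<close> on the positive reals matter.\<close>

definition regular_profile :: "nat \<Rightarrow> real \<Rightarrow> (real \<Rightarrow> real) \<Rightarrow> bool" where
  "regular_profile d \<alpha> J \<longleftrightarrow>
     (\<forall>r>0. J r > 0) \<and>
     antimono_on {0<..} J \<and>
     (\<forall>r>0. J differentiable (at r)) \<and>
     (J \<longlongrightarrow> 0) at_top \<and>
     (\<exists>C>0. \<exists>\<delta> :: real \<Rightarrow> real.
        (\<forall>r>0. \<bar>deriv J r\<bar> = C * (1 + \<delta> r) * r powr (- real d - \<alpha> - 1)) \<and>
        set_borel_measurable borel {0<..} \<delta> \<and>
        (\<delta> \<longlongrightarrow> 0) at_top \<and>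
        (\<exists>r0>0. (\<integral>\<^sup>+ r\<in>{r0..}. ennreal (\<bar>\<delta> r\<bar> / r) \<partial>lborel) < \<infinity>))"

definition lrp_kernel ::
  "(real ^ 'n \<Rightarrow> real) \<Rightarrow> (real \<Rightarrow> real) \<Rightarrow> int ^ 'n \<Rightarrow> int ^ 'n \<Rightarrow> real" where
  "lrp_kernel N J x y = (if x \<noteq> y then J (lattice_dist N x y) else 0)"

definition cutoff_kernel ::
  "(real ^ 'n \<Rightarrow> real) \<Rightarrow> (real \<Rightarrow> real) \<Rightarrow> real \<Rightarrow> int ^ 'n \<Rightarrow> int ^ 'n \<Rightarrow> real" where
  "cutoff_kernel N J r x y =
     (if x \<noteq> y \<and> lattice_dist N x y \<le> r
      then (LINT s : {lattice_dist N x y..r} | lborel. \<bar>deriv J s\<bar>) else 0)"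


section \<open>Long-range percolation\<close>

definition edges :: "'v set set" where
  "edges = {{x, y} | x y. x \<noteq> y}"

text \<open>Well defined because the kernels in use are symmetric.\<close>

definition edge_weight :: "('v \<Rightarrow> 'v \<Rightarrow> real) \<Rightarrow> 'v set \<Rightarrow> real" where
  "edge_weight k e = (THE w. \<exists>x y. e = {x, y} \<and> w = k x y)"

definition percolation :: "real \<Rightarrow> ('v \<Rightarrow> 'v \<Rightarrow> real) \<Rightarrow> ('v set \<Rightarrow> bool) measure" where
  "percolation \<beta> k =
     (\<Pi>\<^sub>M e\<in>edges. measure_pmf (bernoulli_pmf (1 - exp (- \<beta> * edge_weight k e))))"

definition connected_in :: "('v set \<Rightarrow> bool) \<Rightarrow> 'v \<Rightarrow> 'v \<Rightarrow> bool" where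
  "connected_in \<omega> x y \<longleftrightarrow> (x, y) \<in> {(u, v). u \<noteq> v \<and> \<omega> {u, v}}\<^sup>*"

definition cluster :: "('v set \<Rightarrow> bool) \<Rightarrow> 'v \<Rightarrow> 'v set" where
  "cluster \<omega> x = {y. connected_in \<omega> x y}"

definition two_point :: "real \<Rightarrow> ('v \<Rightarrow> 'v \<Rightarrow> real) \<Rightarrow> 'v \<Rightarrow> 'v \<Rightarrow> real" where
  "two_point \<beta> k x y =
     measure (percolation \<beta> k) {\<omega> \<in> space (percolation \<beta> k). connected_in \<omega> x y}"

definition percolates :: "real \<Rightarrow> ('v \<Rightarrow> 'v \<Rightarrow> real) \<Rightarrow> bool" where
  "percolates \<beta> k \<longleftrightarrow>
     measure (percolation \<beta> k)
       {\<omega> \<in> space (percolation \<beta> k). \<exists>x. infinite (cluster \<omega> x)} > 0"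

text \<open>The critical point is \<open>\<infinity>\<close> if there is no percolation at any \<open>\<beta>\<close>.\<close>

definition critical_point :: "('v \<Rightarrow> 'v \<Rightarrow> real) \<Rightarrow> ennreal" where
  "critical_point k = (INF \<beta>\<in>{\<beta>. 0 \<le> \<beta> \<and> percolates \<beta> k}. ennreal \<beta>)"

definition susceptibility :: "real \<Rightarrow> (int ^ 'n \<Rightarrow> int ^ 'n \<Rightarrow> real) \<Rightarrow> ennreal" where
  "susceptibility \<beta> k =
     (\<integral>\<^sup>+ \<omega>. emeasure (count_space UNIV) (cluster \<omega> 0) \<partial>percolation \<beta> k)"

text \<open>Powers of extended nonnegative reals, for positive exponents only.\<close>

definition ennreal_power :: "ennreal \<Rightarrow> real \<Rightarrow> ennreal" where
  "ennreal_power x a = (if x = \<infinity> then \<infinity> else ennreal (enn2real x powr a))"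

text \<open>The radius of gyration uses the Euclidean norm, whatever norm enters the kernel.
  The convention \<open>\<infinity> / \<infinity> = 0\<close> of \<^typ>\<open>ennreal\<close> is immaterial: below \<open>\<beta>\<^sub>c\<close>, and at
  \<open>\<beta>\<^sub>c\<close> for the cut-off kernels, the denominator is finite by sharpness of the phase
  transition.\<close>

definition gyration_radius :: "real \<Rightarrow> real \<Rightarrow> (int ^ 'n \<Rightarrow> int ^ 'n \<Rightarrow> real) \<Rightarrow> ennreal" where
  "gyration_radius p \<beta> k =
     ennreal_power
       ((\<integral>\<^sup>+ \<omega>. (\<integral>\<^sup>+ x\<in>cluster \<omega> 0. ennreal (norm (of_lattice x) powr p) \<partial>count_space UNIV)
           \<partial>percolation \<beta> k)
        / susceptibility \<beta> k)
       (1 / p)"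

definition CL :: "(real ^ 'n \<Rightarrow> real) \<Rightarrow> (real \<Rightarrow> real) \<Rightarrow> bool" where
  "CL N J \<longleftrightarrow>
     critical_point (lrp_kernel N J) < \<infinity> \<and>
     (\<forall>p>0. \<exists>C::real. \<forall>r\<ge>1.
        gyration_radius p (enn2real (critical_point (lrp_kernel N J))) (cutoff_kernel N J r)
          \<le> ennreal (C * r))"

definition xi_star :: "real \<Rightarrow> real \<Rightarrow> (int ^ 'n \<Rightarrow> int ^ 'n \<Rightarrow> real) \<Rightarrow> ennreal" where
  "xi_star \<alpha> \<beta> k = ennreal_power (susceptibility \<beta> k) (1 / \<alpha>)"

text \<open>Since the susceptibility is at least 1, so is \<^const>\<open>xi_star\<close>; hence the maximum below is finite.\<close>

definition two_point_profile ::
  "(real ^ 'n \<Rightarrow> real) \<Rightarrow> (real \<Rightarrow> real) \<Rightarrow> real \<Rightarrow> real \<Rightarrow> int ^ 'n \<Rightarrow> int ^ 'n \<Rightarrow> real" where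
  "two_point_profile N J \<alpha> \<beta> x y =
     lattice_dist N x y powr (- real CARD('n) + \<alpha>)
     * enn2real (max 1 (ennreal (lattice_dist N x y) / xi_star \<alpha> \<beta> (lrp_kernel N J))) powr (- 2 * \<alpha>)"

end

theory Submission
  imports Defs
begin

text \<open>
  Everything is reduced to finite graphs.  Splitting the weights of the edges as a sum of two parts
  amounts to taking the union of two independent configurations; the van den Berg--Kesten inequality
  then gives a Simon--Lieb inequality for the two-point function of the sum.

  The decisive step is that at criticality the susceptibility of the cut-off measure satisfies
  \<open>\<chi>(\<beta>\<^sub>c, r) \<le> M r\<^sup>\<alpha>\<close>.  If this fails at some scale at which the susceptibility grows at most by a fixed
  power, then by tightness of the size of the largest cluster in a window (a large cluster splits into
  two disjointly occurring large pieces) either the large clusters of a window merge as soon as the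
  cut-off is increased, which makes the susceptibility too large, or they are so large that
  the clusters of a long chain of windows merge, which contradicts (CL).

  The upper bounds on the two-point function follow by iterating the Simon--Lieb inequality over scales.
  For the lower bound the clusters of the two points at cut-off \<open>min \<xi>\<^sup>* \<parallel>x - y\<parallel>\<close> are
  joined by one of the remaining edges.
\<close>
section \<open>Independent edges\<close>

text \<open>The obstacle is that (CL) concerns critical cut-off measures, for which not even a
  finite expected cluster size is known at the outset. Cutting off at \<open>r\<close> lowers every
  weight by a factor bounded away from 1, so the critical cut-off measure is dominated by an uncut
  subcritical one, and sharpness makes its susceptibility finite. Only then does Markov's inequality
  turn (CL) into tail bounds of every polynomial order. A high order is needed: gluing a chain of
  \<open>L\<close> windows costs a factor of order up to \<open>L ^ 4\<close>, which a tail of order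
  5 beats. Scales of moderate growth always exist: the tails confine the mass at cut-off
  \<open>r\<close> to a ball of radius of order \<open>r\<close>, so the susceptibility is at most
  of order \<open>r powr d\<close>, whereas the growth allowed over a factor \<open>B\<close> is
  \<open>B powr (d + \<alpha>)\<close>. Below criticality (CL) says nothing; there the tails come by
  monotonicity from the critical cut-off measure, and the bound \<open>M * r powr \<alpha>\<close>
  makes this comparison sharp up to constants for \<open>r\<close> up to the correlation
  length.\<close>

definition pmean :: "'e set \<Rightarrow> ('e \<Rightarrow> real) \<Rightarrow> ('e set \<Rightarrow> real) \<Rightarrow> real" where
  "pmean E w f = (\<Sum>S\<in>Pow E. (\<Prod>e\<in>S. 1 - exp (- w e)) * (\<Prod>e\<in>E - S. exp (- w e)) * f S)"

abbreviation pprob :: "'e set \<Rightarrow> ('e \<Rightarrow> real) \<Rightarrow> ('e set \<Rightarrow> bool) \<Rightarrow> real" where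
  "pprob E w A \<equiv> pmean E w (\<lambda>S. of_bool (A S))"

lemma pmean_cong:
  assumes "E = E'" "\<And>e. e \<in> E' \<Longrightarrow> w e = w' e" "\<And>S. S \<subseteq> E' \<Longrightarrow> f S = g S"
  shows "pmean E w f = pmean E' w' g"
proof -
  have "(\<Prod>e\<in>S. 1 - exp (- w e)) = (\<Prod>e\<in>S. 1 - exp (- w' e))"
    "(\<Prod>e\<in>E' - S. exp (- w e)) = (\<Prod>e\<in>E' - S. exp (- w' e))" if "S \<subseteq> E'" for S
    using that by (auto intro!: prod.cong simp: assms(2) subset_iff)
  then show ?thesis unfolding pmean_def assms(1)
    by (intro sum.cong) (auto simp: assms)
qed

lemma pmean_empty [simp]: "pmean {} w f = f {}"
  by (simp add: pmean_def)

text \<open>Conditioning on the state of one edge. The inductions over edge sets below all run on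
  this recursion.\<close>

lemma pmean_insert:
  assumes "finite E" "e \<notin> E"
  shows "pmean (insert e E) w f =
    exp (- w e) * pmean E w f + (1 - exp (- w e)) * pmean E w (\<lambda>S. f (insert e S))"
proof -
  have inj: "inj_on (insert e) (Pow E)" using assms by (auto simp: inj_on_def)
  have dis: "Pow E \<inter> insert e ` Pow E = {}" using assms by auto
  let ?g = "\<lambda>S. (\<Prod>e\<in>S. 1 - exp (- w e)) * (\<Prod>e\<in>insert e E - S. exp (- w e)) * f S"
  have "pmean (insert e E) w f = sum ?g (Pow E) + sum ?g (insert e ` Pow E)"
    unfolding pmean_def Pow_insert using assms dis by (intro sum.union_disjoint) auto
  also have "sum ?g (insert e ` Pow E) = (\<Sum>S\<in>Pow E. ?g (insert e S))"
    using inj by (simp add: sum.reindex)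
  also have "\<dots> = (1 - exp (- w e)) * pmean E w (\<lambda>S. f (insert e S))"
    unfolding pmean_def sum_distrib_left
  proof (intro sum.cong refl)
    fix S assume "S \<in> Pow E"
    then have "e \<notin> S" "finite S" "insert e E - insert e S = E - S" using assms by (auto intro: finite_subset)
    then show "?g (insert e S) = (1 - exp (- w e)) *
      ((\<Prod>e\<in>S. 1 - exp (- w e)) * (\<Prod>e\<in>E - S. exp (- w e)) * f (insert e S))" by simp
  qed
  also have "sum ?g (Pow E) = exp (- w e) * pmean E w f"
    unfolding pmean_def sum_distrib_left
  proof (intro sum.cong refl)
    fix S assume "S \<in> Pow E"
    then have "insert e E - S = insert e (E - S)" "e \<notin> E - S" "finite (E - S)" using assms by auto
    then show "?g S = exp (- w e) *
      ((\<Prod>e\<in>S. 1 - exp (- w e)) * (\<Prod>e\<in>E - S. exp (- w e)) * f S)" by simp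
  qed
  finally show ?thesis .
qed

lemma pmean_add: "pmean E w (\<lambda>S. f S + g S) = pmean E w f + pmean E w g"
  by (simp add: pmean_def algebra_simps sum.distrib)

lemma pmean_cmult: "pmean E w (\<lambda>S. c * f S) = c * pmean E w f"
  by (simp add: pmean_def algebra_simps sum_distrib_left)

lemma pmean_diff: "pmean E w (\<lambda>S. f S - g S) = pmean E w f - pmean E w g"
  by (simp add: pmean_def algebra_simps sum_subtractf)

lemma pmean_sum: "pmean E w (\<lambda>S. \<Sum>i\<in>I. f i S) = (\<Sum>i\<in>I. pmean E w (f i))"
  unfolding pmean_def sum_distrib_left by (rule sum.swap)

lemma pmean_const [simp]:
  assumes "finite E"
  shows "pmean E w (\<lambda>_. c) = c"
  using assms by (induction E) (auto simp: pmean_insert algebra_simps)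

lemma pmean_mono:
  assumes "\<And>e. e \<in> E \<Longrightarrow> 0 \<le> w e" "\<And>S. S \<subseteq> E \<Longrightarrow> f S \<le> g S"
  shows "pmean E w f \<le> pmean E w g"
  unfolding pmean_def
proof (rule sum_mono)
  fix S assume S: "S \<in> Pow E"
  have "0 \<le> (\<Prod>e\<in>S. 1 - exp (- w e))" "0 \<le> (\<Prod>e\<in>E - S. exp (- w e))"
    using S assms(1) by (auto intro!: prod_nonneg)
  then show "(\<Prod>e\<in>S. 1 - exp (- w e)) * (\<Prod>e\<in>E - S. exp (- w e)) * f S
     \<le> (\<Prod>e\<in>S. 1 - exp (- w e)) * (\<Prod>e\<in>E - S. exp (- w e)) * g S"
    using assms(2)[of S] S by (intro mult_left_mono) auto
qed

lemma pmean_nonneg: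
  assumes "\<And>e. e \<in> E \<Longrightarrow> 0 \<le> w e" "\<And>S. S \<subseteq> E \<Longrightarrow> 0 \<le> f S"
  shows "0 \<le> pmean E w f"
  using pmean_mono[of E w "\<lambda>_. 0" f] assms by (simp add: pmean_def)

lemma pprob_le_1:
  assumes "finite E" "\<And>e. e \<in> E \<Longrightarrow> 0 \<le> w e"
  shows "pprob E w A \<le> 1"
  using pmean_mono[of E w "\<lambda>S. of_bool (A S)" "\<lambda>_. 1"] assms by simp

lemma pmean_Un:
  assumes "finite E" "finite E'" "E \<inter> E' = {}"
  shows "pmean (E \<union> E') w f = pmean E w (\<lambda>S. pmean E' w (\<lambda>S'. f (S \<union> S')))"
  using assms(1,3)
proof (induction E arbitrary: f)
  case (insert e E)
  have "pmean (insert e E \<union> E') w f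
      = exp (- w e) * pmean (E \<union> E') w f + (1 - exp (- w e)) * pmean (E \<union> E') w (\<lambda>S. f (insert e S))"
    using insert assms(2) by (subst pmean_insert[symmetric]) auto
  then show ?case using insert by (simp add: pmean_insert)
qed simp

lemma pmean_restrict:
  assumes "finite E" "E' \<subseteq> E" "\<And>S. S \<subseteq> E \<Longrightarrow> f S = f (S \<inter> E')"
  shows "pmean E w f = pmean E' w f"
proof -
  have "pmean E w f = pmean (E' \<union> (E - E')) w f" using assms by (simp add: Un_absorb1)
  also have "\<dots> = pmean E' w (\<lambda>S. pmean (E - E') w (\<lambda>S'. f (S \<union> S')))"
    using assms by (intro pmean_Un) (auto intro: finite_subset)
  also have "\<dots> = pmean E' w (\<lambda>S. pmean (E - E') w (\<lambda>S'. f S))"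
  proof (intro pmean_cong refl)
    fix S S' assume "S \<subseteq> E'" "S' \<subseteq> E - E'"
    then have "S \<union> S' \<subseteq> E" "(S \<union> S') \<inter> E' = S" using assms(2) by auto
    then show "f (S \<union> S') = f S" using assms(3) by metis
  qed
  finally show ?thesis using assms(1) by simp
qed

lemma pmean_image:
  assumes "finite E" "inj_on h E"
  shows "pmean (h ` E) w f = pmean E (\<lambda>e. w (h e)) (\<lambda>S. f (h ` S))"
  using assms
proof (induction E arbitrary: f)
  case (insert e E)
  then have "h e \<notin> h ` E" by (auto simp: inj_on_def)
  then show ?case using insert by (simp add: pmean_insert)
qed simp

text \<open>An edge is missing from the union of two independent configurations with probability
  \<open>exp (- w e) * exp (- w' e)\<close>. This additivity is the reason for describing edge
  probabilities by weights.\<close>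

lemma pmean_superpose:
  assumes "finite E"
  shows "pmean E (\<lambda>e. w e + w' e) f = pmean E w (\<lambda>S. pmean E w' (\<lambda>S'. f (S \<union> S')))"
  using assms
proof (induction E arbitrary: f)
  case (insert e E)
  define a b where "a = exp (- w e)" "b = exp (- w' e)"
  have ab: "exp (- (w e + w' e)) = a * b" by (simp add: exp_add[symmetric] a_b_def)
  let ?m = "\<lambda>g. pmean E w (\<lambda>S. pmean E w' (\<lambda>S'. g (S \<union> S')))" and ?f = "\<lambda>S. f (insert e S)"
  have "pmean (insert e E) (\<lambda>e. w e + w' e) f = a * b * ?m f + (1 - a * b) * ?m ?f"
    using insert by (simp only: pmean_insert insert.IH ab not_False_eq_True)
  also have "\<dots> = a * (b * ?m f + (1 - b) * ?m ?f) + (1 - a) * (b * ?m ?f + (1 - b) * ?m ?f)"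
    by (simp add: algebra_simps)
  also have "\<dots> = pmean (insert e E) w (\<lambda>S. pmean (insert e E) w' (\<lambda>S'. f (S \<union> S')))"
    using insert(1,2) by (simp add: pmean_insert a_b_def[symmetric] pmean_add pmean_cmult) (simp add: algebra_simps)
  finally show ?case .
qed simp

text \<open>Monotone coupling: a configuration of the larger weight is one of weight
  \<open>w\<close> together with an independent one of weight \<open>w' e - w e\<close>.\<close>

lemma pmean_mono_weight:
  assumes "finite E" "\<And>e. e \<in> E \<Longrightarrow> 0 \<le> w e" "\<And>e. e \<in> E \<Longrightarrow> w e \<le> w' e" "mono f"
  shows "pmean E w f \<le> pmean E w' f"
proof -
  have "pmean E w f = pmean E w (\<lambda>S. pmean E (\<lambda>e. w' e - w e) (\<lambda>S'. f S))" using assms(1) by simp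
  also have "\<dots> \<le> pmean E w (\<lambda>S. pmean E (\<lambda>e. w' e - w e) (\<lambda>S'. f (S \<union> S')))"
    using assms by (intro pmean_mono monoD[OF assms(4)]) auto
  also have "\<dots> = pmean E (\<lambda>e. w e + (w' e - w e)) f" using assms(1) by (rule pmean_superpose[symmetric])
  finally show ?thesis by simp
qed

text \<open>Once the other edges are averaged out, the last edge contributes the covariance
  \<open>p * (1 - p)\<close> times the product of two increments, one for each function. Both
  increments are nonnegative, because opening an edge can only increase an increasing
  function.\<close>

lemma harris:
  assumes "finite E" "\<And>e. e \<in> E \<Longrightarrow> 0 \<le> w e" "mono f" "mono g"
  shows "pmean E w f * pmean E w g \<le> pmean E w (\<lambda>S. f S * g S)"
  using assms
proof (induction E arbitrary: f g)
  case (insert e E)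
  define p where "p = exp (- w e)"
  have p: "0 \<le> p" "p \<le> 1" using insert by (auto simp: p_def)
  have mono': "mono (\<lambda>S. h (insert e S))" if "mono h" for h :: "'a set \<Rightarrow> real"
    by (intro monoI) (rule monoD[OF that], auto)
  let ?f = "\<lambda>S. f (insert e S)" and ?g = "\<lambda>S. g (insert e S)"
  have le: "pmean E w f \<le> pmean E w ?f" "pmean E w g \<le> pmean E w ?g"
    by (rule pmean_mono, use insert.prems in simp, rule monoD, use insert.prems in auto)+
  have "0 \<le> p * (1 - p) * ((pmean E w ?f - pmean E w f) * (pmean E w ?g - pmean E w g))"
    using p le by (intro mult_nonneg_nonneg) auto
  then have "(p * pmean E w f + (1 - p) * pmean E w ?f) * (p * pmean E w g + (1 - p) * pmean E w ?g)
    \<le> p * (pmean E w f * pmean E w g) + (1 - p) * (pmean E w ?f * pmean E w ?g)"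
    by (simp add: algebra_simps power2_eq_square)
  also have "\<dots> \<le> p * pmean E w (\<lambda>S. f S * g S) + (1 - p) * pmean E w (\<lambda>S. ?f S * ?g S)"
    using p insert mono' by (intro add_mono mult_left_mono insert.IH) auto
  finally show ?case using insert by (simp add: pmean_insert p_def)
qed simp

section \<open>Increasing events and their disjoint occurrence\<close>

definition increasing :: "('e set \<Rightarrow> bool) \<Rightarrow> bool" where
  "increasing A \<longleftrightarrow> (\<forall>S T. A S \<longrightarrow> S \<subseteq> T \<longrightarrow> A T)"

text \<open>For increasing events a witness is any set of open edges on which the event already
  holds, so closed edges need not be recorded.\<close>

definition disjointly :: "('e set \<Rightarrow> bool) \<Rightarrow> ('e set \<Rightarrow> bool) \<Rightarrow> 'e set \<Rightarrow> bool" where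
  "disjointly A B S \<longleftrightarrow> (\<exists>I J. I \<inter> J = {} \<and> I \<union> J \<subseteq> S \<and> A I \<and> B J)"

lemma increasing_mono: "increasing A \<Longrightarrow> mono (\<lambda>S. of_bool (A S) :: real)"
  unfolding increasing_def mono_def by auto

lemma increasing_disjointly: "increasing (disjointly A B)"
  unfolding increasing_def disjointly_def by (meson subset_trans)

lemma increasingD: "increasing A \<Longrightarrow> A S \<Longrightarrow> S \<subseteq> T \<Longrightarrow> A T"
  unfolding increasing_def by blast

lemma increasing_insert:
  assumes "increasing A"
  shows "increasing (\<lambda>S. A (insert e S))"
  unfolding increasing_def
proof (intro allI impI)
  fix S T assume "A (insert e S)" "S \<subseteq> T"
  then show "A (insert e T)" using increasingD[OF assms, of "insert e S" "insert e T"] by auto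
qed

lemma disjointlyI: "A I \<Longrightarrow> B J \<Longrightarrow> I \<inter> J = {} \<Longrightarrow> I \<union> J \<subseteq> S \<Longrightarrow> disjointly A B S"
  unfolding disjointly_def by blast

lemma disjointlyE:
  assumes "disjointly A B S"
  obtains I J where "I \<inter> J = {}" "I \<union> J \<subseteq> S" "A I" "B J"
  using assms unfolding disjointly_def by (elim exE conjE)

text \<open>Induction on the edges. An open edge \<open>e\<close> can serve only one of the two
  witnesses. This bounds the conditional probability \<open>u\<close> of disjoint occurrence given
  that \<open>e\<close> is open in two ways, \<open>u1\<close> and \<open>u2\<close>, and a suitable
  mixture of the two suffices for either bias of \<open>e\<close>.\<close>

theorem van_den_berg_kesten:
  assumes "finite E" "\<And>e. e \<in> E \<Longrightarrow> 0 \<le> w e" "increasing A" "increasing B"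
  shows "pprob E w (disjointly A B) \<le> pprob E w A * pprob E w B"
  using assms
proof (induction E arbitrary: A B)
  case empty
  then show ?case by (auto simp: disjointly_def)
next
  case (insert e E)
  define q where "q = exp (- w e)"
  have q: "0 \<le> q" "q \<le> 1" using insert by (auto simp: q_def)
  define A1 where "A1 S = A (insert e S)" for S
  define B1 where "B1 S = B (insert e S)" for S
  have inc: "increasing A1" "increasing B1"
    unfolding A1_def B1_def by (rule increasing_insert, rule insert.prems)+
  have A1: "A S \<Longrightarrow> A1 S" and B1: "B S \<Longrightarrow> B1 S" for S
    unfolding A1_def B1_def
    by (erule increasingD[OF insert.prems(2)] increasingD[OF insert.prems(3)], rule subset_insertI)+
  define a0 a1 b0 b1 where "a0 = pprob E w A" "a1 = pprob E w A1" "b0 = pprob E w B" "b1 = pprob E w B1"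
  note ab = this
  have le: "a0 \<le> a1" "b0 \<le> b1" 
    unfolding ab by (rule pmean_mono, use insert.prems A1 B1 in auto)+
  define x where "x = pprob E w (disjointly A B)"
  define u where "u = pprob E w (\<lambda>S. disjointly A B (insert e S))"
  \<comment> \<open>A witness containing \<open>e\<close> gives it up, and its event is replaced by
    the version in which \<open>e\<close> is open. The other witness does not contain
    \<open>e\<close>.\<close>
  have split: "disjointly A1 B S \<or> disjointly A B1 S"
    if d: "disjointly A B (insert e S)" and "e \<notin> S" for S
  proof -
    obtain I J where IJ: "I \<inter> J = {}" "I \<union> J \<subseteq> insert e S" "A I" "B J"
      by (rule disjointlyE[OF d])
    show ?thesis
    proof (cases "e \<in> J")
      case True
      then have "B1 (J - {e})" unfolding B1_def using IJ(4) by (simp add: insert_absorb)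
      moreover have "I \<inter> (J - {e}) = {}" "I \<union> (J - {e}) \<subseteq> S" using True IJ(1,2) by blast+
      ultimately show ?thesis using IJ(3) disjointlyI[of A I B1 "J - {e}" S] by simp
    next
      case False
      have "A (insert e (I - {e}))" by (rule increasingD[OF insert.prems(2) IJ(3)]) auto
      then have "A1 (I - {e})" unfolding A1_def .
      moreover have "(I - {e}) \<inter> J = {}" "(I - {e}) \<union> J \<subseteq> S" using False IJ(1,2) by blast+
      ultimately show ?thesis using IJ(4) disjointlyI[of A1 "I - {e}" B J S] by simp
    qed
  qed
  \<comment> \<open>Disjoint occurrence on \<open>S\<close> alone implies both events on the right
    of \<open>split\<close>, so its indicator can be subtracted once from the sum of the
    two.\<close>
  have u1: "u \<le> a1 * b0 + a0 * b1 - x"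
  proof -
    have "u \<le> pmean E w (\<lambda>S. of_bool (disjointly A1 B S) + of_bool (disjointly A B1 S)
        - of_bool (disjointly A B S))"
      unfolding u_def
    proof (rule pmean_mono)
      fix S assume "S \<subseteq> E"
      then have "e \<notin> S" using insert by auto
      moreover have "disjointly A B S \<Longrightarrow> disjointly A1 B S \<and> disjointly A B1 S"
        using A1 B1 unfolding disjointly_def by blast
      moreover have "disjointly A B S \<Longrightarrow> disjointly A B (insert e S)"
        using increasing_disjointly unfolding increasing_def by blast
      ultimately show "of_bool (disjointly A B (insert e S)) \<le> (of_bool (disjointly A1 B S) + of_bool (disjointly A B1 S)
        - of_bool (disjointly A B S) :: real)"
        using split[of S] by (auto simp: of_bool_def)
    qed (use insert.prems in auto)
    also have "\<dots> = pprob E w (disjointly A1 B) + pprob E w (disjointly A B1) - x"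
      by (simp add: pmean_add pmean_diff x_def)
    also have "\<dots> \<le> a1 * b0 + a0 * b1 - x"
      unfolding ab using insert.prems inc
      by (intro add_mono diff_mono insert.IH order_refl) simp_all
    finally show ?thesis .
  qed
  have u2: "u \<le> a1 * b1"
  proof -
    have "u \<le> pprob E w (disjointly A1 B1)" unfolding u_def
    proof (rule pmean_mono)
      fix S assume "S \<subseteq> E"
      then have "e \<notin> S" using insert by auto
      then have "disjointly A B (insert e S) \<Longrightarrow> disjointly A1 B1 S"
        using split[of S] A1 B1 unfolding disjointly_def by blast
      then show "of_bool (disjointly A B (insert e S)) \<le> (of_bool (disjointly A1 B1 S) :: real)" by auto
    qed (use insert.prems in auto)
    also have "\<dots> \<le> a1 * b1" unfolding ab using insert.prems inc by (intro insert.IH) simp_all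
    finally show ?thesis .
  qed
  have x: "x \<le> a0 * b0" unfolding x_def ab using insert.prems by (intro insert.IH) simp_all
  \<comment> \<open>If \<open>e\<close> is closed with probability at least 1/2, then
    \<open>u1\<close> alone suffices because the coefficient \<open>2 * q - 1\<close> of
    \<open>x\<close> is nonnegative. Otherwise \<open>u1\<close> is used with weight
    \<open>q\<close> and \<open>u2\<close> with weight \<open>1 - 2 * q\<close>. In both cases the
    defect is a square times \<open>(a1 - a0) * (b1 - b0)\<close>.\<close>
  have "q * x + (1 - q) * u \<le> (q * a0 + (1 - q) * a1) * (q * b0 + (1 - q) * b1)"
  proof -
    have pos: "0 \<le> (a1 - a0) * (b1 - b0)" using le by simp
    show ?thesis
    proof (cases "1 - q \<le> 1 / 2")
      case True
      have "q * x + (1 - q) * u \<le> q * x + (1 - q) * (a1 * b0 + a0 * b1 - x)"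
        using u1 q by (intro add_left_mono mult_left_mono) auto
      also have "\<dots> = (2 * q - 1) * x + (1 - q) * (a1 * b0 + a0 * b1)" by (simp add: algebra_simps)
      also have "\<dots> \<le> (2 * q - 1) * (a0 * b0) + (1 - q) * (a1 * b0 + a0 * b1)"
        using x True by (intro add_right_mono mult_left_mono) auto
      also have "\<dots> \<le> (2 * q - 1) * (a0 * b0) + (1 - q) * (a1 * b0 + a0 * b1)
          + (1 - q)\<^sup>2 * ((a1 - a0) * (b1 - b0))" using pos by simp
      also have "\<dots> = (q * a0 + (1 - q) * a1) * (q * b0 + (1 - q) * b1)"
        by (simp add: algebra_simps power2_eq_square)
      finally show ?thesis .
    next
      case False
      have "q * x + (1 - q) * u = q * (x + u) + (1 - 2 * q) * u" by (simp add: algebra_simps)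
      also have "\<dots> \<le> q * (a1 * b0 + a0 * b1) + (1 - 2 * q) * (a1 * b1)"
        by (rule add_mono[OF mult_left_mono mult_left_mono[OF u2]]) (use u1 False q in simp_all)
      also have "\<dots> \<le> q * (a1 * b0 + a0 * b1) + (1 - 2 * q) * (a1 * b1)
          + q\<^sup>2 * ((a1 - a0) * (b1 - b0))" using pos by simp
      also have "\<dots> = (q * a0 + (1 - q) * a1) * (q * b0 + (1 - q) * b1)"
        by (simp add: algebra_simps power2_eq_square)
      finally show ?thesis .
    qed
  qed
  then show ?case
    using insert(1,2) by (simp add: pmean_insert q_def x_def u_def ab A1_def B1_def)
qed

section \<open>Percolation on finite graphs\<close>

definition linked :: "'v set set \<Rightarrow> 'v \<Rightarrow> 'v \<Rightarrow> bool" where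
  "linked S x y \<longleftrightarrow> connected_in (\<lambda>e. e \<in> S) x y"

lemma linked_refl [simp]: "linked S x x"
  by (simp add: linked_def connected_in_def)

lemma linked_trans: "linked S x y \<Longrightarrow> linked S y z \<Longrightarrow> linked S x z"
  unfolding linked_def connected_in_def by (rule rtrancl_trans)

lemma linked_edge: "{x, y} \<in> S \<Longrightarrow> linked S x y"
  unfolding linked_def connected_in_def by (cases "x = y") auto

lemma linked_mono: "linked S x y \<Longrightarrow> S \<subseteq> T \<Longrightarrow> linked T x y"
  unfolding linked_def connected_in_def
  by (erule rev_subsetD, rule rtrancl_mono) auto

lemma linked_sym: "linked S x y \<Longrightarrow> linked S y x"
  unfolding linked_def connected_in_def
  by (rule symD[OF sym_rtrancl]) (auto simp: sym_def insert_commute)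

lemma linked_commute: "linked S x y \<longleftrightarrow> linked S y x"
  by (rule iffI) (erule linked_sym)+

lemma linked_induct [consumes 1, case_names refl step]:
  assumes "linked S x y" "P x"
    and "\<And>y z. linked S x y \<Longrightarrow> {y, z} \<in> S \<Longrightarrow> y \<noteq> z \<Longrightarrow> P y \<Longrightarrow> P z"
  shows "P y"
proof -
  have "(x, y) \<in> {(u, v). u \<noteq> v \<and> {u, v} \<in> S}\<^sup>*" using assms(1) by (simp add: linked_def connected_in_def)
  then show ?thesis
  proof (induction rule: rtrancl_induct)
    case (step y z)
    then show ?case using assms(3)[of y z] by (auto simp: linked_def connected_in_def)
  qed (rule assms(2))
qed

lemma linked_converse_induct [consumes 1, case_names refl step]:
  assumes "linked S x y" "P y"
    and "\<And>x z. linked S z y \<Longrightarrow> {x, z} \<in> S \<Longrightarrow> x \<noteq> z \<Longrightarrow> P z \<Longrightarrow> P x"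
  shows "P x"
  using linked_sym[OF assms(1)] assms(2)
proof (induction rule: linked_induct)
  case (step a z)
  then show ?case using assms(3)[of a z] by (simp add: linked_commute insert_commute)
qed

text \<open>A path stays inside the cluster of its starting point. In the Simon-Lieb inequality this
  makes the first piece of a path disjoint from everything that avoids the cluster.\<close>

lemma linked_inside_cluster:
  assumes "linked S x y"
  shows "linked {e \<in> S. e \<subseteq> {z. linked S x z}} x y"
  using assms
proof (induction rule: linked_induct)
  case (step y z)
  then have "linked S x z" using linked_trans linked_edge by metis
  then have "{y, z} \<in> {e \<in> S. e \<subseteq> {z. linked S x z}}" using step by auto
  then show ?case by (rule linked_trans[OF step(4) linked_edge])
qed simp

text \<open>Follow the path back from \<open>y\<close> to its last vertex in the cluster
  \<open>K\<close> of \<open>x\<close> in \<open>S\<close>. The edge by which it leaves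
  \<open>K\<close> cannot belong to \<open>S\<close>, since otherwise \<open>K\<close> would be
  larger, and the rest of the path avoids \<open>K\<close>.\<close>

lemma linked_last_exit:
  assumes "linked (S \<union> S') x y"
  defines "K \<equiv> {z. linked S x z}"
  assumes "y \<notin> K"
  obtains u v where "u \<in> K" "v \<notin> K" "{u, v} \<in> S'" "linked {e \<in> S \<union> S'. e \<inter> K = {}} v y"
proof -
  let ?L = "\<lambda>z. linked {e \<in> S \<union> S'. e \<inter> K = {}} z y"
  let ?Q = "\<exists>u v. u \<in> K \<and> v \<notin> K \<and> {u, v} \<in> S' \<and> ?L v"
  have "?Q \<or> (x \<notin> K \<and> ?L x)"
    using assms(1)
  proof (induction rule: linked_converse_induct)
    case refl
    then show ?case using assms(3) by simp
  next
    case (step x z)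
    show ?case
    proof (cases ?Q)
      case False
      then have z: "z \<notin> K" "?L z" using step by auto
      show ?thesis
      proof (cases "x \<in> K")
        case True
        then have "{x, z} \<notin> S" using z(1) linked_trans[OF _ linked_edge[of x z S]] unfolding K_def by auto
        then show ?thesis using step(2) True z by auto
      next
        case False
        then have "{x, z} \<in> {e \<in> S \<union> S'. e \<inter> K = {}}" using step(2) z by auto
        then show ?thesis using False linked_trans[OF linked_edge z(2)] by blast
      qed
    qed simp
  qed
  moreover have "x \<in> K" by (simp add: K_def)
  ultimately show ?thesis using that by blast
qed

section \<open>Connection probabilities in finite vertex sets\<close>

definition edges_in :: "'v set \<Rightarrow> 'v set set" where
  "edges_in F = {{x, y} | x y. x \<in> F \<and> y \<in> F \<and> x \<noteq> y}"

lemma edges_in_subset_Pow: "edges_in F \<subseteq> Pow F"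
  by (auto simp: edges_in_def)

lemma finite_edges_in [simp]: "finite F \<Longrightarrow> finite (edges_in F)"
  by (rule finite_subset[OF edges_in_subset_Pow]) simp

lemma edges_in_iff [simp]: "{x, y} \<in> edges_in F \<longleftrightarrow> x \<in> F \<and> y \<in> F \<and> x \<noteq> y"
  by (auto simp: edges_in_def doubleton_eq_iff)

lemma edges_in_mono: "F \<subseteq> G \<Longrightarrow> edges_in F \<subseteq> edges_in G"
  by (auto simp: edges_in_def)

lemma linked_in:
  assumes "linked S x y" "S \<subseteq> edges_in F" "x \<in> F"
  shows "y \<in> F"
  using assms by (induction rule: linked_induct) (auto dest!: subsetD)

definition link_prob :: "'v set \<Rightarrow> ('v set \<Rightarrow> real) \<Rightarrow> 'v \<Rightarrow> 'v \<Rightarrow> real" where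
  "link_prob F w x y = pprob (edges_in F) w (\<lambda>S. linked S x y)"

lemma increasing_linked: "increasing (\<lambda>S. linked S x y)"
  unfolding increasing_def by (intro allI impI) (rule linked_mono)

lemma link_prob_commute: "link_prob F w x y = link_prob F w y x"
  unfolding link_prob_def by (simp add: linked_commute)

lemma link_prob_refl [simp]: "finite F \<Longrightarrow> link_prob F w x x = 1"
  unfolding link_prob_def by simp

lemma link_prob_nonneg:
  assumes "\<And>e. e \<in> edges_in F \<Longrightarrow> 0 \<le> w e"
  shows "0 \<le> link_prob F w x y"
  unfolding link_prob_def using assms by (intro pmean_nonneg) auto

lemma link_prob_le_1:
  assumes "finite F" "\<And>e. e \<in> edges_in F \<Longrightarrow> 0 \<le> w e"
  shows "link_prob F w x y \<le> 1"
  unfolding link_prob_def using assms by (intro pprob_le_1) auto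

lemma link_prob_mono:
  assumes "finite F" "\<And>e. e \<in> edges_in F \<Longrightarrow> 0 \<le> w e" "\<And>e. e \<in> edges_in F \<Longrightarrow> w e \<le> w' e"
  shows "link_prob F w x y \<le> link_prob F w' x y"
  unfolding link_prob_def using assms
  by (intro pmean_mono_weight increasing_mono increasing_linked) auto

lemma link_prob_mono_set:
  assumes "finite G" "F \<subseteq> G" "\<And>e. e \<in> edges_in G \<Longrightarrow> 0 \<le> w e"
  shows "link_prob F w x y \<le> link_prob G w x y"
proof -
  have "link_prob F w x y = pprob (edges_in F) w (\<lambda>S. linked (S \<inter> edges_in F) x y)"
    unfolding link_prob_def by (intro pmean_cong) (auto simp: Int_absorb2)
  also have "\<dots> = pprob (edges_in G) w (\<lambda>S. linked (S \<inter> edges_in F) x y)"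
    using assms edges_in_mono[OF assms(2)] by (intro pmean_restrict[symmetric]) auto
  also have "\<dots> \<le> link_prob G w x y"
    unfolding link_prob_def
  proof (rule pmean_mono)
    fix S show "of_bool (linked (S \<inter> edges_in F) x y) \<le> (of_bool (linked S x y) :: real)"
      using linked_mono[of "S \<inter> edges_in F" x y S] by auto
  qed (use assms in auto)
  finally show ?thesis .
qed

text \<open>Edges of weight 0 are closed almost surely. This allows the edges inside a set
  \<open>F\<close> to be taken as the first of the two parts in the Simon-Lieb inequality.\<close>

lemma link_prob_zero_outside:
  assumes "finite G" "F \<subseteq> G"
  shows "link_prob G (\<lambda>e. if e \<subseteq> F then w e else 0) x y = link_prob F w x y"
proof -
  let ?w = "\<lambda>e. if e \<subseteq> F then w e else 0"
  have E: "edges_in G = edges_in F \<union> (edges_in G - edges_in F)" using edges_in_mono[OF assms(2)] by auto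
  have out: "?w e = 0" if "e \<in> edges_in G - edges_in F" for e
    using that by (auto simp: edges_in_def)
  have "finite F" using assms finite_subset by auto
  have "pmean A ?w f = f {}" if "finite A" "A \<subseteq> edges_in G - edges_in F" for A and f :: "'a set set \<Rightarrow> real"
    using that out by (induction A arbitrary: f) (auto simp: pmean_insert)
  then have "link_prob G ?w x y = pmean (edges_in F) ?w (\<lambda>S. of_bool (linked (S \<union> {}) x y))"
    unfolding link_prob_def using assms \<open>finite F\<close>
    by (subst E, subst pmean_Un) auto
  also have "\<dots> = link_prob F w x y"
    unfolding link_prob_def using edges_in_subset_Pow by (intro pmean_cong) auto
  finally show ?thesis .
qed

text \<open>Two independent configurations on the same edges form one configuration on a disjoint
  sum of edge sets. The van den Berg-Kesten inequality, which is about a single configuration, then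
  applies to both at once, and the two copies of an edge count as different.\<close>

lemma pmean_Plus:
  assumes "finite E" "finite E'"
  shows "pmean (E <+> E') (case_sum w w') f
    = pmean E w (\<lambda>S. pmean E' w' (\<lambda>S'. f (S <+> S')))"
proof -
  have "pmean (E <+> E') (case_sum w w') f
      = pmean (Inl ` E) (case_sum w w') (\<lambda>S. pmean (Inr ` E') (case_sum w w') (\<lambda>S'. f (S \<union> S')))"
    unfolding Plus_def using assms by (intro pmean_Un) auto
  also have "\<dots> = pmean E w (\<lambda>S. pmean E' w' (\<lambda>S'. f (S <+> S')))"
    using assms by (simp add: pmean_image Plus_def)
  finally show ?thesis .
qed

lemma pprob_edge:
  assumes "finite E" "e \<in> E"
  shows "pprob E w (\<lambda>S. e \<in> S) = 1 - exp (- w e)"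
proof -
  have "E = insert e (E - {e})" using assms by auto
  then have "pprob E w (\<lambda>S. e \<in> S) = pprob (insert e (E - {e})) w (\<lambda>S. e \<in> S)" by simp
  also have "\<dots> = exp (- w e) * pprob (E - {e}) w (\<lambda>S. e \<in> S) + (1 - exp (- w e))"
    using assms by (subst pmean_insert) auto
  also have "pprob (E - {e}) w (\<lambda>S. e \<in> S) = pprob (E - {e}) w (\<lambda>S. False)"
    by (intro pmean_cong) auto
  finally show ?thesis using assms by simp
qed

text \<open>Either \<open>y\<close> lies in the \<open>w\<close>-cluster of \<open>x\<close>, or a
  path to \<open>y\<close> leaves that cluster for the last time through a \<open>w'\<close>-edge
  \<open>{u, v}\<close>. In the second case a path inside the cluster, the edge, and a path avoiding
  the cluster are three disjoint witnesses, and \<open>1 - exp (- t)\<close> is at most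
  \<open>t\<close> for the edge.\<close>

lemma simon_lieb:
  assumes F: "finite F" and w: "\<And>e. e \<in> edges_in F \<Longrightarrow> 0 \<le> w e" and w': "\<And>e. e \<in> edges_in F \<Longrightarrow> 0 \<le> w' e"
  shows "link_prob F (\<lambda>e. w e + w' e) x y \<le> link_prob F w x y +
    (\<Sum>u\<in>F. \<Sum>v\<in>F - {u}. link_prob F w x u * w' {u, v} * link_prob F (\<lambda>e. w e + w' e) v y)"
proof -
  let ?E = "edges_in F" and ?W = "case_sum w w'" and ?w = "\<lambda>e. w e + w' e"
  let ?M = "pmean (?E <+> ?E) ?W"
  define A where "A u Z = linked (Inl -` Z) x u" for u and Z :: "('a set + 'a set) set"
  define B where "B u v Z = (Inr {u, v} \<in> Z)" for u v and Z :: "('a set + 'a set) set"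
  define C where "C v Z = linked (Inl -` Z \<union> Inr -` Z) v y" for v and Z :: "('a set + 'a set) set"
  have W: "0 \<le> ?W e" if "e \<in> ?E <+> ?E" for e using that w w' by auto
  have inc: "increasing (A u)" "increasing (B u v)" "increasing (C v)" for u v
    unfolding increasing_def A_def B_def C_def
    by (intro allI impI, (erule linked_mono, intro Un_mono vimage_mono | blast), assumption?)+
  have vS [simp]: "Inl -` (S <+> S') = S" "Inr -` (S <+> S') = S'" for S S' :: "'a set set" by auto
  have PA: "?M (\<lambda>Z. of_bool (A u Z)) = link_prob F w x u" for u
    unfolding A_def link_prob_def using F by (simp add: pmean_Plus)
  have PC: "?M (\<lambda>Z. of_bool (C v Z)) = link_prob F ?w v y" for v
    unfolding C_def link_prob_def using F by (simp add: pmean_Plus pmean_superpose)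
  have PB: "?M (\<lambda>Z. of_bool (B u v Z)) \<le> w' {u, v}" if "u \<in> F" "v \<in> F" "u \<noteq> v" for u v
  proof -
    have "?M (\<lambda>Z. of_bool (B u v Z)) = 1 - exp (- w' {u, v})"
      unfolding B_def using F that by (subst pprob_edge) (auto intro: finite_Plus)
    then show ?thesis using exp_ge_add_one_self[of "- w' {u, v}"] by simp
  qed
  have "link_prob F ?w x y = ?M (\<lambda>Z. of_bool (C x Z))" by (rule PC[symmetric])
  also have "\<dots> \<le> ?M (\<lambda>Z. of_bool (A y Z) +
      (\<Sum>u\<in>F. \<Sum>v\<in>F - {u}. of_bool (disjointly (A u) (disjointly (B u v) (C v)) Z)))"
  proof (rule pmean_mono)
    fix Z assume Z: "Z \<subseteq> ?E <+> ?E"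
    define S S' where "S = Inl -` Z" "S' = Inr -` Z"
    note SS = this
    let ?d = "\<lambda>u v. of_bool (disjointly (A u) (disjointly (B u v) (C v)) Z) :: real"
    have nn: "0 \<le> (\<Sum>u\<in>F. \<Sum>v\<in>F - {u}. ?d u v)" by (intro sum_nonneg) auto
    show "of_bool (C x Z) \<le> of_bool (A y Z) + (\<Sum>u\<in>F. \<Sum>v\<in>F - {u}. ?d u v)"
    proof (cases "C x Z \<and> \<not> A y Z")
      case True
      let ?K = "{z. linked S x z}"
      have "linked (S \<union> S') x y" "y \<notin> ?K" using True unfolding C_def A_def SS by auto
      then obtain u v where uv: "u \<in> ?K" "v \<notin> ?K" "{u, v} \<in> S'"
        "linked {e \<in> S \<union> S'. e \<inter> ?K = {}} v y" by (rule linked_last_exit)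
      have ne: "u \<noteq> v" using uv(1,2) by auto
      have uvF: "u \<in> F" "v \<in> F" using uv(3) Z ne unfolding SS by (auto dest!: subsetD)
      \<comment> \<open>Only the empty set lies inside \<open>?K\<close> and also misses it, so
        excluding it makes the first witness disjoint from the last one.\<close>
      have "{} \<notin> S" using Z unfolding SS by (auto simp: edges_in_def dest!: subsetD)
      let ?I = "Inl ` {e \<in> S. e \<subseteq> ?K}" and ?J1 = "{Inr {u, v}}"
        and ?J2 = "{e \<in> S. e \<inter> ?K = {}} <+> {e \<in> S'. e \<inter> ?K = {}}"
      have "A u ?I" unfolding A_def using linked_inside_cluster[of S x u] uv(1)
        by (simp add: inj_vimage_image_eq)
      moreover have "B u v ?J1" by (simp add: B_def)
      moreover have "C v ?J2" unfolding C_def vS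
        using uv(4) by (rule linked_mono) auto
      moreover have "?J1 \<inter> ?J2 = {}" using uv(1) by auto
      moreover have "?I \<inter> (?J1 \<union> ?J2) = {}" using \<open>{} \<notin> S\<close>
        by (auto dest: Int_absorb2)
      moreover have "?I \<union> (?J1 \<union> ?J2) \<subseteq> Z" using uv(3) unfolding SS by auto
      ultimately have "disjointly (A u) (disjointly (B u v) (C v)) Z"
        using disjointlyI[of "A u" ?I "disjointly (B u v) (C v)" "?J1 \<union> ?J2" Z]
          disjointlyI[of "B u v" ?J1 "C v" ?J2 "?J1 \<union> ?J2"] by simp
      then have "1 = ?d u v" by simp
      also have "\<dots> \<le> (\<Sum>v\<in>F - {u}. ?d u v)"
        using uvF ne F by (intro member_le_sum) auto
      also have "\<dots> \<le> (\<Sum>u\<in>F. \<Sum>v\<in>F - {u}. ?d u v)"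
        using uvF ne F by (intro member_le_sum[of u F "\<lambda>u. \<Sum>v\<in>F - {u}. ?d u v"] sum_nonneg) auto
      finally show ?thesis by (auto simp: of_bool_def)
    qed (use nn in auto)
  qed (use W in auto)
  also have "\<dots> = link_prob F w x y +
      (\<Sum>u\<in>F. \<Sum>v\<in>F - {u}. pprob (?E <+> ?E) ?W (disjointly (A u) (disjointly (B u v) (C v))))"
    by (simp only: pmean_add pmean_sum PA)
  also have "\<dots> \<le> link_prob F w x y +
      (\<Sum>u\<in>F. \<Sum>v\<in>F - {u}. link_prob F w x u * w' {u, v} * link_prob F ?w v y)"
  proof (intro add_left_mono sum_mono)
    fix u v assume uv: "u \<in> F" "v \<in> F - {u}"
    have fin: "finite (?E <+> ?E)" using F by (auto intro: finite_Plus)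
    have "pprob (?E <+> ?E) ?W (disjointly (A u) (disjointly (B u v) (C v)))
        \<le> ?M (\<lambda>Z. of_bool (A u Z)) * pprob (?E <+> ?E) ?W (disjointly (B u v) (C v))"
      by (rule van_den_berg_kesten[OF fin W inc(1) increasing_disjointly])
    also have "\<dots> \<le> ?M (\<lambda>Z. of_bool (A u Z)) * (?M (\<lambda>Z. of_bool (B u v Z)) * ?M (\<lambda>Z. of_bool (C v Z)))"
      by (rule mult_left_mono[OF van_den_berg_kesten[OF fin W inc(2,3)]]) (auto intro!: pmean_nonneg W)
    also have "\<dots> \<le> link_prob F w x u * (w' {u, v} * link_prob F ?w v y)"
      unfolding PA PC using uv PB[of u v] w w'
      by (intro mult_left_mono mult_right_mono link_prob_nonneg) auto
    finally show "pprob (?E <+> ?E) ?W (disjointly (A u) (disjointly (B u v) (C v)))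
        \<le> link_prob F w x u * w' {u, v} * link_prob F ?w v y" by (simp add: mult.assoc)
  qed
  finally show ?thesis .
qed

section \<open>Tightness of the largest cluster\<close>

text \<open>A tree is assembled by hanging a whole subtree below the root. Induction then descends
  into subtrees, which is what the splitting of a tree requires.\<close>

inductive rooted_tree :: "'v \<Rightarrow> 'v set \<Rightarrow> 'v set set \<Rightarrow> bool" where
  single: "rooted_tree v {v} {}"
| join: "rooted_tree v V E \<Longrightarrow> rooted_tree u V' E' \<Longrightarrow> V \<inter> V' = {} \<Longrightarrow>
    rooted_tree v (V \<union> V') (insert {v, u} (E \<union> E'))"

lemma rooted_tree_facts:
  assumes "rooted_tree v V E"
  shows "v \<in> V \<and> finite V \<and> E \<subseteq> edges_in V \<and> (\<forall>x\<in>V. linked E v x)"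
  using assms
proof (induction rule: rooted_tree.induct)
  case (join v V E u V' E')
  have "linked (insert {v, u} (E \<union> E')) v x" if "x \<in> V \<union> V'" for x
  proof (cases "x \<in> V")
    case True
    then have "linked E v x" using join by auto
    then show ?thesis by (rule linked_mono) auto
  next
    case False
    then have "linked E' u x" using join that by auto
    then have "linked (insert {v, u} (E \<union> E')) u x" by (rule linked_mono) auto
    moreover have "linked (insert {v, u} (E \<union> E')) v u" by (rule linked_edge) simp
    ultimately show ?thesis using linked_trans by metis
  qed
  moreover have "insert {v, u} (E \<union> E') \<subseteq> edges_in (V \<union> V')"
    using join edges_in_mono[of V "V \<union> V'"] edges_in_mono[of V' "V \<union> V'"] by auto
  ultimately show ?case using join by auto
qed simp

text \<open>Growth by a leaf at an arbitrary vertex, which the inductive definition offers only at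
  the root.\<close>

lemma rooted_tree_attach:
  assumes "rooted_tree v V E" "a \<in> V" "b \<notin> V"
  shows "rooted_tree v (insert b V) (insert {a, b} E)"
  using assms
proof (induction rule: rooted_tree.induct)
  case (single v)
  then show ?case using rooted_tree.join[OF rooted_tree.single[of v] rooted_tree.single[of b]]
    by (simp add: insert_commute)
next
  case (join v V E u V' E')
  show ?case
  proof (cases "a \<in> V")
    case True
    then have "rooted_tree v (insert b V \<union> V') (insert {v, u} (insert {a, b} E \<union> E'))"
      using join by (intro rooted_tree.join) auto
    then show ?thesis by (simp add: insert_commute)
  next
    case False
    then have "rooted_tree v (V \<union> insert b V') (insert {v, u} (E \<union> insert {a, b} E'))"
      using join by (intro rooted_tree.join) auto
    then show ?thesis by (simp add: insert_commute)
  qed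
qed

lemma linked_exit_edge:
  assumes "linked S x y" "x \<in> V" "y \<notin> V"
  obtains a b where "a \<in> V" "b \<notin> V" "{a, b} \<in> S" "linked S x b"
proof -
  have "y \<notin> V \<longrightarrow> (\<exists>a b. a \<in> V \<and> b \<notin> V \<and> {a, b} \<in> S \<and> linked S x b)"
    using assms(1)
  proof (induction rule: linked_induct)
    case (step y z)
    then have "linked S x z" using linked_trans[OF step(1) linked_edge] by simp
    then show ?case using step by auto
  qed (use assms in simp)
  then show ?thesis using assms(3) that by auto
qed

text \<open>A rooted tree with the largest number of vertices inside the cluster must span it,
  because an open edge leaving it could be attached.\<close>

lemma spanning_rooted_tree:
  assumes "finite {z. linked S x z}"
  obtains E where "E \<subseteq> S" "rooted_tree x {z. linked S x z} E"
proof -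
  let ?K = "{z. linked S x z}"
  define \<V> where "\<V> = {V. V \<subseteq> ?K \<and> (\<exists>E\<subseteq>S. rooted_tree x V E)}"
  have "finite \<V>" unfolding \<V>_def by (rule finite_subset[of _ "Pow ?K"]) (use assms in auto)
  moreover have "{x} \<in> \<V>" unfolding \<V>_def using rooted_tree.single[of x] by auto
  ultimately have "Max (card ` \<V>) \<in> card ` \<V>" and Max: "\<And>V'. V' \<in> \<V> \<Longrightarrow> card V' \<le> Max (card ` \<V>)"
    by (auto intro!: Max_in)
  then obtain V where V: "V \<in> \<V>" "\<And>V'. V' \<in> \<V> \<Longrightarrow> card V' \<le> card V" by auto
  then obtain E where E: "E \<subseteq> S" "rooted_tree x V E" "V \<subseteq> ?K" unfolding \<V>_def by auto
  note f = rooted_tree_facts[OF E(2)]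
  have "V = ?K"
  proof (rule ccontr)
    assume "V \<noteq> ?K"
    then obtain y where "linked S x y" "y \<notin> V" using E(3) by auto
    then obtain a b where ab: "a \<in> V" "b \<notin> V" "{a, b} \<in> S" "linked S x b"
      using linked_exit_edge f by metis
    have "insert b V \<in> \<V>"
      unfolding \<V>_def using rooted_tree_attach[OF E(2) ab(1,2)] E ab
      by (auto intro!: exI[of _ "insert {a, b} E"])
    then show False using V(2)[of "insert b V"] f ab(2) by simp
  qed
  then show ?thesis using that E by auto
qed

lemma edges_in_disjoint: "V \<inter> V' = {} \<Longrightarrow> edges_in V \<inter> edges_in V' = {}"
  by (auto simp: edges_in_def doubleton_eq_iff)

text \<open>Descend from the root into a subtree as long as it still contains \<open>n\<close>
  points of \<open>B\<close>, and cut it off where this stops. The upper bound \<open>2 * n\<close>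
  ensures that the part that keeps the root is not left too small.\<close>

lemma rooted_tree_split:
  assumes "rooted_tree v V E" "1 \<le> n" "n \<le> card (V \<inter> B)"
  shows "\<exists>E1 E2 V1 V2 u. E1 \<inter> E2 = {} \<and> E1 \<union> E2 \<subseteq> E \<and> V1 \<union> V2 = V \<and>
    (\<forall>x\<in>V1. linked E1 v x) \<and> (\<forall>x\<in>V2. linked E2 u x) \<and>
    n \<le> card (V2 \<inter> B) \<and> card (V2 \<inter> B) < 2 * n"
  using assms
proof (induction rule: rooted_tree.induct)
  case (single v)
  have "card ({v} \<inter> B) \<le> 1" using card_mono[of "{v}" "{v} \<inter> B"] by simp
  then show ?case using single
    by (intro exI[of _ "{}"] exI[of _ "{v}"] exI[of _ v]) auto
next
  case (join v V E u V' E')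
  note f = rooted_tree_facts[OF join(1)] and f' = rooted_tree_facts[OF join(2)]
  have EE: "E \<inter> E' = {}" using f f' join(3) edges_in_disjoint[of V V'] by blast
  have "{v, u} \<notin> edges_in V" "{v, u} \<notin> edges_in V'" using f f' join(3) by auto
  then have vu: "{v, u} \<notin> E" "{v, u} \<notin> E'" using f f' by blast+
  note ft = rooted_tree_facts[OF rooted_tree.join[OF join(1-3)]]
  show ?case
  proof (cases "n \<le> card (V \<inter> B)")
    case True
    then obtain E1 E2 V1 V2 t where IH: "E1 \<inter> E2 = {}" "E1 \<union> E2 \<subseteq> E" "V1 \<union> V2 = V"
      "\<forall>x\<in>V1. linked E1 v x" "\<forall>x\<in>V2. linked E2 t x" "n \<le> card (V2 \<inter> B)" "card (V2 \<inter> B) < 2 * n"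
      using join by blast
    let ?E1 = "insert {v, u} (E1 \<union> E')"
    have "linked ?E1 v x" if "x \<in> V1 \<union> V'" for x
    proof (cases "x \<in> V1")
      case True
      then have "linked E1 v x" using IH(4) by auto
      then show ?thesis by (rule linked_mono) auto
    next
      case False
      then have "linked E' u x" using f' that by auto
      then have "linked ?E1 u x" by (rule linked_mono) auto
      moreover have "linked ?E1 v u" by (rule linked_edge) simp
      ultimately show ?thesis using linked_trans by metis
    qed
    moreover have "?E1 \<inter> E2 = {}" "?E1 \<union> E2 \<subseteq> insert {v, u} (E \<union> E')" "(V1 \<union> V') \<union> V2 = V \<union> V'"
      using IH(1-3) EE vu by auto
    ultimately show ?thesis using IH
      by (intro exI[of _ ?E1] exI[of _ E2] exI[of _ "V1 \<union> V'"] exI[of _ V2] exI[of _ t]) simp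
  next
    case nV: False
    show ?thesis
    proof (cases "n \<le> card (V' \<inter> B)")
      case True
      then obtain E1 E2 V1 V2 t where IH: "E1 \<inter> E2 = {}" "E1 \<union> E2 \<subseteq> E'" "V1 \<union> V2 = V'"
        "\<forall>x\<in>V1. linked E1 u x" "\<forall>x\<in>V2. linked E2 t x" "n \<le> card (V2 \<inter> B)" "card (V2 \<inter> B) < 2 * n"
        using join by blast
      let ?E1 = "insert {v, u} (E1 \<union> E)"
      have "linked ?E1 v x" if "x \<in> V \<union> V1" for x
      proof (cases "x \<in> V")
        case True
        then have "linked E v x" using f by auto
        then show ?thesis by (rule linked_mono) auto
      next
        case False
        then have "linked E1 u x" using IH(4) that by auto
        then have "linked ?E1 u x" by (rule linked_mono) auto
        moreover have "linked ?E1 v u" by (rule linked_edge) simp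
        ultimately show ?thesis using linked_trans by metis
      qed
      moreover have "?E1 \<inter> E2 = {}" "?E1 \<union> E2 \<subseteq> insert {v, u} (E \<union> E')" "(V \<union> V1) \<union> V2 = V \<union> V'"
        using IH(1-3) EE vu by auto
      ultimately show ?thesis using IH
        by (intro exI[of _ ?E1] exI[of _ E2] exI[of _ "V \<union> V1"] exI[of _ V2] exI[of _ t]) simp
    next
      \<comment> \<open>Neither part reaches \<open>n\<close>, so the whole has fewer than
        \<open>2 * n\<close> points and serves as the second piece. The first piece may be the root
        without edges: only the edge sets have to be disjoint, the vertex sets may overlap.\<close>
      case False
      have "card ((V \<union> V') \<inter> B) \<le> card (V \<inter> B) + card (V' \<inter> B)"
        by (simp add: Int_Un_distrib2 card_Un_le)
      then have "card ((V \<union> V') \<inter> B) < 2 * n" using False nV by simp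
      then show ?thesis using join(7) ft
        by (intro exI[of _ "{}"] exI[of _ "insert {v, u} (E \<union> E')"] exI[of _ "{v}"]
            exI[of _ "V \<union> V'"] exI[of _ v] conjI) simp_all
    qed
  qed
qed

section \<open>Cluster sizes counted inside a finite set\<close>

definition hits :: "'v set \<Rightarrow> 'v set set \<Rightarrow> 'v \<Rightarrow> nat" where
  "hits B S x = card {z \<in> B. linked S x z}"

lemma hits_mono:
  assumes "finite B" "S \<subseteq> T"
  shows "hits B S x \<le> hits B T x"
  unfolding hits_def using assms by (intro card_mono) (auto intro: linked_mono)

lemma hits_le: "finite B \<Longrightarrow> hits B S x \<le> card B"
  unfolding hits_def by (intro card_mono) auto

lemma increasing_hits: "finite B \<Longrightarrow> increasing (\<lambda>S. n \<le> hits B S x)"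
  unfolding increasing_def using hits_mono order_trans by metis

lemma increasing_hits_ex: "finite B \<Longrightarrow> increasing (\<lambda>S. \<exists>u. n \<le> hits B S u)"
  unfolding increasing_def using hits_mono order_trans by metis

text \<open>Of at least \<open>3 * n\<close> points the piece that is cut off takes fewer than
  \<open>2 * n\<close> and at least \<open>n\<close>, so at least \<open>n\<close> remain linked to
  \<open>x\<close>. The two pieces use disjoint edges of one spanning tree.\<close>

lemma cluster_split:
  assumes "finite B" "S \<subseteq> edges_in F" "finite F" "1 \<le> n" "3 * n \<le> hits B S x"
  shows "disjointly (\<lambda>S. n \<le> hits B S x) (\<lambda>S. \<exists>u. n \<le> hits B S u) S"
proof -
  let ?K = "{z. linked S x z}"
  \<comment> \<open>The vertex \<open>x\<close> need not belong to \<open>F\<close>; in that case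
    its cluster is \<open>{x}\<close>.\<close>
  have "z \<in> insert x F" if "linked S x z" for z
    using that assms(2) by (induction rule: linked_induct) (auto dest!: subsetD)
  then have "?K \<subseteq> insert x F" by auto
  then have finK: "finite ?K" using assms(3) finite_subset by blast
  then obtain E where E: "E \<subseteq> S" "rooted_tree x ?K E" by (rule spanning_rooted_tree)
  have hK: "hits B S x = card (?K \<inter> B)" unfolding hits_def by (rule arg_cong[of _ _ card]) auto
  then obtain E1 E2 V1 V2 u where s: "E1 \<inter> E2 = {}" "E1 \<union> E2 \<subseteq> E" "V1 \<union> V2 = ?K"
    "\<forall>x'\<in>V1. linked E1 x x'" "\<forall>x\<in>V2. linked E2 u x" "n \<le> card (V2 \<inter> B)" "card (V2 \<inter> B) < 2 * n"
    using rooted_tree_split[OF E(2) assms(4), of B] assms(5) by auto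
  have "card (?K \<inter> B) \<le> card (V1 \<inter> B) + card (V2 \<inter> B)"
    using card_Un_le[of "V1 \<inter> B" "V2 \<inter> B"] s(3) by (simp add: Int_Un_distrib2[symmetric])
  then have "n \<le> card (V1 \<inter> B)" using assms(5) hK s(7) by simp
  also have "\<dots> \<le> hits B E1 x" unfolding hits_def using s(4) assms(1) by (intro card_mono) auto
  finally have "n \<le> hits B E1 x" .
  moreover have "card (V2 \<inter> B) \<le> hits B E2 u"
    unfolding hits_def using s(5) assms(1) by (intro card_mono) auto
  then have "\<exists>u. n \<le> hits B E2 u" using s(6) order_trans by blast
  ultimately show ?thesis using s(1,2) E(1) by (intro disjointlyI[of _ E1 _ E2]) auto
qed

lemma mean_hits:
  assumes "finite B"
  shows "pmean E w (\<lambda>S. real (hits B S x)) = (\<Sum>y\<in>B. pprob E w (\<lambda>S. linked S x y))"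
proof -
  have "real (hits B S x) = (\<Sum>y\<in>B. of_bool (linked S x y))" for S
    unfolding hits_def using assms by (simp add: sum_of_bool_eq Int_def)
  then show ?thesis by (simp add: pmean_sum)
qed

section \<open>Tails of the largest cluster in a finite set\<close>

context
  fixes F B :: "'v set" and w :: "'v set \<Rightarrow> real"
  assumes F: "finite F" and w: "\<And>e. e \<in> edges_in F \<Longrightarrow> 0 \<le> w e" and B: "finite B"
begin

abbreviation "gmean \<equiv> pmean (edges_in F) w"
abbreviation "some_hits n \<equiv> gmean (\<lambda>S. of_bool (\<exists>u. n \<le> hits B S u))"

text \<open>By the van den Berg-Kesten inequality, tripling the size of a cluster costs the
  probability that some large cluster exists. This factor does not depend on \<open>x\<close>, which
  is what makes the tail uniform over starting points.\<close>

lemma hits_tail: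
  assumes "1 \<le> n"
  shows "gmean (\<lambda>S. of_bool (3 * n \<le> hits B S x)) \<le> gmean (\<lambda>S. of_bool (n \<le> hits B S x)) * some_hits n"
proof -
  have "gmean (\<lambda>S. of_bool (3 * n \<le> hits B S x))
      \<le> gmean (\<lambda>S. of_bool (disjointly (\<lambda>S. n \<le> hits B S x) (\<lambda>S. \<exists>u. n \<le> hits B S u) S))"
  proof (rule pmean_mono[OF w], assumption)
    fix S assume "S \<subseteq> edges_in F"
    then show "of_bool (3 * n \<le> hits B S x)
      \<le> (of_bool (disjointly (\<lambda>S. n \<le> hits B S x) (\<lambda>S. \<exists>u. n \<le> hits B S u) S) :: real)"
      using cluster_split[OF B _ F assms, of S x] by auto
  qed
  also have "\<dots> \<le> gmean (\<lambda>S. of_bool (n \<le> hits B S x)) * some_hits n"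
    using F w by (intro van_den_berg_kesten increasing_hits increasing_hits_ex B) auto
  finally show ?thesis .
qed

lemma some_hits_tail:
  assumes "1 \<le> n"
  shows "some_hits (3 * n) \<le> (some_hits n)\<^sup>2"
proof -
  let ?A = "\<lambda>S. \<exists>u. n \<le> hits B S u"
  have "some_hits (3 * n) \<le> gmean (\<lambda>S. of_bool (disjointly ?A ?A S))"
  proof (rule pmean_mono[OF w], assumption)
    fix S assume S: "S \<subseteq> edges_in F"
    have "disjointly ?A ?A S" if "3 * n \<le> hits B S x" for x
      using cluster_split[OF B S F assms that] unfolding disjointly_def by metis
    then show "of_bool (\<exists>u. 3 * n \<le> hits B S u) \<le> (of_bool (disjointly ?A ?A S) :: real)"
      by auto
  qed
  also have "\<dots> \<le> some_hits n * some_hits n"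
    using F w by (intro van_den_berg_kesten increasing_hits_ex B) auto
  finally show ?thesis by (simp add: power2_eq_square)
qed

lemma some_hits_nonneg: "0 \<le> some_hits n"
  using w by (intro pmean_nonneg) auto

lemma some_hits_pow_tail:
  assumes "1 \<le> n"
  shows "some_hits (3 ^ k * n) \<le> some_hits n ^ (2 ^ k)"
proof (induction k)
  case (Suc k)
  have "some_hits (3 ^ Suc k * n) \<le> (some_hits (3 ^ k * n))\<^sup>2"
    using some_hits_tail[of "3 ^ k * n"] assms by (simp add: mult.assoc)
  also have "\<dots> \<le> (some_hits n ^ (2 ^ k))\<^sup>2"
    using Suc some_hits_nonneg by (intro power_mono) auto
  finally show ?case by (simp add: power_mult[symmetric] mult.commute)
qed simp

text \<open>Sum the tail in steps of 3. By \<open>hits_tail\<close> each term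
  \<open>3 * j \<le> hits\<close> has at most 1/9 of the probability of \<open>j \<le> hits\<close>,
  so the whole tail beyond the truncation is at most \<open>3 * (1 / 9)\<close> of the mean and can
  be absorbed on the left.\<close>

lemma mean_hits_le_truncated:
  assumes "1 \<le> n" "some_hits n \<le> 1 / 9"
  shows "gmean (\<lambda>S. real (hits B S x)) \<le> 3 / 2 * gmean (\<lambda>S. real (min (hits B S x) (3 * n)))"
proof -
  let ?h = "\<lambda>S. hits B S x" and ?c = "card B"
  let ?I = "\<lambda>j S. of_bool (3 * j \<le> ?h S) :: real"
  have "gmean (\<lambda>S. real (?h S)) \<le> gmean (\<lambda>S. real (min (?h S) (3 * n)) + 3 * (\<Sum>j=n..?c. ?I j S))"
  proof (rule pmean_mono[OF w], assumption)
    fix S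
    have "(\<Sum>j=n..?c. ?I j S) = real (card {j \<in> {n..?c}. 3 * j \<le> ?h S})"
      by (simp add: sum_of_bool_eq Int_def)
    also have "{j \<in> {n..?c}. 3 * j \<le> ?h S} = {n..?h S div 3}"
      using hits_le[OF B, of S x] by auto
    finally have "(\<Sum>j=n..?c. ?I j S) = real (Suc (?h S div 3) - n)" by simp
    then have eq: "3 * (\<Sum>j=n..?c. ?I j S) = real (3 * (Suc (?h S div 3) - n))" by simp
    have "?h S \<le> min (?h S) (3 * n) + 3 * (Suc (?h S div 3) - n)" by linarith
    then have "real (?h S) \<le> real (min (?h S) (3 * n) + 3 * (Suc (?h S div 3) - n))" by (rule of_nat_mono)
    then show "real (?h S) \<le> real (min (?h S) (3 * n)) + 3 * (\<Sum>j=n..?c. ?I j S)"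
      unfolding eq by simp
  qed
  also have "\<dots> = gmean (\<lambda>S. real (min (?h S) (3 * n))) + 3 * (\<Sum>j=n..?c. gmean (?I j))"
    by (simp only: pmean_add pmean_cmult pmean_sum)
  finally have le: "gmean (\<lambda>S. real (?h S)) \<le> gmean (\<lambda>S. real (min (?h S) (3 * n))) + 3 * (\<Sum>j=n..?c. gmean (?I j))" .
  have "(\<Sum>j=n..?c. gmean (?I j)) \<le> (\<Sum>j=n..?c. gmean (\<lambda>S. of_bool (j \<le> ?h S)) * (1 / 9))"
  proof (rule sum_mono)
    fix j assume j: "j \<in> {n..?c}"
    have "some_hits j \<le> some_hits n"
      using w j by (intro pmean_mono) (auto simp: of_bool_def intro: order_trans)
    then have "gmean (\<lambda>S. of_bool (j \<le> ?h S)) * some_hits j \<le> gmean (\<lambda>S. of_bool (j \<le> ?h S)) * (1 / 9)"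
      using assms(2) w by (intro mult_left_mono pmean_nonneg) auto
    then show "gmean (?I j) \<le> gmean (\<lambda>S. of_bool (j \<le> ?h S)) * (1 / 9)"
      using hits_tail[of j x] j assms by simp
  qed
  also have "\<dots> = gmean (\<lambda>S. \<Sum>j=n..?c. of_bool (j \<le> ?h S)) * (1 / 9)"
    by (simp only: pmean_sum sum_distrib_right)
  also have "gmean (\<lambda>S. \<Sum>j=n..?c. of_bool (j \<le> ?h S)) \<le> gmean (\<lambda>S. real (?h S))"
  proof (rule pmean_mono[OF w], assumption)
    fix S
    have "(\<Sum>j=n..?c. of_bool (j \<le> ?h S)) = real (card {j \<in> {n..?c}. j \<le> ?h S})"
      by (simp add: sum_of_bool_eq Int_def)
    also have "card {j \<in> {n..?c}. j \<le> ?h S} \<le> card {1..?h S}"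
      using assms by (intro card_mono) auto
    finally show "(\<Sum>j=n..?c. of_bool (j \<le> ?h S)) \<le> real (?h S)" by simp
  qed
  finally have "(\<Sum>j=n..?c. gmean (?I j)) \<le> gmean (\<lambda>S. real (?h S)) * (1 / 9)" by simp
  then show ?thesis using le by linarith
qed

text \<open>The size \<open>m\<close> is the largest one that some cluster attains with probability
  at least \<open>q\<close>. Since \<open>m + 1\<close> is attained with probability below
  \<open>q\<close>, iterating the squaring bound \<open>k\<close> times shows that
  \<open>3 ^ k * (m + 1)\<close> is attained with probability at most 1/9, and the truncation lemma
  applies.\<close>

lemma typical_size:
  assumes ne: "B \<noteq> {}" and q: "0 < q" "q ^ (2 ^ k) \<le> 1 / 9"
  obtains m where "1 \<le> m" "q \<le> some_hits m"
    "\<And>x. gmean (\<lambda>S. real (hits B S x)) \<le> 3 ^ (k + 2) * gmean (\<lambda>S. real (min (hits B S x) m))"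
    "q * (real m)\<^sup>2 \<le> (\<Sum>x\<in>B. gmean (\<lambda>S. real (hits B S x)))"
proof -
  have q1: "q < 1"
  proof (rule ccontr)
    assume "\<not> q < 1"
    then have "1 \<le> q ^ (2 ^ k)" by simp
    then show False using q by simp
  qed
  define m where "m = Max {n. q \<le> some_hits n}"
  have "\<not> q \<le> some_hits n" if "card B < n" for n
  proof -
    have "\<not> n \<le> hits B S u" for S u using hits_le[OF B, of S u] that by simp
    then show ?thesis using F q by simp
  qed
  then have "{n. q \<le> some_hits n} \<subseteq> {..card B}" by (auto simp: not_less[symmetric])
  then have fin: "finite {n. q \<le> some_hits n}" by (rule finite_subset) simp
  have "1 \<in> {n. q \<le> some_hits n}"
  proof -
    obtain b where "b \<in> B" using ne by auto
    then have "0 < hits B S b" for S unfolding hits_def using B by (auto simp: card_gt_0_iff intro: exI[of _ b])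
    then have "\<exists>u. 1 \<le> hits B S u" for S by (metis One_nat_def Suc_leI)
    then show ?thesis using F q1 by simp
  qed
  then have m: "1 \<le> m" "q \<le> some_hits m" and mx: "\<And>n. q \<le> some_hits n \<Longrightarrow> n \<le> m"
    unfolding m_def using fin Max_ge[OF fin] Max_in[OF fin] by blast+
  have trunc: "gmean (\<lambda>S. real (hits B S x)) \<le> 3 ^ (k + 2) * gmean (\<lambda>S. real (min (hits B S x) m))" for x
  proof -
    have "some_hits (m + 1) < q" using mx[of "m + 1"] by force
    then have "some_hits (m + 1) ^ (2 ^ k) \<le> q ^ (2 ^ k)" using some_hits_nonneg by (intro power_mono) auto
    then have "some_hits (3 ^ k * (m + 1)) \<le> 1 / 9"
      using some_hits_pow_tail[of "m + 1" k] q(2) by simp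
    then have "gmean (\<lambda>S. real (hits B S x)) \<le> 3 / 2 * gmean (\<lambda>S. real (min (hits B S x) (3 * (3 ^ k * (m + 1)))))"
      by (intro mean_hits_le_truncated) (simp_all add: Suc_le_eq)
    \<comment> \<open>The truncation levels \<open>3 ^ (k + 1) * (m + 1)\<close> and
      \<open>m\<close> differ by a factor of at most \<open>2 * 3 ^ (k + 1)\<close>. Together with
      the factor 3/2 this makes \<open>3 ^ (k + 2)\<close>.\<close>
    also have "gmean (\<lambda>S. real (min (hits B S x) (3 * (3 ^ k * (m + 1)))))
        \<le> gmean (\<lambda>S. (2 * 3 ^ (k + 1)) * real (min (hits B S x) m))"
    proof (rule pmean_mono[OF w], assumption)
      fix S
      define h where "h = hits B S x"
      have "min h (3 * (3 ^ k * (m + 1))) \<le> (2 * 3 ^ (k + 1)) * min h m"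
      proof (cases "h \<le> m")
        case True
        have "h * 1 \<le> h * (2 * 3 ^ (k + 1))" by (intro mult_left_mono) auto
        then show ?thesis using True by (simp add: min.coboundedI1 mult.commute)
      next
        case False
        have "3 * (3 ^ k * (m + 1)) \<le> (3 * 3 ^ k) * (2 * m)"
          using m(1) mult_left_mono[of "m + 1" "2 * m" "3 * 3 ^ k"] by (simp only: mult.assoc[symmetric])
        then show ?thesis using False by (simp add: min.coboundedI2 mult_ac)
      qed
      then have "real (min h (3 * (3 ^ k * (m + 1)))) \<le> real ((2 * 3 ^ (k + 1)) * min h m)" by (rule of_nat_mono)
      then show "real (min (hits B S x) (3 * (3 ^ k * (m + 1)))) \<le> (2 * 3 ^ (k + 1)) * real (min (hits B S x) m)"
        unfolding h_def by simp
    qed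
    finally show ?thesis by (simp add: pmean_cmult)
  qed
  have "q * (real m)\<^sup>2 \<le> some_hits m * (real m)\<^sup>2" using m(2) by (intro mult_right_mono) auto
  also have "\<dots> = gmean (\<lambda>S. (real m)\<^sup>2 * of_bool (\<exists>u. m \<le> hits B S u))" by (simp add: pmean_cmult)
  also have "\<dots> \<le> gmean (\<lambda>S. \<Sum>x\<in>B. real (hits B S x))"
  proof (rule pmean_mono[OF w], assumption)
    fix S
    \<comment> \<open>Each of the at least \<open>m\<close> points of \<open>B\<close> in the
      cluster of \<open>u\<close> sees the same cluster, hence contributes at least \<open>m\<close>
      to the sum.\<close>
    have "(real m)\<^sup>2 \<le> (\<Sum>x\<in>B. real (hits B S x))" if u: "m \<le> hits B S u" for u
    proof -
      let ?Q = "{z \<in> B. linked S u z}"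
      have "(real m)\<^sup>2 \<le> (real (hits B S u))\<^sup>2" using u by (intro power_mono) auto
      also have "\<dots> = (\<Sum>x\<in>?Q. real (hits B S u))" by (simp add: hits_def power2_eq_square)
      also have "\<dots> = (\<Sum>x\<in>?Q. real (hits B S x))"
      proof (intro sum.cong refl arg_cong[of _ _ real])
        fix x assume "x \<in> ?Q"
        then have "linked S u z \<longleftrightarrow> linked S x z" for z using linked_trans linked_sym by (metis mem_Collect_eq)
        then show "hits B S u = hits B S x" unfolding hits_def by simp
      qed
      also have "\<dots> \<le> (\<Sum>x\<in>B. real (hits B S x))" using B by (intro sum_mono2) auto
      finally show ?thesis .
    qed
    then show "(real m)\<^sup>2 * of_bool (\<exists>u. m \<le> hits B S u) \<le> (\<Sum>x\<in>B. real (hits B S x))"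
      by (auto simp: of_bool_def sum_nonneg)
  qed
  finally have "q * (real m)\<^sup>2 \<le> (\<Sum>x\<in>B. gmean (\<lambda>S. real (hits B S x)))" by (simp add: pmean_sum)
  then show ?thesis using that m trunc by blast
qed

end

section \<open>Gluing large clusters by long edges\<close>

lemma prob_no_edge:
  assumes "finite E" "A \<subseteq> E"
  shows "pprob E w (\<lambda>S. S \<inter> A = {}) = exp (- (\<Sum>e\<in>A. w e))"
proof -
  have fin: "finite A" using assms finite_subset by auto
  have "pprob E w (\<lambda>S. S \<inter> A = {}) = pprob A w (\<lambda>S. S \<inter> A = {})"
    using assms by (intro pmean_restrict) (auto simp: Int_assoc)
  also have "\<dots> = pprob A w (\<lambda>S. S = {})" by (intro pmean_cong) (auto simp: Int_absorb2)
  also have "\<dots> = exp (- (\<Sum>e\<in>A. w e))"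
    using fin by (induction A) (auto simp: pmean_insert mult_exp_exp)
  finally show ?thesis .
qed

text \<open>Intersecting sets are joined for free. For disjoint sets the pairs give
  \<open>card X * card Y\<close> different edges, each of weight at least \<open>\<kappa>\<close>,
  and it is enough that one of them is open.\<close>

lemma prob_join_sets:
  assumes F: "finite F" and w: "\<And>e. e \<in> edges_in F \<Longrightarrow> 0 \<le> w e" and XY: "X \<subseteq> F" "Y \<subseteq> F"
    and \<kappa>: "0 \<le> \<kappa>" "\<And>u v. u \<in> X \<Longrightarrow> v \<in> Y \<Longrightarrow> u \<noteq> v \<Longrightarrow> \<kappa> \<le> w {u, v}"
  shows "1 - exp (- (\<kappa> * (real (card X) * real (card Y))))
    \<le> pprob (edges_in F) w (\<lambda>S. \<exists>u\<in>X. \<exists>v\<in>Y. linked S u v)"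
proof (cases "X \<inter> Y = {}")
  case False
  then obtain z where "z \<in> X" "z \<in> Y" by auto
  then have "\<exists>u\<in>X. \<exists>v\<in>Y. linked S u v" for S using linked_refl[of S z] by blast
  then show ?thesis using F by simp
next
  case True
  let ?A = "(\<lambda>(u, v). {u, v}) ` (X \<times> Y)"
  have fin: "finite X" "finite Y" using F XY finite_subset by auto
  have inj: "inj_on (\<lambda>(u, v). {u, v}) (X \<times> Y)" using True by (auto simp: inj_on_def doubleton_eq_iff)
  have A: "?A \<subseteq> edges_in F" using XY True by auto
  have "\<kappa> * (real (card X) * real (card Y)) = (\<Sum>p\<in>X \<times> Y. \<kappa>)" using fin by (simp add: card_cartesian_product)
  also have "\<dots> \<le> (\<Sum>p\<in>X \<times> Y. w (case p of (u, v) \<Rightarrow> {u, v}))"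
    using \<kappa>(2) True by (intro sum_mono) auto
  also have "\<dots> = (\<Sum>e\<in>?A. w e)" using inj by (simp add: sum.reindex)
  finally have "1 - exp (- (\<kappa> * (real (card X) * real (card Y)))) \<le> 1 - exp (- (\<Sum>e\<in>?A. w e))" by simp
  also have "\<dots> = pmean (edges_in F) w (\<lambda>S. 1 - of_bool (S \<inter> ?A = {}))"
    using prob_no_edge[OF finite_edges_in[OF F] A] F by (simp add: pmean_diff)
  also have "\<dots> \<le> pprob (edges_in F) w (\<lambda>S. \<exists>u\<in>X. \<exists>v\<in>Y. linked S u v)"
  proof (rule pmean_mono[OF w], assumption)
    fix S
    have "\<exists>u\<in>X. \<exists>v\<in>Y. linked S u v" if "S \<inter> ?A \<noteq> {}" using that linked_edge by fastforce
    then show "1 - of_bool (S \<inter> ?A = {}) \<le> (of_bool (\<exists>u\<in>X. \<exists>v\<in>Y. linked S u v) :: real)"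
      by (auto simp: of_bool_def)
  qed
  finally show ?thesis .
qed

text \<open>The sets may overlap, so consecutive joins need not be independent. They are increasing
  events, however, and the Harris inequality gives the product.\<close>

lemma prob_chain:
  fixes X :: "nat \<Rightarrow> 'v set"
  assumes F: "finite F" and w: "\<And>e. e \<in> edges_in F \<Longrightarrow> 0 \<le> w e" and X: "\<And>i. i \<le> k \<Longrightarrow> X i \<subseteq> F"
    and \<kappa>: "0 \<le> \<kappa>" "\<And>i u v. i < k \<Longrightarrow> u \<in> X i \<Longrightarrow> v \<in> X (Suc i) \<Longrightarrow> u \<noteq> v \<Longrightarrow> \<kappa> \<le> w {u, v}"
  shows "(\<Prod>i<k. 1 - exp (- (\<kappa> * (real (card (X i)) * real (card (X (Suc i)))))))
    \<le> pprob (edges_in F) w (\<lambda>S. \<forall>i<k. \<exists>u\<in>X i. \<exists>v\<in>X (Suc i). linked S u v)"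
  using X \<kappa>(2)
proof (induction k)
  case (Suc k)
  let ?A = "\<lambda>S. \<forall>i<k. \<exists>u\<in>X i. \<exists>v\<in>X (Suc i). linked S u v"
  let ?B = "\<lambda>S. \<exists>u\<in>X k. \<exists>v\<in>X (Suc k). linked S u v"
  have inc: "increasing ?B" "increasing ?A"
    unfolding increasing_def by (meson linked_mono)+
  have A: "(\<Prod>i<k. 1 - exp (- (\<kappa> * (real (card (X i)) * real (card (X (Suc i)))))))
      \<le> pprob (edges_in F) w ?A"
    by (rule Suc.IH) (use Suc.prems(1) in simp, use Suc.prems(2)[OF less_SucI] in blast)
  have B: "1 - exp (- (\<kappa> * (real (card (X k)) * real (card (X (Suc k)))))) \<le> pprob (edges_in F) w ?B"
    by (rule prob_join_sets[OF F w _ _ \<kappa>(1)])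
      (simp, use Suc.prems(1) in simp, use Suc.prems(1) in simp, rule Suc.prems(2)[OF lessI])
  have "(\<Prod>i<Suc k. 1 - exp (- (\<kappa> * (real (card (X i)) * real (card (X (Suc i)))))))
    \<le> pprob (edges_in F) w ?A * pprob (edges_in F) w ?B"
    unfolding prod.lessThan_Suc
    using \<kappa>(1) by (intro mult_mono A B pmean_nonneg w) auto
  also have "\<dots> \<le> pmean (edges_in F) w (\<lambda>S. of_bool (?A S) * of_bool (?B S))"
    using F w inc by (intro harris increasing_mono) auto
  also have "\<dots> = pprob (edges_in F) w (\<lambda>S. \<forall>i<Suc k. \<exists>u\<in>X i. \<exists>v\<in>X (Suc i). linked S u v)"
    by (intro pmean_cong) (auto simp: less_Suc_eq of_bool_def)
  finally show ?case .
qed (use F in simp)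

lemma chain_links:
  fixes X :: "nat \<Rightarrow> 'v set"
  assumes "\<And>i u v. i \<le> k \<Longrightarrow> u \<in> X i \<Longrightarrow> v \<in> X i \<Longrightarrow> linked S u v"
    and "\<forall>i<k. \<exists>u\<in>X i. \<exists>v\<in>X (Suc i). linked S' u v" and "0 < k" "a \<in> X 0" "b \<in> X k"
  shows "linked (S \<union> S') a b"
  using assms
proof (induction k arbitrary: b)
  case (Suc k)
  then obtain u v where uv: "u \<in> X k" "v \<in> X (Suc k)" "linked S' u v" by auto
  have "linked S v b" using Suc.prems(1)[of "Suc k"] uv Suc.prems(5) by auto
  then have "linked (S \<union> S') u b"
    using linked_trans[OF linked_mono[OF uv(3)] linked_mono[of S v b]] by auto
  moreover have "linked (S \<union> S') a u"
  proof (cases "k = 0")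
    case True
    then have "linked S a u" using Suc.prems(1)[of 0] Suc.prems(4) uv by auto
    then show ?thesis by (rule linked_mono) auto
  next
    case False
    show ?thesis
      by (rule Suc.IH, rule Suc.prems(1)[OF le_SucI]) (use Suc.prems(2,4) uv False in auto)
  qed
  ultimately show ?case using linked_trans by metis
qed simp

lemma prob_linked_chain:
  fixes X :: "nat \<Rightarrow> 'v set"
  assumes F: "finite F" and w: "\<And>e. e \<in> edges_in F \<Longrightarrow> 0 \<le> w e" and X: "\<And>i. i \<le> k \<Longrightarrow> X i \<subseteq> F"
    and \<kappa>: "0 \<le> \<kappa>" "\<And>i u v. i < k \<Longrightarrow> u \<in> X i \<Longrightarrow> v \<in> X (Suc i) \<Longrightarrow> u \<noteq> v \<Longrightarrow> \<kappa> \<le> w {u, v}"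
    and k: "0 < k" and link: "\<And>i u v. i \<le> k \<Longrightarrow> u \<in> X i \<Longrightarrow> v \<in> X i \<Longrightarrow> linked S u v"
    and x: "\<And>a. a \<in> X 0 \<Longrightarrow> linked S x a" and y: "\<And>b. b \<in> X k \<Longrightarrow> linked S b y"
  shows "(\<Prod>i<k. 1 - exp (- (\<kappa> * (real (card (X i)) * real (card (X (Suc i)))))))
    \<le> pprob (edges_in F) w (\<lambda>S'. linked (S \<union> S') x y)"
proof -
  have "pprob (edges_in F) w (\<lambda>S. \<forall>i<k. \<exists>u\<in>X i. \<exists>v\<in>X (Suc i). linked S u v)
    \<le> pprob (edges_in F) w (\<lambda>S'. linked (S \<union> S') x y)"
  proof (rule pmean_mono[OF w], assumption)
    fix S'
    have "linked (S \<union> S') x y" if ch: "\<forall>i<k. \<exists>u\<in>X i. \<exists>v\<in>X (Suc i). linked S' u v"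
    proof -
      obtain a where a: "a \<in> X 0" using ch k by blast
      obtain b where b: "b \<in> X k" using ch k by (metis Suc_pred' lessI)
      have "linked (S \<union> S') a b" by (rule chain_links[of k X]) (use link ch k a b in auto)
      moreover have "linked (S \<union> S') x a" using linked_mono[OF x[OF a]] by auto
      moreover have "linked (S \<union> S') b y" using linked_mono[OF y[OF b]] by auto
      ultimately show ?thesis using linked_trans by metis
    qed
    then show "of_bool (\<forall>i<k. \<exists>u\<in>X i. \<exists>v\<in>X (Suc i). linked S' u v) \<le> (of_bool (linked (S \<union> S') x y) :: real)"
      by (auto simp: of_bool_def)
  qed
  moreover have "(\<Prod>i<k. 1 - exp (- (\<kappa> * (real (card (X i)) * real (card (X (Suc i)))))))
    \<le> pprob (edges_in F) w (\<lambda>S. \<forall>i<k. \<exists>u\<in>X i. \<exists>v\<in>X (Suc i). linked S u v)"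
    using F w X \<kappa> by (intro prob_chain) blast+
  ultimately show ?thesis by linarith
qed

lemma one_minus_exp_ge_half:
  assumes "0 \<le> s" "s \<le> 1" "s \<le> t"
  shows "s / 2 \<le> 1 - exp (- t :: real)"
proof -
  have "exp (- t) \<le> exp (- s)" using assms by simp
  also have "\<dots> \<le> 1 / (1 + s)"
    using exp_ge_add_one_self[of s] assms by (simp add: exp_minus inverse_eq_divide frac_le)
  also have "\<dots> \<le> 1 - s / 2"
  proof -
    have "s * s \<le> s * 1" using assms by (intro mult_left_mono) auto
    then show ?thesis using assms by (simp add: field_simps)
  qed
  finally show ?thesis by simp
qed

lemma mono_min_hits: "finite B \<Longrightarrow> mono (\<lambda>S. real (min (hits B S x) m))"
  unfolding mono_def using hits_mono by (metis min.mono of_nat_mono order_refl)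

text \<open>Given the first configuration, the second joins the clusters of \<open>x\<close> and
  \<open>y\<close> with probability at least \<open>1 - exp (- \<kappa> * h * h')\<close>, where
  \<open>h\<close> and \<open>h'\<close> are their numbers of points in \<open>B\<close>. Truncating
  both at \<open>m\<close> and capping \<open>\<kappa>\<close> at \<open>1 / m ^ 2\<close> keeps the
  exponent in the range where this is at least half of a linear function, and the Harris inequality
  splits the mean of the product.\<close>

lemma link_prob_glue:
  assumes F: "finite F" and w: "\<And>e. e \<in> edges_in F \<Longrightarrow> 0 \<le> w e" and w': "\<And>e. e \<in> edges_in F \<Longrightarrow> 0 \<le> w' e"
    and B: "B \<subseteq> F" and \<kappa>: "0 \<le> \<kappa>" "\<And>u v. u \<in> B \<Longrightarrow> v \<in> B \<Longrightarrow> u \<noteq> v \<Longrightarrow> \<kappa> \<le> w' {u, v}" and m: "1 \<le> m"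
  defines "M \<equiv> pmean (edges_in F) w"
  shows "min \<kappa> (1 / (real m)\<^sup>2) * (M (\<lambda>S. real (min (hits B S x) m)) * M (\<lambda>S. real (min (hits B S y) m))) / 2
    \<le> link_prob F (\<lambda>e. w e + w' e) x y"
proof -
  let ?c = "min \<kappa> (1 / (real m)\<^sup>2)"
  let ?a = "\<lambda>x S. real (min (hits B S x) m)"
  have finB: "finite B" using F B finite_subset by auto
  have c: "0 \<le> ?c" using \<kappa> by simp
  have "?c * (M (?a x) * M (?a y)) / 2 \<le> ?c * M (\<lambda>S. ?a x S * ?a y S) / 2"
    unfolding M_def using F w c by (intro divide_right_mono mult_left_mono harris mono_min_hits finB) auto
  also have "\<dots> = M (\<lambda>S. ?c / 2 * (?a x S * ?a y S))" unfolding M_def by (simp only: pmean_cmult)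
  also have "\<dots> \<le> M (\<lambda>S. pprob (edges_in F) w' (\<lambda>S'. linked (S \<union> S') x y))"
    unfolding M_def
  proof (rule pmean_mono[OF w], assumption)
    fix S
    define X where "X i = (if i = 0 then {z \<in> B. linked S x z} else {z \<in> B. linked S y z})" for i :: nat
    have link: "linked S u v" if "u \<in> X i" "v \<in> X i" for i u v
    proof -
      have "linked S x u \<and> linked S x v \<or> linked S y u \<and> linked S y v"
        using that by (auto simp: X_def split: if_splits)
      then show ?thesis using linked_trans[of S u x v] linked_trans[of S u y v] by (auto simp: linked_commute)
    qed
    have t: "?a x S * ?a y S \<le> real (hits B S x) * real (hits B S y)" by (intro mult_mono) auto
    have aa: "?a x S * ?a y S \<le> (real m)\<^sup>2" unfolding power2_eq_square by (intro mult_mono) auto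
    have "?c * (?a x S * ?a y S) \<le> 1"
    proof -
      have "?c * (?a x S * ?a y S) \<le> 1 / (real m)\<^sup>2 * (real m)\<^sup>2" using aa by (intro mult_mono) auto
      then show ?thesis using m by simp
    qed
    moreover have "?c * (?a x S * ?a y S) \<le> \<kappa> * (real (hits B S x) * real (hits B S y))"
      using t \<kappa>(1) by (intro mult_mono) auto
    ultimately have "?c * (?a x S * ?a y S) / 2 \<le> 1 - exp (- (\<kappa> * (real (hits B S x) * real (hits B S y))))"
      using c by (intro one_minus_exp_ge_half) auto
    also have "\<dots> = (\<Prod>i<1. 1 - exp (- (\<kappa> * (real (card (X i)) * real (card (X (Suc i)))))))"
      by (simp add: X_def hits_def)
    also have "\<dots> \<le> pprob (edges_in F) w' (\<lambda>S'. linked (S \<union> S') x y)"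
    proof (rule prob_linked_chain[OF F w' _ \<kappa>(1)])
      fix i :: nat assume "i \<le> 1" then show "X i \<subseteq> F" using B by (auto simp: X_def)
    next
      fix i u v assume "u \<in> X i" "v \<in> X (Suc i)" "u \<noteq> v"
      then show "\<kappa> \<le> w' {u, v}" by (intro \<kappa>(2)) (auto simp: X_def split: if_splits)
    qed (assumption, simp, rule link, assumption+, auto simp: X_def linked_commute)
    finally show "?c / 2 * (?a x S * ?a y S) \<le> pprob (edges_in F) w' (\<lambda>S'. linked (S \<union> S') x y)" by simp
  qed
  also have "\<dots> = link_prob F (\<lambda>e. w e + w' e) x y"
    unfolding link_prob_def M_def using F by (simp add: pmean_superpose)
  finally show ?thesis .
qed

text \<open>In the first configuration every window is required to contain a cluster of its typical
  size. The second configuration has to join the cluster of \<open>x\<close> to the one in the first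
  window, each large cluster to the next, and the last one to the cluster of \<open>y\<close>. The
  conditions on the first configuration are increasing functions, so the Harris inequality separates
  them.\<close>

lemma link_prob_glue_chain:
  fixes b :: "nat \<Rightarrow> 'v set"
  assumes F: "finite F" and w: "\<And>e. e \<in> edges_in F \<Longrightarrow> 0 \<le> w e" and w': "\<And>e. e \<in> edges_in F \<Longrightarrow> 0 \<le> w' e"
    and b: "\<And>i. i \<le> L \<Longrightarrow> b i \<subseteq> F" and \<kappa>: "0 \<le> \<kappa>"
      "\<And>i u v. i \<le> L \<Longrightarrow> u \<in> b i \<Longrightarrow> v \<in> b i \<Longrightarrow> u \<noteq> v \<Longrightarrow> \<kappa> \<le> w' {u, v}"
      "\<And>i u v. i < L \<Longrightarrow> u \<in> b i \<Longrightarrow> v \<in> b (Suc i) \<Longrightarrow> u \<noteq> v \<Longrightarrow> \<kappa> \<le> w' {u, v}"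
    and m: "\<And>i. i \<le> L \<Longrightarrow> 1 \<le> m i" and \<Lambda>: "0 \<le> \<Lambda>" "\<And>i. i < L \<Longrightarrow> \<Lambda> \<le> \<kappa> * (real (m i) * real (m (Suc i)))"
      "1 \<le> \<kappa> * (real (m 0))\<^sup>2" "1 \<le> \<kappa> * (real (m L))\<^sup>2"
  defines "M \<equiv> pmean (edges_in F) w"
  assumes q: "\<And>i. i \<le> L \<Longrightarrow> q \<le> M (\<lambda>S. of_bool (\<exists>u. m i \<le> hits (b i) S u))" and q1: "0 \<le> 1 - real (L + 1) * (1 - q)"
  shows "(1 - real (L + 1) * (1 - q)) * (1 - exp (- \<Lambda>)) ^ L *
      (M (\<lambda>S. real (min (hits (b 0) S x) (m 0))) / (2 * real (m 0)) *
       (M (\<lambda>S. real (min (hits (b L) S y) (m L))) / (2 * real (m L))))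
    \<le> link_prob F (\<lambda>e. w e + w' e) x y"
proof -
  have finb: "finite (b i)" if "i \<le> L" for i using F b[OF that] finite_subset by auto
  define f where "f S = 1 - exp (- (\<kappa> * (real (hits (b 0) S x) * real (m 0))))" for S
  define g where "g S = 1 - exp (- (\<kappa> * (real (m L) * real (hits (b L) S y))))" for S
  define h where "h S = (of_bool (\<forall>i\<le>L. \<exists>u. m i \<le> hits (b i) S u) :: real)" for S
  have fin: "finite (b 0)" "finite (b L)" by (rule finb, simp)+
  have mono_f: "mono f" unfolding mono_def f_def
    using \<kappa>(1) hits_mono[OF fin(1)] by (auto intro!: mult_left_mono mult_right_mono)
  have mono_g: "mono g" unfolding mono_def g_def
    using \<kappa>(1) hits_mono[OF fin(2)] by (auto intro!: mult_left_mono mult_right_mono)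
  have mono_h: "mono h" unfolding h_def
  proof (rule increasing_mono)
    show "increasing (\<lambda>S. \<forall>i\<le>L. \<exists>u. m i \<le> hits (b i) S u)"
      using increasing_hits_ex[OF finb] unfolding increasing_def by meson
  qed
  have nn: "0 \<le> f S" "0 \<le> g S" "0 \<le> h S" for S using \<kappa>(1) by (auto simp: f_def g_def h_def)
  \<comment> \<open>Because \<open>\<kappa> * m ^ 2\<close> is at least 1, a cluster containing a
    fraction of \<open>m\<close> points of the window joins the large cluster with at least half of
    that fraction as probability.\<close>
  have Mf: "M (\<lambda>S. real (min (hits (b 0) S x) (m 0))) / (2 * real (m 0)) \<le> M f"
  proof -
    have "M (\<lambda>S. real (min (hits (b 0) S x) (m 0)) / real (m 0) / 2) \<le> M f"
      unfolding M_def
    proof (rule pmean_mono[OF w], assumption)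
      fix S
      let ?h = "hits (b 0) S x" and ?m = "m 0"
      have m0: "1 \<le> real ?m" using m[of 0] by simp
      have "real (min ?h ?m) / real ?m \<le> (\<kappa> * (real ?m)\<^sup>2) * (real ?h / real ?m)"
        using mult_mono[OF \<Lambda>(3), of "real (min ?h ?m) / real ?m" "real ?h / real ?m"] m0 \<kappa>(1)
        by (auto simp: divide_right_mono)
      also have "\<dots> = \<kappa> * (real ?h * real ?m)" using m0 by (simp add: power2_eq_square)
      finally show "real (min ?h ?m) / real ?m / 2 \<le> f S"
        unfolding f_def using m0 by (intro one_minus_exp_ge_half) auto
    qed
    also have "M (\<lambda>S. real (min (hits (b 0) S x) (m 0)) / real (m 0) / 2)
        = M (\<lambda>S. 1 / (2 * real (m 0)) * real (min (hits (b 0) S x) (m 0)))"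
      by (rule arg_cong[of _ _ M]) (auto simp: fun_eq_iff)
    finally show ?thesis unfolding M_def by (simp only: pmean_cmult) simp
  qed
  have Mg: "M (\<lambda>S. real (min (hits (b L) S y) (m L))) / (2 * real (m L)) \<le> M g"
  proof -
    have "M (\<lambda>S. real (min (hits (b L) S y) (m L)) / real (m L) / 2) \<le> M g"
      unfolding M_def
    proof (rule pmean_mono[OF w], assumption)
      fix S
      let ?h = "hits (b L) S y" and ?m = "m L"
      have m0: "1 \<le> real ?m" using m[of L] by simp
      have "real (min ?h ?m) / real ?m \<le> (\<kappa> * (real ?m)\<^sup>2) * (real ?h / real ?m)"
        using mult_mono[OF \<Lambda>(4), of "real (min ?h ?m) / real ?m" "real ?h / real ?m"] m0 \<kappa>(1)
        by (auto simp: divide_right_mono)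
      also have "\<dots> = \<kappa> * (real ?m * real ?h)" using m0 by (simp add: power2_eq_square)
      finally show "real (min ?h ?m) / real ?m / 2 \<le> g S"
        unfolding g_def using m0 by (intro one_minus_exp_ge_half) auto
    qed
    also have "M (\<lambda>S. real (min (hits (b L) S y) (m L)) / real (m L) / 2)
        = M (\<lambda>S. 1 / (2 * real (m L)) * real (min (hits (b L) S y) (m L)))"
      by (rule arg_cong[of _ _ M]) (auto simp: fun_eq_iff)
    finally show ?thesis unfolding M_def by (simp only: pmean_cmult) simp
  qed
  \<comment> \<open>Union bound over the \<open>L + 1\<close> windows.\<close>
  have Mh: "1 - real (L + 1) * (1 - q) \<le> M h"
  proof -
    have "M (\<lambda>S. 1 - (\<Sum>i\<le>L. 1 - of_bool (\<exists>u. m i \<le> hits (b i) S u))) \<le> M h"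
      unfolding M_def
    proof (rule pmean_mono[OF w], assumption)
      fix S
      let ?o = "\<lambda>i. of_bool (\<exists>u. m i \<le> hits (b i) S u) :: real"
      have "0 \<le> (\<Sum>i\<le>L. 1 - ?o i)" by (intro sum_nonneg) auto
      moreover have "1 \<le> (\<Sum>i\<le>L. 1 - ?o i)" if "i \<le> L" "\<not> (\<exists>u. m i \<le> hits (b i) S u)" for i
      proof -
        have "1 - ?o i \<le> (\<Sum>i\<le>L. 1 - ?o i)" using that by (intro member_le_sum) auto
        then show ?thesis using that by simp
      qed
      ultimately show "1 - (\<Sum>i\<le>L. 1 - ?o i) \<le> h S" unfolding h_def by (auto simp: of_bool_def)
    qed
    moreover have "(\<Sum>i\<le>L. 1 - M (\<lambda>S. of_bool (\<exists>u. m i \<le> hits (b i) S u))) \<le> (\<Sum>i\<le>L. 1 - q)"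
      using q by (intro sum_mono) auto
    ultimately show ?thesis unfolding M_def using F by (simp add: pmean_diff pmean_sum del: sum_subtractf sum_constant) simp
  qed
  have pt: "(1 - exp (- \<Lambda>)) ^ L * (f S * (g S * h S)) \<le> pprob (edges_in F) w' (\<lambda>S'. linked (S \<union> S') x y)" for S
  proof (cases "h S = 0")
    case True
    then show ?thesis using w' by (auto intro!: pmean_nonneg)
  next
    case False
    then have h1: "h S = 1" and "\<forall>i\<le>L. \<exists>u. m i \<le> hits (b i) S u" by (auto simp: h_def of_bool_def split: if_splits)
    then obtain c where c: "\<And>i. i \<le> L \<Longrightarrow> m i \<le> hits (b i) S (c i)" by metis
    \<comment> \<open>The chain has \<open>L + 2\<close> links: position 0 is the cluster of
      \<open>x\<close>, position \<open>L + 2\<close> that of \<open>y\<close>, and window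
      \<open>i\<close> sits at position \<open>i + 1\<close>. The clusters of \<open>x\<close> and
      \<open>y\<close> are counted in the first and in the last window, so both of these windows
      occur twice.\<close>
    define s where "s i = (if i = 0 then x else if i = L + 2 then y else c (i - 1))" for i
    define B where "B i = (if i = 0 then b 0 else if i = L + 2 then b L else b (i - 1))" for i
    define X where "X i = {z \<in> B i. linked S (s i) z}" for i
    let ?t = "\<lambda>i. 1 - exp (- (\<kappa> * (real (card (X i)) * real (card (X (Suc i))))))"
    have cardX: "card (X i) = hits (B i) S (s i)" for i by (simp add: X_def hits_def)
    have cX: "m i \<le> card (X (Suc i))" if "i \<le> L" for i
      using c[OF that] that by (simp add: cardX B_def s_def)
    have "f S \<le> ?t 0" unfolding f_def using cX[of 0] \<kappa>(1)
      by (auto simp: cardX[of 0] B_def s_def intro!: mult_left_mono)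
    moreover have "g S \<le> ?t (Suc L)" unfolding g_def using cX[of L] \<kappa>(1)
      by (auto simp: cardX[of "Suc (Suc L)"] B_def s_def intro!: mult_left_mono mult_right_mono)
    moreover have "(1 - exp (- \<Lambda>)) ^ L \<le> (\<Prod>i<L. ?t (Suc i))"
    proof -
      have "(\<Prod>i<L. 1 - exp (- \<Lambda>)) \<le> (\<Prod>i<L. ?t (Suc i))"
      proof (rule prod_mono, intro conjI)
        fix i assume i: "i \<in> {..<L}"
        have "\<Lambda> \<le> \<kappa> * (real (m i) * real (m (Suc i)))" using \<Lambda>(2) i by simp
        also have "\<dots> \<le> \<kappa> * (real (card (X (Suc i))) * real (card (X (Suc (Suc i)))))"
          using cX[of i] cX[of "Suc i"] i \<kappa>(1) by (intro mult_left_mono mult_mono) auto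
        finally show "1 - exp (- \<Lambda>) \<le> ?t (Suc i)" by simp
      qed (use \<Lambda>(1) in auto)
      then show ?thesis by simp
    qed
    ultimately have "f S * (1 - exp (- \<Lambda>)) ^ L * g S \<le> ?t 0 * (\<Prod>i<L. ?t (Suc i)) * ?t (Suc L)"
      using nn \<kappa>(1) \<Lambda>(1) by (intro mult_mono mult_nonneg_nonneg prod_nonneg) auto
    also have "\<dots> = (\<Prod>i<L + 2. ?t i)"
      by (simp add: prod.lessThan_Suc_shift[of _ L] prod.lessThan_Suc[of _ "Suc L"] del: prod.lessThan_Suc)
    also have "\<dots> \<le> pprob (edges_in F) w' (\<lambda>S'. linked (S \<union> S') x y)"
    proof (rule prob_linked_chain[OF F w' _ \<kappa>(1)])
      fix i :: nat assume i: "i \<le> L + 2"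
      then have "i = L + 2 \<or> i - 1 \<le> L" by linarith
      then show "X i \<subseteq> F" using b[of 0] b[of L] b[of "i - 1"] by (auto simp: X_def B_def split: if_splits)
      fix u v assume "u \<in> X i" "v \<in> X i"
      then have "linked S (s i) u" "linked S (s i) v" by (auto simp: X_def)
      then show "linked S u v" using linked_trans[of S u "s i" v] by (simp add: linked_commute)
    next
      fix i u v assume i: "i < L + 2" and uv: "u \<in> X i" "v \<in> X (Suc i)" "u \<noteq> v"
      then have "u \<in> B i" "v \<in> B (Suc i)" by (auto simp: X_def)
      moreover have "i = 0 \<or> i = Suc L \<or> (\<exists>j<L. i = Suc j)" using i by (cases i) auto
      ultimately show "\<kappa> \<le> w' {u, v}"
        using \<kappa>(2)[of 0 u v] \<kappa>(2)[of L u v] \<kappa>(3)[of "i - 1" u v] uv(3) by (auto simp: B_def split: if_splits)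
    qed (auto simp: X_def s_def linked_commute)
    finally show ?thesis by (simp add: h1 mult_ac)
  qed
  have "(1 - real (L + 1) * (1 - q)) * (1 - exp (- \<Lambda>)) ^ L *
      (M (\<lambda>S. real (min (hits (b 0) S x) (m 0))) / (2 * real (m 0)) *
       (M (\<lambda>S. real (min (hits (b L) S y) (m L))) / (2 * real (m L))))
    \<le> M h * (1 - exp (- \<Lambda>)) ^ L * (M f * M g)"
    using Mf Mg Mh \<Lambda>(1) q1 nn w unfolding M_def
    by (intro mult_mono mult_nonneg_nonneg divide_nonneg_nonneg pmean_nonneg) auto
  also have "\<dots> = (1 - exp (- \<Lambda>)) ^ L * (M f * (M g * M h))" by simp
  also have "\<dots> \<le> (1 - exp (- \<Lambda>)) ^ L * (M f * M (\<lambda>S. g S * h S))"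
    unfolding M_def using \<Lambda>(1) nn w F mono_g mono_h
    by (intro mult_left_mono harris pmean_nonneg) auto
  also have "\<dots> \<le> (1 - exp (- \<Lambda>)) ^ L * M (\<lambda>S. f S * (g S * h S))"
  proof -
    have "mono (\<lambda>S. g S * h S)"
      unfolding mono_def using mono_g mono_h nn by (auto intro!: mult_mono dest: monoD)
    then show ?thesis
      unfolding M_def using \<Lambda>(1) w F mono_f by (intro mult_left_mono harris) auto
  qed
  also have "\<dots> = M (\<lambda>S. (1 - exp (- \<Lambda>)) ^ L * (f S * (g S * h S)))" unfolding M_def by (simp add: pmean_cmult)
  also have "\<dots> \<le> M (\<lambda>S. pprob (edges_in F) w' (\<lambda>S'. linked (S \<union> S') x y))"
    unfolding M_def by (rule pmean_mono[OF w], assumption, rule pt)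
  also have "\<dots> = link_prob F (\<lambda>e. w e + w' e) x y"
    unfolding link_prob_def M_def using F by (simp add: pmean_superpose)
  finally show ?thesis .
qed

section \<open>Escape from a finite set\<close>

text \<open>The part of \<open>F\<close> that remains after removing all clusters that leave
  \<Lambda>. It can be found by exploring these clusters from outside, without looking at any edge
  inside the trapped set.\<close>

definition trapped :: "'v set \<Rightarrow> 'v set \<Rightarrow> 'v set set \<Rightarrow> 'v set" where
  "trapped F \<Lambda> S = {x \<in> F. \<forall>z\<in>F - \<Lambda>. \<not> linked S x z}"

lemma singleton_not_edge [simp]: "{x} \<notin> edges_in F"
  by (auto simp: edges_in_def)

lemma trapped_subset: "trapped F \<Lambda> S \<subseteq> \<Lambda>"
proof
  fix x assume "x \<in> trapped F \<Lambda> S"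
  then show "x \<in> \<Lambda>" unfolding trapped_def by (auto dest: bspec[of _ _ x])
qed

lemma trapped_antimono: "S \<subseteq> T \<Longrightarrow> trapped F \<Lambda> T \<subseteq> trapped F \<Lambda> S"
  unfolding trapped_def by (auto dest: linked_mono)

lemma trapped_closed:
  assumes "x \<in> trapped F \<Lambda> S" "linked S x y" "y \<in> F"
  shows "y \<in> trapped F \<Lambda> S"
  using assms linked_trans unfolding trapped_def by fast

lemma linked_inside_trapped:
  assumes S: "S1 \<subseteq> edges_in A" "S2 \<subseteq> edges_in F - edges_in A" and A: "trapped F \<Lambda> S2 = A"
    and x: "x \<in> A" and l: "linked (S1 \<union> S2) x y"
  shows "y \<in> A \<and> linked S1 x y"
  using l
proof (induction rule: linked_induct)
  case (step y z)
  have "{y, z} \<notin> S2"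
  proof
    assume e: "{y, z} \<in> S2"
    then have "{y, z} \<in> edges_in F - edges_in A" using S by auto
    then have "z \<in> F" "z \<notin> A" using step by auto
    moreover have "y \<in> trapped F \<Lambda> S2" using step A by simp
    ultimately show False using trapped_closed[OF _ linked_edge[OF e]] A by blast
  qed
  then have e: "{y, z} \<in> S1" using step by auto
  then have "z \<in> A" using S(1) by (auto dest: subsetD)
  then show ?case using step linked_trans[OF _ linked_edge[OF e]] by auto
qed (use x in simp)

text \<open>Whether the trapped set equals \<open>A\<close> depends only on the edges that are not
  inside \<open>A\<close>, since vertices of \<open>A\<close> are not on any path to the outside of
  \<Lambda>. Hence the edges inside \<open>A\<close> are independent of this event.\<close>

lemma trapped_Un_inside:
  assumes S: "S1 \<subseteq> edges_in A" "S2 \<subseteq> edges_in F - edges_in A" and A: "A \<subseteq> F"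
  shows "trapped F \<Lambda> (S1 \<union> S2) = A \<longleftrightarrow> trapped F \<Lambda> S2 = A"
proof
  assume T: "trapped F \<Lambda> S2 = A"
  have "A \<subseteq> trapped F \<Lambda> (S1 \<union> S2)"
  proof
    fix x assume x: "x \<in> A"
    have "z \<in> \<Lambda>" if "linked (S1 \<union> S2) x z" for z
      using linked_inside_trapped[OF S T x that] trapped_subset[of F \<Lambda> S2] T by auto
    then show "x \<in> trapped F \<Lambda> (S1 \<union> S2)" using x A unfolding trapped_def by auto
  qed
  then show "trapped F \<Lambda> (S1 \<union> S2) = A" using trapped_antimono[of S2 "S1 \<union> S2" F \<Lambda>] T by auto
next
  assume T: "trapped F \<Lambda> (S1 \<union> S2) = A"
  have "linked S2 y z" if "linked (S1 \<union> S2) y z" "z \<in> F - \<Lambda>" for y z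
    using that(1)
  proof (induction rule: linked_converse_induct)
    case (step x p)
    have e: "{x, p} \<in> edges_in F"
      using step(2) S edges_in_mono[OF A] by auto
    have "linked (S1 \<union> S2) x z" using linked_trans[OF linked_edge[OF step(2)] step(1)] .
    then have "x \<notin> A" using T that(2) unfolding trapped_def by auto
    then have "{x, p} \<notin> edges_in A" by auto
    then have "{x, p} \<in> S2" using step(2) S by auto
    then show ?case using linked_trans[OF linked_edge step(4)] by blast
  qed simp
  then have "trapped F \<Lambda> S2 \<subseteq> trapped F \<Lambda> (S1 \<union> S2)" unfolding trapped_def by blast
  then show "trapped F \<Lambda> S2 = A" using trapped_antimono[of S2 "S1 \<union> S2" F \<Lambda>] T by auto
qed

text \<open>Given that the trapped set is \<open>A\<close>, the configuration inside
  \<open>A\<close> is still fresh, and a vertex of \<open>A\<close> is linked only through edges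
  inside \<open>A\<close>.\<close>

lemma prob_trapped_linked:
  assumes F: "finite F" and A: "A \<subseteq> F" and o: "o' \<in> A"
  shows "pprob (edges_in F) w (\<lambda>S. trapped F \<Lambda> S = A \<and> linked S o' x)
    = pprob (edges_in F) w (\<lambda>S. trapped F \<Lambda> S = A) * link_prob A w o' x"
proof -
  let ?R = "edges_in F - edges_in A"
  have fA: "finite A" using F A finite_subset by auto
  have E: "edges_in F = edges_in A \<union> ?R" using edges_in_mono[OF A] by auto
  have split: "pmean (edges_in F) w f = pmean (edges_in A) w (\<lambda>S1. pmean ?R w (\<lambda>S2. f (S1 \<union> S2)))" for f
    using F fA by (subst E, intro pmean_Un) auto
  have 1: "pprob (edges_in F) w (\<lambda>S. trapped F \<Lambda> S = A) = pprob ?R w (\<lambda>S2. trapped F \<Lambda> S2 = A)"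
  proof -
    have "pprob (edges_in F) w (\<lambda>S. trapped F \<Lambda> S = A)
        = pmean (edges_in A) w (\<lambda>S1. pprob ?R w (\<lambda>S2. trapped F \<Lambda> S2 = A))"
      unfolding split by (intro pmean_cong refl arg_cong[of _ _ of_bool] trapped_Un_inside A)
    then show ?thesis using fA by simp
  qed
  have "pprob (edges_in F) w (\<lambda>S. trapped F \<Lambda> S = A \<and> linked S o' x)
      = pmean (edges_in A) w (\<lambda>S1. pmean ?R w (\<lambda>S2. of_bool (linked S1 o' x) * of_bool (trapped F \<Lambda> S2 = A)))"
    unfolding split
  proof (intro pmean_cong refl)
    fix S1 S2 assume S: "S1 \<subseteq> edges_in A" "S2 \<subseteq> ?R"
    have "linked (S1 \<union> S2) o' x \<longleftrightarrow> linked S1 o' x" if "trapped F \<Lambda> S2 = A"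
      using linked_inside_trapped[OF S that o] linked_mono[of S1 o' x "S1 \<union> S2"] by auto
    then show "of_bool (trapped F \<Lambda> (S1 \<union> S2) = A \<and> linked (S1 \<union> S2) o' x)
        = (of_bool (linked S1 o' x) * of_bool (trapped F \<Lambda> S2 = A) :: real)"
      using trapped_Un_inside[OF S A, of \<Lambda>] by (auto simp: of_bool_def)
  qed
  also have "\<dots> = pmean (edges_in A) w (\<lambda>S1. pprob ?R w (\<lambda>S2. trapped F \<Lambda> S2 = A) * of_bool (linked S1 o' x))"
    by (simp add: pmean_cmult mult.commute)
  also have "\<dots> = pprob ?R w (\<lambda>S2. trapped F \<Lambda> S2 = A) * link_prob A w o' x"
    unfolding link_prob_def by (rule pmean_cmult)
  finally show ?thesis unfolding 1 .
qed

text \<open>One increment of the argument of Duminil-Copin and Tassion for sharpness. After adding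
  weight \<open>\<delta> * k\<close>, the vertex \<open>o'\<close> escapes as soon as one new edge
  joins its cluster to a vertex that is not trapped. To first order this has conditional probability
  \<open>\<delta> * X S\<close>, and averaging over the possible trapped sets bounds its mean below
  by \<open>\<delta> * c\<close>. The constant \<open>D\<close> only controls the second-order
  error.\<close>

lemma prob_trapped_step:
  assumes F: "finite F" and \<Lambda>: "\<Lambda> \<subseteq> F" and w: "\<And>e. e \<in> edges_in F \<Longrightarrow> 0 \<le> w e" and k: "\<And>e. e \<in> edges_in F \<Longrightarrow> 0 \<le> k e"
    and \<delta>: "0 \<le> \<delta>"
    and c: "\<And>A. o' \<in> A \<Longrightarrow> A \<subseteq> \<Lambda> \<Longrightarrow> c \<le> (\<Sum>x\<in>A. \<Sum>y\<in>F - A. link_prob A w o' x * k {x, y})"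
    and D: "(\<Sum>x\<in>F. \<Sum>y\<in>F - {x}. k {x, y}) \<le> D"
  shows "pprob (edges_in F) (\<lambda>e. w e + \<delta> * k e) (\<lambda>S. o' \<in> trapped F \<Lambda> S)
    \<le> pprob (edges_in F) w (\<lambda>S. o' \<in> trapped F \<Lambda> S) * (1 - \<delta> * c + (\<delta> * D)\<^sup>2)"
proof -
  let ?U = "trapped F \<Lambda>" and ?E = "edges_in F"
  define X where "X S = (\<Sum>x\<in>?U S. \<Sum>y\<in>F - ?U S. of_bool (linked S o' x) * k {x, y})" for S
  have UF: "?U S \<subseteq> F" for S by (auto simp: trapped_def)
  have finU: "finite (?U S)" for S using F UF finite_subset by metis
  have X0: "0 \<le> X S" for S unfolding X_def
    using UF[of S] by (intro sum_nonneg mult_nonneg_nonneg k) auto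
  have XD: "X S \<le> D" for S
  proof -
    have "X S \<le> (\<Sum>x\<in>?U S. \<Sum>y\<in>F - {x}. k {x, y})" unfolding X_def
    proof (intro sum_mono)
      fix x assume x: "x \<in> ?U S"
      have "(\<Sum>y\<in>F - ?U S. of_bool (linked S o' x) * k {x, y}) \<le> (\<Sum>y\<in>F - ?U S. k {x, y})"
        using x UF[of S] by (intro sum_mono) (auto intro!: k simp: of_bool_def)
      also have "\<dots> \<le> (\<Sum>y\<in>F - {x}. k {x, y})"
        using x UF[of S] F by (intro sum_mono2) (auto intro!: k)
      finally show "(\<Sum>y\<in>F - ?U S. of_bool (linked S o' x) * k {x, y}) \<le> (\<Sum>y\<in>F - {x}. k {x, y})" .
    qed
    also have "\<dots> \<le> (\<Sum>x\<in>F. \<Sum>y\<in>F - {x}. k {x, y})"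
      using F UF by (intro sum_mono2 sum_nonneg k) auto
    finally show ?thesis using D by simp
  qed
  have "pprob ?E (\<lambda>e. w e + \<delta> * k e) (\<lambda>S. o' \<in> ?U S)
      = pmean ?E w (\<lambda>S. pprob ?E (\<lambda>e. \<delta> * k e) (\<lambda>S'. o' \<in> ?U (S \<union> S')))"
    using F by (simp add: pmean_superpose)
  also have "\<dots> \<le> pmean ?E w (\<lambda>S. of_bool (o' \<in> ?U S) * (1 - \<delta> * X S + (\<delta> * D)\<^sup>2))"
  proof (rule pmean_mono[OF w], assumption)
    fix S
    show "pprob ?E (\<lambda>e. \<delta> * k e) (\<lambda>S'. o' \<in> ?U (S \<union> S'))
        \<le> of_bool (o' \<in> ?U S) * (1 - \<delta> * X S + (\<delta> * D)\<^sup>2)"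
    proof (cases "o' \<in> ?U S")
      case False
      then have "o' \<notin> ?U (S \<union> S')" for S' using trapped_antimono[of S "S \<union> S'"] by auto
      then show ?thesis using False F by simp
    next
      case True
      let ?K = "{x \<in> ?U S. linked S o' x}"
      let ?A = "(\<lambda>(x, y). {x, y}) ` (?K \<times> (F - ?U S))"
      have AE: "?A \<subseteq> ?E" using UF[of S] by auto
      have "inj_on (\<lambda>(x, y). {x, y}) (?K \<times> (F - ?U S))" by (auto simp: inj_on_def doubleton_eq_iff)
      then have "(\<Sum>e\<in>?A. k e) = (\<Sum>(x, y)\<in>?K \<times> (F - ?U S). k {x, y})"
        by (simp add: sum.reindex case_prod_unfold)
      also have "\<dots> = (\<Sum>x\<in>?K. \<Sum>y\<in>F - ?U S. k {x, y})" by (simp add: sum.cartesian_product)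
      also have "\<dots> = X S" unfolding X_def using finU[of S]
        unfolding sum.inter_filter[OF finU] by (intro sum.cong) auto
      finally have XA: "(\<Sum>e\<in>?A. k e) = X S" .
      have "pprob ?E (\<lambda>e. \<delta> * k e) (\<lambda>S'. o' \<in> ?U (S \<union> S')) \<le> pprob ?E (\<lambda>e. \<delta> * k e) (\<lambda>S'. S' \<inter> ?A = {})"
      proof (rule pmean_mono)
        fix S'
        \<comment> \<open>A vertex outside the trapped set is already linked to the outside of
          \<Lambda>, so an edge to it frees \<open>o'\<close>.\<close>
        have "False" if t: "o' \<in> ?U (S \<union> S')" and xy: "x \<in> ?K" "y \<in> F - ?U S" "{x, y} \<in> S'" for x y
        proof -
          obtain z where "z \<in> F - \<Lambda>" "linked S y z" using xy unfolding trapped_def by auto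
          moreover have "linked (S \<union> S') o' y"
            using xy linked_trans[OF linked_mono[of S o' x "S \<union> S'"] linked_edge[of x y "S \<union> S'"]] by auto
          ultimately have "linked (S \<union> S') o' z"
            using linked_trans[OF _ linked_mono[of S y z "S \<union> S'"]] by auto
          then show False using t \<open>z \<in> F - \<Lambda>\<close> unfolding trapped_def by auto
        qed
        then show "of_bool (o' \<in> ?U (S \<union> S')) \<le> (of_bool (S' \<inter> ?A = {}) :: real)"
          by (auto simp: of_bool_def)
      qed (use k \<delta> in auto)
      also have "\<dots> = exp (- (\<delta> * X S))"
        using prob_no_edge[OF finite_edges_in[OF F] AE, of "\<lambda>e. \<delta> * k e"] by (simp add: sum_distrib_left[symmetric] XA)
      also have "\<dots> \<le> 1 - \<delta> * X S + (\<delta> * X S)\<^sup>2"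
      proof -
        define t where "t = \<delta> * X S"
        have t: "0 \<le> t" unfolding t_def using \<delta> X0 by simp
        have "1 \<le> (1 - t + t\<^sup>2) * (1 + t)" using t by (simp add: algebra_simps power2_eq_square)
        also have "\<dots> \<le> (1 - t + t\<^sup>2) * exp t"
        proof (rule mult_left_mono)
          show "0 \<le> 1 - t + t\<^sup>2"
            using zero_le_power2[of "t - 1 / 2"] by (simp add: power2_eq_square algebra_simps)
        qed (use exp_ge_add_one_self[of t] in simp)
        finally show ?thesis unfolding t_def[symmetric] by (simp add: exp_minus field_simps)
      qed
      also have "(\<delta> * X S)\<^sup>2 \<le> (\<delta> * D)\<^sup>2"
        using X0 XD \<delta> by (intro power_mono mult_left_mono mult_nonneg_nonneg) auto
      finally show ?thesis using True by simp
    qed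
  qed
  also have "\<dots> = pmean ?E w (\<lambda>S. (1 + (\<delta> * D)\<^sup>2) * of_bool (o' \<in> ?U S) - \<delta> * (of_bool (o' \<in> ?U S) * X S))"
    by (intro pmean_cong) (auto simp: algebra_simps)
  also have "\<dots> = (1 + (\<delta> * D)\<^sup>2) * pprob ?E w (\<lambda>S. o' \<in> ?U S) - \<delta> * pmean ?E w (\<lambda>S. of_bool (o' \<in> ?U S) * X S)"
    by (simp only: pmean_diff pmean_cmult)
  also have "\<dots> \<le> (1 + (\<delta> * D)\<^sup>2) * pprob ?E w (\<lambda>S. o' \<in> ?U S) - \<delta> * (c * pprob ?E w (\<lambda>S. o' \<in> ?U S))"
  proof -
    let ?\<A> = "{A. o' \<in> A \<and> A \<subseteq> \<Lambda>}"
    have fin\<Lambda>: "finite \<Lambda>" using F \<Lambda> finite_subset by auto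
    then have fin: "finite ?\<A>" by simp
    \<comment> \<open>Decomposition according to the value of the trapped set, which is always a
      subset of \<Lambda>.\<close>
    have dec: "(\<Sum>A\<in>?\<A>. of_bool (?U S = A) * f A) = of_bool (o' \<in> ?U S) * f (?U S)" for S and f :: "'a set \<Rightarrow> real"
    proof -
      have "(\<Sum>A\<in>?\<A>. of_bool (?U S = A) * f A) = (\<Sum>A\<in>?\<A>. if ?U S = A then f A else 0)"
        by (intro sum.cong) auto
      then show ?thesis using trapped_subset[of F \<Lambda> S] fin by (auto simp: sum.delta)
    qed
    have "c * pprob ?E w (\<lambda>S. o' \<in> ?U S) = (\<Sum>A\<in>?\<A>. pprob ?E w (\<lambda>S. ?U S = A) * c)"
    proof -
      have "c * pprob ?E w (\<lambda>S. o' \<in> ?U S) = pmean ?E w (\<lambda>S. \<Sum>A\<in>?\<A>. of_bool (?U S = A) * c)"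
        unfolding dec by (simp add: pmean_cmult[symmetric] mult.commute)
      also have "\<dots> = (\<Sum>A\<in>?\<A>. pmean ?E w (\<lambda>S. c * of_bool (?U S = A)))"
        by (simp only: pmean_sum mult.commute)
      finally show ?thesis by (simp only: pmean_cmult mult.commute)
    qed
    also have "\<dots> \<le> (\<Sum>A\<in>?\<A>. pprob ?E w (\<lambda>S. ?U S = A) * (\<Sum>x\<in>A. \<Sum>y\<in>F - A. link_prob A w o' x * k {x, y}))"
      using c w by (intro sum_mono mult_left_mono pmean_nonneg) auto
    also have "\<dots> = (\<Sum>A\<in>?\<A>. \<Sum>x\<in>A. \<Sum>y\<in>F - A. k {x, y} * pprob ?E w (\<lambda>S. ?U S = A \<and> linked S o' x))"
      unfolding sum_distrib_left using \<Lambda>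
      by (intro sum.cong refl, subst prob_trapped_linked[OF F]) auto
    also have "\<dots> = pmean ?E w (\<lambda>S. \<Sum>A\<in>?\<A>. \<Sum>x\<in>A. \<Sum>y\<in>F - A. k {x, y} * of_bool (?U S = A \<and> linked S o' x))"
      by (simp only: pmean_sum pmean_cmult)
    also have "\<dots> = pmean ?E w (\<lambda>S. \<Sum>A\<in>?\<A>. of_bool (?U S = A) * (\<Sum>x\<in>A. \<Sum>y\<in>F - A. of_bool (linked S o' x) * k {x, y}))"
      unfolding sum_distrib_left by (intro pmean_cong sum.cong refl) (auto simp: of_bool_def)
    also have "\<dots> = pmean ?E w (\<lambda>S. of_bool (o' \<in> ?U S) * X S)"
      unfolding dec X_def ..
    finally show ?thesis using \<delta> by (simp add: mult_left_mono)
  qed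
  finally show ?thesis by (simp add: algebra_simps)
qed

text \<open>Integration of the differential inequality by finitely many steps. The error terms of
  \<open>n\<close> steps of length \<open>\<delta> = a / n\<close> add up to
  \<open>a * \<delta> * D ^ 2\<close>, which is made at most half of the gain
  \<open>a * c\<close>.\<close>

lemma prob_trapped_decay:
  assumes F: "finite F" and \<Lambda>: "\<Lambda> \<subseteq> F" and k: "\<And>e. e \<in> edges_in F \<Longrightarrow> 0 \<le> k e" and \<beta>: "0 \<le> \<beta>" "\<beta> < \<beta>'" and c0: "0 < c"
    and c: "\<And>A. o' \<in> A \<Longrightarrow> A \<subseteq> \<Lambda> \<Longrightarrow> c \<le> (\<Sum>x\<in>A. \<Sum>y\<in>F - A. link_prob A (\<lambda>e. \<beta> * k e) o' x * k {x, y})"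
  shows "pprob (edges_in F) (\<lambda>e. \<beta>' * k e) (\<lambda>S. o' \<in> trapped F \<Lambda> S) \<le> exp (- ((\<beta>' - \<beta>) * c / 2))"
proof -
  define D where "D = (\<Sum>x\<in>F. \<Sum>y\<in>F - {x}. k {x, y})"
  define a where "a = \<beta>' - \<beta>"
  have a: "0 < a" using \<beta> by (simp add: a_def)
  \<comment> \<open>So many steps that \<open>\<delta> * D ^ 2\<close> is at most
    \<open>c / 2\<close>.\<close>
  obtain n :: nat where n: "max 1 (2 * a * D\<^sup>2 / c) \<le> real n" using real_arch_simple by blast
  define \<delta> where "\<delta> = a / real n"
  have \<delta>: "0 < \<delta>" "\<delta> * real n = a" using a n by (auto simp: \<delta>_def)
  let ?P = "\<lambda>\<beta>. pprob (edges_in F) (\<lambda>e. \<beta> * k e) (\<lambda>S. o' \<in> trapped F \<Lambda> S)"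
  have P0: "0 \<le> ?P b" if "0 \<le> b" for b using that k by (auto intro!: pmean_nonneg)
  have "?P (\<beta> + real i * \<delta>) \<le> exp (- \<delta> * c + (\<delta> * D)\<^sup>2) ^ i" for i
  proof (induction i)
    case 0
    then show ?case using F k \<beta> pprob_le_1[of "edges_in F" "\<lambda>e. \<beta> * k e"] by simp
  next
    case (Suc i)
    let ?b = "\<beta> + real i * \<delta>"
    have b: "\<beta> \<le> ?b" using \<delta> by simp
    have "?P (\<beta> + real (Suc i) * \<delta>) = pprob (edges_in F) (\<lambda>e. ?b * k e + \<delta> * k e) (\<lambda>S. o' \<in> trapped F \<Lambda> S)"
      by (simp add: algebra_simps)
    also have "\<dots> \<le> ?P ?b * (1 - \<delta> * c + (\<delta> * D)\<^sup>2)"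
    proof (rule prob_trapped_step[OF F \<Lambda>])
      fix A assume A: "o' \<in> A" "A \<subseteq> \<Lambda>"
      have "finite A" "A \<subseteq> F" using A \<Lambda> finite_subset[of A F] F by auto
      then have "(\<Sum>x\<in>A. \<Sum>y\<in>F - A. link_prob A (\<lambda>e. \<beta> * k e) o' x * k {x, y})
          \<le> (\<Sum>x\<in>A. \<Sum>y\<in>F - A. link_prob A (\<lambda>e. ?b * k e) o' x * k {x, y})"
        using b \<beta> edges_in_mono[of A F]
        by (intro sum_mono mult_right_mono link_prob_mono mult_nonneg_nonneg k) auto
      then show "c \<le> (\<Sum>x\<in>A. \<Sum>y\<in>F - A. link_prob A (\<lambda>e. ?b * k e) o' x * k {x, y})" using c[OF A] by linarith
    qed (use \<delta> \<beta> b k D_def in auto)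
    also have "\<dots> \<le> ?P ?b * exp (- \<delta> * c + (\<delta> * D)\<^sup>2)"
    proof (rule mult_left_mono)
      show "1 - \<delta> * c + (\<delta> * D)\<^sup>2 \<le> exp (- \<delta> * c + (\<delta> * D)\<^sup>2)"
        using exp_ge_add_one_self[of "- \<delta> * c + (\<delta> * D)\<^sup>2"] by linarith
    qed (use P0[of ?b] b \<beta> in auto)
    also have "\<dots> \<le> exp (- \<delta> * c + (\<delta> * D)\<^sup>2) ^ i * exp (- \<delta> * c + (\<delta> * D)\<^sup>2)"
      using Suc by (intro mult_right_mono) auto
    finally show ?case by (simp add: mult.commute)
  qed
  from this[of n] have "?P \<beta>' \<le> exp (real n * (- \<delta> * c + (\<delta> * D)\<^sup>2))"
    using \<delta>(2) by (simp add: exp_of_nat_mult[symmetric] a_def mult.commute)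
  also have "real n * (- \<delta> * c + (\<delta> * D)\<^sup>2) = - a * c + a * (\<delta> * D\<^sup>2)"
    unfolding \<delta>(2)[symmetric] by (simp add: algebra_simps power2_eq_square)
  finally have "?P \<beta>' \<le> exp (- a * c + a * (\<delta> * D\<^sup>2))" .
  moreover have "\<delta> * D\<^sup>2 \<le> c / 2"
  proof -
    have "2 * a * D\<^sup>2 \<le> real n * c" using n c0 by (simp add: pos_divide_le_eq)
    then show ?thesis unfolding \<delta>_def using n by (simp add: field_simps)
  qed
  then have "a * (\<delta> * D\<^sup>2) \<le> a * (c / 2)" using a by (intro mult_left_mono) auto
  then have "exp (- a * c + a * (\<delta> * D\<^sup>2)) \<le> exp (- (a * c / 2))" by simp
  ultimately show ?thesis unfolding a_def by linarith
qed

section \<open>Infinite graphs\<close>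

text \<open>A supremum over finite vertex sets instead of a probability on the infinite product:
  estimates on finite graphs then pass to the limit at once. The lemma \<open>two_point_eq\<close>
  identifies the two.\<close>

definition conn_prob :: "('v set \<Rightarrow> real) \<Rightarrow> 'v \<Rightarrow> 'v \<Rightarrow> real" where
  "conn_prob w x y = (SUP F\<in>{F. finite F}. link_prob F w x y)"

context
  fixes w :: "'v set \<Rightarrow> real"
  assumes w: "\<And>e. 0 \<le> w e"
begin

lemma bdd_link_prob: "bdd_above ((\<lambda>F. link_prob F w x y) ` {F. finite F})"
  by (intro bdd_aboveI2[where M = 1] link_prob_le_1) (auto simp: w)

lemma link_prob_le_conn_prob: "finite F \<Longrightarrow> link_prob F w x y \<le> conn_prob w x y"
  unfolding conn_prob_def using bdd_link_prob by (intro cSUP_upper) auto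

lemma conn_prob_le: "(\<And>F. finite F \<Longrightarrow> link_prob F w x y \<le> c) \<Longrightarrow> conn_prob w x y \<le> c"
  unfolding conn_prob_def by (intro cSUP_least) auto

lemma conn_prob_le_1: "conn_prob w x y \<le> 1"
  using w by (intro conn_prob_le link_prob_le_1) auto

lemma conn_prob_nonneg: "0 \<le> conn_prob w x y"
  using link_prob_le_conn_prob[of "{}" x y] link_prob_nonneg[of "{}" w x y] w by auto

lemma conn_prob_refl: "conn_prob w x x = 1"
  using link_prob_le_conn_prob[of "{}" x x] conn_prob_le_1[of x x] by simp

lemma conn_prob_commute: "conn_prob w x y = conn_prob w y x"
  unfolding conn_prob_def by (simp add: link_prob_commute)

lemma conn_prob_mono:
  assumes "\<And>x y. x \<noteq> y \<Longrightarrow> w {x, y} \<le> w' {x, y}" "\<And>e. 0 \<le> w' e"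
  shows "conn_prob w x y \<le> conn_prob w' x y"
proof (rule conn_prob_le)
  fix F :: "'v set" assume F: "finite F"
  have "link_prob F w x y \<le> link_prob F w' x y"
    using w assms(1) F by (intro link_prob_mono) (auto simp: edges_in_def)
  also have "\<dots> \<le> conn_prob w' x y" unfolding conn_prob_def
    using F assms(2) by (intro cSUP_upper bdd_aboveI2[where M = 1] link_prob_le_1) auto
  finally show "link_prob F w x y \<le> conn_prob w' x y" .
qed

lemma conn_prob_approx:
  assumes "\<epsilon> > 0"
  obtains F where "finite F" "\<And>G. finite G \<Longrightarrow> F \<subseteq> G \<Longrightarrow> conn_prob w x y - \<epsilon> < link_prob G w x y"
proof -
  have "conn_prob w x y - \<epsilon> < conn_prob w x y" using assms by simp
  then obtain F where F: "finite F" "conn_prob w x y - \<epsilon> < link_prob F w x y"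
    unfolding conn_prob_def using less_cSUP_iff[OF _ bdd_link_prob] by (metis empty_iff finite.emptyI mem_Collect_eq)
  then show ?thesis using that[OF F(1)] link_prob_mono_set[of _ F w x y] w by (meson order_less_le_trans)
qed

text \<open>A single finite set serves finitely many pairs simultaneously, because enlarging the
  vertex set only increases connection probabilities.\<close>

lemma conn_prob_approx_sum:
  assumes "\<epsilon> > 0" "finite P" "finite F0"
  obtains F where "finite F" "F0 \<subseteq> F" "\<And>x y. (x, y) \<in> P \<Longrightarrow> conn_prob w x y - \<epsilon> < link_prob F w x y"
proof -
  have "\<exists>F. finite F \<and> (\<forall>G. finite G \<longrightarrow> F \<subseteq> G \<longrightarrow> conn_prob w x y - \<epsilon> < link_prob G w x y)" for x y
    using conn_prob_approx[OF assms(1), of x y] by metis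
  then obtain f where f: "\<And>x y. finite (f x y)"
    "\<And>x y G. finite G \<Longrightarrow> f x y \<subseteq> G \<Longrightarrow> conn_prob w x y - \<epsilon> < link_prob G w x y" by metis
  let ?F = "F0 \<union> (\<Union>(x, y)\<in>P. f x y)"
  have "finite ?F" using assms f(1) by auto
  moreover have "f x y \<subseteq> ?F" if "(x, y) \<in> P" for x y using that by auto
  ultimately show ?thesis using that[of ?F] f(2) by blast
qed

end

lemma conn_prob_relabel:
  fixes w :: "'v set \<Rightarrow> real" and h :: "'v \<Rightarrow> 'v"
  assumes h: "bij h" and w: "\<And>e. 0 \<le> w e"
  shows "conn_prob (\<lambda>e. w (h ` e)) x y = conn_prob w (h x) (h y)"
proof -
  have inj: "inj h" using h by (rule bij_is_inj)
  have link: "linked ((`) h ` S) (h x) (h y) \<longleftrightarrow> linked S x y" if "bij h" for h :: "'v \<Rightarrow> 'v" and S x y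
  proof -
    have *: "linked S x y \<Longrightarrow> linked ((`) h ` S) (h x) (h y)" for h :: "'v \<Rightarrow> 'v" and S x y
    proof (induction rule: linked_induct)
      case (step y z)
      have "{h y, h z} \<in> (`) h ` S" using step(2) by (intro image_eqI[of _ _ "{y, z}"]) auto
      then show ?case by (rule linked_trans[OF step(4) linked_edge])
    qed simp
    have inv: "inv h (h z) = z" for z using that by (simp add: bij_is_inj)
    then have "(`) (inv h) ` (`) h ` S = S" by (simp add: image_image)
    then show ?thesis using *[of "(`) h ` S" "h x" "h y" "inv h"] *[of S x y h] inv by auto
  qed
  have E: "edges_in (h ` F) = (`) h ` edges_in F" for F
  proof (intro equalityI subsetI)
    fix e assume "e \<in> edges_in (h ` F)"
    then obtain a b where "a \<in> F" "b \<in> F" "h a \<noteq> h b" "e = {h a, h b}" by (auto simp: edges_in_def)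
    then show "e \<in> (`) h ` edges_in F" by (intro image_eqI[of _ _ "{a, b}"]) auto
  next
    fix e assume "e \<in> (`) h ` edges_in F"
    then obtain a b where "a \<in> F" "b \<in> F" "a \<noteq> b" "e = h ` {a, b}" by (auto simp: edges_in_def)
    then show "e \<in> edges_in (h ` F)" using inj by (auto simp: inj_eq)
  qed
  have eq: "link_prob F (\<lambda>e. w (h ` e)) x y = link_prob (h ` F) w (h x) (h y)" if "finite F" for F
  proof -
    have "inj_on ((`) h) (edges_in F)" using inj by (auto intro!: inj_onI simp: inj_image_eq_iff)
    then show ?thesis unfolding link_prob_def E using that
      by (simp add: pmean_image link[OF h])
  qed
  show ?thesis
  proof (rule antisym)
    show "conn_prob (\<lambda>e. w (h ` e)) x y \<le> conn_prob w (h x) (h y)"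
      using w by (intro conn_prob_le) (auto simp: eq intro!: link_prob_le_conn_prob)
    show "conn_prob w (h x) (h y) \<le> conn_prob (\<lambda>e. w (h ` e)) x y"
    proof (rule conn_prob_le[OF w])
      fix F :: "'v set" assume F: "finite F"
      have "h ` (h -` F) = F" using h by (simp add: bij_is_surj surj_image_vimage_eq)
      moreover have "finite (h -` F)" using F inj by (rule finite_vimageI)
      ultimately show "link_prob F w (h x) (h y) \<le> conn_prob (\<lambda>e. w (h ` e)) x y"
        using eq[of "h -` F"] link_prob_le_conn_prob[of "\<lambda>e. w (h ` e)" "h -` F" x y] w by simp
    qed
  qed
qed

subsection \<open>The product measure\<close>

text \<open>The value of \<open>edge_weight\<close> is meaningful only on genuine edges. The measure
  is therefore tied to a weight \<open>w\<close> that agrees with it there and is nonnegative on all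
  sets of vertices.\<close>

locale edge_product =
  fixes \<beta> :: real and k :: "'v::countable \<Rightarrow> 'v \<Rightarrow> real" and w :: "'v set \<Rightarrow> real"
  assumes w_nonneg: "\<And>e. 0 \<le> w e"
    and w_eq: "\<And>e. e \<in> edges \<Longrightarrow> \<beta> * edge_weight k e = w e"
begin

definition bern :: "'v set \<Rightarrow> bool measure" where
  "bern e = measure_pmf (bernoulli_pmf (1 - exp (- \<beta> * edge_weight k e)))"

sublocale product_prob_space bern edges
  unfolding product_prob_space_def product_prob_space_axioms_def product_sigma_finite_def bern_def
  by (auto intro: prob_space_imp_sigma_finite measure_pmf.prob_space_axioms)

lemma percolation_eq: "percolation \<beta> k = Pi\<^sub>M edges bern"
  unfolding percolation_def bern_def ..

abbreviation "\<Omega> \<equiv> space (percolation \<beta> k)"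

lemma prob_space_percolation: "prob_space (percolation \<beta> k)"
  unfolding percolation_eq by (rule P.prob_space_axioms)

lemma edges_in_edges: "edges_in F \<subseteq> edges"
  by (auto simp: edges_in_def edges_def)

lemma sets_open [measurable]: "e \<in> edges \<Longrightarrow> {\<omega> \<in> \<Omega>. \<omega> e \<in> A} \<in> sets (percolation \<beta> k)"
  unfolding percolation_eq
  by (rule measurable_sets_Collect[OF measurable_component_singleton]) (auto simp: bern_def)

lemma sets_cylinder:
  assumes "finite E" "E \<subseteq> edges"
  shows "{\<omega> \<in> \<Omega>. \<forall>e\<in>E. \<omega> e = (e \<in> S)} \<in> sets (percolation \<beta> k)"
proof -
  have "{\<omega> \<in> \<Omega>. \<omega> e = (e \<in> S)} \<in> sets (percolation \<beta> k)" if "e \<in> E" for e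
    using sets_open[of e "{e \<in> S}"] assms that by auto
  then show ?thesis using assms by (intro sets.sets_Collect_finite_All) auto
qed

lemma measure_cylinder:
  assumes "finite E" "E \<subseteq> edges" "S \<subseteq> E"
  shows "measure (percolation \<beta> k) {\<omega> \<in> \<Omega>. \<forall>e\<in>E. \<omega> e = (e \<in> S)}
    = (\<Prod>e\<in>S. 1 - exp (- w e)) * (\<Prod>e\<in>E - S. exp (- w e))"
proof -
  have pm: "measure (bern e) {b} = (if b then 1 - exp (- w e) else exp (- w e))" if "e \<in> edges" for e b
    using w_nonneg[of e] w_eq[OF that] unfolding bern_def measure_pmf_single
    by (cases b) (auto simp: pmf_bernoulli_True pmf_bernoulli_False)
  have "emeasure (percolation \<beta> k) {\<omega> \<in> \<Omega>. \<forall>e\<in>E. \<omega> e \<in> {e \<in> S}} = (\<Prod>e\<in>E. emeasure (bern e) {e \<in> S})"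
    unfolding percolation_eq using assms by (intro emeasure_PiM_Collect) (auto simp: bern_def)
  also have "\<dots> = ennreal (\<Prod>e\<in>E. measure (bern e) {e \<in> S})"
    unfolding M.emeasure_eq_measure by (simp add: prod_ennreal)
  finally have "measure (percolation \<beta> k) {\<omega> \<in> \<Omega>. \<forall>e\<in>E. \<omega> e = (e \<in> S)} = (\<Prod>e\<in>E. measure (bern e) {e \<in> S})"
    unfolding measure_def by (simp add: prod_nonneg)
  also have "\<dots> = (\<Prod>e\<in>E. if e \<in> S then 1 - exp (- w e) else exp (- w e))"
    using assms pm by (intro prod.cong) auto
  also have "\<dots> = (\<Prod>e\<in>E \<inter> S. 1 - exp (- w e)) * (\<Prod>e\<in>E \<inter> - S. exp (- w e))"
    using assms(1) by (simp add: prod.If_cases)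
  finally show ?thesis using assms(3) by (simp add: Int_absorb1 Diff_eq)
qed

lemma finite_event:
  assumes "finite E" "E \<subseteq> edges"
  shows "{\<omega> \<in> \<Omega>. P {e \<in> E. \<omega> e}} \<in> sets (percolation \<beta> k)"
    and "measure (percolation \<beta> k) {\<omega> \<in> \<Omega>. P {e \<in> E. \<omega> e}} = pprob E w P"
proof -
  let ?C = "\<lambda>S. {\<omega> \<in> \<Omega>. \<forall>e\<in>E. \<omega> e = (e \<in> S)}"
  have eq: "{\<omega> \<in> \<Omega>. P {e \<in> E. \<omega> e}} = (\<Union>S\<in>{S \<in> Pow E. P S}. ?C S)"
  proof (intro set_eqI iffI)
    fix \<omega> assume "\<omega> \<in> {\<omega> \<in> \<Omega>. P {e \<in> E. \<omega> e}}"
    then show "\<omega> \<in> (\<Union>S\<in>{S \<in> Pow E. P S}. ?C S)" by (intro UN_I[of "{e \<in> E. \<omega> e}"]) auto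
  next
    fix \<omega> assume "\<omega> \<in> (\<Union>S\<in>{S \<in> Pow E. P S}. ?C S)"
    then obtain S where S: "S \<subseteq> E" "P S" "\<omega> \<in> ?C S" by auto
    then have "{e \<in> E. \<omega> e} = S" by auto
    then show "\<omega> \<in> {\<omega> \<in> \<Omega>. P {e \<in> E. \<omega> e}}" using S by auto
  qed
  have fin: "finite {S \<in> Pow E. P S}" using assms(1) by simp
  show "{\<omega> \<in> \<Omega>. P {e \<in> E. \<omega> e}} \<in> sets (percolation \<beta> k)"
    unfolding eq using fin sets_cylinder[OF assms] by (intro sets.finite_UN) auto
  have "measure (percolation \<beta> k) {\<omega> \<in> \<Omega>. P {e \<in> E. \<omega> e}} = (\<Sum>S\<in>{S \<in> Pow E. P S}. measure (percolation \<beta> k) (?C S))"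
    unfolding eq
  proof (rule finite_measure.finite_measure_finite_Union[OF prob_space.finite_measure[OF prob_space_percolation] fin])
    show "?C ` {S \<in> Pow E. P S} \<subseteq> sets (percolation \<beta> k)"
      using sets_cylinder[OF assms] by auto
    show "disjoint_family_on ?C {S \<in> Pow E. P S}"
      unfolding disjoint_family_on_def
    proof (intro ballI impI equals0I)
      fix S T \<omega> assume S: "S \<in> {S \<in> Pow E. P S}" "T \<in> {S \<in> Pow E. P S}" "S \<noteq> T" and "\<omega> \<in> ?C S \<inter> ?C T"
      then have "\<forall>e\<in>E. e \<in> S \<longleftrightarrow> e \<in> T" by auto
      then show False using S by auto
    qed
  qed
  also have "\<dots> = (\<Sum>S\<in>{S \<in> Pow E. P S}. (\<Prod>e\<in>S. 1 - exp (- w e)) * (\<Prod>e\<in>E - S. exp (- w e)))"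
    using assms by (intro sum.cong measure_cylinder) auto
  also have "\<dots> = pprob E w P"
    unfolding pmean_def using assms(1) by (simp only: sum.inter_filter finite_Pow_iff) (intro sum.cong, auto)
  finally show "measure (percolation \<beta> k) {\<omega> \<in> \<Omega>. P {e \<in> E. \<omega> e}} = pprob E w P" .
qed

section \<open>Passage to the limit along finite vertex sets\<close>

definition initial :: "nat \<Rightarrow> 'v set" where "initial n = from_nat ` {..n}"

lemma initial: "finite (initial n)" "mono initial" "\<exists>n. x \<in> initial n"
proof -
  show "finite (initial n)" "mono initial" by (auto simp: initial_def mono_def)
  have "x \<in> initial (to_nat x)" unfolding initial_def by (intro image_eqI[of _ _ "to_nat x"]) auto
  then show "\<exists>n. x \<in> initial n" ..
qed

lemma finite_subset_box: "finite G \<Longrightarrow> \<exists>n. G \<subseteq> initial n"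
proof (induction G rule: finite_induct)
  case (insert x G)
  then obtain n m where "G \<subseteq> initial n" "x \<in> initial m" using initial(3) by blast
  then have "insert x G \<subseteq> initial (max n m)"
    using monoD[OF initial(2), of n "max n m"] monoD[OF initial(2), of m "max n m"] by auto
  then show ?case by blast
qed simp

lemma connected_in_iff_box:
  "connected_in \<omega> x y \<longleftrightarrow> (\<exists>n. linked {e \<in> edges_in (initial n). \<omega> e} x y)"
proof
  have sub: "{e \<in> edges_in (initial n). \<omega> e} \<subseteq> {e \<in> edges. \<omega> e}" for n using edges_in_edges by auto
  have "{u, v} \<in> edges \<longleftrightarrow> u \<noteq> v" for u v :: 'v by (auto simp: edges_def doubleton_eq_iff)
  then have "{(u, v). u \<noteq> v \<and> \<omega> {u, v}} = {(u, v). u \<noteq> v \<and> {u, v} \<in> {e \<in> edges. \<omega> e}}" by auto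
  then have eq: "connected_in \<omega> x y \<longleftrightarrow> linked {e \<in> edges. \<omega> e} x y"
    unfolding linked_def connected_in_def by (simp only:)
  show "connected_in \<omega> x y" if ex: "\<exists>n. linked {e \<in> edges_in (initial n). \<omega> e} x y"
  proof -
    obtain n where "linked {e \<in> edges_in (initial n). \<omega> e} x y" using ex by auto
    then show ?thesis unfolding eq by (rule linked_mono) (rule sub)
  qed
  assume "connected_in \<omega> x y"
  then have "linked {e \<in> edges. \<omega> e} x y" unfolding eq .
  then show "\<exists>n. linked {e \<in> edges_in (initial n). \<omega> e} x y"
  proof (induction rule: linked_induct)
    case (step y z)
    then obtain n where n: "linked {e \<in> edges_in (initial n). \<omega> e} x y" by auto
    obtain m where m: "{y, z} \<subseteq> initial m" using finite_subset_box[of "{y, z}"] by auto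
    let ?S = "{e \<in> edges_in (initial (max n m)). \<omega> e}"
    have "initial n \<subseteq> initial (max n m)" "initial m \<subseteq> initial (max n m)" using monoD[OF initial(2)] by auto
    then have "linked ?S x y" "{y, z} \<in> ?S"
      using linked_mono[OF n, of ?S] edges_in_mono[of "initial n" "initial (max n m)"] m step(2,3) by auto
    then have "linked ?S x z" by (rule linked_trans[OF _ linked_edge])
    then show ?case ..
  qed simp
qed

lemma sets_connected [measurable]: "{\<omega> \<in> \<Omega>. connected_in \<omega> x y} \<in> sets (percolation \<beta> k)"
proof -
  have "{\<omega> \<in> \<Omega>. connected_in \<omega> x y} = (\<Union>n. {\<omega> \<in> \<Omega>. linked {e \<in> edges_in (initial n). \<omega> e} x y})"
    using connected_in_iff_box by auto
  also have "\<dots> \<in> sets (percolation \<beta> k)"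
    using finite_event(1)[OF finite_edges_in[OF initial(1)] edges_in_edges, of "\<lambda>S. linked S x y"] by auto
  finally show ?thesis .
qed

lemma two_point_eq: "two_point \<beta> k x y = conn_prob w x y"
proof -
  let ?A = "\<lambda>n. {\<omega> \<in> \<Omega>. linked {e \<in> edges_in (initial n). \<omega> e} x y}"
  have "?A m \<subseteq> ?A n" if "m \<le> n" for m n
    using edges_in_mono[OF monoD[OF initial(2) that]] by (auto elim!: linked_mono)
  then have inc: "incseq ?A" by (rule incseq_SucI) simp
  have U: "(\<Union>n. ?A n) = {\<omega> \<in> \<Omega>. connected_in \<omega> x y}" using connected_in_iff_box by auto
  have "?A n \<in> sets (percolation \<beta> k)" for n
    by (rule finite_event(1)[OF finite_edges_in[OF initial(1)] edges_in_edges])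
  then have "(\<lambda>n. measure (percolation \<beta> k) (?A n)) \<longlonglongrightarrow> measure (percolation \<beta> k) (\<Union>n. ?A n)"
    using inc unfolding percolation_eq by (intro P.finite_Lim_measure_incseq) auto
  then have lim: "(\<lambda>n. link_prob (initial n) w x y) \<longlonglongrightarrow> two_point \<beta> k x y"
    unfolding U two_point_def link_prob_def
    using finite_event(2)[OF finite_edges_in[OF initial(1)] edges_in_edges, of "\<lambda>S. linked S x y"] by simp
  show ?thesis
  proof (rule antisym)
    show "two_point \<beta> k x y \<le> conn_prob w x y"
      using w_nonneg initial(1) by (intro LIMSEQ_le_const2[OF lim] exI[of _ 0]) (auto intro: link_prob_le_conn_prob)
    show "conn_prob w x y \<le> two_point \<beta> k x y"
    proof (rule conn_prob_le[OF w_nonneg])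
      fix F :: "'v set" assume "finite F"
      then obtain n where n: "F \<subseteq> initial n" using finite_subset_box by blast
      show "link_prob F w x y \<le> two_point \<beta> k x y"
      proof (rule LIMSEQ_le_const[OF lim], intro exI[of _ n] allI impI)
        fix m assume "n \<le> m"
        then have "F \<subseteq> initial m" using n monoD[OF initial(2), of n m] by auto
        then show "link_prob F w x y \<le> link_prob (initial m) w x y"
          using w_nonneg initial(1) by (intro link_prob_mono_set) auto
      qed
    qed
  qed
qed

lemma nn_integral_cluster:
  "(\<integral>\<^sup>+ \<omega>. (\<integral>\<^sup>+ x\<in>cluster \<omega> z. f x \<partial>count_space UNIV) \<partial>percolation \<beta> k)
    = (\<integral>\<^sup>+ x. f x * ennreal (conn_prob w z x) \<partial>count_space UNIV)"
proof -
  let ?P = "percolation \<beta> k"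
  interpret prob_space ?P unfolding percolation_eq by (rule P.prob_space_axioms)
  have meas: "(\<lambda>\<omega>. f x * indicator {\<omega> \<in> \<Omega>. connected_in \<omega> z x} \<omega>) \<in> borel_measurable ?P" for x
    by (intro borel_measurable_times_ennreal borel_measurable_indicator sets_connected) auto
  have "(\<integral>\<^sup>+ \<omega>. (\<integral>\<^sup>+ x\<in>cluster \<omega> z. f x \<partial>count_space UNIV) \<partial>?P)
      = (\<integral>\<^sup>+ \<omega>. (\<integral>\<^sup>+ x. f x * indicator {\<omega> \<in> \<Omega>. connected_in \<omega> z x} \<omega> \<partial>count_space UNIV) \<partial>?P)"
    by (intro nn_integral_cong) (auto simp: cluster_def indicator_def)
  also have "\<dots> = (\<integral>\<^sup>+ x. (\<integral>\<^sup>+ \<omega>. f x * indicator {\<omega> \<in> \<Omega>. connected_in \<omega> z x} \<omega> \<partial>?P) \<partial>count_space UNIV)"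
    by (rule nn_integral_count_space_nn_integral) (use meas in auto)
  also have "\<dots> = (\<integral>\<^sup>+ x. f x * ennreal (conn_prob w z x) \<partial>count_space UNIV)"
  proof (rule nn_integral_cong)
    fix x
    show "(\<integral>\<^sup>+ \<omega>. f x * indicator {\<omega> \<in> \<Omega>. connected_in \<omega> z x} \<omega> \<partial>?P) = f x * ennreal (conn_prob w z x)"
      using sets_connected[of z x] two_point_eq[of z x]
      by (simp add: nn_integral_cmult_indicator two_point_def emeasure_eq_measure)
  qed
  finally show ?thesis .
qed

text \<open>If the cluster of \<open>x\<close> is contained in a finite \<Lambda>, then
  \<open>x\<close> is trapped in every finite graph around \<Lambda>, so this has probability at
  most \<open>1 - c\<close>. The bound is uniform in \<Lambda> and survives the increasing limit, in
  which the event becomes finiteness of the cluster.\<close>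

lemma percolatesI:
  assumes c: "c > 0" and esc: "\<And>\<Lambda>. finite \<Lambda> \<Longrightarrow> x \<in> \<Lambda> \<Longrightarrow>
    \<exists>F. finite F \<and> \<Lambda> \<subseteq> F \<and> pprob (edges_in F) w (\<lambda>S. x \<in> trapped F \<Lambda> S) \<le> 1 - c"
  shows "percolates \<beta> k"
proof -
  let ?P = "percolation \<beta> k"
  interpret Q: prob_space ?P by (rule prob_space_percolation)
  obtain n0 where n0: "x \<in> initial n0" using initial(3) by blast
  let ?A = "\<lambda>n. {\<omega> \<in> \<Omega>. cluster \<omega> x \<subseteq> initial (n0 + n)}"
  have conn_sets: "{\<omega> \<in> \<Omega>. connected_in \<omega> x y \<longrightarrow> Q y} \<in> sets ?P" for x y Q
    using sets_connected[of x y] by (cases "Q y") (auto intro: sets.sets_Collect_neg)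
  have sub_sets: "{\<omega> \<in> \<Omega>. cluster \<omega> z \<subseteq> G} \<in> sets ?P" for z G
    unfolding cluster_def subset_iff mem_Collect_eq
    by (intro sets.sets_Collect_countable_All conn_sets)
  have inc: "incseq ?A"
    using monoD[OF initial(2)] by (intro incseq_SucI Collect_mono) (meson le_SucI nat_add_left_cancel_le order_refl subset_trans)
  have fin_iff: "finite (cluster \<omega> z) \<longleftrightarrow> (\<exists>n. cluster \<omega> z \<subseteq> initial n)" for \<omega> z
    using finite_subset_box initial(1) finite_subset by metis
  have fin_sets: "{\<omega> \<in> \<Omega>. finite (cluster \<omega> z)} \<in> sets ?P" for z
    unfolding fin_iff by (intro sets.sets_Collect_countable_Ex sub_sets)
  have inf_sets: "{\<omega> \<in> \<Omega>. infinite (cluster \<omega> z)} \<in> sets ?P" for z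
    by (intro sets.sets_Collect_neg fin_sets)
  have bound: "measure ?P (?A n) \<le> 1 - c" for n
  proof -
    let ?\<Lambda> = "initial (n0 + n)"
    have "x \<in> ?\<Lambda>" using n0 monoD[OF initial(2), of n0 "n0 + n"] by auto
    then obtain F where F: "finite F" "?\<Lambda> \<subseteq> F" "pprob (edges_in F) w (\<lambda>S. x \<in> trapped F ?\<Lambda> S) \<le> 1 - c"
      using esc[OF initial(1)] by blast
    have "x \<in> trapped F ?\<Lambda> {e \<in> edges_in F. \<omega> e}" if "cluster \<omega> x \<subseteq> ?\<Lambda>" for \<omega>
    proof -
      have "z \<in> ?\<Lambda>" if "linked {e \<in> edges_in F. \<omega> e} x z" for z
      proof -
        obtain m where "F \<subseteq> initial m" using finite_subset_box F(1) by blast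
        then have "{e \<in> edges_in F. \<omega> e} \<subseteq> {e \<in> edges_in (initial m). \<omega> e}" using edges_in_mono by blast
        then have "connected_in \<omega> x z" unfolding connected_in_iff_box using linked_mono[OF that] by blast
        then show ?thesis using \<open>cluster \<omega> x \<subseteq> ?\<Lambda>\<close> by (auto simp: cluster_def)
      qed
      then show ?thesis using F(2) \<open>x \<in> ?\<Lambda>\<close> by (auto simp: trapped_def)
    qed
    then have "measure ?P (?A n) \<le> measure ?P {\<omega> \<in> \<Omega>. x \<in> trapped F ?\<Lambda> {e \<in> edges_in F. \<omega> e}}"
      using finite_event(1)[OF finite_edges_in[OF F(1)] edges_in_edges, of "\<lambda>S. x \<in> trapped F ?\<Lambda> S"]
      by (intro Q.finite_measure_mono) auto
    then show ?thesis
      using F(3) finite_event(2)[OF finite_edges_in[OF F(1)] edges_in_edges, of "\<lambda>S. x \<in> trapped F ?\<Lambda> S"] by simp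
  qed
  have "(\<lambda>n. measure ?P (?A n)) \<longlonglongrightarrow> measure ?P (\<Union>n. ?A n)"
    using sub_sets inc by (intro Q.finite_Lim_measure_incseq) auto
  then have "measure ?P (\<Union>n. ?A n) \<le> 1 - c" by (rule LIMSEQ_le_const2) (use bound in auto)
  moreover have "(\<Union>n. ?A n) = {\<omega> \<in> \<Omega>. finite (cluster \<omega> x)}"
  proof (intro equalityI subsetI)
    fix \<omega> assume "\<omega> \<in> {\<omega> \<in> \<Omega>. finite (cluster \<omega> x)}"
    then obtain n where "\<omega> \<in> \<Omega>" "cluster \<omega> x \<subseteq> initial n" using fin_iff by auto
    then show "\<omega> \<in> (\<Union>n. ?A n)" using monoD[OF initial(2), of n "n0 + n"] by auto
  qed (use fin_iff in auto)
  moreover have "{\<omega> \<in> \<Omega>. infinite (cluster \<omega> x)} = \<Omega> - {\<omega> \<in> \<Omega>. finite (cluster \<omega> x)}" by auto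
  ultimately have "c \<le> measure ?P {\<omega> \<in> \<Omega>. infinite (cluster \<omega> x)}"
    using Q.prob_compl[OF fin_sets[of x]] by simp
  also have "\<dots> \<le> measure ?P {\<omega> \<in> \<Omega>. \<exists>x. infinite (cluster \<omega> x)}"
    by (intro Q.finite_measure_mono sets.sets_Collect_countable_Ex inf_sets) auto
  finally show ?thesis using c unfolding percolates_def by simp
qed

end

lemma nn_integral_count_space_ge:
  assumes "finite G"
  shows "(\<Sum>x\<in>G. f x) \<le> (\<integral>\<^sup>+ x. f x \<partial>count_space UNIV)"
proof -
  have "(\<Sum>x\<in>G. f x) = (\<integral>\<^sup>+ x. f x * indicator G x \<partial>count_space UNIV)"
    by (subst nn_integral_count_space'[of G]) (use assms in auto)
  also have "\<dots> \<le> (\<integral>\<^sup>+ x. f x \<partial>count_space UNIV)"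
    by (intro nn_integral_mono) (auto simp: indicator_def)
  finally show ?thesis .
qed

lemma nn_integral_count_space_le:
  fixes f :: "'a::countable \<Rightarrow> ennreal"
  assumes "\<And>G. finite G \<Longrightarrow> (\<Sum>x\<in>G. f x) \<le> c"
  shows "(\<integral>\<^sup>+ x. f x \<partial>count_space UNIV) \<le> c"
proof -
  let ?G = "\<lambda>n. from_nat ` {..n} :: 'a set"
  have "(SUP n. f x * indicator (?G n) x) = f x" for x
  proof (rule antisym)
    show "(SUP n. f x * indicator (?G n) x) \<le> f x" by (intro SUP_least) (auto simp: indicator_def)
    have "x \<in> ?G (to_nat x)" by (intro image_eqI[of _ _ "to_nat x"]) auto
    then show "f x \<le> (SUP n. f x * indicator (?G n) x)" by (intro SUP_upper2[of "to_nat x"]) auto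
  qed
  then have "(\<integral>\<^sup>+ x. f x \<partial>count_space UNIV) = (\<integral>\<^sup>+ x. (SUP n. f x * indicator (?G n) x) \<partial>count_space UNIV)" by simp
  also have "\<dots> = (SUP n. \<integral>\<^sup>+ x. f x * indicator (?G n) x \<partial>count_space UNIV)"
    by (intro nn_integral_monotone_convergence_SUP) (auto simp: incseq_def le_fun_def indicator_def)
  also have "\<dots> \<le> c"
  proof (rule SUP_least)
    fix n
    have "(\<integral>\<^sup>+ x. f x * indicator (?G n) x \<partial>count_space UNIV) = (\<Sum>x\<in>?G n. f x)"
      by (subst nn_integral_count_space'[of "?G n"]) auto
    then show "(\<integral>\<^sup>+ x. f x * indicator (?G n) x \<partial>count_space UNIV) \<le> c" using assms by simp
  qed
  finally show ?thesis .
qed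

section \<open>Lattice geometry\<close>

lemma of_lattice_simps [simp]:
  "of_lattice 0 = 0" "of_lattice (x + y) = of_lattice x + of_lattice y"
  "of_lattice (x - y) = of_lattice x - of_lattice y" "of_lattice (- x) = - of_lattice x"
  by (simp_all add: of_lattice_def vec_eq_iff)

lemma of_lattice_eq_iff [simp]: "of_lattice x = of_lattice y \<longleftrightarrow> x = y"
  by (simp add: of_lattice_def vec_eq_iff)

lemma card_cube: "card {x :: int ^ 'n. \<forall>i. \<bar>x $ i\<bar> \<le> int m} = (2 * m + 1) ^ CARD('n)"
  and finite_cube: "finite {x :: int ^ 'n. \<forall>i. \<bar>x $ i\<bar> \<le> int m}"
proof -
  let ?P = "\<Pi>\<^sub>E i\<in>(UNIV :: 'n set). {- int m..int m}"
  have bij: "bij_betw (\<lambda>x. ($) x) {x :: int ^ 'n. \<forall>i. \<bar>x $ i\<bar> \<le> int m} ?P"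
  proof (rule bij_betw_byWitness[where f' = vec_lambda])
    have abs: "\<bar>z\<bar> \<le> int m \<longleftrightarrow> - int m \<le> z \<and> z \<le> int m" for z by auto
    show "(\<lambda>x. ($) x) ` {x :: int ^ 'n. \<forall>i. \<bar>x $ i\<bar> \<le> int m} \<subseteq> ?P" unfolding abs by auto
    show "vec_lambda ` ?P \<subseteq> {x :: int ^ 'n. \<forall>i. \<bar>x $ i\<bar> \<le> int m}" unfolding abs by (auto simp: PiE_iff)
  qed auto
  have "card {- int m..int m} = 2 * m + 1" by simp
  then have "card ?P = (2 * m + 1) ^ CARD('n)" by (simp add: card_PiE)
  then show "card {x :: int ^ 'n. \<forall>i. \<bar>x $ i\<bar> \<le> int m} = (2 * m + 1) ^ CARD('n)"
    using bij_betw_same_card[OF bij] by simp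
  show "finite {x :: int ^ 'n. \<forall>i. \<bar>x $ i\<bar> \<le> int m}"
    using bij_betw_finite[OF bij] by (simp add: finite_PiE)
qed

locale lattice_norm =
  fixes N :: "real ^ 'n \<Rightarrow> real"
  assumes is_norm: "is_norm N"
begin

definition len :: "int ^ 'n \<Rightarrow> real" where "len x = N (of_lattice x)"

lemma N_nonneg: "0 \<le> N v" and N_eq_0: "N v = 0 \<longleftrightarrow> v = 0" and N_scale: "N (c *\<^sub>R v) = \<bar>c\<bar> * N v"
  and N_triangle: "N (v + v') \<le> N v + N v'"
  using is_norm unfolding is_norm_def by auto

lemma N_minus: "N (- v) = N v"
  using N_scale[of "-1" v] by simp

lemma lattice_dist_eq: "lattice_dist N x y = len (x - y)"
  by (simp add: lattice_dist_def len_def)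

lemma len_nonneg [simp]: "0 \<le> len x" and len_0 [simp]: "len 0 = 0" and len_minus: "len (- x) = len x"
  and len_triangle: "len (x + y) \<le> len x + len y"
  unfolding len_def using N_nonneg N_eq_0 N_minus N_triangle by auto

lemma len_eq_0: "len x = 0 \<longleftrightarrow> x = 0"
  unfolding len_def using N_eq_0 of_lattice_eq_iff[of x 0] by simp

lemma len_pos: "x \<noteq> 0 \<Longrightarrow> 0 < len x"
  using len_eq_0[of x] len_nonneg[of x] by linarith

lemma len_minus_commute: "len (x - y) = len (y - x)"
  using len_minus[of "x - y"] by simp

lemma len_triangle3: "len (x - z) \<le> len (x - y) + len (y - z)"
  using len_triangle[of "x - y" "y - z"] by simp

lemma len_triangle_diff: "len x - len y \<le> len (x - y)"
  using len_triangle[of "x - y" y] by simp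

lemma norm_equiv: obtains c C where "0 < c" "0 < C" "\<And>v. c * norm v \<le> N v" "\<And>v. N v \<le> C * norm v"
proof -
  define C where "C = (\<Sum>i\<in>UNIV. N (axis i 1)) + 1"
  have C: "0 < C" unfolding C_def using sum_nonneg[of UNIV "\<lambda>i. N (axis i 1)"] N_nonneg by (simp add: add_nonneg_pos)
  have sum_le: "N (sum f A) \<le> (\<Sum>i\<in>A. N (f i))" if "finite A" for f and A :: "'n set"
    using that
  proof (induction A)
    case (insert a A)
    then show ?case using N_triangle[of "f a" "sum f A"] by simp
  qed (use N_eq_0[of 0] in simp)
  have up: "N v \<le> C * norm v" for v
  proof -
    have "v = (\<Sum>i\<in>UNIV. (v $ i) *\<^sub>R axis i 1)"
      by (simp add: vec_eq_iff axis_def sum.If_cases if_distrib cong: if_cong)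
    then have "N v = N (\<Sum>i\<in>UNIV. (v $ i) *\<^sub>R axis i 1)" by simp
    also have "\<dots> \<le> (\<Sum>i\<in>UNIV. \<bar>v $ i\<bar> * N (axis i 1))"
      using sum_le[of UNIV "\<lambda>i. (v $ i) *\<^sub>R axis i 1"] by (simp add: N_scale)
    also have "\<dots> \<le> (\<Sum>i\<in>UNIV. norm v * N (axis i 1))"
      using component_le_norm_cart N_nonneg by (intro sum_mono mult_right_mono) auto
    also have "\<dots> \<le> C * norm v" unfolding C_def by (simp add: sum_distrib_left[symmetric] algebra_simps)
    finally show ?thesis .
  qed
  have "N v - N v' \<le> C * norm (v - v')" for v v'
    using N_triangle[of "v - v'" v'] up[of "v - v'"] by simp
  then have lip: "\<bar>N v - N v'\<bar> \<le> C * dist v v'" for v v'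
    unfolding dist_norm by (metis abs_le_iff minus_diff_eq norm_minus_commute)
  have "C-lipschitz_on UNIV N" using lip C by (intro lipschitz_onI) (auto simp: dist_real_def)
  then have cont: "continuous_on (sphere 0 1) N"
    using lipschitz_on_continuous_on continuous_on_subset by blast
  have "sphere (0 :: real ^ 'n) 1 \<noteq> {}" using norm_axis_1[of undefined] by (auto simp: sphere_def dist_norm intro: exI[of _ "axis undefined 1"])
  then obtain u where u: "u \<in> sphere 0 1" "\<And>v. v \<in> sphere 0 1 \<Longrightarrow> N u \<le> N v"
    using continuous_attains_inf[OF compact_sphere _ cont] by blast
  have "u \<noteq> 0" using u(1) by auto
  then have "0 < N u" using N_nonneg[of u] N_eq_0[of u] by linarith
  moreover have "N u * norm v \<le> N v" for v
  proof (cases "v = 0")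
    case True
    then show ?thesis using N_nonneg by simp
  next
    case False
    then have "N u \<le> N ((1 / norm v) *\<^sub>R v)" by (intro u(2)) simp
    then show ?thesis using False by (simp add: N_scale field_simps)
  qed
  ultimately show ?thesis using that C up by blast
qed

abbreviation ball_at :: "int ^ 'n \<Rightarrow> real \<Rightarrow> (int ^ 'n) set" where
  "ball_at c s \<equiv> {x. len (x - c) \<le> s}"

lemma len_cube: obtains c C where "0 < c" "0 < C" "\<And>x i. c * \<bar>real_of_int (x $ i)\<bar> \<le> len x"
    "\<And>x t. (\<And>i. \<bar>real_of_int (x $ i)\<bar> \<le> t) \<Longrightarrow> len x \<le> C * t"
proof -
  obtain c C where c: "0 < c" "0 < C" "\<And>v. c * norm v \<le> N v" "\<And>v. N v \<le> C * norm v" by (rule norm_equiv) blast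
  show ?thesis
  proof (rule that[of c "C * real CARD('n)"])
    fix x :: "int ^ 'n" and i
    have "\<bar>real_of_int (x $ i)\<bar> \<le> norm (of_lattice x)"
      using component_le_norm_cart[of "of_lattice x" i] by (simp add: of_lattice_def)
    then have "c * \<bar>real_of_int (x $ i)\<bar> \<le> c * norm (of_lattice x)" using c by (intro mult_left_mono) auto
    then show "c * \<bar>real_of_int (x $ i)\<bar> \<le> len x" using c(3)[of "of_lattice x"] unfolding len_def by linarith
  next
    fix x :: "int ^ 'n" and t
    assume t: "\<And>i. \<bar>real_of_int (x $ i)\<bar> \<le> t"
    have "norm (of_lattice x) \<le> (\<Sum>i\<in>UNIV. \<bar>of_lattice x $ i\<bar>)" by (rule norm_le_l1_cart)
    also have "\<dots> \<le> (\<Sum>i\<in>(UNIV :: 'n set). t)" using t by (intro sum_mono) (simp add: of_lattice_def)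
    finally have "C * norm (of_lattice x) \<le> C * (real CARD('n) * t)" using c by (intro mult_left_mono) auto
    then show "len x \<le> C * real CARD('n) * t" using c(4)[of "of_lattice x"] unfolding len_def by (simp add: mult.assoc)
  qed (use c in auto)
qed

lemma finite_ball_at [simp]: "finite (ball_at c s)"
proof -
  obtain c0 C0 where c: "0 < c0" "\<And>(x :: int ^ 'n) i. c0 * \<bar>real_of_int (x $ i)\<bar> \<le> len x" by (rule len_cube) blast
  have "ball_at 0 s \<subseteq> {x. \<forall>i. \<bar>x $ i\<bar> \<le> int (nat \<lceil>s / c0\<rceil>)}"
  proof safe
    fix x :: "int ^ 'n" and i assume "len (x - 0) \<le> s"
    then have "c0 * \<bar>real_of_int (x $ i)\<bar> \<le> s" using c(2)[of x i] by simp
    then have "real_of_int \<bar>x $ i\<bar> \<le> s / c0" using c(1) by (simp add: field_simps)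
    then show "\<bar>x $ i\<bar> \<le> int (nat \<lceil>s / c0\<rceil>)" by linarith
  qed
  then have "finite (ball_at 0 s)" using finite_cube finite_subset by blast
  moreover have "ball_at c s = (+) c ` ball_at 0 s"
    by (auto simp: image_iff intro!: exI[of _ "x - c" for x])
  ultimately show ?thesis by simp
qed

lemma finite_ball_0 [simp]: "finite {x. len x \<le> s}"
  using finite_ball_at[of 0 s] by simp

lemma card_ball_at: "card (ball_at c s) = card (ball_at 0 s)"
proof -
  have "ball_at c s = (+) c ` ball_at 0 s"
    by (auto simp: image_iff intro!: exI[of _ "x - c" for x])
  then show ?thesis by (simp add: card_image)
qed

text \<open>Comparison with cubes of integer points. A ball always contains its centre; hence the
  lower bound holds from \<open>s = 0\<close> on, whereas the upper bound needs a radius bounded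
  below.\<close>

lemma card_ball: obtains c C where "0 < c" "0 < C"
    "\<And>z s. 0 \<le> s \<Longrightarrow> c * s ^ CARD('n) \<le> real (card (ball_at z s))"
    "\<And>z s. 1 \<le> s \<Longrightarrow> real (card (ball_at z s)) \<le> C * s ^ CARD('n)"
proof -
  obtain a b where a: "0 < a" "0 < b" "\<And>(x :: int ^ 'n) i. a * \<bar>real_of_int (x $ i)\<bar> \<le> len x"
    "\<And>(x :: int ^ 'n) t. (\<And>i. \<bar>real_of_int (x $ i)\<bar> \<le> t) \<Longrightarrow> len x \<le> b * t" by (rule len_cube) blast
  let ?d = "CARD('n)"
  have low: "(1 / b) ^ ?d * s ^ ?d \<le> real (card (ball_at z s))" if s: "0 \<le> s" for s z
  proof -
    define m where "m = nat \<lfloor>s / b\<rfloor>"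
    have m: "real m \<le> s / b" "s / b < real m + 1" using s a by (simp_all add: m_def)
    have "{x. \<forall>i. \<bar>x $ i\<bar> \<le> int m} \<subseteq> ball_at 0 s"
    proof
      fix x :: "int ^ 'n" assume "x \<in> {x. \<forall>i. \<bar>x $ i\<bar> \<le> int m}"
      then have "real_of_int \<bar>x $ i\<bar> \<le> real_of_int (int m)" for i unfolding of_int_le_iff by simp
      then have "\<bar>real_of_int (x $ i)\<bar> \<le> real m" for i by simp
      then have "len x \<le> b * real m" by (rule a(4))
      also have "\<dots> \<le> s" using m(1) a(2) by (simp add: field_simps)
      finally show "x \<in> ball_at 0 s" by simp
    qed
    then have "(2 * m + 1) ^ ?d \<le> card (ball_at 0 s)"
      unfolding card_cube[symmetric] by (rule card_mono[OF finite_ball_at])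
    then have "real ((2 * m + 1) ^ ?d) \<le> real (card (ball_at z s))" unfolding card_ball_at[of z] by (rule of_nat_mono)
    moreover have "(s / b) ^ ?d \<le> (real (2 * m + 1)) ^ ?d" using m s a by (intro power_mono) auto
    ultimately show ?thesis by (simp add: power_divide)
  qed
  have up: "real (card (ball_at z s)) \<le> (2 / a + 1) ^ ?d * s ^ ?d" if s: "1 \<le> s" for s z
  proof -
    define m where "m = nat \<lfloor>s / a\<rfloor>"
    have m: "real m \<le> s / a" "s / a < real m + 1" using s a by (simp_all add: m_def)
    have "ball_at 0 s \<subseteq> {x. \<forall>i. \<bar>x $ i\<bar> \<le> int m}"
    proof safe
      fix x :: "int ^ 'n" and i assume "len (x - 0) \<le> s"
      then have "a * \<bar>real_of_int (x $ i)\<bar> \<le> s" using a(3)[of x i] by simp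
      then have "real_of_int \<bar>x $ i\<bar> \<le> s / a" using a(1) by (simp add: field_simps)
      then show "\<bar>x $ i\<bar> \<le> int m" unfolding m_def by linarith
    qed
    then have "card (ball_at 0 s) \<le> (2 * m + 1) ^ ?d"
      unfolding card_cube[symmetric] by (rule card_mono[OF finite_cube])
    then have "real (card (ball_at z s)) \<le> real ((2 * m + 1) ^ ?d)" unfolding card_ball_at[of z] by (rule of_nat_mono)
    also have "\<dots> = (2 * real m + 1) ^ ?d" by (simp add: add.commute)
    also have "(2 / a + 1) * s = 2 * (s / a) + s" by (simp add: algebra_simps)
    then have "(2 * real m + 1) ^ ?d \<le> ((2 / a + 1) * s) ^ ?d"
      using m s by (intro power_mono) auto
    finally show ?thesis by (simp add: power_mult_distrib)
  qed
  have "0 < 2 / a + 1" using a(1) by (simp add: add_pos_pos)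
  then show ?thesis using a(2) by (intro that[of "(1 / b) ^ ?d" "(2 / a + 1) ^ ?d"] low up zero_less_power) auto
qed

lemma min_len: obtains s where "0 < s" "s \<le> 1" "\<And>x. x \<noteq> 0 \<Longrightarrow> s \<le> len x"
proof -
  let ?B = "ball_at 0 1 - {0}"
  have fin: "finite (insert 1 (len ` ?B))" by simp
  define s where "s = Min (insert 1 (len ` ?B))"
  have "0 < s" unfolding s_def using len_pos by (subst Min_gr_iff) auto
  moreover have "s \<le> 1" unfolding s_def by (rule Min_le) auto
  moreover have "s \<le> len x" if "x \<noteq> 0" for x
  proof (cases "len x \<le> 1")
    case True
    then show ?thesis unfolding s_def using that by (intro Min_le) auto
  next
    case False
    then show ?thesis using \<open>s \<le> 1\<close> by simp
  qed
  ultimately show ?thesis using that by blast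
qed

end

section \<open>Translation-invariant percolation on the lattice\<close>

lemma edge_weight_pair:
  assumes "\<And>x y. k x y = k y x"
  shows "edge_weight k {x, y} = k x y"
  unfolding edge_weight_def
proof (rule the_equality)
  fix t assume "\<exists>x' y'. {x, y} = {x', y'} \<and> t = k x' y'"
  then show "t = k x y" using assms by (auto simp: doubleton_eq_iff)
qed auto

lemma sum_swap3: "(\<Sum>x\<in>G. \<Sum>u\<in>A. \<Sum>v\<in>B u. f x u v) = (\<Sum>u\<in>A. \<Sum>v\<in>B u. \<Sum>x\<in>G. f x u v)"
  by (subst sum.swap) (intro sum.cong refl sum.swap)

context lattice_norm
begin

text \<open>The value 0 on sets that are not edges makes the weight nonnegative everywhere and
  translation invariant without side conditions.\<close>

definition radial :: "(real \<Rightarrow> real) \<Rightarrow> (int ^ 'n) set \<Rightarrow> real" where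
  "radial \<phi> e = (if e \<in> edges then \<phi> (edge_weight (lattice_dist N) e) else 0)"

lemma radial_pair [simp]: "x \<noteq> y \<Longrightarrow> radial \<phi> {x, y} = \<phi> (len (x - y))"
  unfolding radial_def using edge_weight_pair[of "lattice_dist N" x y]
  by (auto simp: edges_def lattice_dist_eq len_minus_commute)

lemma edge_cases:
  assumes "e \<in> edges"
  obtains x y where "x \<noteq> y" "e = {x, y}"
  using assms unfolding edges_def by auto

lemma radial_nonneg: "(\<And>t. 0 < t \<Longrightarrow> 0 \<le> \<phi> t) \<Longrightarrow> 0 \<le> radial \<phi> e"
  by (cases "e \<in> edges") (auto elim!: edge_cases simp: len_pos, simp add: radial_def)

lemma radial_add: "radial (\<lambda>t. \<phi> t + \<psi> t) = (\<lambda>e. radial \<phi> e + radial \<psi> e)"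
  by (auto simp: radial_def fun_eq_iff)

lemma radial_translate: "radial \<phi> ((+) a ` e) = radial \<phi> e"
proof (cases "e \<in> edges")
  case True
  then obtain x y where "x \<noteq> y" "e = {x, y}" by (rule edge_cases)
  then show ?thesis by simp
next
  case False
  have "(+) a ` e \<notin> edges"
  proof
    assume "(+) a ` e \<in> edges"
    then obtain x y where xy: "x \<noteq> y" "(+) a ` e = {x, y}" by (rule edge_cases)
    have "e = (+) (- a) ` (+) a ` e" by (simp add: image_image)
    then have e: "e = {x - a, y - a}" unfolding xy(2) by simp
    have "e \<in> edges" unfolding edges_def using xy(1)
      by (intro CollectI exI[of _ "x - a"] exI[of _ "y - a"]) (simp add: e)
    then show False using False by simp
  qed
  then show ?thesis using False by (simp add: radial_def)
qed

section \<open>Two-point function and susceptibility of a radial weight\<close>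

definition tau :: "(real \<Rightarrow> real) \<Rightarrow> int ^ 'n \<Rightarrow> real" where
  "tau \<phi> x = conn_prob (radial \<phi>) 0 x"

text \<open>A real supremum, meaningful only together with \<open>fin_chi\<close>. Real values keep
  inequalities in which the susceptibility occurs on both sides free of infinite cases.\<close>

definition chi :: "(real \<Rightarrow> real) \<Rightarrow> real" where
  "chi \<phi> = (SUP G\<in>{G. finite G}. \<Sum>x\<in>G. tau \<phi> x)"

definition fin_chi :: "(real \<Rightarrow> real) \<Rightarrow> bool" where
  "fin_chi \<phi> \<longleftrightarrow> bdd_above ((\<lambda>G. \<Sum>x\<in>G. tau \<phi> x) ` {G. finite G})"

definition nn :: "(real \<Rightarrow> real) \<Rightarrow> bool" where
  "nn \<phi> \<longleftrightarrow> (\<forall>t>0. 0 \<le> \<phi> t)"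

lemma nn_radial: "nn \<phi> \<Longrightarrow> 0 \<le> radial \<phi> e"
  unfolding nn_def by (intro radial_nonneg) auto

lemma tau_nonneg: "nn \<phi> \<Longrightarrow> 0 \<le> tau \<phi> x" and tau_le_1: "nn \<phi> \<Longrightarrow> tau \<phi> x \<le> 1"
  and tau_0: "nn \<phi> \<Longrightarrow> tau \<phi> 0 = 1"
  unfolding tau_def by (auto intro: conn_prob_nonneg conn_prob_le_1 conn_prob_refl nn_radial)

lemma conn_prob_eq_tau:
  assumes "nn \<phi>"
  shows "conn_prob (radial \<phi>) x y = tau \<phi> (y - x)"
proof -
  have "bij ((+) x)" by (rule bij_betw_byWitness[where f' = "(+) (- x)"]) auto
  then have "conn_prob (\<lambda>e. radial \<phi> ((+) x ` e)) 0 (y - x) = conn_prob (radial \<phi>) (x + 0) (x + (y - x))"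
    using nn_radial[OF assms] by (intro conn_prob_relabel)
  then show ?thesis unfolding radial_translate tau_def by simp
qed

lemma tau_minus: "nn \<phi> \<Longrightarrow> tau \<phi> (- x) = tau \<phi> x"
  using conn_prob_eq_tau[of \<phi> 0 x] conn_prob_eq_tau[of \<phi> x 0] conn_prob_commute[of "radial \<phi>" 0 x]
  by (simp add: nn_radial)

lemma tau_minus_commute: "nn \<phi> \<Longrightarrow> tau \<phi> (x - y) = tau \<phi> (y - x)"
  using tau_minus[of \<phi> "x - y"] by simp

lemma tau_mono:
  assumes "nn \<phi>" "nn \<psi>" "\<And>x. x \<noteq> 0 \<Longrightarrow> \<phi> (len x) \<le> \<psi> (len x)"
  shows "tau \<phi> x \<le> tau \<psi> x"
  unfolding tau_def using assms by (intro conn_prob_mono nn_radial) auto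

lemma link_prob_le_tau:
  assumes "nn \<phi>" "finite F"
  shows "link_prob F (radial \<phi>) x y \<le> tau \<phi> (y - x)"
  using link_prob_le_conn_prob[of "radial \<phi>" F x y] assms nn_radial conn_prob_eq_tau by simp

lemma sum_tau_le_chi: "fin_chi \<phi> \<Longrightarrow> finite G \<Longrightarrow> (\<Sum>x\<in>G. tau \<phi> x) \<le> chi \<phi>"
  unfolding fin_chi_def chi_def by (intro cSUP_upper) auto

lemma sum_tau_shift_le_chi:
  assumes "fin_chi \<phi>" "finite G"
  shows "(\<Sum>x\<in>G. tau \<phi> (x - v)) \<le> chi \<phi>"
proof -
  have "(\<Sum>x\<in>G. tau \<phi> (x - v)) = (\<Sum>x\<in>(\<lambda>x. x - v) ` G. tau \<phi> x)"
    by (subst sum.reindex) (auto simp: inj_on_def)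
  then show ?thesis using sum_tau_le_chi[OF assms(1)] assms(2) by simp
qed

lemma chi_le: "(\<And>G. finite G \<Longrightarrow> (\<Sum>x\<in>G. tau \<phi> x) \<le> c) \<Longrightarrow> chi \<phi> \<le> c"
  unfolding chi_def by (intro cSUP_least) auto

lemma fin_chiI: "(\<And>G. finite G \<Longrightarrow> (\<Sum>x\<in>G. tau \<phi> x) \<le> c) \<Longrightarrow> fin_chi \<phi>"
  unfolding fin_chi_def by (rule bdd_aboveI2[where M = c]) simp

lemma chi_ge_1: "nn \<phi> \<Longrightarrow> fin_chi \<phi> \<Longrightarrow> 1 \<le> chi \<phi>"
  using sum_tau_le_chi[of \<phi> "{0}"] tau_0 by simp

lemma chi_approx:
  assumes "fin_chi \<phi>" "c < chi \<phi>"
  obtains G where "finite G" "c < (\<Sum>x\<in>G. tau \<phi> x)"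
  using assms less_cSUP_iff[of "{G. finite G}" "\<lambda>G. \<Sum>x\<in>G. tau \<phi> x" c]
  unfolding fin_chi_def chi_def by auto

lemma fin_chi_mono:
  assumes "nn \<phi>" "nn \<psi>" "\<And>x. x \<noteq> 0 \<Longrightarrow> \<phi> (len x) \<le> \<psi> (len x)" "fin_chi \<psi>"
  shows "fin_chi \<phi>" "chi \<phi> \<le> chi \<psi>"
proof -
  have "(\<Sum>x\<in>G. tau \<phi> x) \<le> chi \<psi>" if "finite G" for G
  proof -
    have "(\<Sum>x\<in>G. tau \<phi> x) \<le> (\<Sum>x\<in>G. tau \<psi> x)" using assms by (intro sum_mono tau_mono) auto
    then show ?thesis using sum_tau_le_chi[OF assms(4) that] by linarith
  qed
  then show "fin_chi \<phi>" "chi \<phi> \<le> chi \<psi>" by (auto intro: fin_chiI chi_le)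
qed

lemma link_prob_superpose:
  assumes "nn \<phi>" "nn \<psi>" "finite F"
  shows "link_prob F (radial (\<lambda>t. \<phi> t + \<psi> t)) 0 x \<le> tau \<phi> x +
    (\<Sum>u\<in>F. \<Sum>v\<in>F - {u}. tau \<phi> u * \<psi> (len (v - u)) * tau (\<lambda>t. \<phi> t + \<psi> t) (x - v))"
proof -
  have nn: "nn (\<lambda>t. \<phi> t + \<psi> t)" using assms by (auto simp: nn_def)
  have "link_prob F (radial (\<lambda>t. \<phi> t + \<psi> t)) 0 x \<le> link_prob F (radial \<phi>) 0 x +
    (\<Sum>u\<in>F. \<Sum>v\<in>F - {u}. link_prob F (radial \<phi>) 0 u * radial \<psi> {u, v} * link_prob F (radial (\<lambda>t. \<phi> t + \<psi> t)) v x)"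
    unfolding radial_add using assms by (intro simon_lieb nn_radial)
  also have "\<dots> \<le> tau \<phi> x +
    (\<Sum>u\<in>F. \<Sum>v\<in>F - {u}. tau \<phi> u * \<psi> (len (v - u)) * tau (\<lambda>t. \<phi> t + \<psi> t) (x - v))"
  proof (intro add_mono sum_mono mult_mono)
    fix u v assume "u \<in> F" "v \<in> F - {u}"
    then have "u \<noteq> v" by auto
    then show "radial \<psi> {u, v} \<le> \<psi> (len (v - u))" "0 \<le> radial \<psi> {u, v}"
      using assms(2) len_pos[of "u - v"] by (auto simp: nn_def len_minus_commute)
    have "0 < len (v - u)" using \<open>u \<noteq> v\<close> by (intro len_pos) auto
    then show "0 \<le> tau \<phi> u * \<psi> (len (v - u))" using assms(1,2) tau_nonneg by (auto simp: nn_def)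
    show "0 \<le> link_prob F (radial (\<lambda>t. \<phi> t + \<psi> t)) v x" using nn_radial[OF nn] by (intro link_prob_nonneg)
    show "link_prob F (radial (\<lambda>t. \<phi> t + \<psi> t)) v x \<le> tau (\<lambda>t. \<phi> t + \<psi> t) (x - v)"
      by (rule link_prob_le_tau[OF nn assms(3)])
    show "link_prob F (radial \<phi>) 0 u \<le> tau \<phi> u" using link_prob_le_tau[OF assms(1,3), of 0 u] by simp
  qed (use assms(1) link_prob_le_tau[OF assms(1,3), of 0 x] tau_nonneg in auto)
  finally show ?thesis .
qed

lemma tau_le_of_link_prob: "(\<And>F. finite F \<Longrightarrow> link_prob F (radial \<phi>) 0 x \<le> c) \<Longrightarrow> nn \<phi> \<Longrightarrow> tau \<phi> x \<le> c"
  unfolding tau_def by (rule conn_prob_le) (auto intro: nn_radial)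

text \<open>The error is shared among the points of \<open>G\<close>, so that one finite graph
  approximates the whole sum. The set \<open>F0\<close> is carried along for uses that need a
  prescribed part of the graph.\<close>

lemma sum_tau_approx:
  assumes "nn \<phi>" "finite G" "0 < \<epsilon>" "finite F0"
  obtains F where "finite F" "F0 \<subseteq> F" "(\<Sum>x\<in>G. tau \<phi> x) \<le> (\<Sum>x\<in>G. link_prob F (radial \<phi>) 0 x) + \<epsilon>"
proof -
  define \<delta> where "\<delta> = \<epsilon> / (1 + real (card G))"
  have "0 < \<delta>" using assms(3) by (simp add: \<delta>_def add_pos_nonneg)
  obtain F where F: "finite F" "F0 \<subseteq> F"
    "\<And>x y. (x, y) \<in> {0} \<times> G \<Longrightarrow> conn_prob (radial \<phi>) x y - \<delta> < link_prob F (radial \<phi>) x y"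
    using conn_prob_approx_sum[of "radial \<phi>" \<delta> "{0} \<times> G" F0] nn_radial[OF assms(1)] \<open>0 < \<delta>\<close> assms(2,4) by auto
  have "(\<Sum>x\<in>G. tau \<phi> x) \<le> (\<Sum>x\<in>G. link_prob F (radial \<phi>) 0 x + \<delta>)"
    using F(3)[of 0] by (intro sum_mono) (force simp: tau_def)
  also have "\<dots> = (\<Sum>x\<in>G. link_prob F (radial \<phi>) 0 x) + real (card G) * \<delta>" by (simp add: sum.distrib)
  also have "real (card G) * \<delta> \<le> \<epsilon>" unfolding \<delta>_def using assms(3) by (simp add: field_simps)
  finally show ?thesis using that F by auto
qed

text \<open>Sum the Simon-Lieb inequality over \<open>x\<close>, then over \<open>v\<close>, then
  over \<open>u\<close>. By translation invariance each sum is bounded uniformly in the remaining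
  variables, and the three bounds multiply.\<close>

lemma chi_superpose_le:
  assumes nn: "nn \<phi>" "nn \<psi>" and fin: "fin_chi \<phi>" "fin_chi (\<lambda>t. \<phi> t + \<psi> t)"
    and \<Psi>: "\<And>G. finite G \<Longrightarrow> 0 \<notin> G \<Longrightarrow> (\<Sum>v\<in>G. \<psi> (len v)) \<le> \<Psi>"
  shows "chi (\<lambda>t. \<phi> t + \<psi> t) \<le> chi \<phi> + chi \<phi> * \<Psi> * chi (\<lambda>t. \<phi> t + \<psi> t)"
proof (rule chi_le)
  let ?s = "\<lambda>t. \<phi> t + \<psi> t"
  fix G :: "(int ^ 'n) set" assume G: "finite G"
  have nns: "nn ?s" using nn by (auto simp: nn_def)
  have \<Psi>0: "0 \<le> \<Psi>" using \<Psi>[of "{}"] by simp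
  have chis: "0 \<le> chi ?s" using chi_ge_1[OF nns fin(2)] by simp
  show "(\<Sum>x\<in>G. tau ?s x) \<le> chi \<phi> + chi \<phi> * \<Psi> * chi ?s"
  proof (rule field_le_epsilon)
    fix \<epsilon> :: real assume "0 < \<epsilon>"
    obtain F where F: "finite F" "(\<Sum>x\<in>G. tau ?s x) \<le> (\<Sum>x\<in>G. link_prob F (radial ?s) 0 x) + \<epsilon>"
      using sum_tau_approx[OF nns G \<open>0 < \<epsilon>\<close>, of "{}"] by auto
    have "(\<Sum>x\<in>G. link_prob F (radial ?s) 0 x) \<le> (\<Sum>x\<in>G. tau \<phi> x +
        (\<Sum>u\<in>F. \<Sum>v\<in>F - {u}. tau \<phi> u * \<psi> (len (v - u)) * tau ?s (x - v)))"
      using link_prob_superpose[OF nn F(1)] by (intro sum_mono)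
    also have "\<dots> = (\<Sum>x\<in>G. tau \<phi> x) + (\<Sum>u\<in>F. \<Sum>v\<in>F - {u}. tau \<phi> u * \<psi> (len (v - u)) * (\<Sum>x\<in>G. tau ?s (x - v)))"
      unfolding sum.distrib sum_distrib_left by (rule arg_cong2[of _ _ _ _ "(+)", OF refl sum_swap3])
    also have "\<dots> \<le> chi \<phi> + (\<Sum>u\<in>F. \<Sum>v\<in>F - {u}. tau \<phi> u * \<psi> (len (v - u)) * chi ?s)"
    proof (intro add_mono sum_mono mult_left_mono)
      fix u v assume "u \<in> F" "v \<in> F - {u}"
      then have "0 < len (v - u)" by (intro len_pos) auto
      then show "0 \<le> tau \<phi> u * \<psi> (len (v - u))" using nn tau_nonneg by (auto simp: nn_def)
    qed (use sum_tau_le_chi fin G sum_tau_shift_le_chi in auto)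
    also have "(\<Sum>u\<in>F. \<Sum>v\<in>F - {u}. tau \<phi> u * \<psi> (len (v - u)) * chi ?s)
        = (\<Sum>u\<in>F. tau \<phi> u * (\<Sum>v\<in>F - {u}. \<psi> (len (v - u)))) * chi ?s"
      by (simp add: sum_distrib_left sum_distrib_right mult.assoc)
    also have "\<dots> \<le> (\<Sum>u\<in>F. tau \<phi> u * \<Psi>) * chi ?s"
    proof (intro mult_right_mono sum_mono mult_left_mono)
      fix u
      have "(\<Sum>v\<in>F - {u}. \<psi> (len (v - u))) = (\<Sum>v\<in>(\<lambda>v. v - u) ` (F - {u}). \<psi> (len v))"
        by (subst sum.reindex) (auto simp: inj_on_def)
      also have "\<dots> \<le> \<Psi>" using F(1) by (intro \<Psi>) auto
      finally show "(\<Sum>v\<in>F - {u}. \<psi> (len (v - u))) \<le> \<Psi>" .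
    qed (use nn chis tau_nonneg in auto)
    also have "\<dots> \<le> chi \<phi> * \<Psi> * chi ?s"
      unfolding sum_distrib_right[symmetric]
      using sum_tau_le_chi[OF fin(1) F(1)] \<Psi>0 chis by (intro mult_right_mono) auto
    finally show "(\<Sum>x\<in>G. tau ?s x) \<le> chi \<phi> + chi \<phi> * \<Psi> * chi ?s + \<epsilon>" using F(2) by linarith
  qed
qed

subsection \<open>Sharpness\<close>

text \<open>With the edges inside \<open>S\<close> as first part, the Simon-Lieb inequality bounds a
  sum of two-point functions by \<open>card S\<close> plus half of the supremum of translated sums,
  and the latter is absorbed.\<close>

lemma fin_chi_of_small_exit:
  assumes nn: "nn \<phi>" and S: "finite S" "0 \<in> S"
    and exit: "\<And>V. finite V \<Longrightarrow> (\<Sum>u\<in>S. \<Sum>v\<in>V - S. link_prob S (radial \<phi>) 0 u * \<phi> (len (v - u))) \<le> 1 / 2"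
  shows "fin_chi \<phi>"
proof (rule fin_chiI)
  fix G0 :: "(int ^ 'n) set" assume G0: "finite G0"
  let ?w = "\<lambda>e. if e \<subseteq> S then radial \<phi> e else 0" and ?w' = "\<lambda>e. if e \<subseteq> S then 0 else radial \<phi> e"
  \<comment> \<open>Restricting to sets of bounded cardinality makes the supremum finite before
    anything is known, and the family is still closed under translation.\<close>
  let ?\<G> = "{G. finite G \<and> card G \<le> card G0}" and ?T = "\<lambda>G. \<Sum>x\<in>G. tau \<phi> x"
  define X where "X = (SUP G\<in>?\<G>. ?T G)"
  have "?T G \<le> real (card G0)" if "G \<in> ?\<G>" for G
  proof -
    have "?T G \<le> (\<Sum>x\<in>G. 1)" using tau_le_1[OF nn] by (intro sum_mono)
    then show ?thesis using that by simp
  qed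
  then have bdd: "bdd_above (?T ` ?\<G>)" by (intro bdd_aboveI2[where M = "real (card G0)"])
  have TX: "?T G \<le> X" if "G \<in> ?\<G>" for G unfolding X_def by (rule cSUP_upper[OF that bdd])
  have X0: "0 \<le> X" using TX[of "{}"] by simp
  have "?T G \<le> real (card S) + X / 2" if G: "G \<in> ?\<G>" for G
  proof (rule field_le_epsilon)
    fix \<epsilon> :: real assume "0 < \<epsilon>"
    obtain F where F: "finite F" "S \<subseteq> F" "?T G \<le> (\<Sum>x\<in>G. link_prob F (radial \<phi>) 0 x) + \<epsilon>"
      using sum_tau_approx[OF nn _ \<open>0 < \<epsilon>\<close> S(1), of G] G by auto
    have nonneg: "0 \<le> radial \<phi> e" for e using nn by (rule nn_radial)
    have eq: "(\<lambda>e. ?w e + ?w' e) = radial \<phi>" by auto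
    have inS: "link_prob F ?w 0 u = link_prob S (radial \<phi>) 0 u" for u
      by (rule link_prob_zero_outside[OF F(1,2)])
    have outS: "link_prob S (radial \<phi>) 0 u = 0" if "u \<notin> S" for u
    proof -
      have "link_prob S (radial \<phi>) 0 u = pmean (edges_in S) (radial \<phi>) (\<lambda>_. 0)"
        unfolding link_prob_def using linked_in[OF _ _ S(2)] that by (intro pmean_cong) auto
      then show ?thesis using S(1) by simp
    qed
    have step: "link_prob F (radial \<phi>) 0 x \<le> link_prob S (radial \<phi>) 0 x +
        (\<Sum>u\<in>S. \<Sum>v\<in>F - S. link_prob S (radial \<phi>) 0 u * \<phi> (len (v - u)) * tau \<phi> (x - v))" for x
    proof -
      have "link_prob F (\<lambda>e. ?w e + ?w' e) 0 x \<le> link_prob F ?w 0 x +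
        (\<Sum>u\<in>F. \<Sum>v\<in>F - {u}. link_prob F ?w 0 u * ?w' {u, v} * link_prob F (\<lambda>e. ?w e + ?w' e) v x)"
        by (rule simon_lieb[OF F(1)]) (use nonneg in auto)
      then have "link_prob F (radial \<phi>) 0 x \<le> link_prob S (radial \<phi>) 0 x +
        (\<Sum>u\<in>F. \<Sum>v\<in>F - {u}. link_prob S (radial \<phi>) 0 u * ?w' {u, v} * link_prob F (radial \<phi>) v x)"
        unfolding eq inS .
      also have "(\<Sum>u\<in>F. \<Sum>v\<in>F - {u}. link_prob S (radial \<phi>) 0 u * ?w' {u, v} * link_prob F (radial \<phi>) v x)
        = (\<Sum>u\<in>S. \<Sum>v\<in>F - S. link_prob S (radial \<phi>) 0 u * ?w' {u, v} * link_prob F (radial \<phi>) v x)"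
        using F(1,2) outS by (intro sum.mono_neutral_cong_right) (auto intro!: sum.mono_neutral_right)
      also have "\<dots> \<le> (\<Sum>u\<in>S. \<Sum>v\<in>F - S. link_prob S (radial \<phi>) 0 u * \<phi> (len (v - u)) * tau \<phi> (x - v))"
      proof (intro sum_mono mult_mono)
        fix u v assume uv: "u \<in> S" "v \<in> F - S"
        then have "u \<noteq> v" by auto
        then show "?w' {u, v} \<le> \<phi> (len (v - u))" using uv by (simp add: len_minus_commute)
        have "0 < len (v - u)" using \<open>u \<noteq> v\<close> by (intro len_pos) auto
        then show "0 \<le> link_prob S (radial \<phi>) 0 u * \<phi> (len (v - u))"
          using nn link_prob_nonneg[of S "radial \<phi>" 0 u] nonneg by (auto simp: nn_def)
      qed (use nonneg link_prob_nonneg[of S "radial \<phi>" 0] link_prob_nonneg[of F "radial \<phi>"]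
          link_prob_le_tau[OF nn F(1)] in auto)
      finally show ?thesis by simp
    qed
    have "(\<Sum>x\<in>G. link_prob F (radial \<phi>) 0 x) \<le> (\<Sum>x\<in>G. link_prob S (radial \<phi>) 0 x +
        (\<Sum>u\<in>S. \<Sum>v\<in>F - S. link_prob S (radial \<phi>) 0 u * \<phi> (len (v - u)) * tau \<phi> (x - v)))"
      using step by (intro sum_mono)
    also have "\<dots> = (\<Sum>x\<in>G. link_prob S (radial \<phi>) 0 x) +
        (\<Sum>u\<in>S. \<Sum>v\<in>F - S. link_prob S (radial \<phi>) 0 u * \<phi> (len (v - u)) * (\<Sum>x\<in>G. tau \<phi> (x - v)))"
      unfolding sum.distrib sum_distrib_left by (rule arg_cong2[of _ _ _ _ "(+)", OF refl sum_swap3])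
    also have "\<dots> \<le> real (card S) + (\<Sum>u\<in>S. \<Sum>v\<in>F - S. link_prob S (radial \<phi>) 0 u * \<phi> (len (v - u)) * X)"
    proof (intro add_mono sum_mono mult_left_mono)
      have "(\<Sum>x\<in>G. link_prob S (radial \<phi>) 0 x) \<le> (\<Sum>x\<in>G \<union> S. link_prob S (radial \<phi>) 0 x)"
        using G S(1) link_prob_nonneg[of S "radial \<phi>" 0] nonneg by (intro sum_mono2) auto
      also have "\<dots> = (\<Sum>x\<in>S. link_prob S (radial \<phi>) 0 x)"
        using G S(1) outS by (intro sum.mono_neutral_right) auto
      also have "\<dots> \<le> (\<Sum>x\<in>S. 1)" using S(1) nonneg by (intro sum_mono link_prob_le_1) auto
      finally show "(\<Sum>x\<in>G. link_prob S (radial \<phi>) 0 x) \<le> real (card S)" by simp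
    next
      fix u v assume uv: "u \<in> S" "v \<in> F - S"
      then have "0 < len (v - u)" by (intro len_pos) auto
      then show "0 \<le> link_prob S (radial \<phi>) 0 u * \<phi> (len (v - u))"
        using nn link_prob_nonneg[of S "radial \<phi>" 0 u] nonneg by (auto simp: nn_def)
      have "(\<Sum>x\<in>G. tau \<phi> (x - v)) = ?T ((\<lambda>x. x - v) ` G)"
        by (subst sum.reindex) (auto simp: inj_on_def)
      also have "\<dots> \<le> X" using G by (intro TX) (auto intro: order_trans[OF card_image_le])
      finally show "(\<Sum>x\<in>G. tau \<phi> (x - v)) \<le> X" .
    qed
    also have "\<dots> = real (card S) + (\<Sum>u\<in>S. \<Sum>v\<in>F - S. link_prob S (radial \<phi>) 0 u * \<phi> (len (v - u))) * X"
      by (simp add: sum_distrib_right)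
    also have "\<dots> \<le> real (card S) + 1 / 2 * X"
      using exit[OF F(1)] X0 by (intro add_left_mono mult_right_mono)
    finally show "?T G \<le> real (card S) + X / 2 + \<epsilon>" using F(3) by simp
  qed
  then have "X \<le> real (card S) + X / 2" unfolding X_def[symmetric] by (subst X_def, intro cSUP_least) auto
  then have "X \<le> 2 * real (card S)" by simp
  then show "?T G0 \<le> 2 * real (card S)" using TX[of G0] G0 by simp
qed

text \<open>If the susceptibility is infinite, every finite set containing 0 has exit weight above
  1/2. This is the lower bound \<open>c = 1 / (2 * \<beta>)\<close> required by
  \<open>prob_trapped_decay\<close>, so at a larger parameter the origin escapes with a probability
  that does not depend on \<Lambda>.\<close>

lemma escape_of_not_fin_chi:
  assumes nn: "nn \<phi>" and \<beta>: "0 < \<beta>" "\<beta> < \<beta>'" and inf: "\<not> fin_chi (\<lambda>t. \<beta> * \<phi> t)"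
    and \<Lambda>: "finite \<Lambda>" "0 \<in> \<Lambda>"
  shows "\<exists>F. finite F \<and> \<Lambda> \<subseteq> F \<and>
    pprob (edges_in F) (radial (\<lambda>t. \<beta>' * \<phi> t)) (\<lambda>S. 0 \<in> trapped F \<Lambda> S) \<le> exp (- ((\<beta>' - \<beta>) / (4 * \<beta>)))"
proof -
  have scale: "radial (\<lambda>t. b * \<phi> t) = (\<lambda>e. b * radial \<phi> e)" for b by (auto simp: radial_def)
  have nn\<beta>: "nn (\<lambda>t. \<beta> * \<phi> t)" using nn \<beta> by (simp add: nn_def)
  let ?E = "\<lambda>S V. \<Sum>u\<in>S. \<Sum>v\<in>V - S. link_prob S (radial (\<lambda>t. \<beta> * \<phi> t)) 0 u * (\<beta> * \<phi> (len (v - u)))"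
  have ex: "\<exists>V. finite V \<and> 1 / 2 < ?E S V" if "finite S" "0 \<in> S" for S
    using fin_chi_of_small_exit[OF nn\<beta> that] inf by (meson not_less)
  define V where "V S = (SOME V. finite V \<and> 1 / 2 < ?E S V)" for S
  have V: "finite (V S)" "1 / 2 < ?E S (V S)" if "finite S" "0 \<in> S" for S
    using someI_ex[OF ex[OF that]] unfolding V_def by auto
  let ?\<A> = "{A. 0 \<in> A \<and> A \<subseteq> \<Lambda>}"
  \<comment> \<open>Each of the finitely many candidates for the trapped set brings its own finite
    set of exits, and \<open>F\<close> collects all of them.\<close>
  define F where "F = \<Lambda> \<union> (\<Union>A\<in>?\<A>. V A)"
  have finA: "finite A" if "A \<in> ?\<A>" for A using that \<Lambda>(1) finite_subset[of A \<Lambda>] by auto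
  have "finite ?\<A>" using \<Lambda>(1) by simp
  then have finF: "finite F"
    unfolding F_def by (intro finite_UnI \<Lambda>(1) finite_UN_I V(1)) (use finA in blast)+
  have "pprob (edges_in F) (\<lambda>e. \<beta>' * radial \<phi> e) (\<lambda>S. 0 \<in> trapped F \<Lambda> S) \<le> exp (- ((\<beta>' - \<beta>) * (1 / (2 * \<beta>)) / 2))"
  proof (rule prob_trapped_decay[OF finF])
    show "\<Lambda> \<subseteq> F" by (auto simp: F_def)
    fix A assume A: "0 \<in> A" "A \<subseteq> \<Lambda>"
    have fA: "finite A" using finA A by simp
    let ?l = "link_prob A (radial (\<lambda>t. \<beta> * \<phi> t)) 0"
    have l0: "0 \<le> ?l u" for u using nn_radial[OF nn\<beta>] by (intro link_prob_nonneg) auto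
    have "1 / 2 < (\<Sum>u\<in>A. \<Sum>v\<in>V A - A. ?l u * (\<beta> * \<phi> (len (v - u))))" using V(2)[OF fA A(1)] .
    also have "\<dots> \<le> (\<Sum>u\<in>A. \<Sum>v\<in>F - A. ?l u * (\<beta> * \<phi> (len (v - u))))"
    proof (intro sum_mono sum_mono2)
      fix u v assume "u \<in> A" "v \<in> (F - A) - (V A - A)"
      then have "0 < len (v - u)" by (intro len_pos) auto
      then show "0 \<le> ?l u * (\<beta> * \<phi> (len (v - u)))" using nn\<beta> l0 by (auto simp: nn_def)
    qed (use finF A in \<open>auto simp: F_def\<close>)
    also have "\<dots> = \<beta> * (\<Sum>u\<in>A. \<Sum>v\<in>F - A. ?l u * \<phi> (len (v - u)))"
      by (simp add: sum_distrib_left mult_ac)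
    also have "(\<Sum>u\<in>A. \<Sum>v\<in>F - A. ?l u * \<phi> (len (v - u))) = (\<Sum>x\<in>A. \<Sum>y\<in>F - A. ?l x * radial \<phi> {x, y})"
    proof (intro sum.cong refl)
      fix u v assume "u \<in> A" "v \<in> F - A"
      then have "u \<noteq> v" by auto
      then show "?l u * \<phi> (len (v - u)) = ?l u * radial \<phi> {u, v}" by (simp add: len_minus_commute)
    qed
    finally show "1 / (2 * \<beta>) \<le> (\<Sum>x\<in>A. \<Sum>y\<in>F - A. link_prob A (\<lambda>e. \<beta> * radial \<phi> e) 0 x * radial \<phi> {x, y})"
      using \<beta>(1) unfolding scale by (simp add: field_simps)
  qed (use nn_radial[OF nn] \<beta> in auto)
  then show ?thesis using finF unfolding scale
    by (intro exI[of _ F]) (auto simp: F_def field_simps)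
qed

end

section \<open>The kernel\<close>

locale lrp = lattice_norm N for N :: "real ^ 'n \<Rightarrow> real" +
  fixes J :: "real \<Rightarrow> real" and \<alpha> :: real
  assumes \<alpha>: "0 < \<alpha>" and profile: "regular_profile CARD('n) \<alpha> J"
begin

definition d :: real where "d = real CARD('n)"

lemma d_ge_1: "1 \<le> d"
proof -
  have "0 < CARD('n)" by simp
  then show ?thesis unfolding d_def by linarith
qed

section \<open>Regularity and decay of the profile\<close>

lemma J_pos: "0 < r \<Longrightarrow> 0 < J r"
  using profile unfolding regular_profile_def by blast

lemma J_anti: "0 < r \<Longrightarrow> r \<le> s \<Longrightarrow> J s \<le> J r"
proof -
  have "antimono_on {0<..} J" using profile unfolding regular_profile_def by blast
  then show "0 < r \<Longrightarrow> r \<le> s \<Longrightarrow> J s \<le> J r" by (auto simp: monotone_on_def)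
qed

lemma J_tendsto: "(J \<longlongrightarrow> 0) at_top"
  using profile unfolding regular_profile_def by blast

lemma J_deriv: "0 < r \<Longrightarrow> (J has_real_derivative deriv J r) (at r)"
  using profile unfolding regular_profile_def by (auto simp: DERIV_deriv_iff_real_differentiable)

lemma J_deriv_nonpos:
  assumes r: "0 < r"
  shows "deriv J r \<le> 0"
proof (rule ccontr)
  assume "\<not> deriv J r \<le> 0"
  then obtain e where e: "0 < e" "\<And>h. 0 < h \<Longrightarrow> h < e \<Longrightarrow> J r < J (r + h)"
    using DERIV_pos_inc_right[OF J_deriv[OF r]] by auto
  have "J r < J (r + e / 2)" using e by auto
  moreover have "J (r + e / 2) \<le> J r" using r e(1) by (intro J_anti) auto
  ultimately show False by simp
qed

lemma J_deriv_asymp: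
  obtains C R \<delta> where "0 < C" "1 \<le> R" "\<And>r. 0 < r \<Longrightarrow> \<bar>deriv J r\<bar> = C * (1 + \<delta> r) * r powr (- d - \<alpha> - 1)"
    "set_borel_measurable borel {0<..} \<delta>" "\<And>r. R \<le> r \<Longrightarrow> \<bar>\<delta> r\<bar> \<le> 1 / 2"
proof -
  obtain C \<delta> where C: "0 < C" "\<And>r. 0 < r \<Longrightarrow> \<bar>deriv J r\<bar> = C * (1 + \<delta> r) * r powr (- d - \<alpha> - 1)"
    "set_borel_measurable borel {0<..} \<delta>" "(\<delta> \<longlongrightarrow> 0) at_top"
    using profile unfolding regular_profile_def d_def by blast
  have "eventually (\<lambda>r. \<bar>\<delta> r\<bar> < 1 / 2) at_top"
    using tendstoD[OF C(4), of "1 / 2"] by (simp add: dist_real_def)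
  then obtain R where R: "\<And>r. R \<le> r \<Longrightarrow> \<bar>\<delta> r\<bar> < 1 / 2" unfolding eventually_at_top_linorder by blast
  show ?thesis
    by (rule that[of C "max 1 R" \<delta>]) (use C R in \<open>auto intro: less_imp_le\<close>)
qed

text \<open>Identifies the cut-off kernel as \<open>J t - J r\<close>. The fundamental theorem of
  calculus asks for a measurable derivative, and the formula in terms of \<open>\<delta>\<close>
  supplies it.\<close>

lemma integral_deriv:
  assumes "0 < t" "t \<le> r"
  shows "(LINT s : {t..r} | lborel. \<bar>deriv J s\<bar>) = J t - J r"
proof -
  obtain C R \<delta> where C: "\<And>r. 0 < r \<Longrightarrow> \<bar>deriv J r\<bar> = C * (1 + \<delta> r) * r powr (- d - \<alpha> - 1)"
    "set_borel_measurable borel {0<..} \<delta>" by (rule J_deriv_asymp) blast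
  \<comment> \<open>A globally Borel measurable function that equals the absolute derivative on the
    positive reals.\<close>
  define g where "g s = C * (indicator {0<..} s + indicator {0<..} s *\<^sub>R \<delta> s) * s powr (- d - \<alpha> - 1)" for s :: real
  have [measurable]: "(\<lambda>s. indicator {0<..} s *\<^sub>R \<delta> s) \<in> borel_measurable borel"
    using C(2) unfolding set_borel_measurable_def .
  have g_meas: "g \<in> borel_measurable borel" unfolding g_def by measurable
  have g_eq: "g s = - deriv J s" if "0 < s" for s
    using that C(1)[OF that] J_deriv_nonpos[OF that] unfolding g_def by simp
  have "has_bochner_integral lborel (\<lambda>x. g x * indicator {t..r} x) ((\<lambda>x. - J x) r - (\<lambda>x. - J x) t)"
  proof -
    have "((\<lambda>x. - J x) has_real_derivative g x) (at x)" "0 \<le> g x" if "t \<le> x" "x \<le> r" for x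
      using DERIV_minus[OF J_deriv[of x]] g_eq[of x] J_deriv_nonpos[of x] that assms by simp_all
    then show ?thesis using assms(2)
      by (intro has_bochner_integral_FTC_Icc_nonneg[where F = "\<lambda>x. - J x", OF g_meas]) auto
  qed
  then have "integral\<^sup>L lborel (\<lambda>x. g x * indicator {t..r} x) = J t - J r"
    by (simp add: has_bochner_integral_integral_eq)
  moreover have "(\<lambda>x. g x * indicator {t..r} x) = (\<lambda>s. indicator {t..r} s *\<^sub>R \<bar>deriv J s\<bar>)"
    using g_eq J_deriv_nonpos assms by (auto simp: fun_eq_iff indicator_def)
  ultimately show ?thesis unfolding set_lebesgue_integral_def by simp
qed

lemma powr_deriv: "0 < s \<Longrightarrow> ((\<lambda>s. a * s powr (- d - \<alpha>)) has_real_derivative - (a * (d + \<alpha>)) * s powr (- d - \<alpha> - 1)) (at s)"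
  by (auto intro!: derivative_eq_intros simp: algebra_simps)

text \<open>The difference of \<open>J\<close> and the power function has nonnegative derivative
  beyond \<open>R\<close> and tends to 0, hence is nonpositive there. The constant satisfies
  \<open>A * (d + \<alpha>) = 2 * C\<close>, which dominates
  \<open>C * (1 + \<delta> r)\<close>.\<close>

lemma J_le_tail: obtains A R where "0 < A" "1 \<le> R" "\<And>r. R \<le> r \<Longrightarrow> J r \<le> A * r powr (- d - \<alpha>)"
proof -
  obtain C R \<delta> where C: "0 < C" "1 \<le> R" "\<And>r. 0 < r \<Longrightarrow> \<bar>deriv J r\<bar> = C * (1 + \<delta> r) * r powr (- d - \<alpha> - 1)"
    "\<And>r. R \<le> r \<Longrightarrow> \<bar>\<delta> r\<bar> \<le> 1 / 2" by (rule J_deriv_asymp) blast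
  define A where "A = 2 * C / (d + \<alpha>)"
  have dp: "0 < d + \<alpha>" using d_ge_1 \<alpha> by simp
  have A: "0 < A" "A * (d + \<alpha>) = 2 * C" unfolding A_def using C(1) dp by auto
  have "J r \<le> A * r powr (- d - \<alpha>)" if r: "R \<le> r" for r
  proof -
    let ?h = "\<lambda>s. J s - A * s powr (- d - \<alpha>)"
    have mono: "?h r \<le> ?h s" if "r \<le> s" for s
    proof (rule DERIV_nonneg_imp_nondecreasing[OF that])
      fix x assume x: "r \<le> x" "x \<le> s"
      then have x0: "0 < x" using r C(2) by linarith
      have "\<bar>deriv J x\<bar> \<le> 2 * C * x powr (- d - \<alpha> - 1)"
        unfolding C(3)[OF x0] using C(1) C(4)[of x] x r by (intro mult_right_mono) auto
      then have "0 \<le> deriv J x - - (A * (d + \<alpha>)) * x powr (- d - \<alpha> - 1)" unfolding A(2) by simp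
      then show "\<exists>y. (?h has_real_derivative y) (at x) \<and> 0 \<le> y"
        using DERIV_diff[OF J_deriv[OF x0] powr_deriv[OF x0, of A]] by blast
    qed
    have "((\<lambda>s. s powr (- d - \<alpha>)) \<longlongrightarrow> 0) at_top"
      using dp by (intro tendsto_neg_powr filterlim_ident) simp
    then have "(?h \<longlongrightarrow> 0 - A * 0) at_top" by (intro tendsto_intros J_tendsto)
    then have "?h r \<le> 0 - A * 0"
      by (rule tendsto_lowerbound) (auto intro!: eventually_at_top_linorderI[of r] mono)
    then show ?thesis by simp
  qed
  then show ?thesis using that A C(2) by blast
qed

lemma J_le: 
  assumes "0 < s0"
  obtains A where "0 < A" "\<And>r. s0 \<le> r \<Longrightarrow> J r \<le> A * r powr (- d - \<alpha>)"
proof -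
  obtain A R where A: "0 < A" "1 \<le> R" "\<And>r. R \<le> r \<Longrightarrow> J r \<le> A * r powr (- d - \<alpha>)" by (rule J_le_tail) blast
  define A' where "A' = max A (J s0 * R powr (d + \<alpha>))"
  have "J r \<le> A' * r powr (- d - \<alpha>)" if "s0 \<le> r" for r
  proof (cases "R \<le> r")
    case True
    have "A * r powr (- d - \<alpha>) \<le> A' * r powr (- d - \<alpha>)" unfolding A'_def by (intro mult_right_mono) auto
    then show ?thesis using A(3)[OF True] by linarith
  next
    case False
    have r: "0 < r" using that assms by simp
    have "J r \<le> J s0 * 1" using J_anti[OF assms that] by simp
    also have "1 \<le> R powr (d + \<alpha>) * r powr (- d - \<alpha>)"
    proof -
      have "r powr (d + \<alpha>) * r powr (- d - \<alpha>) \<le> R powr (d + \<alpha>) * r powr (- d - \<alpha>)"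
        using False r d_ge_1 \<alpha> by (intro mult_right_mono powr_mono2) auto
      then show ?thesis using r by (simp add: powr_add[symmetric])
    qed
    then have "J s0 * 1 \<le> J s0 * (R powr (d + \<alpha>) * r powr (- d - \<alpha>))"
      using J_pos[OF assms] by (intro mult_left_mono) auto
    also have "\<dots> \<le> A' * r powr (- d - \<alpha>)"
      unfolding A'_def mult.assoc[symmetric] by (intro mult_right_mono) auto
    finally show ?thesis .
  qed
  moreover have "0 < A'" unfolding A'_def using A(1) by simp
  ultimately show ?thesis using that by blast
qed

text \<open>Beyond \<open>R\<close> the profile decreases at least as fast as
  \<open>A * r powr (- d - \<alpha>)\<close>, and this power loses at least half of its value
  between \<open>r\<close> and \<open>2 * r\<close> because \<open>d + \<alpha>\<close> is at least
  1.\<close>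

lemma J_diff_ge: obtains a R where "0 < a" "1 \<le> R" "\<And>r. R \<le> r \<Longrightarrow> a * r powr (- d - \<alpha>) \<le> J r - J (2 * r)"
proof -
  obtain C R \<delta> where C: "0 < C" "1 \<le> R" "\<And>r. 0 < r \<Longrightarrow> \<bar>deriv J r\<bar> = C * (1 + \<delta> r) * r powr (- d - \<alpha> - 1)"
    "\<And>r. R \<le> r \<Longrightarrow> \<bar>\<delta> r\<bar> \<le> 1 / 2" by (rule J_deriv_asymp) blast
  define A where "A = C / 2 / (d + \<alpha>)"
  have dp: "1 \<le> d + \<alpha>" using d_ge_1 \<alpha> by simp
  have A: "0 < A" "A * (d + \<alpha>) = C / 2" unfolding A_def using C(1) dp by (auto simp: divide_simps)
  have "A / 2 * r powr (- d - \<alpha>) \<le> J r - J (2 * r)" if r: "R \<le> r" for r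
  proof -
    let ?h = "\<lambda>s. J s - A * s powr (- d - \<alpha>)"
    have r0: "0 < r" using r C(2) by simp
    have "?h (2 * r) \<le> ?h r"
    proof (rule DERIV_nonpos_imp_nonincreasing[where f = ?h])
      fix x assume x: "r \<le> x" "x \<le> 2 * r"
      then have x0: "0 < x" using r C(2) by linarith
      have "C / 2 * x powr (- d - \<alpha> - 1) \<le> \<bar>deriv J x\<bar>"
      proof -
        have "1 / 2 \<le> 1 + \<delta> x" using C(4)[of x] x r by linarith
        then have "C * (1 / 2) \<le> C * (1 + \<delta> x)" using C(1) by (intro mult_left_mono) auto
        then show ?thesis unfolding C(3)[OF x0] by (intro mult_right_mono) auto
      qed
      then have "deriv J x - - (A * (d + \<alpha>)) * x powr (- d - \<alpha> - 1) \<le> 0"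
        unfolding A(2) using J_deriv_nonpos[OF x0] by simp
      then show "\<exists>y. (?h has_real_derivative y) (at x) \<and> y \<le> 0"
        using DERIV_diff[OF J_deriv[OF x0] powr_deriv[OF x0, of A]] by blast
    qed (use r0 in simp)
    moreover have "(2 * r) powr (- d - \<alpha>) \<le> r powr (- d - \<alpha>) / 2"
    proof -
      have "(2 :: real) powr (- d - \<alpha>) \<le> 2 powr (- 1)" using dp by (intro powr_mono) auto
      then have "(2 :: real) powr (- d - \<alpha>) \<le> 1 / 2" by (simp add: powr_minus_divide)
      then have "2 powr (- d - \<alpha>) * r powr (- d - \<alpha>) \<le> 1 / 2 * r powr (- d - \<alpha>)" by (intro mult_right_mono) auto
      then show ?thesis using r0 by (simp add: powr_mult)
    qed
    then have "A * (2 * r) powr (- d - \<alpha>) \<le> A * (r powr (- d - \<alpha>) / 2)" using A(1) by (intro mult_left_mono) auto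
    ultimately show ?thesis by simp
  qed
  then show ?thesis using that[of "A / 2" R] A(1) C(2) by simp
qed

text \<open>Dyadic shells: the shell at radius \<open>2 ^ n * s\<close> contributes at most a
  constant times \<open>(2 ^ n * s) powr (d - q)\<close>, which is a geometric series for
  \<open>q > d\<close>.\<close>

lemma sum_len_powr:
  assumes q: "d < q"
  obtains C where "0 < C" "\<And>s G. 1 \<le> s \<Longrightarrow> finite G \<Longrightarrow> (\<And>v. v \<in> G \<Longrightarrow> s < len v) \<Longrightarrow>
    (\<Sum>v\<in>G. len v powr (- q)) \<le> C * s powr (d - q)"
proof -
  obtain B where B: "0 < B" "\<And>z s. 1 \<le> s \<Longrightarrow> real (card (ball_at z s)) \<le> B * s ^ CARD('n)"
    by (rule card_ball) blast
  let ?\<rho> = "2 powr (d - q) :: real"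
  have \<rho>: "0 < ?\<rho>" "?\<rho> < 1" using q powr_less_mono[of "d - q" 0 "2 :: real"] by auto
  define C where "C = B * 2 powr d / (1 - ?\<rho>)"
  have "(\<Sum>v\<in>G. len v powr (- q)) \<le> C * s powr (d - q)"
    if s: "1 \<le> s" and G: "finite G" "\<And>v. v \<in> G \<Longrightarrow> s < len v" for s G
  proof -
    have part: "(\<Sum>v\<in>{v \<in> G. len v \<le> 2 ^ n * s}. len v powr (- q)) \<le> B * 2 powr d * s powr (d - q) * (\<Sum>k<n. ?\<rho> ^ k)" for n
    proof (induction n)
      case 0
      have "{v \<in> G. len v \<le> s} = {}" using G(2) by force
      then have "(\<Sum>v\<in>{v \<in> G. len v \<le> s}. len v powr (- q)) = 0" by (simp only: sum.empty)
      then show ?case by simp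
    next
      case (Suc n)
      let ?A = "\<lambda>n. {v \<in> G. len v \<le> 2 ^ n * s}" and ?D = "{v \<in> G. 2 ^ n * s < len v \<and> len v \<le> 2 ^ Suc n * s}"
      have sn: "1 \<le> 2 ^ n * s" using s by (metis mult_mono' mult_1 one_le_numeral one_le_power zero_le_one)
      have "?A (Suc n) = ?A n \<union> ?D" using s by (auto intro: order_trans[of _ "2 ^ n * s"])
      then have split: "(\<Sum>v\<in>?A (Suc n). len v powr (- q)) = (\<Sum>v\<in>?A n. len v powr (- q)) + (\<Sum>v\<in>?D. len v powr (- q))"
        using G(1) by (subst sum.union_disjoint[symmetric]) auto
      have "(\<Sum>v\<in>?D. len v powr (- q)) \<le> (\<Sum>v\<in>?D. (2 ^ n * s) powr (- q))"
        using sn q d_ge_1 by (intro sum_mono powr_mono2') auto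
      also have "\<dots> = real (card ?D) * (2 ^ n * s) powr (- q)" by simp
      also have "\<dots> \<le> (B * (2 ^ Suc n * s) ^ CARD('n)) * (2 ^ n * s) powr (- q)"
      proof (intro mult_right_mono)
        have "card ?D \<le> card (ball_at 0 (2 ^ Suc n * s))" by (intro card_mono) auto
        then show "real (card ?D) \<le> B * (2 ^ Suc n * s) ^ CARD('n)" using B(2)[of "2 ^ Suc n * s" 0] sn by simp
      qed auto
      finally have D: "(\<Sum>v\<in>?D. len v powr (- q)) \<le> (B * (2 ^ Suc n * s) ^ CARD('n)) * (2 ^ n * s) powr (- q)" .
      have e1: "(2 ^ Suc n * s) ^ CARD('n) = 2 powr d * (2 ^ n * s) powr d"
        using s by (simp add: d_def powr_realpow power_mult_distrib)
      have e2: "(2 ^ n * s) powr d * (2 ^ n * s) powr (- q) = (2 ^ n * s) powr (d - q)"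
        by (simp add: powr_add[symmetric])
      have e3: "(2 ^ n * s) powr (d - q) = s powr (d - q) * ?\<rho> ^ n"
        using s by (simp add: powr_mult powr_power powr_realpow[symmetric] powr_powr mult.commute)
      have "(\<Sum>v\<in>?D. len v powr (- q)) \<le> B * 2 powr d * s powr (d - q) * ?\<rho> ^ n"
        using D unfolding e1 e3[symmetric] mult.assoc e2[symmetric] .
      then have "(\<Sum>v\<in>?A (Suc n). len v powr (- q)) \<le> B * 2 powr d * s powr (d - q) * (\<Sum>k<n. ?\<rho> ^ k)
          + B * 2 powr d * s powr (d - q) * ?\<rho> ^ n"
        unfolding split using Suc by (intro add_mono)
      then show ?case by (simp only: sum.lessThan_Suc distrib_left)
    qed
    obtain n where n: "\<And>v. v \<in> G \<Longrightarrow> len v \<le> 2 ^ n * s"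
    proof -
      obtain n where n: "Max (insert 0 (len ` G)) < 2 ^ n" using real_arch_pow[of 2] by auto
      have "len v \<le> 2 ^ n * s" if "v \<in> G" for v
      proof -
        have "len v \<le> Max (insert 0 (len ` G))" using G(1) that by (intro Max_ge) auto
        also have "\<dots> \<le> 2 ^ n * 1" using n by simp
        also have "\<dots> \<le> 2 ^ n * s" using s by (intro mult_left_mono) auto
        finally show ?thesis .
      qed
      then show ?thesis using that by blast
    qed
    have "{v \<in> G. len v \<le> 2 ^ n * s} = G" using n by auto
    then have "(\<Sum>v\<in>G. len v powr (- q)) \<le> B * 2 powr d * s powr (d - q) * (\<Sum>k<n. ?\<rho> ^ k)" using part[of n] by simp
    also have "\<dots> \<le> B * 2 powr d * s powr (d - q) * (1 / (1 - ?\<rho>))"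
    proof (intro mult_left_mono)
      have "?\<rho> \<noteq> 1" using \<rho> by linarith
      then have "(\<Sum>k<n. ?\<rho> ^ k) = (1 - ?\<rho> ^ n) / (1 - ?\<rho>)" by (simp add: sum_gp_strict del: powr_eq_one_iff)
      also have "\<dots> \<le> 1 / (1 - ?\<rho>)" using \<rho> by (intro divide_right_mono) auto
      finally show "(\<Sum>k<n. ?\<rho> ^ k) \<le> 1 / (1 - ?\<rho>)" .
    qed (use B(1) in auto)
    finally show ?thesis unfolding C_def by (simp add: mult_ac)
  qed
  moreover have "0 < C" unfolding C_def using B(1) \<rho> by simp
  ultimately show ?thesis using that by blast
qed

text \<open>Up to the factor \<beta>, this is the total weight that the cut-off at \<open>r\<close>
  removes at a vertex. Inside radius \<open>r\<close> it is at most the volume times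
  \<open>J r\<close>; outside, the tail of \<open>J\<close> is summed.\<close>

lemma sum_truncated_kernel:
  obtains A where "0 < A" "\<And>r G. 1 \<le> r \<Longrightarrow> finite G \<Longrightarrow> 0 \<notin> G \<Longrightarrow>
    (\<Sum>v\<in>G. min (J (len v)) (J r)) \<le> A * r powr (- \<alpha>)"
proof -
  obtain B where B: "0 < B" "\<And>z s. 1 \<le> s \<Longrightarrow> real (card (ball_at z s)) \<le> B * s ^ CARD('n)"
    by (rule card_ball) blast
  obtain A where A: "0 < A" "\<And>r. 1 \<le> r \<Longrightarrow> J r \<le> A * r powr (- d - \<alpha>)" by (rule J_le[of 1]) auto
  obtain C where C: "0 < C" "\<And>s G. 1 \<le> s \<Longrightarrow> finite G \<Longrightarrow> (\<And>v. v \<in> G \<Longrightarrow> s < len v) \<Longrightarrow>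
    (\<Sum>v\<in>G. len v powr (- (d + \<alpha>))) \<le> C * s powr (d - (d + \<alpha>))"
    using sum_len_powr[of "d + \<alpha>"] \<alpha> by auto
  have "(\<Sum>v\<in>G. min (J (len v)) (J r)) \<le> (B * A + A * C) * r powr (- \<alpha>)"
    if r: "1 \<le> r" and G: "finite G" "0 \<notin> G" for r G
  proof -
    let ?G1 = "{v \<in> G. len v \<le> r}" and ?G2 = "{v \<in> G. r < len v}"
    have "G = ?G1 \<union> ?G2" by auto
    then have "(\<Sum>v\<in>G. min (J (len v)) (J r)) = (\<Sum>v\<in>?G1 \<union> ?G2. min (J (len v)) (J r))" by simp
    also have "\<dots> = (\<Sum>v\<in>?G1. min (J (len v)) (J r)) + (\<Sum>v\<in>?G2. min (J (len v)) (J r))"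
      using G(1) by (intro sum.union_disjoint) auto
    also have "(\<Sum>v\<in>?G1. min (J (len v)) (J r)) \<le> (\<Sum>v\<in>?G1. J r)" by (intro sum_mono) auto
    also have "\<dots> = real (card ?G1) * J r" by simp
    also have "\<dots> \<le> (B * r ^ CARD('n)) * (A * r powr (- d - \<alpha>))"
    proof (intro mult_mono)
      have "card ?G1 \<le> card (ball_at 0 r)" by (intro card_mono) auto
      then show "real (card ?G1) \<le> B * r ^ CARD('n)" using B(2)[OF r, of 0] by linarith
    qed (use A(2)[OF r] B(1) r J_pos[of r] in auto)
    also have "r ^ CARD('n) = r powr d" using r by (simp add: d_def powr_realpow)
    also have "B * r powr d * (A * r powr (- d - \<alpha>)) = B * A * r powr (- \<alpha>)"
      using r by (simp add: powr_add[symmetric])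
    also have "(\<Sum>v\<in>?G2. min (J (len v)) (J r)) \<le> (\<Sum>v\<in>?G2. A * len v powr (- (d + \<alpha>)))"
    proof (rule sum_mono)
      fix v assume "v \<in> ?G2"
      then have "J (len v) \<le> A * len v powr (- d - \<alpha>)" using r by (intro A(2)) auto
      then show "min (J (len v)) (J r) \<le> A * len v powr (- (d + \<alpha>))" by simp
    qed
    also have "\<dots> \<le> A * (C * r powr (d - (d + \<alpha>)))"
      unfolding sum_distrib_left[symmetric] using A(1) G(1) r by (intro mult_left_mono C(2)) auto
    finally show ?thesis by (simp add: algebra_simps)
  qed
  moreover have "0 < B * A + A * C" using A(1) B(1) C(1) by (simp add: add_pos_pos)
  ultimately show ?thesis using that by blast
qed

end

section \<open>Observables of the percolation measure\<close>

context lattice_norm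
begin

lemma edge_product_radial:
  assumes "nn \<phi>" "\<And>x y. k x y = k y x" "\<And>x y. x \<noteq> y \<Longrightarrow> \<beta> * k x y = \<phi> (len (x - y))"
  shows "edge_product \<beta> k (radial \<phi>)"
proof
  fix e :: "(int ^ 'n) set" assume "e \<in> edges"
  then obtain x y where "x \<noteq> y" "e = {x, y}" by (rule edge_cases)
  then show "\<beta> * edge_weight k e = radial \<phi> e" using assms(3) edge_weight_pair[of k x y, OF assms(2)] by simp
qed (rule nn_radial[OF assms(1)])

lemma nn_integral_tau_le:
  assumes nn: "nn \<phi>" and f: "\<And>x. 0 \<le> f x" and c: "\<And>G. finite G \<Longrightarrow> (\<Sum>x\<in>G. f x * tau \<phi> x) \<le> c"
  shows "(\<integral>\<^sup>+ x. ennreal (f x) * ennreal (tau \<phi> x) \<partial>count_space UNIV) \<le> ennreal c"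
proof (rule nn_integral_count_space_le)
  fix G :: "(int ^ 'n) set" assume "finite G"
  have "(\<Sum>x\<in>G. ennreal (f x) * ennreal (tau \<phi> x)) = ennreal (\<Sum>x\<in>G. f x * tau \<phi> x)"
    using f tau_nonneg[OF nn] by (simp add: ennreal_mult[symmetric])
  also have "\<dots> \<le> ennreal c" using c[OF \<open>finite G\<close>] by (rule ennreal_leI)
  finally show "(\<Sum>x\<in>G. ennreal (f x) * ennreal (tau \<phi> x)) \<le> ennreal c" .
qed

lemma nn_integral_tau_ge:
  assumes nn: "nn \<phi>" and f: "\<And>x. 0 \<le> f x" and G: "finite G"
  shows "ennreal (\<Sum>x\<in>G. f x * tau \<phi> x) \<le> (\<integral>\<^sup>+ x. ennreal (f x) * ennreal (tau \<phi> x) \<partial>count_space UNIV)"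
proof -
  have "ennreal (\<Sum>x\<in>G. f x * tau \<phi> x) = (\<Sum>x\<in>G. ennreal (f x) * ennreal (tau \<phi> x))"
    using f tau_nonneg[OF nn] by (simp add: ennreal_mult[symmetric])
  then show ?thesis using nn_integral_count_space_ge[OF G] by simp
qed

context
  fixes \<beta> k \<phi>
  assumes ep: "edge_product \<beta> k (radial \<phi>)" and nn: "nn \<phi>"
begin

lemma two_point_tau: "two_point \<beta> k x y = tau \<phi> (y - x)"
  using edge_product.two_point_eq[OF ep] conn_prob_eq_tau[OF nn] by simp

lemma susceptibility_eq: "susceptibility \<beta> k = (\<integral>\<^sup>+ x. ennreal 1 * ennreal (tau \<phi> x) \<partial>count_space UNIV)"
proof -
  have "susceptibility \<beta> k = (\<integral>\<^sup>+ \<omega>. (\<integral>\<^sup>+ x\<in>cluster \<omega> 0. 1 \<partial>count_space UNIV) \<partial>percolation \<beta> k)"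
    unfolding susceptibility_def by (simp add: nn_integral_indicator)
  also have "\<dots> = (\<integral>\<^sup>+ x. 1 * ennreal (conn_prob (radial \<phi>) 0 x) \<partial>count_space UNIV)"
    by (rule edge_product.nn_integral_cluster[OF ep])
  finally show ?thesis unfolding tau_def by simp
qed

lemma susceptibility_fin:
  assumes "fin_chi \<phi>"
  shows "susceptibility \<beta> k = ennreal (chi \<phi>)"
proof (rule antisym)
  show "susceptibility \<beta> k \<le> ennreal (chi \<phi>)"
    unfolding susceptibility_eq using sum_tau_le_chi[OF assms] by (intro nn_integral_tau_le[OF nn]) auto
  show "ennreal (chi \<phi>) \<le> susceptibility \<beta> k"
  proof (rule ennreal_le_epsilon)
    fix e :: real assume e: "0 < e"
    have "chi \<phi> - e < chi \<phi>" using e by simp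
    then obtain G where G: "finite G" "chi \<phi> - e < (\<Sum>x\<in>G. tau \<phi> x)" by (rule chi_approx[OF assms])
    have "ennreal (chi \<phi>) \<le> ennreal ((\<Sum>x\<in>G. 1 * tau \<phi> x) + e)" using G(2) by (intro ennreal_leI) simp
    also have "\<dots> = ennreal (\<Sum>x\<in>G. 1 * tau \<phi> x) + ennreal e"
      using e tau_nonneg[OF nn] by (intro ennreal_plus sum_nonneg) auto
    also have "ennreal (\<Sum>x\<in>G. 1 * tau \<phi> x) \<le> susceptibility \<beta> k"
      unfolding susceptibility_eq by (rule nn_integral_tau_ge[OF nn _ G(1)]) simp
    finally show "ennreal (chi \<phi>) \<le> susceptibility \<beta> k + ennreal e" by (simp add: add_right_mono)
  qed
qed

lemma gyration_radius_eq:
  assumes "fin_chi \<phi>"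
  shows "gyration_radius p \<beta> k = ennreal_power
    ((\<integral>\<^sup>+ x. ennreal (norm (of_lattice x) powr p) * ennreal (tau \<phi> x) \<partial>count_space UNIV) / ennreal (chi \<phi>)) (1 / p)"
  unfolding gyration_radius_def susceptibility_fin[OF assms] edge_product.nn_integral_cluster[OF ep] tau_def ..

lemma percolates_of_escape:
  assumes "0 < c" "\<And>\<Lambda>. finite \<Lambda> \<Longrightarrow> 0 \<in> \<Lambda> \<Longrightarrow>
    \<exists>F. finite F \<and> \<Lambda> \<subseteq> F \<and> pprob (edges_in F) (radial \<phi>) (\<lambda>S. 0 \<in> trapped F \<Lambda> S) \<le> 1 - c"
  shows "percolates \<beta> k"
  by (rule edge_product.percolatesI[OF ep assms])

end

end

lemma ennreal_power_le_iff:
  assumes "0 < p" "0 \<le> c"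
  shows "ennreal_power x (1 / p) \<le> ennreal c \<longleftrightarrow> x \<le> ennreal (c powr p)"
proof (cases "x = \<infinity>")
  case True
  then show ?thesis by (simp add: ennreal_power_def top_unique)
next
  case False
  then obtain y where y: "0 \<le> y" "x = ennreal y" by (cases x) (auto simp: top_unique)
  have "y powr (1 / p) \<le> c \<longleftrightarrow> y \<le> c powr p"
  proof
    assume "y powr (1 / p) \<le> c"
    then have "(y powr (1 / p)) powr p \<le> c powr p" using assms by (intro powr_mono2) auto
    then show "y \<le> c powr p" using assms y by (simp add: powr_powr)
  next
    assume "y \<le> c powr p"
    then have "y powr (1 / p) \<le> (c powr p) powr (1 / p)" using assms y by (intro powr_mono2) auto
    then show "y powr (1 / p) \<le> c" using assms by (simp add: powr_powr)
  qed
  then show ?thesis using y assms by (simp add: ennreal_power_def)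
qed

lemma ennreal_power_ge_iff:
  assumes "0 < p" "0 \<le> c"
  shows "ennreal c \<le> ennreal_power x (1 / p) \<longleftrightarrow> ennreal (c powr p) \<le> x"
proof (cases "x = \<infinity>")
  case True
  then show ?thesis by (simp add: ennreal_power_def)
next
  case False
  then obtain y where y: "0 \<le> y" "x = ennreal y" by (cases x) (auto simp: top_unique)
  have "c \<le> y powr (1 / p) \<longleftrightarrow> c powr p \<le> y"
  proof
    assume "c \<le> y powr (1 / p)"
    then have "c powr p \<le> (y powr (1 / p)) powr p" using assms by (intro powr_mono2) auto
    then show "c powr p \<le> y" using assms y by (simp add: powr_powr)
  next
    assume "c powr p \<le> y"
    then have "(c powr p) powr (1 / p) \<le> y powr (1 / p)" using assms y by (intro powr_mono2) auto
    then show "c \<le> y powr (1 / p)" using assms by (simp add: powr_powr)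
  qed
  then show ?thesis using y assms by (simp add: ennreal_power_def)
qed

context lrp
begin

definition full :: "real \<Rightarrow> real \<Rightarrow> real" where "full \<beta> t = \<beta> * J t"
text \<open>By the fundamental theorem of calculus this is \<beta> times the integral that defines
  the cut-off kernel; the maximum takes care of distances beyond \<open>r\<close>.\<close>

definition cut :: "real \<Rightarrow> real \<Rightarrow> real \<Rightarrow> real" where "cut \<beta> r t = \<beta> * max 0 (J t - J r)"

lemma nn_full: "0 \<le> \<beta> \<Longrightarrow> nn (full \<beta>)"
  unfolding nn_def full_def using J_pos by (simp add: less_imp_le)

lemma nn_cut: "0 \<le> \<beta> \<Longrightarrow> nn (cut \<beta> r)"
  unfolding nn_def cut_def by auto

lemma edge_product_full: "0 \<le> \<beta> \<Longrightarrow> edge_product \<beta> (lrp_kernel N J) (radial (full \<beta>))"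
  by (rule edge_product_radial[OF nn_full]) (auto simp: lrp_kernel_def lattice_dist_eq len_minus_commute full_def)

lemma cutoff_kernel_eq:
  assumes "0 < r" "x \<noteq> y"
  shows "cutoff_kernel N J r x y = max 0 (J (len (x - y)) - J r)"
proof -
  have "0 < len (x - y)" using assms by (intro len_pos) auto
  then show ?thesis
    unfolding cutoff_kernel_def lattice_dist_eq
    using assms(2) integral_deriv[of "len (x - y)" r] J_anti[of "len (x - y)" r] J_anti[OF assms(1), of "len (x - y)"]
    by (cases "len (x - y) \<le> r") simp_all
qed

lemma edge_product_cut: "0 \<le> \<beta> \<Longrightarrow> 0 < r \<Longrightarrow> edge_product \<beta> (cutoff_kernel N J r) (radial (cut \<beta> r))"
proof (rule edge_product_radial[OF nn_cut])
  fix x y :: "int ^ 'n"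
  show "cutoff_kernel N J r x y = cutoff_kernel N J r y x"
    unfolding cutoff_kernel_def lattice_dist_eq len_minus_commute[of y x] by auto
qed (auto simp: cutoff_kernel_eq cut_def)

text \<open>Sharpness of the phase transition. An infinite susceptibility at \<beta> would give
  percolation at the midpoint of \<beta> and the critical point.\<close>

lemma fin_chi_subcritical:
  assumes fin: "critical_point (lrp_kernel N J) < \<infinity>" and \<beta>: "0 < \<beta>" "\<beta> < enn2real (critical_point (lrp_kernel N J))"
  shows "fin_chi (full \<beta>)"
proof (rule ccontr)
  let ?c = "critical_point (lrp_kernel N J)"
  assume inf: "\<not> fin_chi (full \<beta>)"
  define \<beta>' where "\<beta>' = (\<beta> + enn2real ?c) / 2"
  have \<beta>': "\<beta> < \<beta>'" "\<beta>' < enn2real ?c" using \<beta> by (auto simp: \<beta>'_def)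
  have nnJ: "nn J" using J_pos by (auto simp: nn_def intro: less_imp_le)
  have "percolates \<beta>' (lrp_kernel N J)"
  proof (rule percolates_of_escape[OF edge_product_full nn_full])
    show "0 < 1 - exp (- ((\<beta>' - \<beta>) / (4 * \<beta>)))" using \<beta> \<beta>' by simp
    show "\<exists>F. finite F \<and> \<Lambda> \<subseteq> F \<and> pprob (edges_in F) (radial (full \<beta>')) (\<lambda>S. 0 \<in> trapped F \<Lambda> S)
        \<le> 1 - (1 - exp (- ((\<beta>' - \<beta>) / (4 * \<beta>))))" if "finite \<Lambda>" "0 \<in> \<Lambda>" for \<Lambda>
      using escape_of_not_fin_chi[OF nnJ \<beta>(1) \<beta>'(1) _ that] inf unfolding full_def[abs_def] by simp
  qed (use \<beta> \<beta>' in auto)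
  then have "?c \<le> ennreal \<beta>'" unfolding critical_point_def using \<beta> \<beta>' by (intro INF_lower) auto
  then have "enn2real ?c \<le> \<beta>'" using \<beta> \<beta>' fin by (cases ?c) (auto simp: ennreal_le_iff)
  then show False using \<beta>'(2) by simp
qed

end

text \<open>The hypotheses of the theorem in the form in which they are used: finiteness of the
  susceptibility below \<open>b\<close> is sharpness of the phase transition, and the tail bound is (CL).\<close>

locale lrp_critical = lrp N J \<alpha> for N :: "real ^ 'n \<Rightarrow> real" and J \<alpha> +
  fixes b :: real
  assumes b: "0 < b"
    and subcritical: "\<And>\<beta>. 0 < \<beta> \<Longrightarrow> \<beta> < b \<Longrightarrow> fin_chi (full \<beta>)"
    and cut_tail: "\<And>p. 0 < p \<Longrightarrow> \<exists>C>0. \<forall>r\<ge>1. \<forall>s>0. \<forall>G. finite G \<longrightarrow> (\<forall>x\<in>G. s \<le> len x) \<longrightarrow>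
      (\<Sum>x\<in>G. tau (cut b r) x) \<le> C * (r / s) powr p * chi (cut b r)"

context lrp
begin

text \<open>On the lattice \<open>J\<close> is at most \<open>J s\<close>, where \<open>s\<close> is
  the smallest distance, so subtracting \<open>J r\<close> costs at least the fixed proportion
  \<open>J r / J s\<close>. The critical cut-off measure is thus dominated by the full measure at
  \<open>b * \<theta>\<close>, which is subcritical.\<close>

lemma fin_chi_cut:
  assumes sub: "\<And>\<beta>. 0 < \<beta> \<Longrightarrow> \<beta> < b \<Longrightarrow> fin_chi (full \<beta>)" and b: "0 < b" and r: "0 < r"
  shows "fin_chi (cut b r)"
proof -
  obtain s where s: "0 < s" "\<And>x. x \<noteq> 0 \<Longrightarrow> s \<le> len x" by (rule min_len) blast
  \<comment> \<open>The maximum with 1/2 keeps \<theta> positive when \<open>r\<close> is smaller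
    than the least lattice distance.\<close>
  define \<theta> where "\<theta> = max (1 / 2) (1 - J r / J s)"
  have \<theta>: "0 < \<theta>" "\<theta> < 1" using J_pos[OF r] J_pos[OF s(1)] by (auto simp: \<theta>_def)
  have "b * \<theta> < b" using mult_strict_left_mono[OF \<theta>(2) b] by simp
  then have "fin_chi (full (b * \<theta>))" using \<theta> b by (intro sub) auto
  then show ?thesis
  proof (rule fin_chi_mono(1)[rotated 3])
    fix x :: "int ^ 'n" assume "x \<noteq> 0"
    then have sx: "s \<le> len x" "0 < len x" using s(2) len_pos by auto
    have "J (len x) * (J r / J s) \<le> J s * (J r / J s)"
      using J_anti[OF s(1) sx(1)] J_pos[OF r] J_pos[OF s(1)] by (intro mult_right_mono) auto
    then have "J (len x) - J r \<le> J (len x) * (1 - J r / J s)" using J_pos[OF s(1)] by (simp add: algebra_simps)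
    also have "\<dots> \<le> J (len x) * \<theta>" using J_pos[OF sx(2)] by (intro mult_left_mono) (auto simp: \<theta>_def)
    finally have "max 0 (J (len x) - J r) \<le> J (len x) * \<theta>" using J_pos[OF sx(2)] \<theta> by auto
    then have "b * max 0 (J (len x) - J r) \<le> b * (J (len x) * \<theta>)" using b by (intro mult_left_mono) auto
    then show "cut b r (len x) \<le> full (b * \<theta>) (len x)" by (simp add: cut_def full_def mult_ac)
  qed (use nn_cut nn_full b \<theta> in auto)
qed

text \<open>Markov's inequality for the \<open>p\<close>-th moment. Finiteness of the susceptibility
  makes the quotient in the radius of gyration an honest one, and \<open>c2\<close> converts between
  the norm of the kernel and the Euclidean norm.\<close>

lemma cut_tail_of_CL:
  assumes CL: "CL N J" and b: "b = enn2real (critical_point (lrp_kernel N J))" "0 < b" and p: "0 < p"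
    and fin: "\<And>r. 0 < r \<Longrightarrow> fin_chi (cut b r)"
  shows "\<exists>C>0. \<forall>r\<ge>1. \<forall>s>0. \<forall>G. finite G \<longrightarrow> (\<forall>x\<in>G. s \<le> len x) \<longrightarrow>
      (\<Sum>x\<in>G. tau (cut b r) x) \<le> C * (r / s) powr p * chi (cut b r)"
proof -
  obtain C where C: "\<And>r. 1 \<le> r \<Longrightarrow> gyration_radius p b (cutoff_kernel N J r) \<le> ennreal (C * r)"
    using CL p unfolding CL_def b(1) by blast
  obtain c2 where c2: "0 < c2" "\<And>v. N v \<le> c2 * norm v" by (rule norm_equiv) blast
  define D where "D = c2 * (\<bar>C\<bar> + 1)"
  have D0: "0 < D" unfolding D_def using c2 by (intro mult_pos_pos) auto
  have "(\<Sum>x\<in>G. tau (cut b r) x) \<le> D powr p * (r / s) powr p * chi (cut b r)"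
    if r: "1 \<le> r" and s: "0 < s" and G: "finite G" "\<forall>x\<in>G. s \<le> len x" for r s G
  proof -
    let ?\<phi> = "cut b r"
    have r0: "0 < r" using r by simp
    have nn: "nn ?\<phi>" using b by (intro nn_cut) auto
    have chi: "1 \<le> chi ?\<phi>" using nn fin[OF r0] by (rule chi_ge_1)
    let ?I = "\<integral>\<^sup>+ x. ennreal (norm (of_lattice x) powr p) * ennreal (tau ?\<phi> x) \<partial>count_space UNIV"
    have "C * r \<le> (\<bar>C\<bar> + 1) * r" using r by (intro mult_right_mono) auto
    then have "gyration_radius p b (cutoff_kernel N J r) \<le> ennreal ((\<bar>C\<bar> + 1) * r)"
      using C[OF r] by (meson ennreal_leI order_trans)
    then have "?I / ennreal (chi ?\<phi>) \<le> ennreal (((\<bar>C\<bar> + 1) * r) powr p)"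
      using gyration_radius_eq[OF edge_product_cut nn fin] b r p by (simp add: ennreal_power_le_iff)
    then have "?I / ennreal (chi ?\<phi>) * ennreal (chi ?\<phi>) \<le> ennreal (((\<bar>C\<bar> + 1) * r) powr p) * ennreal (chi ?\<phi>)"
      by (rule mult_right_mono) simp
    then have I: "?I \<le> ennreal (((\<bar>C\<bar> + 1) * r) powr p * chi ?\<phi>)"
      using chi by (simp add: ennreal_divide_times ennreal_mult_divide_eq ennreal_mult[symmetric] ennreal_times_divide)
    have "ennreal (\<Sum>x\<in>G. norm (of_lattice x) powr p * tau ?\<phi> x) \<le> ?I"
      by (rule nn_integral_tau_ge[OF nn _ G(1)]) simp
    then have "ennreal (\<Sum>x\<in>G. norm (of_lattice x) powr p * tau ?\<phi> x) \<le> ennreal (((\<bar>C\<bar> + 1) * r) powr p * chi ?\<phi>)"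
      using I by (rule order_trans)
    then have "(\<Sum>x\<in>G. norm (of_lattice x) powr p * tau ?\<phi> x) \<le> ((\<bar>C\<bar> + 1) * r) powr p * chi ?\<phi>"
      using chi by (simp add: ennreal_le_iff)
    moreover have "(s / c2) powr p * (\<Sum>x\<in>G. tau ?\<phi> x) \<le> (\<Sum>x\<in>G. norm (of_lattice x) powr p * tau ?\<phi> x)"
      unfolding sum_distrib_left
    proof (intro sum_mono mult_right_mono powr_mono2)
      fix x assume "x \<in> G"
      then have "s \<le> c2 * norm (of_lattice x)" using G(2) c2(2)[of "of_lattice x"] unfolding len_def by force
      then show "s / c2 \<le> norm (of_lattice x)" using c2(1) by (simp add: field_simps)
    qed (use p s c2 tau_nonneg[OF nn] in auto)
    ultimately have "(s / c2) powr p * (\<Sum>x\<in>G. tau ?\<phi> x) \<le> ((\<bar>C\<bar> + 1) * r) powr p * chi ?\<phi>" by simp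
    moreover have "((\<bar>C\<bar> + 1) * r) powr p = (s / c2) powr p * (D powr p * (r / s) powr p)"
      unfolding D_def using s c2 r by (simp add: powr_mult powr_divide)
    ultimately have "(s / c2) powr p * (\<Sum>x\<in>G. tau ?\<phi> x) \<le> (s / c2) powr p * (D powr p * (r / s) powr p * chi ?\<phi>)"
      by (simp add: mult.assoc)
    moreover have "0 < (s / c2) powr p" using s c2 by simp
    ultimately show ?thesis by (rule mult_left_le_imp_le)
  qed
  moreover have "0 < D powr p" using D0 by simp
  ultimately show ?thesis by blast
qed

lemma lrp_critical_of_CL:
  assumes CL: "CL N J" and b: "b = enn2real (critical_point (lrp_kernel N J))" "0 < b"
  shows "lrp_critical N J \<alpha> b"
proof -
  have sub: "fin_chi (full \<beta>)" if "0 < \<beta>" "\<beta> < b" for \<beta>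
    using that CL unfolding b(1) CL_def by (intro fin_chi_subcritical) auto
  show ?thesis
  proof (intro lrp_critical.intro lrp_critical_axioms.intro)
    show "lrp N J \<alpha>" by (rule lrp_axioms)
  qed (use b sub cut_tail_of_CL[OF CL b] fin_chi_cut[OF sub b(2)] in blast)+
qed

end

section \<open>The susceptibility of the cut-off measures at criticality\<close>

context lattice_norm
begin

text \<open>Here \<open>m i\<close> is a typical size of the largest cluster restricted to \<open>b i\<close>: truncating
  the mass of a cluster at this size costs only a constant factor in the mean.\<close>

lemma finite_window:
  fixes b :: "nat \<Rightarrow> (int ^ 'n) set"
  assumes nn: "nn \<phi>" and fin: "fin_chi \<phi>" and b: "\<And>i. i \<le> L \<Longrightarrow> finite (b i)" "\<And>i. i \<le> L \<Longrightarrow> b i \<noteq> {}"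
    and q: "0 < q" "q ^ (2 ^ k) \<le> 1 / 9" and h: "0 < h"
  obtains F m where "finite F" "\<And>i. i \<le> L \<Longrightarrow> b i \<subseteq> F" "\<And>i. i \<le> L \<Longrightarrow> 1 \<le> m i"
    "\<And>i. i \<le> L \<Longrightarrow> q \<le> pprob (edges_in F) (radial \<phi>) (\<lambda>S. \<exists>u. m i \<le> hits (b i) S u)"
    "\<And>i. i \<le> L \<Longrightarrow> q * (real (m i))\<^sup>2 \<le> real (card (b i)) * chi \<phi>"
    "\<And>i x. i \<le> L \<Longrightarrow> x \<in> b i \<Longrightarrow> h \<le> (\<Sum>y\<in>b i. tau \<phi> (y - x)) \<Longrightarrow>
      h / (2 * 3 ^ (k + 2)) \<le> pmean (edges_in F) (radial \<phi>) (\<lambda>S. real (min (hits (b i) S x) (m i)))"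
proof -
  let ?U = "\<Union>i\<in>{..L}. b i"
  have finU: "finite ?U" using b by auto
  have r0: "0 \<le> radial \<phi> e" for e by (rule nn_radial[OF nn])
  \<comment> \<open>The approximation errors over a window add up to at most \<open>h / 2\<close>,
    whence the factor 2 in the denominator of the last conclusion.\<close>
  define \<epsilon> where "\<epsilon> = h / (2 * (1 + real (card ?U)))"
  have \<epsilon>: "0 < \<epsilon>" unfolding \<epsilon>_def using h by (simp add: add_pos_nonneg)
  obtain F where F: "finite F" "?U \<subseteq> F"
    "\<And>x y. (x, y) \<in> ?U \<times> ?U \<Longrightarrow> conn_prob (radial \<phi>) x y - \<epsilon> < link_prob F (radial \<phi>) x y"
    using conn_prob_approx_sum[of "radial \<phi>" \<epsilon> "?U \<times> ?U" ?U] r0 \<epsilon> finU by blast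
  let ?M = "pmean (edges_in F) (radial \<phi>)"
  have mean: "?M (\<lambda>S. real (hits (b i) S x)) = (\<Sum>y\<in>b i. link_prob F (radial \<phi>) x y)" if "i \<le> L" for i x
    unfolding link_prob_def by (rule mean_hits[OF b(1)[OF that]])
  define P where "P i m \<longleftrightarrow> 1 \<le> m \<and> q \<le> ?M (\<lambda>S. of_bool (\<exists>u. m \<le> hits (b i) S u)) \<and>
      (\<forall>x. ?M (\<lambda>S. real (hits (b i) S x)) \<le> 3 ^ (k + 2) * ?M (\<lambda>S. real (min (hits (b i) S x) m))) \<and>
      q * (real m)\<^sup>2 \<le> (\<Sum>x\<in>b i. ?M (\<lambda>S. real (hits (b i) S x)))" for i m
  have ex: "\<exists>m. P i m" if "i \<le> L" for i
    unfolding P_def by (rule typical_size[where w = "radial \<phi>", OF F(1) r0 b(1)[OF that] b(2)[OF that] q]) blast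
  define m where "m i = (SOME m. P i m)" for i
  have P: "P i (m i)" if "i \<le> L" for i unfolding m_def by (rule someI_ex[OF ex[OF that]])
  have m: "1 \<le> m i" "q \<le> ?M (\<lambda>S. of_bool (\<exists>u. m i \<le> hits (b i) S u))"
    "\<And>x. ?M (\<lambda>S. real (hits (b i) S x)) \<le> 3 ^ (k + 2) * ?M (\<lambda>S. real (min (hits (b i) S x) (m i)))"
    "q * (real (m i))\<^sup>2 \<le> (\<Sum>x\<in>b i. ?M (\<lambda>S. real (hits (b i) S x)))" if "i \<le> L" for i
    using P[OF that] unfolding P_def by blast+
  show ?thesis
  proof (rule that[OF F(1) _ m(1,2)])
    fix i assume i: "i \<le> L"
    show "b i \<subseteq> F" using F(2) i by auto
    have "(\<Sum>x\<in>b i. ?M (\<lambda>S. real (hits (b i) S x))) \<le> (\<Sum>x\<in>b i. chi \<phi>)"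
    proof (rule sum_mono)
      fix x
      have "(\<Sum>y\<in>b i. link_prob F (radial \<phi>) x y) \<le> (\<Sum>y\<in>b i. tau \<phi> (y - x))"
        by (intro sum_mono link_prob_le_tau[OF nn F(1)])
      also have "\<dots> \<le> chi \<phi>" by (rule sum_tau_shift_le_chi[OF fin b(1)[OF i]])
      finally show "?M (\<lambda>S. real (hits (b i) S x)) \<le> chi \<phi>" unfolding mean[OF i] .
    qed
    then show "q * (real (m i))\<^sup>2 \<le> real (card (b i)) * chi \<phi>" using m(4)[OF i] by simp
    fix x assume x: "x \<in> b i" "h \<le> (\<Sum>y\<in>b i. tau \<phi> (y - x))"
    have "(\<Sum>y\<in>b i. tau \<phi> (y - x)) \<le> (\<Sum>y\<in>b i. link_prob F (radial \<phi>) x y + \<epsilon>)"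
    proof (rule sum_mono)
      fix y assume "y \<in> b i"
      then have "(x, y) \<in> ?U \<times> ?U" using x(1) i by auto
      from F(3)[OF this] show "tau \<phi> (y - x) \<le> link_prob F (radial \<phi>) x y + \<epsilon>"
        using conn_prob_eq_tau[OF nn, of x y] by simp
    qed
    also have "\<dots> = (\<Sum>y\<in>b i. link_prob F (radial \<phi>) x y) + real (card (b i)) * \<epsilon>" by (simp add: sum.distrib)
    also have "real (card (b i)) * \<epsilon> \<le> real (card ?U) * \<epsilon>"
      using i finU \<epsilon> by (intro mult_right_mono of_nat_mono card_mono) auto
    also have "\<dots> \<le> h / 2" unfolding \<epsilon>_def using h by (simp add: field_simps)
    finally have "h / 2 \<le> ?M (\<lambda>S. real (hits (b i) S x))" using x(2) unfolding mean[OF i] by linarith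
    also note m(3)[OF i]
    finally show "h / (2 * 3 ^ (k + 2)) \<le> ?M (\<lambda>S. real (min (hits (b i) S x) (m i)))"
      by (simp add: field_simps)
  qed
qed

text \<open>A lattice direction along which windows are lined up at exactly known distances.\<close>

lemma unit_vector: obtains e where "e \<noteq> (0 :: int ^ 'n)" "\<And>k. len (k *s e) = \<bar>real_of_int k\<bar> * len e"
proof -
  define e :: "int ^ 'n" where "e = (\<chi> i. 1)"
  have "of_lattice (k *s e) = real_of_int k *\<^sub>R of_lattice e" for k
    by (simp add: e_def of_lattice_def vec_eq_iff)
  then have "len (k *s e) = \<bar>real_of_int k\<bar> * len e" for k
    unfolding len_def by (simp add: N_scale)
  moreover have "e \<noteq> 0" by (simp add: e_def vec_eq_iff)
  ultimately show ?thesis using that by blast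
qed

end

context lrp_critical
begin

abbreviation "X r \<equiv> chi (cut b r)"

lemma nn_cut_b: "nn (cut b r)"
  using b by (intro nn_cut) simp

lemma fin_cut: "0 < r \<Longrightarrow> fin_chi (cut b r)"
  using fin_chi_cut[OF subcritical b] .

lemma X_ge_1: "0 < r \<Longrightarrow> 1 \<le> X r"
  by (rule chi_ge_1[OF nn_cut_b fin_cut])

lemma cut_mono:
  assumes "0 < r" "r \<le> r'" "0 \<le> \<beta>" "\<beta> \<le> \<beta>'"
  shows "cut \<beta> r t \<le> cut \<beta>' r' t"
  unfolding cut_def using assms J_anti[OF assms(1,2)] by (intro mult_mono) auto

lemma X_mono: "0 < r \<Longrightarrow> r \<le> r' \<Longrightarrow> X r \<le> X r'"
  using b cut_mono by (intro fin_chi_mono(2) nn_cut_b fin_cut) auto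

text \<open>The tail bound of order 1 leaves at most half of the susceptibility outside a ball of
  radius \<open>\<Gamma> * r\<close>.\<close>

lemma X_mass: obtains \<Gamma> where "1 \<le> \<Gamma>" "\<And>r. 1 \<le> r \<Longrightarrow> X r / 2 \<le> (\<Sum>y\<in>ball_at 0 (\<Gamma> * r). tau (cut b r) y)"
proof -
  obtain C where C: "0 < C" "\<And>r s G. 1 \<le> r \<Longrightarrow> 0 < s \<Longrightarrow> finite G \<Longrightarrow> \<forall>x\<in>G. s \<le> len x \<Longrightarrow>
      (\<Sum>x\<in>G. tau (cut b r) x) \<le> C * (r / s) powr 1 * X r"
    using cut_tail[of 1] by auto
  define \<Gamma> where "\<Gamma> = max 1 (2 * C)"
  have "X r / 2 \<le> (\<Sum>y\<in>ball_at 0 (\<Gamma> * r). tau (cut b r) y)" if r: "1 \<le> r" for r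
  proof -
    have \<Gamma>r: "0 < \<Gamma> * r" using r by (simp add: \<Gamma>_def)
    have "X r \<le> (\<Sum>y\<in>ball_at 0 (\<Gamma> * r). tau (cut b r) y) + X r / 2"
    proof (rule chi_le)
      fix G :: "(int ^ 'n) set" assume G: "finite G"
      let ?A = "{x \<in> G. len x \<le> \<Gamma> * r}" and ?B = "{x \<in> G. \<Gamma> * r < len x}"
      have "G = ?A \<union> ?B" by auto
      then have "(\<Sum>x\<in>G. tau (cut b r) x) = (\<Sum>x\<in>?A \<union> ?B. tau (cut b r) x)" by simp
      also have "\<dots> = (\<Sum>x\<in>?A. tau (cut b r) x) + (\<Sum>x\<in>?B. tau (cut b r) x)"
        using G by (intro sum.union_disjoint) auto
      finally have split: "(\<Sum>x\<in>G. tau (cut b r) x) = (\<Sum>x\<in>?A. tau (cut b r) x) + (\<Sum>x\<in>?B. tau (cut b r) x)" .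
      have A: "(\<Sum>x\<in>?A. tau (cut b r) x) \<le> (\<Sum>y\<in>ball_at 0 (\<Gamma> * r). tau (cut b r) y)"
        by (intro sum_mono2) (auto intro: tau_nonneg nn_cut_b)
      have "(\<Sum>x\<in>?B. tau (cut b r) x) \<le> C * (r / (\<Gamma> * r)) powr 1 * X r"
        using G \<Gamma>r r by (intro C(2)) auto
      moreover have "C * (r / (\<Gamma> * r)) powr 1 * X r \<le> 1 / 2 * X r"
      proof (rule mult_right_mono)
        show "C * (r / (\<Gamma> * r)) powr 1 \<le> 1 / 2"
          using r \<Gamma>r C(1) by (simp add: \<Gamma>_def field_simps max_def)
        show "0 \<le> X r" using X_ge_1[of r] r by simp
      qed
      ultimately show "(\<Sum>x\<in>G. tau (cut b r) x) \<le> (\<Sum>y\<in>ball_at 0 (\<Gamma> * r). tau (cut b r) y) + X r / 2"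
        using split A by linarith
    qed
    then show ?thesis by simp
  qed
  moreover have "1 \<le> \<Gamma>" by (simp add: \<Gamma>_def)
  ultimately show ?thesis using that by blast
qed

text \<open>An a priori bound by the volume of the ball that carries half of the mass. It serves to
  exclude rapid growth at all scales.\<close>

lemma X_le_volume: obtains C where "0 < C" "\<And>r. 1 \<le> r \<Longrightarrow> X r \<le> C * r powr d"
proof -
  obtain \<Gamma> where \<Gamma>: "1 \<le> \<Gamma>" "\<And>r. 1 \<le> r \<Longrightarrow> X r / 2 \<le> (\<Sum>y\<in>ball_at 0 (\<Gamma> * r). tau (cut b r) y)"
    by (rule X_mass) blast
  obtain V where V: "0 < V" "\<And>z s. 1 \<le> s \<Longrightarrow> real (card (ball_at z s)) \<le> V * s ^ CARD('n)"
    by (rule card_ball) blast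
  have "X r \<le> 2 * V * \<Gamma> powr d * r powr d" if r: "1 \<le> r" for r
  proof -
    have \<Gamma>r: "1 \<le> \<Gamma> * r" using \<Gamma>(1) r by (metis mult_mono' mult_1 zero_le_one)
    have "X r / 2 \<le> (\<Sum>y\<in>ball_at 0 (\<Gamma> * r). 1)"
      using \<Gamma>(2)[OF r] sum_mono[of "ball_at 0 (\<Gamma> * r)" "tau (cut b r)" "\<lambda>_. 1"] tau_le_1[OF nn_cut_b] by fastforce
    also have "\<dots> \<le> V * (\<Gamma> * r) ^ CARD('n)" using V(2)[OF \<Gamma>r, of 0] by simp
    also have "(\<Gamma> * r) ^ CARD('n) = \<Gamma> powr d * r powr d"
      using \<Gamma>(1) r by (simp add: d_def powr_realpow power_mult_distrib)
    finally show ?thesis by simp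
  qed
  moreover have "0 < 2 * V * \<Gamma> powr d" using V \<Gamma> by simp
  ultimately show ?thesis using that by blast
qed

text \<open>Raising the cut-off strengthens also the pairs closer than the old cut-off, so every
  pair within distance \<rho> gains at least this amount.\<close>

lemma cut_diff_ge:
  assumes "0 < r" "r \<le> \<rho>" "0 < t" "t \<le> \<rho>" "0 \<le> \<beta>"
  shows "\<beta> * (J \<rho> - J (2 * \<rho>)) \<le> cut \<beta> (2 * \<rho>) t - cut \<beta> r t"
proof -
  have "J \<rho> \<le> J t" "J \<rho> \<le> J r" "J (2 * \<rho>) \<le> J \<rho>" using assms by (auto intro!: J_anti)
  then have "J \<rho> - J (2 * \<rho>) \<le> max 0 (J t - J (2 * \<rho>)) - max 0 (J t - J r)" by auto
  then have "\<beta> * (J \<rho> - J (2 * \<rho>)) \<le> \<beta> * (max 0 (J t - J (2 * \<rho>)) - max 0 (J t - J r))"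
    using assms(5) by (rule mult_left_mono)
  then show ?thesis unfolding cut_def by (simp add: algebra_simps)
qed

text \<open>Let \<open>\<kappa>\<close>, of order \<open>r powr (- d - \<alpha>)\<close>, be the
  weight gained by each pair of points in the same or in adjacent windows. If some typical size
  satisfies \<open>\<kappa> * m ^ 2 < \<Lambda>\<close>, gluing in that window gives
  \<open>X (B * r)\<close> at least a constant times \<open>r powr (- \<alpha>) * X r ^ 2\<close>,
  and the growth hypothesis yields the claim. Otherwise the large clusters of \<open>L + 1\<close>
  windows merge, which puts mass of order at least \<open>X r / L ^ 4\<close> at distance
  \<open>L * r\<close>; this is impossible for large \<open>L\<close>.\<close>

lemma X_doubling_bound:
  obtains B M r0 where "1 < B" "0 < M" "1 \<le> r0"
    "\<And>r. r0 \<le> r \<Longrightarrow> X (B * r) \<le> B powr (d + \<alpha>) * X r \<Longrightarrow> X r \<le> M * r powr \<alpha>"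
proof -
  obtain \<Gamma> where \<Gamma>: "1 \<le> \<Gamma>" "\<And>r. 1 \<le> r \<Longrightarrow> X r / 2 \<le> (\<Sum>y\<in>ball_at 0 (\<Gamma> * r). tau (cut b r) y)"
    by (rule X_mass) blast
  obtain v V where V: "0 < v" "0 < V" "\<And>z s. 0 \<le> s \<Longrightarrow> v * s ^ CARD('n) \<le> real (card (ball_at z s))"
    "\<And>z s. 1 \<le> s \<Longrightarrow> real (card (ball_at z s)) \<le> V * s ^ CARD('n)" by (rule card_ball) blast
  obtain a R0 where a: "0 < a" "1 \<le> R0" "\<And>r. R0 \<le> r \<Longrightarrow> a * r powr (- d - \<alpha>) \<le> J r - J (2 * r)" by (rule J_diff_ge) blast
  \<comment> \<open>Order 5, one more than the power of \<open>L\<close> that is lost in gluing, see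
    \<open>\<theta>L\<close> below.\<close>
  obtain C5 where C5: "0 < C5" "\<And>r s G. 1 \<le> r \<Longrightarrow> 0 < s \<Longrightarrow> finite G \<Longrightarrow> \<forall>x\<in>G. s \<le> len x \<Longrightarrow>
      (\<Sum>x\<in>G. tau (cut b r) x) \<le> C5 * (r / s) powr 5 * X r"
    using cut_tail[of 5] by auto
  obtain e where e: "e \<noteq> 0" "\<And>k. len (k *s e) = \<bar>real_of_int k\<bar> * len e" by (rule unit_vector) blast
  define n1 where "n1 = len e"
  have n1: "0 < n1" unfolding n1_def by (rule len_pos[OF e(1)])
  \<comment> \<open>Chosen so that \<open>B0 * r\<close> equals \<open>(3 + n1) * R\<close> with
    \<open>R = 2 * \<Gamma> * r\<close>, which bounds the distance of points in adjacent windows: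
    two radii \<open>R\<close> and a spacing of at most \<open>R + n1\<close>.\<close>
  define B0 where "B0 = (3 + n1) * (2 * \<Gamma>)"
  have B0: "6 * \<Gamma> \<le> B0" unfolding B0_def using n1 \<Gamma>(1) by (simp add: algebra_simps)
  define B where "B = 2 * B0"
  have B1: "1 < B" using B0 \<Gamma>(1) by (simp add: B_def)
  define K where "K = B powr (d + \<alpha>)"
  define \<kappa>0 where "\<kappa>0 = b * a * B0 powr (- d - \<alpha>)"
  have \<kappa>0: "0 < \<kappa>0" unfolding \<kappa>0_def using b a(1) B0 \<Gamma>(1) by simp
  define V' where "V' = V * (2 * \<Gamma>) powr d"
  have V': "0 < V'" unfolding V'_def using V(2) \<Gamma>(1) by simp
  define Q where "Q = C5 * B powr 5 * K * 32 * V' * 2 ^ 30 / v"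
  \<comment> \<open>With \<open>L\<close> a power of two, \<open>3 ^ k\<close> for
    \<open>k = l + 4\<close> is bounded by a constant times \<open>L ^ 2\<close>, so that the
    truncation loss is polynomial in \<open>L\<close>.\<close>
  obtain l :: nat where l: "max 1 Q < 2 ^ l" using real_arch_pow[of 2 "max 1 Q"] by auto
  define L :: nat where "L = 2 ^ l"
  have L1: "1 \<le> L" "Q < real L" using l by (auto simp: L_def)
  \<comment> \<open>Then \<open>L + 1\<close> events of probability at least
    \<open>1 - \<delta>\<close> occur together with probability at least 1/2.\<close>
  define \<delta> where "\<delta> = 1 / (2 * real (L + 1))"
  \<comment> \<open>Since \<open>2 ^ k = 16 * L\<close> and
    \<open>\<delta> \<ge> 1 / (4 * L)\<close>, the power \<open>(1 - \<delta>) ^ (2 ^ k)\<close> is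
    at most \<open>exp (- 4)\<close>, below 1/9.\<close>
  define k where "k = l + 4"
  define \<theta> where "\<theta> = 1 / (4 * 3 ^ (k + 2) :: real)"
  \<comment> \<open>Makes \<open>(1 - exp (- \<Lambda>)) ^ L\<close> at least 1/2 by Bernoulli's
    inequality.\<close>
  define \<Lambda> where "\<Lambda> = 2 * real L"
  have \<theta>0: "0 < \<theta>" by (simp add: \<theta>_def)
  have \<Lambda>1: "1 \<le> \<Lambda>" using L1 by (simp add: \<Lambda>_def)
  have \<delta>: "0 < \<delta>" "\<delta> \<le> 1 / 4" "1 / (4 * real L) \<le> \<delta>" using L1 by (auto simp: \<delta>_def field_simps)
  have q: "0 < 1 - \<delta>" "(1 - \<delta>) ^ (2 ^ k) \<le> 1 / 9"
  proof -
    show "0 < 1 - \<delta>" using \<delta> by simp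
    have "(1 - \<delta>) ^ (2 ^ k) \<le> exp (- \<delta>) ^ (2 ^ k)"
      using \<delta> exp_ge_add_one_self[of "- \<delta>"] by (intro power_mono) auto
    also have "\<dots> = exp (- (\<delta> * 2 ^ k))" by (simp add: exp_of_nat_mult[symmetric] mult.commute)
    also have "\<dots> \<le> exp (- 4)"
    proof -
      have "1 / (4 * real L) * 2 ^ k \<le> \<delta> * 2 ^ k" using \<delta>(3) by (intro mult_right_mono) auto
      moreover have "1 / (4 * real L) * 2 ^ k = 4" by (simp add: L_def k_def power_add)
      ultimately show ?thesis by simp
    qed
    also have "exp (- 4) \<le> (1 / 9 :: real)"
    proof -
      have "(3 :: real) ^ 2 \<le> (exp 2) ^ 2" using exp_ge_add_one_self[of 2] by (intro power_mono) auto
      also have "(exp 2) ^ 2 = exp (4 :: real)" by (simp add: exp_of_nat_mult[symmetric])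
      finally show ?thesis by (simp add: exp_minus field_simps)
    qed
    finally show "(1 - \<delta>) ^ (2 ^ k) \<le> 1 / 9" .
  qed
  have \<theta>L: "1 / (2 ^ 28 * real L ^ 4) \<le> \<theta>\<^sup>2"
  proof -
    have "(3 :: real) ^ (k + 2) \<le> 4 ^ (k + 2)" by (intro power_mono) auto
    also have "(4 :: real) ^ (k + 2) = 4 ^ 6 * (2 ^ 2) ^ l" by (simp add: k_def power_add)
    also have "\<dots> = 4 ^ 6 * (real L)\<^sup>2" unfolding L_def by (simp only: power_mult[symmetric] of_nat_power of_nat_numeral mult.commute)
    finally have "4 * 3 ^ (k + 2) \<le> 2 ^ 14 * (real L)\<^sup>2" by simp
    then have "1 / (2 ^ 14 * (real L)\<^sup>2) \<le> \<theta>" unfolding \<theta>_def using L1 by (intro divide_left_mono) auto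
    then have "(1 / (2 ^ 14 * (real L)\<^sup>2))\<^sup>2 \<le> \<theta>\<^sup>2" by (intro power_mono) auto
    then show ?thesis by (simp add: power_divide power_mult_distrib power_mult[symmetric])
  qed
  define c where "c = v * \<kappa>0 * \<theta>\<^sup>2 / (2 * \<Lambda>)"
  have c: "0 < c" unfolding c_def using V \<kappa>0 \<theta>0 \<Lambda>1 by simp
  have main: "X r \<le> K / c * r powr \<alpha>" if r: "R0 \<le> r" and dbl: "X (B * r) \<le> K * X r" for r
  proof -
    have r1: "1 \<le> r" and r0: "0 < r" using r a(2) by simp_all
    let ?\<phi> = "cut b r" and ?\<psi> = "\<lambda>t. cut b (B * r) t - cut b r t"
    have Xr: "1 \<le> X r" using X_ge_1[of r] r1 by simp
    \<comment> \<open>A point of the half window, of radius \<open>R / 2 = \<Gamma> * r\<close>,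
      then has its ball of radius \<open>\<Gamma> * r\<close> inside the window, so that half of its
      expected cluster size is counted there.\<close>
    define R where "R = 2 * \<Gamma> * r"
    have "1 \<le> \<Gamma> * r" using \<Gamma>(1) r1 by (metis mult_mono' mult_1 zero_le_one)
    then have R: "2 \<le> R" "\<Gamma> * r = R / 2" by (auto simp: R_def)
    define \<rho> where "\<rho> = B0 * r"
    have \<rho>: "\<rho> = (3 + n1) * R" "2 * \<rho> = B * r" "R0 \<le> \<rho>" "r \<le> \<rho>" "2 * R \<le> \<rho>" "0 < \<rho>"
    proof -
      show "\<rho> = (3 + n1) * R" by (simp add: \<rho>_def B0_def R_def)
      then show "2 * R \<le> \<rho>" using R n1 by (simp add: algebra_simps)
      show "2 * \<rho> = B * r" by (simp add: \<rho>_def B_def)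
      have "1 \<le> B0" using B0 \<Gamma>(1) by simp
      then have "1 * r \<le> B0 * r" using r1 by (intro mult_right_mono) auto
      then show "r \<le> \<rho>" "R0 \<le> \<rho>" "0 < \<rho>" using r r1 unfolding \<rho>_def by linarith+
    qed
    define \<kappa> where "\<kappa> = \<kappa>0 * r powr (- d - \<alpha>)"
    have \<kappa>pos: "0 < \<kappa>" unfolding \<kappa>_def using \<kappa>0 r1 by simp
    have \<psi>: "\<kappa> \<le> ?\<psi> t" if "0 < t" "t \<le> \<rho>" for t
    proof -
      have "\<kappa> = b * (a * \<rho> powr (- d - \<alpha>))"
        using B0 \<Gamma>(1) r1 by (simp add: \<kappa>_def \<kappa>0_def \<rho>_def powr_mult)
      also have "\<dots> \<le> b * (J \<rho> - J (2 * \<rho>))" using a(3)[OF \<rho>(3)] b by (intro mult_left_mono) auto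
      also have "\<dots> \<le> ?\<psi> t" unfolding \<rho>(2)[symmetric] using that \<rho> r1 b by (intro cut_diff_ge) auto
      finally show ?thesis .
    qed
    have nn\<psi>: "nn ?\<psi>"
    proof -
      have "r \<le> B * r" using B1 r1 by (simp add: algebra_simps)
      then show ?thesis using cut_mono[of r "B * r" b b] r1 b by (auto simp: nn_def)
    qed
    have sum_eq: "(\<lambda>t. ?\<phi> t + ?\<psi> t) = cut b (B * r)" by auto
    have glue_le: "link_prob F (\<lambda>e. radial ?\<phi> e + radial ?\<psi> e) x z \<le> tau (cut b (B * r)) (z - x)" if "finite F" for F x z
      unfolding radial_add[symmetric] sum_eq by (rule link_prob_le_tau[OF nn_cut_b that])
    \<comment> \<open>The spacing is the least multiple of the step length \<open>n1\<close> that is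
      at least \<open>R\<close>.\<close>
    define g where "g = nat \<lceil>R / n1\<rceil>"
    have g: "R \<le> real g * n1" "real g * n1 \<le> R + n1"
    proof -
      have "R / n1 \<le> real g" "real g \<le> R / n1 + 1" unfolding g_def using R n1 by (simp_all add: real_nat_ceiling_ge)
      then show "R \<le> real g * n1" "real g * n1 \<le> R + n1" using n1 by (simp_all add: field_simps)
    qed
    define z where "z i = int (i * g) *s e" for i
    define \<B> where "\<B> i = ball_at (z i) R" for i
    have zz: "len (z (Suc i) - z i) = real g * n1" for i
    proof -
      have "z (Suc i) - z i = int g *s e" unfolding z_def by (simp add: vec_eq_iff algebra_simps)
      then show ?thesis using e(2)[of "int g"] by (simp add: n1_def)
    qed
    have zL: "len (z i) = real i * (real g * n1)" for i
      using e(2)[of "int (i * g)"] unfolding z_def n1_def by simp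
    have z0: "z 0 = 0" by (simp add: z_def vec_eq_iff)
    have fin\<B>: "finite (\<B> i)" for i by (simp add: \<B>_def)
    have ne\<B>: "\<B> i \<noteq> {}" for i unfolding \<B>_def using R by (auto intro!: exI[of _ "z i"])
    have card\<B>: "real (card (\<B> i)) \<le> V' * r powr d" for i
    proof -
      have "real (card (\<B> i)) \<le> V * R ^ CARD('n)" unfolding \<B>_def using R by (intro V(4)) auto
      also have "R ^ CARD('n) = (2 * \<Gamma>) powr d * r powr d"
        using \<Gamma>(1) r1 unfolding R_def by (simp add: d_def powr_realpow power_mult_distrib)
      finally show ?thesis by (simp add: V'_def)
    qed
    have mass: "X r / 2 \<le> (\<Sum>y\<in>\<B> i. tau ?\<phi> (y - x))" if "x \<in> ball_at (z i) (R / 2)" for i x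
    proof -
      have "X r / 2 \<le> (\<Sum>y\<in>ball_at 0 (R / 2). tau ?\<phi> y)" using \<Gamma>(2)[OF r1] unfolding R(2) .
      also have "\<dots> = (\<Sum>y\<in>(+) x ` ball_at 0 (R / 2). tau ?\<phi> (y - x))"
        by (subst sum.reindex) (auto simp: inj_on_def)
      also have "\<dots> \<le> (\<Sum>y\<in>\<B> i. tau ?\<phi> (y - x))"
      proof (rule sum_mono2[OF fin\<B>])
        show "(+) x ` ball_at 0 (R / 2) \<subseteq> \<B> i"
        proof
          fix y assume "y \<in> (+) x ` ball_at 0 (R / 2)"
          then have "len (y - x) \<le> R / 2" by auto
          then show "y \<in> \<B> i" using that len_triangle3[of y "z i" x] unfolding \<B>_def by simp
        qed
      qed (auto intro: tau_nonneg nn_cut_b)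
      finally show ?thesis .
    qed
    have inB: "x \<in> \<B> i" if "x \<in> ball_at (z i) (R / 2)" for i x using that R unfolding \<B>_def by simp
    have vol: "v * r powr d \<le> real (card (ball_at (z i) (R / 2)))" for i
    proof -
      have "r ^ CARD('n) \<le> (R / 2) ^ CARD('n)" using \<Gamma>(1) r1 unfolding R_def by (intro power_mono) (auto simp: mult_right_mono)
      then have "v * r ^ CARD('n) \<le> v * (R / 2) ^ CARD('n)" using V(1) by (intro mult_left_mono) auto
      also have "\<dots> \<le> real (card (ball_at (z i) (R / 2)))" using R by (intro V(3)) auto
      finally show ?thesis using r1 by (simp add: d_def powr_realpow)
    qed
    have \<psi>\<B>: "\<kappa> \<le> radial ?\<psi> {u, v}" if "u \<in> \<B> i" "v \<in> \<B> i" "u \<noteq> v" for i u v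
    proof -
      have "len (u - v) \<le> 2 * R" using that(1,2) len_triangle3[of u v "z i"] unfolding \<B>_def
        by (simp add: len_minus_commute[of "z i" v])
      then show ?thesis using that(3) \<psi>[of "len (u - v)"] \<rho>(5) len_pos[of "u - v"] by simp
    qed
    have \<psi>\<B>': "\<kappa> \<le> radial ?\<psi> {u, v}" if "u \<in> \<B> i" "v \<in> \<B> (Suc i)" "u \<noteq> v" for i u v
    proof -
      have "len (u - v) \<le> len (u - z i) + len (z i - z (Suc i)) + len (z (Suc i) - v)"
        using len_triangle3[of u v "z i"] len_triangle3[of "z i" v "z (Suc i)"] by simp
      also have "\<dots> \<le> R + (R + n1) + R"
        using that(1,2) zz[of i] g(2) unfolding \<B>_def
        by (simp add: len_minus_commute[of "z (Suc i)" v] len_minus_commute[of "z i" "z (Suc i)"])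
      also have "\<dots> \<le> \<rho>" unfolding \<rho>(1) using R n1 by (simp add: algebra_simps)
      finally show ?thesis using that(3) \<psi>[of "len (u - v)"] len_pos[of "u - v"] by simp
    qed
    have "0 < X r / 2" using Xr by simp
    obtain F m where F: "finite F" "\<And>i. i \<le> L \<Longrightarrow> \<B> i \<subseteq> F" "\<And>i. i \<le> L \<Longrightarrow> 1 \<le> m i"
      "\<And>i. i \<le> L \<Longrightarrow> 1 - \<delta> \<le> pprob (edges_in F) (radial ?\<phi>) (\<lambda>S. \<exists>u. m i \<le> hits (\<B> i) S u)"
      "\<And>i. i \<le> L \<Longrightarrow> (1 - \<delta>) * (real (m i))\<^sup>2 \<le> real (card (\<B> i)) * X r"
      "\<And>i x. i \<le> L \<Longrightarrow> x \<in> \<B> i \<Longrightarrow> X r / 2 \<le> (\<Sum>y\<in>\<B> i. tau ?\<phi> (y - x)) \<Longrightarrow>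
        X r / 2 / (2 * 3 ^ (k + 2)) \<le> pmean (edges_in F) (radial ?\<phi>) (\<lambda>S. real (min (hits (\<B> i) S x) (m i)))"
      by (rule finite_window[where b = \<B> and L = L, OF nn_cut_b fin_cut[OF r0] fin\<B> ne\<B> q \<open>0 < X r / 2\<close>]) blast
    let ?M = "pmean (edges_in F) (radial ?\<phi>)"
    have trunc: "\<theta> * X r \<le> ?M (\<lambda>S. real (min (hits (\<B> i) S x) (m i)))" if "i \<le> L" "x \<in> ball_at (z i) (R / 2)" for i x
      using F(6)[OF that(1) inB[OF that(2)] mass[OF that(2)]] by (simp add: \<theta>_def)
    have r\<phi>: "0 \<le> radial ?\<phi> e" "0 \<le> radial ?\<psi> e" for e using nn_radial nn_cut_b nn\<psi> by auto
    have M0: "0 \<le> ?M (\<lambda>S. real (min (hits (\<B> i) S x) (m i)))" for i x using r\<phi> by (intro pmean_nonneg) auto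
    show ?thesis
    proof (cases "\<exists>i\<le>L. \<kappa> * (real (m i))\<^sup>2 < \<Lambda>")
      case True
      then obtain i where i: "i \<le> L" "\<kappa> * (real (m i))\<^sup>2 < \<Lambda>" by blast
      have zi: "z i \<in> ball_at (z i) (R / 2)" using R by simp
      have m1: "1 \<le> real (m i)" using F(3)[OF i(1)] by simp
      have min: "\<kappa> / \<Lambda> \<le> min \<kappa> (1 / (real (m i))\<^sup>2)"
        using i(2) \<kappa>pos \<Lambda>1 m1 by (auto simp: field_simps)
      have pt: "\<kappa> / \<Lambda> * (\<theta> * X r)\<^sup>2 / 2 \<le> tau (cut b (B * r)) (x - z i)" if x: "x \<in> ball_at (z i) (R / 2)" for x
      proof -
        have "\<kappa> / \<Lambda> * (\<theta> * X r)\<^sup>2 / 2 \<le> min \<kappa> (1 / (real (m i))\<^sup>2) *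
            (?M (\<lambda>S. real (min (hits (\<B> i) S (z i)) (m i))) * ?M (\<lambda>S. real (min (hits (\<B> i) S x) (m i)))) / 2"
          unfolding power2_eq_square[of "\<theta> * X r"] using min trunc[OF i(1) zi] trunc[OF i(1) x] \<kappa>pos \<Lambda>1 \<theta>0 Xr M0
          by (intro divide_right_mono mult_mono) auto
        also have "\<dots> \<le> link_prob F (\<lambda>e. radial ?\<phi> e + radial ?\<psi> e) (z i) x"
          using F(1) r\<phi> F(2)[OF i(1)] \<kappa>pos \<psi>\<B> F(3)[OF i(1)] by (intro link_prob_glue) auto
        also have "\<dots> \<le> tau (cut b (B * r)) (x - z i)" by (rule glue_le[OF F(1)])
        finally show ?thesis .
      qed
      have "c * r powr (- \<alpha>) * (X r)\<^sup>2 = (v * r powr d) * (\<kappa> / \<Lambda> * (\<theta> * X r)\<^sup>2 / 2)"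
      proof -
        have "r powr d * r powr (- d - \<alpha>) = r powr (- \<alpha>)" by (simp add: powr_add[symmetric])
        then show ?thesis unfolding c_def \<kappa>_def by (simp add: power_mult_distrib field_simps)
      qed
      also have "\<dots> \<le> real (card (ball_at (z i) (R / 2))) * (\<kappa> / \<Lambda> * (\<theta> * X r)\<^sup>2 / 2)"
        using vol[of i] \<kappa>pos \<Lambda>1 by (intro mult_right_mono) auto
      also have "\<dots> \<le> (\<Sum>x\<in>ball_at (z i) (R / 2). tau (cut b (B * r)) (x - z i))"
        using sum_mono[OF pt, of "ball_at (z i) (R / 2)"] by simp
      also have "\<dots> \<le> X (B * r)" using B1 r1 by (intro sum_tau_shift_le_chi fin_cut finite_ball_at) auto
      also note dbl
      finally have "c * r powr (- \<alpha>) * (X r)\<^sup>2 \<le> K * X r" .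
      then have "c * r powr (- \<alpha>) * X r \<le> K" using Xr by (simp add: power2_eq_square)
      then show ?thesis using c r1 by (simp add: powr_minus field_simps)
    next
      case False
      \<comment> \<open>All typical sizes are large, so that two adjacent large clusters fail to
        merge with probability at most \<open>exp (- \<Lambda>)\<close>.\<close>
      then have big: "\<Lambda> \<le> \<kappa> * (real (m i))\<^sup>2" if "i \<le> L" for i using that by (meson not_less)
      have m1: "1 \<le> real (m i)" if "i \<le> L" for i using F(3)[OF that] by simp
      have big2: "\<Lambda> \<le> \<kappa> * (real (m i) * real (m (Suc i)))" if "i < L" for i
      proof (cases "m i \<le> m (Suc i)")
        case True
        have "\<Lambda> \<le> \<kappa> * (real (m i))\<^sup>2" using big[of i] that by simp
        also have "\<dots> \<le> \<kappa> * (real (m i) * real (m (Suc i)))"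
          unfolding power2_eq_square using True \<kappa>pos by (intro mult_left_mono) auto
        finally show ?thesis .
      next
        case False
        have "\<Lambda> \<le> \<kappa> * (real (m (Suc i)))\<^sup>2" using big[of "Suc i"] that by simp
        also have "\<dots> \<le> \<kappa> * (real (m i) * real (m (Suc i)))"
          unfolding power2_eq_square using False \<kappa>pos by (intro mult_left_mono mult_right_mono) auto
        finally show ?thesis .
      qed
      have mm: "real (m i) * real (m j) \<le> 2 * (V' * r powr d * X r)" if "i \<le> L" "j \<le> L" for i j
      proof -
        have "(real (m i))\<^sup>2 \<le> 2 * (V' * r powr d * X r)" if "i \<le> L" for i
        proof -
          have "1 / 2 * (real (m i))\<^sup>2 \<le> (1 - \<delta>) * (real (m i))\<^sup>2" using \<delta> by (intro mult_right_mono) auto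
          also have "\<dots> \<le> real (card (\<B> i)) * X r" by (rule F(5)[OF that])
          also have "\<dots> \<le> V' * r powr d * X r" using card\<B>[of i] Xr by (intro mult_right_mono) auto
          finally show ?thesis by simp
        qed
        from this[OF that(1)] this[OF that(2)] have "(real (m i))\<^sup>2 + (real (m j))\<^sup>2 \<le> 2 * (2 * (V' * r powr d * X r))" by simp
        moreover have "2 * (real (m i) * real (m j)) \<le> (real (m i))\<^sup>2 + (real (m j))\<^sup>2"
          using zero_le_power2[of "real (m i) - real (m j)"] by (simp add: power2_diff)
        ultimately show ?thesis by simp
      qed
      have half: "1 / 2 \<le> (1 - exp (- \<Lambda>)) ^ L"
      proof -
        have "exp (- \<Lambda>) \<le> 1 / \<Lambda>"
        proof -
          have "\<Lambda> \<le> exp \<Lambda>" using exp_ge_add_one_self[of \<Lambda>] by linarith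
          then show ?thesis using \<Lambda>1 by (simp add: exp_minus inverse_eq_divide frac_le)
        qed
        then have "real L * exp (- \<Lambda>) \<le> 1 / 2" using mult_left_mono[of "exp (- \<Lambda>)" "1 / \<Lambda>" "real L"] L1 by (simp add: \<Lambda>_def)
        moreover have "1 + real L * (- exp (- \<Lambda>)) \<le> (1 + - exp (- \<Lambda>)) ^ L"
          using \<Lambda>1 by (intro Bernoulli_inequality) auto
        ultimately show ?thesis by simp
      qed
      have q1: "1 - real (L + 1) * (1 - (1 - \<delta>)) = 1 / 2" unfolding \<delta>_def by simp
      have pt: "\<theta>\<^sup>2 / (32 * V') * (X r * r powr (- d)) \<le> tau (cut b (B * r)) x" if x: "x \<in> ball_at (z L) (R / 2)" for x
      proof -
        have z0in: "0 \<in> ball_at (z 0) (R / 2)" using R by (simp add: z0)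
        have mpos: "0 < real (m 0)" "0 < real (m L)" using m1[of 0] m1[of L] by auto
        have "\<theta>\<^sup>2 / (32 * V') * (X r * r powr (- d)) = (\<theta> * X r)\<^sup>2 / (16 * (2 * (V' * r powr d * X r)))"
          using Xr r1 V' by (simp add: power2_eq_square powr_minus field_simps)
        also have "\<dots> \<le> (\<theta> * X r)\<^sup>2 / (16 * (real (m 0) * real (m L)))"
          using mm[of 0 L] mpos V' Xr r0 by (intro divide_left_mono mult_pos_pos) auto
        also have "\<dots> = 1 / 2 * (1 / 2) * (\<theta> * X r / (2 * real (m 0)) * (\<theta> * X r / (2 * real (m L))))"
          by (simp add: power2_eq_square)
        also have "\<dots> \<le> (1 - real (L + 1) * (1 - (1 - \<delta>))) * (1 - exp (- \<Lambda>)) ^ L *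
            (?M (\<lambda>S. real (min (hits (\<B> 0) S 0) (m 0))) / (2 * real (m 0)) *
             (?M (\<lambda>S. real (min (hits (\<B> L) S x) (m L))) / (2 * real (m L))))"
          unfolding q1 using half trunc[OF _ z0in] trunc[OF _ x] \<theta>0 Xr mpos M0
          by (intro mult_mono divide_right_mono mult_nonneg_nonneg divide_nonneg_nonneg) auto
        also have "\<dots> \<le> link_prob F (\<lambda>e. radial ?\<phi> e + radial ?\<psi> e) 0 x"
        proof (rule link_prob_glue_chain[where b = \<B> and \<kappa> = \<kappa>])
          show "1 \<le> \<kappa> * (real (m 0))\<^sup>2" "1 \<le> \<kappa> * (real (m L))\<^sup>2" using big[of 0] big[of L] \<Lambda>1 by auto
          show "0 \<le> 1 - real (L + 1) * (1 - (1 - \<delta>))" unfolding q1 by simp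
        qed (use F r\<phi> \<kappa>pos \<Lambda>1 big2 \<psi>\<B> \<psi>\<B>' in auto)
        also have "\<dots> \<le> tau (cut b (B * r)) (x - 0)" by (rule glue_le[OF F(1)])
        finally show ?thesis by simp
      qed
      have "v * \<theta>\<^sup>2 / (32 * V') * X r = (v * r powr d) * (\<theta>\<^sup>2 / (32 * V') * (X r * r powr (- d)))"
        using r1 by (simp add: powr_minus field_simps)
      also have "\<dots> \<le> real (card (ball_at (z L) (R / 2))) * (\<theta>\<^sup>2 / (32 * V') * (X r * r powr (- d)))"
        using vol[of L] V' Xr by (intro mult_right_mono) auto
      also have "\<dots> \<le> (\<Sum>x\<in>ball_at (z L) (R / 2). tau (cut b (B * r)) x)"
        using sum_mono[OF pt, of "ball_at (z L) (R / 2)"] by simp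
      \<comment> \<open>Here (CL) enters: the last half window lies beyond distance
        \<open>L * r\<close>, where the mass at cut-off \<open>B * r\<close> is of order at most
        \<open>X (B * r) / L ^ 5\<close>.\<close>
      also have "\<dots> \<le> C5 * (B * r / (real L * r)) powr 5 * X (B * r)"
      proof (rule C5(2))
        show "1 \<le> B * r" using B1 r1 by (metis less_imp_le mult_mono' mult_1 zero_le_one)
        show "0 < real L * r" using L1 r1 by simp
        show "\<forall>x\<in>ball_at (z L) (R / 2). real L * r \<le> len x"
        proof
          fix x assume x: "x \<in> ball_at (z L) (R / 2)"
          have "real L * R \<le> len (z L)" unfolding zL using g(1) by (intro mult_left_mono) auto
          moreover have "len (z L) - len x \<le> R / 2"
            using x len_triangle_diff[of "z L" x] by (simp add: len_minus_commute)
          moreover have "real L * r + R / 2 \<le> real L * R"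
          proof -
            have "1 * r \<le> \<Gamma> * r" using \<Gamma>(1) r1 by (intro mult_right_mono) auto
            then have "r \<le> R / 2" using R(2) by linarith
            then have "real L * r \<le> real L * (R / 2)" by (intro mult_left_mono) auto
            moreover have "1 * (R / 2) \<le> real L * (R / 2)" using L1 R by (intro mult_right_mono) auto
            ultimately show ?thesis by simp
          qed
          ultimately show "real L * r \<le> len x" by linarith
        qed
      qed (rule finite_ball_at)
      also have "\<dots> \<le> C5 * (B / real L) powr 5 * (K * X r)"
        using dbl C5(1) r1 X_ge_1[of "B * r"] B1 r0 by (intro mult_mono) auto
      finally have "v * \<theta>\<^sup>2 / (32 * V') * X r \<le> C5 * (B / real L) powr 5 * K * X r" by (simp add: mult.assoc)
      then have le: "v * \<theta>\<^sup>2 / (32 * V') \<le> C5 * (B / real L) powr 5 * K"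
        by (rule mult_right_le_imp_le) (use Xr in simp)
      have "v / (32 * V') * (1 / (2 ^ 28 * real L ^ 4)) \<le> v / (32 * V') * \<theta>\<^sup>2"
        using \<theta>L V V' by (intro mult_left_mono) auto
      also have "\<dots> \<le> C5 * (B / real L) powr 5 * K" using le by simp
      also have "(B / real L) powr 5 = B powr 5 / real L ^ 5"
        using B1 L1 powr_realpow[of "real L" 5] by (simp add: powr_divide)
      finally have "v / (32 * V' * 2 ^ 28) * real L \<le> C5 * B powr 5 * K"
        using L1 by (simp add: field_simps power_Suc[symmetric] eval_nat_numeral)
      then have "real L \<le> C5 * B powr 5 * K * 32 * V' * 2 ^ 28 / v" using V V' by (simp add: field_simps)
      also have "\<dots> \<le> Q" unfolding Q_def using C5 K_def V V' by (intro divide_right_mono mult_left_mono) auto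
      finally show ?thesis using L1(2) by simp
    qed
  qed
  have "0 < K / c" using c B1 by (simp add: K_def)
  then show ?thesis using that[OF B1 _ a(2), of "K / c"] main unfolding K_def by blast
qed

text \<open>Go up from \<open>r\<close> by factors \<open>B\<close> to the first scale of moderate
  growth, where \<open>X_doubling_bound\<close> applies. On the way \<open>X\<close> has grown by at
  least \<open>B powr (d + \<alpha>)\<close>, hence by at least \<open>B powr \<alpha>\<close>, per
  step, so the bound at that scale descends to \<open>r\<close>.\<close>

lemma X_le_powr: obtains M where "0 < M" "\<And>r. 1 \<le> r \<Longrightarrow> X r \<le> M * r powr \<alpha>"
proof -
  obtain B M r0 where BM: "1 < B" "0 < M" "1 \<le> r0"
    "\<And>r. r0 \<le> r \<Longrightarrow> X (B * r) \<le> B powr (d + \<alpha>) * X r \<Longrightarrow> X r \<le> M * r powr \<alpha>" by (rule X_doubling_bound) blast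
  obtain C where C: "0 < C" "\<And>r. 1 \<le> r \<Longrightarrow> X r \<le> C * r powr d" by (rule X_le_volume) blast
  let ?K = "B powr (d + \<alpha>)"
  have large: "X r \<le> M * r powr \<alpha>" if r: "r0 \<le> r" for r
  proof -
    have r1: "1 \<le> r" using r BM(3) by simp
    have Xr: "1 \<le> X r" using X_ge_1[of r] r1 by simp
    have Bn: "1 \<le> B ^ n" for n using BM(1) by (simp add: one_le_power less_imp_le)
    have Bnr: "r0 \<le> B ^ n * r" "1 \<le> B ^ n * r" for n
    proof -
      have "1 * r \<le> B ^ n * r" using Bn r1 by (intro mult_right_mono) auto
      then show "r0 \<le> B ^ n * r" "1 \<le> B ^ n * r" using r r1 by linarith+
    qed
    have Bpow: "(B ^ n) powr t = (B powr t) ^ n" for n t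
      using BM(1) by (simp add: powr_realpow[symmetric] powr_powr powr_power mult.commute)
    \<comment> \<open>Rapid growth at every scale would exceed the volume bound, since
      \<open>?K\<close> is \<open>B powr d * B powr \<alpha>\<close> and the second factor is above
      1.\<close>
    have ex: "\<exists>n. X (B * (B ^ n * r)) \<le> ?K * X (B ^ n * r)"
    proof (rule ccontr)
      assume "\<not> ?thesis"
      then have step: "?K * X (B ^ n * r) \<le> X (B ^ Suc n * r)" for n by (simp add: not_le mult.assoc less_imp_le)
      have pow: "?K ^ n * X r \<le> X (B ^ n * r)" for n
      proof (induction n)
        case (Suc n)
        have "?K ^ Suc n * X r \<le> ?K * X (B ^ n * r)"
          using mult_left_mono[OF Suc, of ?K] by (simp add: mult.assoc)
        then show ?case using step[of n] by linarith
      qed simp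
      have "(B powr \<alpha>) ^ n \<le> C * r powr d" for n
      proof -
        have "?K ^ n * 1 \<le> ?K ^ n * X r" using Xr by (intro mult_left_mono) auto
        also have "\<dots> \<le> C * (B ^ n * r) powr d" using pow[of n] C(2)[OF Bnr(2)] by (rule order_trans)
        finally have "(B powr d) ^ n * (B powr \<alpha>) ^ n \<le> (B powr d) ^ n * (C * r powr d)"
          using BM(1) r1 by (simp add: powr_add power_mult_distrib powr_mult Bpow mult_ac)
        then show ?thesis using BM(1) by (simp add: mult_le_cancel_left_pos)
      qed
      moreover have "1 < B powr \<alpha>" using BM(1) \<alpha> by simp
      then obtain n where "C * r powr d < (B powr \<alpha>) ^ n" using real_arch_pow by blast
      ultimately show False by (meson not_less)
    qed
    define n where "n = (LEAST n. X (B * (B ^ n * r)) \<le> ?K * X (B ^ n * r))"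
    have n: "X (B * (B ^ n * r)) \<le> ?K * X (B ^ n * r)" unfolding n_def by (rule LeastI_ex[OF ex])
    have least: "?K * X (B ^ i * r) \<le> X (B ^ Suc i * r)" if "i < n" for i
      using not_less_Least[OF that[unfolded n_def]] by (simp add: not_le mult.assoc less_imp_le)
    have "?K ^ i * X r \<le> X (B ^ i * r)" if "i \<le> n" for i
      using that
    proof (induction i)
      case (Suc i)
      then have "?K ^ Suc i * X r \<le> ?K * X (B ^ i * r)"
        using mult_left_mono[of "?K ^ i * X r" "X (B ^ i * r)" ?K] by (simp add: mult.assoc)
      then show ?case using least[of i] Suc by simp
    qed simp
    then have "?K ^ n * X r \<le> M * (B ^ n * r) powr \<alpha>"
      using BM(4)[OF Bnr(1) n] by (meson order_refl order_trans)
    also have "\<dots> = M * r powr \<alpha> * (B powr \<alpha>) ^ n" using BM(1) r1 by (simp add: powr_mult Bpow)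
    finally have "(B powr \<alpha>) ^ n * X r \<le> ?K ^ n * X r \<Longrightarrow> (B powr \<alpha>) ^ n * X r \<le> (B powr \<alpha>) ^ n * (M * r powr \<alpha>)"
      by (simp add: mult_ac)
    moreover have "(B powr \<alpha>) ^ n * X r \<le> ?K ^ n * X r"
      using BM(1) d_ge_1 Xr by (intro mult_right_mono power_mono powr_mono) auto
    ultimately show ?thesis using BM(1) by (simp add: mult_le_cancel_left_pos)
  qed
  have "X r \<le> max M (X r0) * r powr \<alpha>" if r: "1 \<le> r" for r
  proof (cases "r0 \<le> r")
    case True
    have "M * r powr \<alpha> \<le> max M (X r0) * r powr \<alpha>" by (intro mult_right_mono) auto
    then show ?thesis using large[OF True] by linarith
  next
    case False
    have "X r * 1 \<le> X r0 * r powr \<alpha>"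
      using False r X_mono[of r r0] X_ge_1[of r0] \<alpha> by (intro mult_mono) (auto intro: ge_one_powr_ge_zero)
    also have "\<dots> \<le> max M (X r0) * r powr \<alpha>" by (intro mult_right_mono) auto
    finally show ?thesis by simp
  qed
  moreover have "0 < max M (X r0)" using BM(2) by simp
  ultimately show ?thesis using that by blast
qed

end

section \<open>Upper bounds on the two-point function\<close>

text \<open>Generic estimate for the double sum in the Simon-Lieb inequality: the long edge starts
  far away (\<open>P u\<close>), or ends near the origin's counterpart only in the sense that
  \<open>Q v\<close> fails as well and the edge itself is long, or \<open>Q v\<close> holds and the
  sum is kept for separate treatment. Empty \<open>P\<close> and \<open>Q\<close> give the crude
  bound \<open>c2\<close> times both sums.\<close>

lemma sum_split_bound:
  fixes f g :: "'a \<Rightarrow> real"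
  assumes F: "finite F" and f: "\<And>u. u \<in> F \<Longrightarrow> 0 \<le> f u" and g: "\<And>v. v \<in> F \<Longrightarrow> 0 \<le> g v"
    and k: "\<And>u v. u \<in> F \<Longrightarrow> v \<in> F \<Longrightarrow> u \<noteq> v \<Longrightarrow> 0 \<le> k u v"
      "\<And>u v. u \<in> F \<Longrightarrow> v \<in> F \<Longrightarrow> u \<noteq> v \<Longrightarrow> k u v \<le> c1"
      "\<And>u v. u \<in> F \<Longrightarrow> v \<in> F \<Longrightarrow> u \<noteq> v \<Longrightarrow> \<not> P u \<Longrightarrow> \<not> Q v \<Longrightarrow> k u v \<le> c2"
    and c: "0 \<le> c1" "0 \<le> c2"
  shows "(\<Sum>u\<in>F. \<Sum>v\<in>F - {u}. f u * k u v * g v)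
    \<le> c1 * (sum f {u \<in> F. P u} * sum g F) + c2 * (sum f F * sum g F)
      + (\<Sum>u\<in>F. f u * (\<Sum>v\<in>{v \<in> F - {u}. Q v}. k u v * g v))"
proof -
  have "(\<Sum>u\<in>F. \<Sum>v\<in>F - {u}. f u * k u v * g v)
    \<le> (\<Sum>u\<in>F. \<Sum>v\<in>F - {u}. c1 * ((if P u then f u else 0) * g v) + c2 * (f u * g v)
        + f u * (if Q v then k u v * g v else 0))"
  proof (intro sum_mono)
    fix u v assume uv: "u \<in> F" "v \<in> F - {u}"
    then have v: "v \<in> F" "u \<noteq> v" by auto
    note nn = f[OF uv(1)] g[OF v(1)] k(1)[OF uv(1) v]
    have fg: "0 \<le> f u * g v" using nn by simp
    show "f u * k u v * g v \<le> c1 * ((if P u then f u else 0) * g v) + c2 * (f u * g v)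
        + f u * (if Q v then k u v * g v else 0)"
    proof (cases "P u")
      case True
      have "k u v * (f u * g v) \<le> c1 * (f u * g v)" using k(2)[OF uv(1) v] fg by (rule mult_right_mono)
      then show ?thesis using True nn fg c by (simp add: mult_ac add_nonneg_nonneg add_increasing2)
    next
      case nP: False
      show ?thesis
      proof (cases "Q v")
        case True
        then show ?thesis using nP nn fg c by (simp add: mult_ac)
      next
        case False
        have "k u v * (f u * g v) \<le> c2 * (f u * g v)" using k(3)[OF uv(1) v nP False] fg by (rule mult_right_mono)
        then show ?thesis using nP False by (simp add: mult_ac)
      qed
    qed
  qed
  also have "\<dots> = (\<Sum>u\<in>F. \<Sum>v\<in>F - {u}. c1 * ((if P u then f u else 0) * g v)) + (\<Sum>u\<in>F. \<Sum>v\<in>F - {u}. c2 * (f u * g v))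
      + (\<Sum>u\<in>F. \<Sum>v\<in>F - {u}. f u * (if Q v then k u v * g v else 0))"
    by (simp only: sum.distrib)
  also have "(\<Sum>u\<in>F. \<Sum>v\<in>F - {u}. c1 * ((if P u then f u else 0) * g v)) \<le> c1 * (sum f {u \<in> F. P u} * sum g F)"
  proof -
    have "(\<Sum>u\<in>F. \<Sum>v\<in>F - {u}. c1 * ((if P u then f u else 0) * g v)) \<le> (\<Sum>u\<in>F. \<Sum>v\<in>F. c1 * ((if P u then f u else 0) * g v))"
      using F f g c by (intro sum_mono sum_mono2) auto
    also have "\<dots> = c1 * (\<Sum>u\<in>F. \<Sum>v\<in>F. (if P u then f u else 0) * g v)"
      by (simp only: sum_distrib_left)
    also have "\<dots> = c1 * ((\<Sum>u\<in>F. if P u then f u else 0) * sum g F)" by (simp only: sum_product)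
    finally show ?thesis by (simp only: sum.inter_filter[OF F])
  qed
  also have "(\<Sum>u\<in>F. \<Sum>v\<in>F - {u}. c2 * (f u * g v)) \<le> c2 * (sum f F * sum g F)"
  proof -
    have "(\<Sum>u\<in>F. \<Sum>v\<in>F - {u}. c2 * (f u * g v)) \<le> (\<Sum>u\<in>F. \<Sum>v\<in>F. c2 * (f u * g v))"
      using F f g c by (intro sum_mono sum_mono2) auto
    also have "\<dots> = c2 * (\<Sum>u\<in>F. \<Sum>v\<in>F. f u * g v)" by (simp only: sum_distrib_left)
    also have "\<dots> = c2 * (sum f F * sum g F)" by (simp only: sum_product)
    finally show ?thesis .
  qed
  also have "(\<Sum>u\<in>F. \<Sum>v\<in>F - {u}. f u * (if Q v then k u v * g v else 0))
      = (\<Sum>u\<in>F. f u * (\<Sum>v\<in>{v \<in> F - {u}. Q v}. k u v * g v))"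
    by (simp only: sum_distrib_left[symmetric] sum.inter_filter[OF finite_Diff[OF F]])
  finally show ?thesis by simp
qed

context lattice_norm
begin

lemma sum_tau_reflect_le_chi:
  assumes "nn \<phi>" "fin_chi \<phi>" "finite G"
  shows "(\<Sum>v\<in>G. tau \<phi> (x - v)) \<le> chi \<phi>"
  using sum_tau_shift_le_chi[OF assms(2,3), of x] tau_minus_commute[OF assms(1)] by simp

end

context lrp_critical
begin

section \<open>The two-point function of the critical cut-off measures\<close>

lemma cut_tailE:
  assumes "0 < p"
  obtains T where "0 < T" "\<And>r s G. 1 \<le> r \<Longrightarrow> 0 < s \<Longrightarrow> finite G \<Longrightarrow> (\<And>x. x \<in> G \<Longrightarrow> s \<le> len x) \<Longrightarrow>
      (\<Sum>x\<in>G. tau (cut b r) x) \<le> T * (r / s) powr p * X r"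
proof -
  obtain T where "0 < T" "\<forall>r\<ge>1. \<forall>s>0. \<forall>G. finite G \<longrightarrow> (\<forall>x\<in>G. s \<le> len x) \<longrightarrow>
      (\<Sum>x\<in>G. tau (cut b r) x) \<le> T * (r / s) powr p * X r"
    using cut_tail[OF assms] by (elim exE conjE)
  then show ?thesis by (intro that[of T]) auto
qed

text \<open>The weight gained between cut-offs \<open>s\<close> and \<open>2 * s\<close> is at most
  of order \<open>s powr (- d - \<alpha>)\<close> and vanishes beyond distance \<open>2 * s\<close>.
  The two susceptibilities in the Simon-Lieb inequality contribute
  \<open>s powr (2 * \<alpha>)\<close>. For distant \<open>x\<close> one of the two path pieces must
  cover a third of the way, and its tail gives the extra factor
  \<open>(s / len x) powr p\<close>.\<close>

lemma cut_increment:
  assumes p: "0 < p"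
  obtains C where "0 < C" "\<And>s x. 1 \<le> s \<Longrightarrow> tau (cut b (2 * s)) x \<le> tau (cut b s) x + C * s powr (\<alpha> - d)"
    "\<And>s x. 1 \<le> s \<Longrightarrow> x \<noteq> 0 \<Longrightarrow> tau (cut b (2 * s)) x \<le> tau (cut b s) x + C * s powr (\<alpha> - d) * (s / len x) powr p"
proof -
  obtain A where A: "0 < A" "\<And>r. 1 \<le> r \<Longrightarrow> J r \<le> A * r powr (- d - \<alpha>)" by (rule J_le[of 1]) auto
  obtain M where M: "0 < M" "\<And>r. 1 \<le> r \<Longrightarrow> X r \<le> M * r powr \<alpha>" by (rule X_le_powr) blast
  obtain T where T: "0 < T" "\<And>r s G. 1 \<le> r \<Longrightarrow> 0 < s \<Longrightarrow> finite G \<Longrightarrow> (\<And>x. x \<in> G \<Longrightarrow> s \<le> len x) \<Longrightarrow>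
      (\<Sum>x\<in>G. tau (cut b r) x) \<le> T * (r / s) powr p * X r"
    by (rule cut_tailE[OF p]; rule that; blast)
  define D where "D = b * A * M * M * 2 powr \<alpha>"
  have D: "0 < D" unfolding D_def using b A M by simp
  define C where "C = D * (6 powr p * (1 + 2 * T))"
  have C: "0 < C" "D \<le> C" "D * (6 powr p) \<le> C" "D * 6 powr p * (2 * T) \<le> C"
  proof -
    have 6: "(1 :: real) \<le> 6 powr p" using p by (simp add: ge_one_powr_ge_zero)
    have "1 * 1 \<le> 6 powr p * (1 + 2 * T)" using 6 T(1) by (intro mult_mono) auto
    then have "D * 1 \<le> D * (6 powr p * (1 + 2 * T))" using D by (intro mult_left_mono) auto
    then show "D \<le> C" unfolding C_def by simp
    then show "0 < C" using D by simp
    show "D * 6 powr p \<le> C" "D * 6 powr p * (2 * T) \<le> C" unfolding C_def using D T(1) by (auto simp: algebra_simps)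
  qed
  have core: "tau (cut b (2 * s)) x \<le> tau (cut b s) x + D * s powr (\<alpha> - d) \<and>
      (6 * s < len x \<longrightarrow> tau (cut b (2 * s)) x \<le> tau (cut b s) x + D * 6 powr p * (2 * T) * s powr (\<alpha> - d) * (s / len x) powr p)"
    if s: "1 \<le> s" for s x
  proof -
    let ?\<phi> = "cut b s" and ?\<psi> = "\<lambda>t. cut b (2 * s) t - cut b s t"
    have nn\<psi>: "nn ?\<psi>" using cut_mono[of s "2 * s" b b] s b by (auto simp: nn_def)
    have eq: "(\<lambda>t. ?\<phi> t + ?\<psi> t) = cut b (2 * s)" by auto
    have \<psi>le: "?\<psi> t \<le> b * (A * s powr (- d - \<alpha>))" if "0 < t" for t
    proof -
      have "max 0 (J t - J (2 * s)) - max 0 (J t - J s) \<le> J s"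
        using J_anti[of s t] J_pos[of "2 * s"] J_pos[of s] J_anti[of t s] that s by (auto simp: max_def)
      also have "\<dots> \<le> A * s powr (- d - \<alpha>)" using A(2)[OF s] .
      finally have "b * (max 0 (J t - J (2 * s)) - max 0 (J t - J s)) \<le> b * (A * s powr (- d - \<alpha>))"
        using b by (intro mult_left_mono) auto
      then show ?thesis by (simp add: cut_def algebra_simps)
    qed
    have \<psi>far: "?\<psi> t = 0" if "2 * s < t" for t
      using J_anti[of "2 * s" t] J_anti[of s t] that s by (simp add: cut_def)
    define c1 where "c1 = b * (A * s powr (- d - \<alpha>))"
    have c1: "0 \<le> c1" unfolding c1_def using b A by simp
    have X0: "0 \<le> X s" "0 \<le> X (2 * s)" using X_ge_1[of s] X_ge_1[of "2 * s"] s by auto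
    have XX: "c1 * (X s * X (2 * s)) \<le> D * s powr (\<alpha> - d)"
    proof -
      have "c1 * (X s * X (2 * s)) \<le> c1 * ((M * s powr \<alpha>) * (M * (2 * s) powr \<alpha>))"
        using M s X0 c1 by (intro mult_left_mono mult_mono) auto
      also have "\<dots> = D * (s powr (- d - \<alpha>) * s powr \<alpha> * s powr \<alpha>)"
        unfolding c1_def D_def using s by (simp add: powr_mult)
      also have "s powr (- d - \<alpha>) * s powr \<alpha> * s powr \<alpha> = s powr (\<alpha> - d)" by (simp add: powr_add[symmetric])
      finally show ?thesis .
    qed
    have lp: "link_prob F (radial (cut b (2 * s))) 0 x \<le> tau ?\<phi> x +
      (\<Sum>u\<in>F. \<Sum>v\<in>F - {u}. tau ?\<phi> u * ?\<psi> (len (v - u)) * tau (cut b (2 * s)) (x - v))" if "finite F" for F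
      using link_prob_superpose[OF nn_cut_b[of s] nn\<psi> that, of x] unfolding eq .
    have k0: "0 \<le> ?\<psi> (len (v - u))" "?\<psi> (len (v - u)) \<le> c1" if "u \<noteq> v" for u v :: "int ^ 'n"
    proof -
      have "0 < len (v - u)" using that by (intro len_pos) auto
      then show "0 \<le> ?\<psi> (len (v - u))" "?\<psi> (len (v - u)) \<le> c1" using nn\<psi> \<psi>le unfolding nn_def c1_def by auto
    qed
    have sums: "(\<Sum>u\<in>F. tau ?\<phi> u) \<le> X s" "(\<Sum>v\<in>F. tau (cut b (2 * s)) (x - v)) \<le> X (2 * s)"
      "0 \<le> (\<Sum>u\<in>F. tau ?\<phi> u)" "0 \<le> (\<Sum>v\<in>F. tau (cut b (2 * s)) (x - v))" if "finite F" for F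
      using sum_tau_le_chi[OF fin_cut that] sum_tau_reflect_le_chi[OF nn_cut_b fin_cut that] s
        sum_nonneg[of F "tau ?\<phi>"] sum_nonneg[of F "\<lambda>v. tau (cut b (2 * s)) (x - v)"] tau_nonneg[OF nn_cut_b] by auto
    let ?g = "\<lambda>v. tau (cut b (2 * s)) (x - v)"
    have g0: "0 \<le> ?g v" and f0: "0 \<le> tau ?\<phi> v" for v by (auto intro: tau_nonneg nn_cut_b)
    show ?thesis
    proof (intro conjI impI)
      show "tau (cut b (2 * s)) x \<le> tau ?\<phi> x + D * s powr (\<alpha> - d)"
      proof (rule tau_le_of_link_prob[OF _ nn_cut_b])
        fix F :: "(int ^ 'n) set" assume F: "finite F"
        have "(\<Sum>u\<in>F. \<Sum>v\<in>F - {u}. tau ?\<phi> u * ?\<psi> (len (v - u)) * ?g v)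
          \<le> c1 * (sum (tau ?\<phi>) {u \<in> F. False} * sum ?g F) + c1 * (sum (tau ?\<phi>) F * sum ?g F)
            + (\<Sum>u\<in>F. tau ?\<phi> u * (\<Sum>v\<in>{v \<in> F - {u}. False}. ?\<psi> (len (v - u)) * ?g v))"
          \<comment> \<open>No pair is distinguished here, so the uniform bound \<open>c1\<close>
            serves as both constants.\<close>
          by (rule sum_split_bound[OF F f0 g0 k0 k0(2) c1 c1])
        also have "\<dots> = c1 * (sum (tau ?\<phi>) F * sum ?g F)" by simp
        also have "\<dots> \<le> c1 * (X s * X (2 * s))" using sums[OF F] c1 X0 by (intro mult_left_mono mult_mono) auto
        also note XX
        finally show "link_prob F (radial (cut b (2 * s))) 0 x \<le> tau ?\<phi> x + D * s powr (\<alpha> - d)"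
          using lp[OF F] by linarith
      qed
      assume far: "6 * s < len x"
      show "tau (cut b (2 * s)) x \<le> tau ?\<phi> x + D * 6 powr p * (2 * T) * s powr (\<alpha> - d) * (s / len x) powr p"
      proof (rule tau_le_of_link_prob[OF _ nn_cut_b])
        fix F :: "(int ^ 'n) set" assume F: "finite F"
        let ?P = "\<lambda>u. len x / 3 \<le> len u" and ?Q = "\<lambda>v. len x / 3 \<le> len (x - v)"
        have R: "0 < len x / 3" using far s by simp
        define Y where "Y = T * (6 * (s / len x)) powr p"
        have Y0: "0 \<le> Y" unfolding Y_def using T(1) by simp
        have fP: "sum (tau ?\<phi>) {u \<in> F. ?P u} \<le> Y * X s"
        proof -
          have "sum (tau ?\<phi>) {u \<in> F. ?P u} \<le> T * (s / (len x / 3)) powr p * X s"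
            using F R s by (intro T(2)) auto
          also have "\<dots> \<le> Y * X s"
          proof -
            have "s / (len x / 3) \<le> 6 * (s / len x)" using R s by (simp add: field_simps)
            then show ?thesis
              unfolding Y_def using R s T(1) X0 p by (intro mult_right_mono mult_left_mono powr_mono2) auto
          qed
          finally show ?thesis .
        qed
        have gQ: "sum ?g {v \<in> F. ?Q v} \<le> Y * X (2 * s)"
        proof -
          have "sum ?g {v \<in> F. ?Q v} = (\<Sum>y\<in>(\<lambda>v. x - v) ` {v \<in> F. ?Q v}. tau (cut b (2 * s)) y)"
            by (subst sum.reindex) (auto simp: inj_on_def)
          also have "\<dots> \<le> T * (2 * s / (len x / 3)) powr p * X (2 * s)"
            using F R s by (intro T(2)) auto
          also have "2 * s / (len x / 3) = 6 * (s / len x)" by simp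
          finally show ?thesis unfolding Y_def .
        qed
        \<comment> \<open>If both path pieces are shorter than a third of \<open>len x\<close>, the
          new edge is longer than \<open>2 * s\<close>, where the increment vanishes; this is the
          reason for the threshold \<open>6 * s\<close>.\<close>
        have zero: "?\<psi> (len (v - u)) \<le> 0" if "\<not> ?P u" "\<not> ?Q v" for u v
        proof -
          have "len x \<le> len (x - v) + len (v - u) + len u"
            using len_triangle3[of x 0 v] len_triangle3[of v 0 u] by simp
          then have "2 * s < len (v - u)" using that far by simp
          then show ?thesis using \<psi>far by simp
        qed
        have "(\<Sum>u\<in>F. \<Sum>v\<in>F - {u}. tau ?\<phi> u * ?\<psi> (len (v - u)) * ?g v)
          \<le> c1 * (sum (tau ?\<phi>) {u \<in> F. ?P u} * sum ?g F) + 0 * (sum (tau ?\<phi>) F * sum ?g F)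
            + (\<Sum>u\<in>F. tau ?\<phi> u * (\<Sum>v\<in>{v \<in> F - {u}. ?Q v}. ?\<psi> (len (v - u)) * ?g v))"
          by (rule sum_split_bound[OF F f0 g0 k0 zero c1 order_refl])
        also have "(\<Sum>u\<in>F. tau ?\<phi> u * (\<Sum>v\<in>{v \<in> F - {u}. ?Q v}. ?\<psi> (len (v - u)) * ?g v))
            \<le> (\<Sum>u\<in>F. tau ?\<phi> u * (c1 * (Y * X (2 * s))))"
        proof (intro sum_mono mult_left_mono f0)
          fix u
          have "(\<Sum>v\<in>{v \<in> F - {u}. ?Q v}. ?\<psi> (len (v - u)) * ?g v) \<le> (\<Sum>v\<in>{v \<in> F - {u}. ?Q v}. c1 * ?g v)"
            using k0(2) g0 by (intro sum_mono mult_right_mono) auto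
          also have "\<dots> \<le> (\<Sum>v\<in>{v \<in> F. ?Q v}. c1 * ?g v)"
            using F g0 c1 by (intro sum_mono2) auto
          also have "\<dots> \<le> c1 * (Y * X (2 * s))"
            unfolding sum_distrib_left[symmetric] using gQ c1 by (intro mult_left_mono)
          finally show "(\<Sum>v\<in>{v \<in> F - {u}. ?Q v}. ?\<psi> (len (v - u)) * ?g v) \<le> c1 * (Y * X (2 * s))" .
        qed
        also have "\<dots> = sum (tau ?\<phi>) F * (c1 * (Y * X (2 * s)))" by (rule sum_distrib_right[symmetric])
        also have "\<dots> \<le> X s * (c1 * (Y * X (2 * s)))" using sums[OF F] c1 Y0 X0 by (intro mult_right_mono) auto
        also have "c1 * (sum (tau ?\<phi>) {u \<in> F. ?P u} * sum ?g F) \<le> c1 * ((Y * X s) * X (2 * s))"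
          using fP sums[OF F] c1 Y0 X0 by (intro mult_left_mono mult_mono) auto
        finally have "(\<Sum>u\<in>F. \<Sum>v\<in>F - {u}. tau ?\<phi> u * ?\<psi> (len (v - u)) * ?g v) \<le> 2 * Y * (c1 * (X s * X (2 * s)))"
          by (simp add: mult_ac)
        also have "\<dots> \<le> 2 * Y * (D * s powr (\<alpha> - d))" using XX Y0 by (intro mult_left_mono) auto
        also have "\<dots> = D * 6 powr p * (2 * T) * s powr (\<alpha> - d) * (s / len x) powr p"
          unfolding Y_def using s far by (simp add: powr_mult powr_divide)
        finally show "link_prob F (radial (cut b (2 * s))) 0 x
            \<le> tau ?\<phi> x + D * 6 powr p * (2 * T) * s powr (\<alpha> - d) * (s / len x) powr p"
          using lp[OF F] by linarith
      qed
    qed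
  qed
  show ?thesis
  proof (rule that[OF C(1)])
    fix s x assume s: "(1 :: real) \<le> s"
    have mono: "D' * s powr (\<alpha> - d) \<le> C * s powr (\<alpha> - d)" if "D' \<le> C" for D' using that by (intro mult_right_mono) auto
    show "tau (cut b (2 * s)) x \<le> tau (cut b s) x + C * s powr (\<alpha> - d)"
      using core[OF s, of x] mono[OF C(2)] by linarith
    assume x: "x \<noteq> 0"
    have lx: "0 < len x" by (rule len_pos[OF x])
    show "tau (cut b (2 * s)) x \<le> tau (cut b s) x + C * s powr (\<alpha> - d) * (s / len x) powr p"
    proof (cases "6 * s < len x")
      case True
      have "D * 6 powr p * (2 * T) * s powr (\<alpha> - d) * (s / len x) powr p \<le> C * s powr (\<alpha> - d) * (s / len x) powr p"
        using mono[OF C(4)] by (rule mult_right_mono) auto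
      then show ?thesis using core[OF s, of x] True by linarith
    next
      case False
      \<comment> \<open>For \<open>x\<close> within \<open>6 * s\<close> the additional factor is
        bounded below, and the uniform estimate suffices.\<close>
      have "1 \<le> 6 * (s / len x)" using False lx by (simp add: field_simps)
      then have "1 \<le> (6 * (s / len x)) powr p" using p by (simp add: ge_one_powr_ge_zero)
      then have 1: "1 \<le> 6 powr p * (s / len x) powr p" using s lx by (simp add: powr_mult powr_divide)
      have "D * s powr (\<alpha> - d) * 1 \<le> D * s powr (\<alpha> - d) * (6 powr p * (s / len x) powr p)"
        using 1 D by (intro mult_left_mono) auto
      also have "\<dots> = (D * 6 powr p) * s powr (\<alpha> - d) * (s / len x) powr p" by (simp add: mult_ac)
      also have "\<dots> \<le> C * s powr (\<alpha> - d) * (s / len x) powr p"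
        using mono[OF C(3)] by (rule mult_right_mono) auto
      finally show ?thesis using core[OF s, of x] by linarith
    qed
  qed
qed

text \<open>Dyadic summation of the increments with \<open>p = d + \<alpha> + 1\<close>. They grow
  like \<open>s powr \<gamma>\<close> with \<open>\<gamma> = 2 * \<alpha> + 1 > 1\<close>, so two
  copies of the bound at scale \<open>s\<close> fit into the bound at \<open>2 * s\<close>.\<close>

lemma tau_cut_le:
  obtains C where "0 < C" "\<And>r x. 1 \<le> r \<Longrightarrow> x \<noteq> 0 \<Longrightarrow>
    tau (cut b r) x \<le> C * r powr (2 * \<alpha> + 1) * len x powr (- d - \<alpha> - 1)"
proof -
  define p where "p = d + \<alpha> + 1"
  define \<gamma> where "\<gamma> = 2 * \<alpha> + 1"
  have p0: "0 < p" "\<alpha> - d + p = \<gamma>" "- d - \<alpha> - 1 = - p" using d_ge_1 \<alpha> by (auto simp: p_def \<gamma>_def)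
  obtain C where C: "0 < C"
    "\<And>s x. 1 \<le> s \<Longrightarrow> x \<noteq> 0 \<Longrightarrow> tau (cut b (2 * s)) x \<le> tau (cut b s) x + C * s powr (\<alpha> - d) * (s / len x) powr p"
    by (rule cut_increment[OF p0(1)]) blast
  obtain T where T: "0 < T" "\<And>r s G. 1 \<le> r \<Longrightarrow> 0 < s \<Longrightarrow> finite G \<Longrightarrow> (\<And>x. x \<in> G \<Longrightarrow> s \<le> len x) \<Longrightarrow>
      (\<Sum>x\<in>G. tau (cut b r) x) \<le> T * (r / s) powr p * X r"
    by (rule cut_tailE[OF p0(1)]; rule that; blast)
  \<comment> \<open>The second entry handles cut-offs up to 2, where the tail bound is applied to a
    single point.\<close>
  define C1 where "C1 = max C (T * 2 powr p * X 2)"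
  have all: "\<forall>r x. (1 :: real) \<le> r \<longrightarrow> r \<le> 2 ^ Suc n \<longrightarrow> x \<noteq> 0 \<longrightarrow> tau (cut b r) x \<le> C1 * r powr \<gamma> * len x powr (- p)" for n
  proof (induction n)
    case 0
    show ?case
    proof (intro allI impI)
      fix r :: real and x :: "int ^ 'n" assume r: "1 \<le> r" "r \<le> 2 ^ Suc 0" and x: "x \<noteq> 0"
      have lx: "0 < len x" by (rule len_pos[OF x])
      have "tau (cut b r) x \<le> tau (cut b 2) x" using r b by (intro tau_mono nn_cut_b cut_mono) auto
      also have "\<dots> = (\<Sum>y\<in>{x}. tau (cut b 2) y)" by simp
      also have "\<dots> \<le> T * (2 / len x) powr p * X 2" using lx by (intro T(2)) auto
      also have "\<dots> = T * 2 powr p * X 2 * len x powr (- p)" using lx by (simp add: powr_divide powr_minus field_simps)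
      also have "\<dots> \<le> C1 * len x powr (- p)" unfolding C1_def by (intro mult_right_mono) auto
      also have "\<dots> \<le> C1 * r powr \<gamma> * len x powr (- p)"
      proof -
        have "1 \<le> r powr \<gamma>" using r \<alpha> by (simp add: \<gamma>_def ge_one_powr_ge_zero)
        then have "C1 * 1 \<le> C1 * r powr \<gamma>" using C(1) by (intro mult_left_mono) (auto simp: C1_def)
        then show ?thesis by (intro mult_right_mono) auto
      qed
      finally show "tau (cut b r) x \<le> C1 * r powr \<gamma> * len x powr (- p)" .
    qed
  next
    case (Suc n)
    show ?case
    proof (intro allI impI)
      fix r :: real and x :: "int ^ 'n" assume r: "1 \<le> r" "r \<le> 2 ^ Suc (Suc n)" and x: "x \<noteq> 0"
      have lx: "0 < len x" by (rule len_pos[OF x])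
      show "tau (cut b r) x \<le> C1 * r powr \<gamma> * len x powr (- p)"
      proof (cases "r \<le> 2 ^ Suc n")
        case True
        then show ?thesis using Suc r x by blast
      next
        case False
        define s where "s = r / 2"
        have "(2 :: real) \<le> 2 ^ Suc n" by simp
        then have "2 < r" using False by linarith
        then have s: "1 \<le> s" "s \<le> 2 ^ Suc n" "r = 2 * s" using r by (auto simp: s_def)
        have "tau (cut b r) x \<le> tau (cut b s) x + C * s powr (\<alpha> - d) * (s / len x) powr p"
          unfolding s(3) by (rule C(2)[OF s(1) x])
        also have "tau (cut b s) x \<le> C1 * s powr \<gamma> * len x powr (- p)" using Suc s x by blast
        also have "C * s powr (\<alpha> - d) * (s / len x) powr p = C * (s powr (\<alpha> - d) * s powr p) * len x powr (- p)"
          using s lx by (simp add: powr_divide powr_minus field_simps)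
        also have "s powr (\<alpha> - d) * s powr p = s powr \<gamma>" by (simp only: powr_add[symmetric] p0(2))
        also have "C1 * s powr \<gamma> * len x powr (- p) + C * s powr \<gamma> * len x powr (- p)
            \<le> C1 * s powr \<gamma> * len x powr (- p) + C1 * s powr \<gamma> * len x powr (- p)"
          unfolding C1_def by (intro add_left_mono mult_right_mono) auto
        also have "\<dots> = C1 * (2 powr 1 * s powr \<gamma>) * len x powr (- p)" by simp
        also have "\<dots> \<le> C1 * (2 powr \<gamma> * s powr \<gamma>) * len x powr (- p)"
          using C(1) \<alpha> by (intro mult_right_mono mult_left_mono powr_mono) (auto simp: C1_def \<gamma>_def)
        also have "2 powr \<gamma> * s powr \<gamma> = r powr \<gamma>" using s by (simp add: powr_mult)
        finally show ?thesis by simp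
      qed
    qed
  qed
  have "tau (cut b r) x \<le> C1 * r powr \<gamma> * len x powr (- p)" if "1 \<le> r" "x \<noteq> 0" for r x
  proof -
    obtain n where "r < 2 ^ n" using real_arch_pow[of 2 r] by auto
    moreover have "(2 :: real) ^ n \<le> 2 ^ Suc n" by simp
    ultimately have "r \<le> 2 ^ Suc n" by linarith
    then show ?thesis using all[of n] that by blast
  qed
  moreover have "0 < C1" using C(1) by (simp add: C1_def)
  ultimately show ?thesis using that unfolding \<gamma>_def p0(3) by blast
qed

text \<open>Up to cut-off \<open>len x\<close> the polynomial bound is used; beyond it the
  increments \<open>s powr (\<alpha> - d)\<close> form a geometric series, which converges because
  \<alpha> is less than \<open>d\<close>. Distances below 1 are covered by the trivial
  bound.\<close>

lemma tau_cut_le_near: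
  assumes "\<alpha> < d"
  obtains C where "0 < C" "\<And>r x. 1 \<le> r \<Longrightarrow> x \<noteq> 0 \<Longrightarrow> tau (cut b r) x \<le> C * len x powr (\<alpha> - d)"
proof -
  obtain C1 where C1: "0 < C1" "\<And>r x. 1 \<le> r \<Longrightarrow> x \<noteq> 0 \<Longrightarrow>
    tau (cut b r) x \<le> C1 * r powr (2 * \<alpha> + 1) * len x powr (- d - \<alpha> - 1)" by (rule tau_cut_le) blast
  obtain C where C: "0 < C" "\<And>s x. 1 \<le> s \<Longrightarrow> tau (cut b (2 * s)) x \<le> tau (cut b s) x + C * s powr (\<alpha> - d)"
    by (rule cut_increment[of 1]) auto
  let ?\<rho> = "2 powr (\<alpha> - d) :: real"
  have \<rho>: "0 < ?\<rho>" "?\<rho> < 1" using assms powr_less_mono[of "\<alpha> - d" 0 "2 :: real"] by auto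
  define C2 where "C2 = max 1 (C1 + C / (1 - ?\<rho>))"
  have "tau (cut b r) x \<le> C2 * len x powr (\<alpha> - d)" if r: "1 \<le> r" and x: "x \<noteq> 0" for r x
  proof -
    have lx: "0 < len x" by (rule len_pos[OF x])
    define R where "R = len x"
    show ?thesis
    proof (cases "R < 1")
      case True
      have "1 \<le> R powr (\<alpha> - d)" using powr_mono'[of "\<alpha> - d" 0 R] True lx assms by (simp add: R_def)
      then have "1 * 1 \<le> C2 * R powr (\<alpha> - d)" by (intro mult_mono) (auto simp: C2_def)
      then show ?thesis using tau_le_1[OF nn_cut_b, of r x] unfolding R_def by linarith
    next
      case False
      then have R: "1 \<le> R" by simp
      have dyad: "tau (cut b (2 ^ n * R)) x \<le> C1 * R powr (\<alpha> - d) + C * R powr (\<alpha> - d) * (\<Sum>k<n. ?\<rho> ^ k)" for n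
      proof (induction n)
        case 0
        have "tau (cut b R) x \<le> C1 * R powr (2 * \<alpha> + 1) * len x powr (- d - \<alpha> - 1)" by (rule C1(2)[OF R x])
        also have "\<dots> = C1 * (R powr (2 * \<alpha> + 1) * R powr (- d - \<alpha> - 1))" by (simp add: R_def)
        also have "R powr (2 * \<alpha> + 1) * R powr (- d - \<alpha> - 1) = R powr (\<alpha> - d)" by (simp add: powr_add[symmetric])
        finally show ?case by simp
      next
        case (Suc n)
        have "1 * 1 \<le> 2 ^ n * R" using R by (intro mult_mono) auto
        then have "tau (cut b (2 * (2 ^ n * R))) x \<le> tau (cut b (2 ^ n * R)) x + C * (2 ^ n * R) powr (\<alpha> - d)"
          by (intro C(2)) simp
        also have "(2 ^ n * R) powr (\<alpha> - d) = R powr (\<alpha> - d) * ?\<rho> ^ n"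
          using R by (simp add: powr_mult powr_power powr_realpow[symmetric] powr_powr mult.commute)
        finally show ?case using Suc by (simp add: algebra_simps)
      qed
      obtain n where "r < 2 ^ n" using real_arch_pow[of 2 r] by auto
      moreover have "2 ^ n * 1 \<le> 2 ^ n * R" using R by (intro mult_left_mono) auto
      ultimately have "r \<le> 2 ^ n * R" by linarith
      then have "tau (cut b r) x \<le> tau (cut b (2 ^ n * R)) x"
        using r b by (intro tau_mono nn_cut_b cut_mono) auto
      also note dyad
      also have "C1 * R powr (\<alpha> - d) + C * R powr (\<alpha> - d) * (\<Sum>k<n. ?\<rho> ^ k)
          \<le> C1 * R powr (\<alpha> - d) + C * R powr (\<alpha> - d) * (1 / (1 - ?\<rho>))"
      proof (intro add_left_mono mult_left_mono)
        have "?\<rho> \<noteq> 1" using \<rho> by linarith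
        then have "(\<Sum>k<n. ?\<rho> ^ k) = (1 - ?\<rho> ^ n) / (1 - ?\<rho>)" by (simp add: sum_gp_strict del: powr_eq_one_iff)
        also have "\<dots> \<le> 1 / (1 - ?\<rho>)" using \<rho> by (intro divide_right_mono) auto
        finally show "(\<Sum>k<n. ?\<rho> ^ k) \<le> 1 / (1 - ?\<rho>)" .
      qed (use C(1) in auto)
      also have "\<dots> = (C1 + C / (1 - ?\<rho>)) * R powr (\<alpha> - d)" by (simp add: algebra_simps)
      also have "\<dots> \<le> C2 * R powr (\<alpha> - d)" unfolding C2_def by (intro mult_right_mono) auto
      finally show ?thesis unfolding R_def .
    qed
  qed
  moreover have "0 < C2" by (simp add: C2_def)
  ultimately show ?thesis using that by blast
qed

end

section \<open>Upper bounds for the full subcritical measure\<close>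

context lrp_critical
begin

definition xi :: "real \<Rightarrow> real" where "xi \<beta> = chi (full \<beta>) powr (1 / \<alpha>)"

text \<open>All the weight that the cut-off removes: long edges entirely, and the amount
  \<open>J r\<close> from each short one.\<close>

definition rem :: "real \<Rightarrow> real \<Rightarrow> real \<Rightarrow> real" where "rem \<beta> r t = \<beta> * min (J t) (J r)"

lemma full_eq_cut_plus_rem: "full \<beta> = (\<lambda>t. cut \<beta> r t + rem \<beta> r t)"
  by (auto simp: full_def cut_def rem_def fun_eq_iff max_def min_def algebra_simps)

lemma nn_rem: "0 \<le> \<beta> \<Longrightarrow> 0 < r \<Longrightarrow> nn (rem \<beta> r)"
  unfolding nn_def rem_def using J_pos by (simp add: less_imp_le)

lemma cut_le_full: "0 \<le> \<beta> \<Longrightarrow> 0 < r \<Longrightarrow> 0 < t \<Longrightarrow> cut \<beta> r t \<le> full \<beta> t"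
  using nn_rem[of \<beta> r] full_eq_cut_plus_rem[of \<beta> r] unfolding nn_def by simp

lemma chi_full_ge_1: "0 < \<beta> \<Longrightarrow> \<beta> < b \<Longrightarrow> 1 \<le> chi (full \<beta>)"
  by (intro chi_ge_1 nn_full subcritical) auto

lemma xi_ge_1: "0 < \<beta> \<Longrightarrow> \<beta> < b \<Longrightarrow> 1 \<le> xi \<beta>"
  unfolding xi_def using chi_full_ge_1 \<alpha> by (intro ge_one_powr_ge_zero) auto

lemma xi_powr: "0 < \<beta> \<Longrightarrow> \<beta> < b \<Longrightarrow> xi \<beta> powr \<alpha> = chi (full \<beta>)"
  unfolding xi_def using chi_full_ge_1[of \<beta>] \<alpha> by (simp add: powr_powr)

lemma fin_chi_cut_sub: "0 < \<beta> \<Longrightarrow> \<beta> \<le> b \<Longrightarrow> 0 < r \<Longrightarrow> fin_chi (cut \<beta> r)"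
  using cut_mono[of r r \<beta> b] by (intro fin_chi_mono(1)[OF _ _ _ fin_cut, of _ r] nn_cut) auto

lemma chi_cut_le_full: "0 < \<beta> \<Longrightarrow> \<beta> < b \<Longrightarrow> 0 < r \<Longrightarrow> chi (cut \<beta> r) \<le> chi (full \<beta>)"
  by (intro fin_chi_mono(2) nn_cut nn_full cut_le_full subcritical len_pos) auto

lemma tau_cut_le_b: "0 \<le> \<beta> \<Longrightarrow> \<beta> \<le> b \<Longrightarrow> 0 < r \<Longrightarrow> tau (cut \<beta> r) x \<le> tau (cut b r) x"
  by (intro tau_mono nn_cut cut_mono) auto

text \<open>Superposing the cut-off kernel and the removed weight gives an inequality with the full
  susceptibility on both sides. Either the full susceptibility is at most
  \<open>r powr \<alpha>\<close> and the removed weight changes it by a bounded factor, or it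
  cancels and leaves \<open>r powr \<alpha>\<close> as lower bound.\<close>

lemma chi_cut_ge: obtains c where "0 < c"
  "\<And>\<beta> r. 0 < \<beta> \<Longrightarrow> \<beta> < b \<Longrightarrow> 1 \<le> r \<Longrightarrow> c * min (chi (full \<beta>)) (r powr \<alpha>) \<le> chi (cut \<beta> r)"
proof -
  obtain A where A: "0 < A" "\<And>r G. 1 \<le> r \<Longrightarrow> finite G \<Longrightarrow> 0 \<notin> G \<Longrightarrow>
    (\<Sum>v\<in>G. min (J (len v)) (J r)) \<le> A * r powr (- \<alpha>)" by (rule sum_truncated_kernel) blast
  have "1 / (1 + b * A) * min (chi (full \<beta>)) (r powr \<alpha>) \<le> chi (cut \<beta> r)"
    if \<beta>: "0 < \<beta>" "\<beta> < b" and r: "1 \<le> r" for \<beta> r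
  proof -
    let ?\<chi> = "chi (full \<beta>)" and ?y = "chi (cut \<beta> r)"
    have \<chi>: "1 \<le> ?\<chi>" by (rule chi_full_ge_1[OF \<beta>])
    have y: "1 \<le> ?y" using \<beta> r by (intro chi_ge_1 nn_cut fin_chi_cut_sub) auto
    have "(\<Sum>v\<in>G. rem \<beta> r (len v)) \<le> b * (A * r powr (- \<alpha>))" if "finite G" "0 \<notin> G" for G
    proof -
      have "(\<Sum>v\<in>G. rem \<beta> r (len v)) = \<beta> * (\<Sum>v\<in>G. min (J (len v)) (J r))"
        unfolding rem_def by (rule sum_distrib_left[symmetric])
      also have "\<dots> \<le> b * (A * r powr (- \<alpha>))"
      proof (rule mult_mono[OF _ A(2)[OF r that]])
        have "0 < min (J (len v)) (J r)" if "v \<in> G" for v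
          using that \<open>0 \<notin> G\<close> r by (auto intro!: J_pos len_pos)
        then show "0 \<le> (\<Sum>v\<in>G. min (J (len v)) (J r))" by (intro sum_nonneg less_imp_le)
      qed (use \<beta> b in auto)
      finally show ?thesis .
    qed
    then have "?\<chi> \<le> ?y + ?y * (b * (A * r powr (- \<alpha>))) * ?\<chi>"
      using chi_superpose_le[of "cut \<beta> r" "rem \<beta> r"] \<beta> r subcritical[OF \<beta>]
      by (simp add: full_eq_cut_plus_rem[symmetric] nn_cut nn_rem fin_chi_cut_sub)
    then have le: "?\<chi> \<le> ?y * (1 + b * A * (?\<chi> * r powr (- \<alpha>)))" by (simp add: algebra_simps)
    have bA: "0 < b * A" using b A by simp
    show ?thesis
    proof (cases "?\<chi> \<le> r powr \<alpha>")
      case True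
      then have "?\<chi> * r powr (- \<alpha>) \<le> 1" using r by (simp add: powr_minus field_simps)
      then have "b * A * (?\<chi> * r powr (- \<alpha>)) \<le> b * A * 1" using bA by (intro mult_left_mono) auto
      then have "?y * (1 + b * A * (?\<chi> * r powr (- \<alpha>))) \<le> ?y * (1 + b * A)" using y by (intro mult_left_mono) auto
      then have "?\<chi> \<le> ?y * (1 + b * A)" using le by linarith
      then show ?thesis using True bA by (simp add: field_simps min_def)
    next
      case False
      then have "1 \<le> ?\<chi> * r powr (- \<alpha>)" using r by (simp add: powr_minus field_simps)
      then have "?y * (1 + b * A * (?\<chi> * r powr (- \<alpha>))) \<le> ?y * ((1 + b * A) * (?\<chi> * r powr (- \<alpha>)))"
        using y by (intro mult_left_mono) (auto simp: algebra_simps)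
      then have "?\<chi> * 1 \<le> ?\<chi> * (?y * (1 + b * A) * r powr (- \<alpha>))" using le by (simp add: mult_ac)
      then have "1 \<le> ?y * (1 + b * A) * r powr (- \<alpha>)" using \<chi> by (simp add: mult_le_cancel_left)
      then have "r powr \<alpha> \<le> ?y * (1 + b * A)" using r by (simp add: powr_minus field_simps)
      then show ?thesis using False bA by (simp add: field_simps min_def)
    qed
  qed
  moreover have "0 < 1 / (1 + b * A)" using b A by (simp add: add_pos_pos)
  ultimately show ?thesis using that by blast
qed

text \<open>With the cut-off at the correlation length both susceptibilities in the Simon-Lieb
  inequality are at most \<open>xi \<beta> powr \<alpha>\<close>, and a removed edge has weight of
  order at most \<open>xi \<beta> powr (- d - \<alpha>)\<close>.\<close>

lemma tau_full_le_one_jump: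
  obtains C where "0 < C" "\<And>\<beta> x. 0 < \<beta> \<Longrightarrow> \<beta> < b \<Longrightarrow> tau (full \<beta>) x \<le> tau (cut b (xi \<beta>)) x + C * xi \<beta> powr (\<alpha> - d)"
proof -
  obtain A where A: "0 < A" "\<And>r. 1 \<le> r \<Longrightarrow> J r \<le> A * r powr (- d - \<alpha>)" by (rule J_le[of 1]) auto
  have "tau (full \<beta>) x \<le> tau (cut b (xi \<beta>)) x + b * A * xi \<beta> powr (\<alpha> - d)" if \<beta>: "0 < \<beta>" "\<beta> < b" for \<beta> x
  proof (rule tau_le_of_link_prob[OF _ nn_full])
    fix F :: "(int ^ 'n) set" assume F: "finite F"
    define r where "r = xi \<beta>"
    have r: "1 \<le> r" unfolding r_def by (rule xi_ge_1[OF \<beta>])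
    let ?\<chi> = "chi (full \<beta>)"
    let ?f = "tau (cut \<beta> r)" and ?g = "\<lambda>v. tau (full \<beta>) (x - v)"
    define c where "c = b * (A * r powr (- d - \<alpha>))"
    have c0: "0 \<le> c" unfolding c_def using b A by simp
    have nn: "nn (cut \<beta> r)" "nn (full \<beta>)" "nn (rem \<beta> r)" using \<beta> r by (auto intro: nn_cut nn_full nn_rem)
    have remle: "rem \<beta> r t \<le> c" if "0 < t" for t
    proof -
      have "0 < min (J t) (J r)" using that r by (simp add: J_pos)
      then have "\<beta> * min (J t) (J r) \<le> b * (A * r powr (- d - \<alpha>))"
        using A(2)[OF r] \<beta> b by (intro mult_mono) auto
      then show ?thesis unfolding rem_def c_def .
    qed
    have k0: "0 \<le> rem \<beta> r (len (v - u))" "rem \<beta> r (len (v - u)) \<le> c" if "u \<noteq> v" for u v :: "int ^ 'n"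
    proof -
      have "0 < len (v - u)" using that by (intro len_pos) auto
      then show "0 \<le> rem \<beta> r (len (v - u))" "rem \<beta> r (len (v - u)) \<le> c" using nn(3) remle unfolding nn_def by auto
    qed
    have f0: "0 \<le> ?f v" and g0: "0 \<le> ?g v" for v by (auto intro: tau_nonneg nn)
    have "link_prob F (radial (full \<beta>)) 0 x \<le> ?f x +
      (\<Sum>u\<in>F. \<Sum>v\<in>F - {u}. ?f u * rem \<beta> r (len (v - u)) * ?g v)"
      using link_prob_superpose[OF nn(1,3) F, of x] unfolding full_eq_cut_plus_rem[symmetric] .
    also have "(\<Sum>u\<in>F. \<Sum>v\<in>F - {u}. ?f u * rem \<beta> r (len (v - u)) * ?g v)
      \<le> c * (sum ?f {u \<in> F. False} * sum ?g F) + c * (sum ?f F * sum ?g F)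
        + (\<Sum>u\<in>F. ?f u * (\<Sum>v\<in>{v \<in> F - {u}. False}. rem \<beta> r (len (v - u)) * ?g v))"
      by (rule sum_split_bound[OF F f0 g0 k0 k0(2) c0 c0])
    also have "\<dots> = c * (sum ?f F * sum ?g F)" by simp
    also have "\<dots> \<le> c * (?\<chi> * ?\<chi>)"
    proof (intro mult_left_mono mult_mono c0)
      show "sum ?f F \<le> ?\<chi>" using sum_tau_le_chi[OF fin_chi_cut_sub F, of \<beta> r] chi_cut_le_full[OF \<beta>, of r] \<beta> r by simp
      show "sum ?g F \<le> ?\<chi>" by (rule sum_tau_reflect_le_chi[OF nn(2) subcritical[OF \<beta>] F])
    qed (use chi_full_ge_1[OF \<beta>] sum_nonneg[of F ?g] g0 in auto)
    also have "\<dots> = b * A * (r powr (- d - \<alpha>) * (r powr \<alpha> * r powr \<alpha>))" unfolding c_def r_def xi_powr[OF \<beta>] by simp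
    also have "r powr (- d - \<alpha>) * (r powr \<alpha> * r powr \<alpha>) = r powr (\<alpha> - d)" by (simp add: powr_add[symmetric])
    also have "?f x \<le> tau (cut b r) x" using \<beta> r by (intro tau_cut_le_b) auto
    finally show "link_prob F (radial (full \<beta>)) 0 x \<le> tau (cut b (xi \<beta>)) x + b * A * xi \<beta> powr (\<alpha> - d)"
      unfolding r_def by simp
  qed (use \<beta> in auto)
  moreover have "0 < b * A" using b A by simp
  ultimately show ?thesis using that by blast
qed

lemma tau_full_le_near:
  obtains C where "0 < C" "\<And>\<beta> x. 0 < \<beta> \<Longrightarrow> \<beta> < b \<Longrightarrow> x \<noteq> 0 \<Longrightarrow> len x \<le> xi \<beta> \<Longrightarrow>
    tau (full \<beta>) x \<le> C * len x powr (\<alpha> - d)"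
proof (cases "\<alpha> < d")
  case True
  obtain C1 where C1: "0 < C1" "\<And>\<beta> x. 0 < \<beta> \<Longrightarrow> \<beta> < b \<Longrightarrow> tau (full \<beta>) x \<le> tau (cut b (xi \<beta>)) x + C1 * xi \<beta> powr (\<alpha> - d)"
    by (rule tau_full_le_one_jump) blast
  obtain C2 where C2: "0 < C2" "\<And>r x. 1 \<le> r \<Longrightarrow> x \<noteq> 0 \<Longrightarrow> tau (cut b r) x \<le> C2 * len x powr (\<alpha> - d)"
    by (rule tau_cut_le_near[OF True]) blast
  have "tau (full \<beta>) x \<le> (C2 + C1) * len x powr (\<alpha> - d)"
    if \<beta>: "0 < \<beta>" "\<beta> < b" and x: "x \<noteq> 0" "len x \<le> xi \<beta>" for \<beta> x
  proof -
    have "xi \<beta> powr (\<alpha> - d) \<le> len x powr (\<alpha> - d)" using x True len_pos[OF x(1)] by (intro powr_mono2') auto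
    then have "C1 * xi \<beta> powr (\<alpha> - d) \<le> C1 * len x powr (\<alpha> - d)" using C1(1) by (intro mult_left_mono) auto
    then show ?thesis using C1(2)[OF \<beta>, of x] C2(2)[OF xi_ge_1[OF \<beta>] x(1)] by (simp add: distrib_right)
  qed
  then show ?thesis using that[of "C2 + C1"] C1(1) C2(1) by simp
next
  \<comment> \<open>For \<alpha> at least \<open>d\<close> the claimed bound is at least a positive
    constant, because nonzero lattice points have length at least \<open>s\<close>.\<close>
  case False
  obtain s where s: "0 < s" "\<And>x. x \<noteq> 0 \<Longrightarrow> s \<le> len x" by (rule min_len) blast
  have "tau (full \<beta>) x \<le> s powr (d - \<alpha>) * len x powr (\<alpha> - d)" if \<beta>: "0 < \<beta>" and x: "x \<noteq> 0" for \<beta> x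
  proof -
    have "s powr (\<alpha> - d) \<le> len x powr (\<alpha> - d)" using s(2)[OF x] s(1) False by (intro powr_mono2) auto
    then have "s powr (d - \<alpha>) * s powr (\<alpha> - d) \<le> s powr (d - \<alpha>) * len x powr (\<alpha> - d)" by (intro mult_left_mono) auto
    moreover have "s powr (d - \<alpha>) * s powr (\<alpha> - d) = 1" using s(1) by (simp add: powr_add[symmetric])
    moreover have "tau (full \<beta>) x \<le> 1" using \<beta> by (intro tau_le_1 nn_full) simp
    ultimately show ?thesis by linarith
  qed
  then show ?thesis using that[of "s powr (d - \<alpha>)"] s(1) by simp
qed

lemma powr_neg_eq: "r powr (- d - \<alpha>) = inverse (r powr (d + \<alpha>))"
proof -
  have "- d - \<alpha> = - (d + \<alpha>)" by simp
  then show ?thesis by (simp only: powr_minus)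
qed

lemma third_powr:
  assumes "0 < R"
  shows "(R / 3) powr (- d - \<alpha>) = R powr (- d - \<alpha>) * 3 powr (d + \<alpha>)"
  unfolding powr_neg_eq using assms by (simp only: powr_divide) (simp add: divide_inverse)

text \<open>Induction over the scales \<open>3\<^sup>n \<xi>\<^sup>*\<close> with the cut-off at \<open>K \<xi>\<^sup>*\<close>: the first edge not
  in the cut-off kernel starts far from the origin, or it ends at distance at least \<open>\<parallel>x\<parallel> / 3\<close>
  from \<open>x\<close>, or its length is at least \<open>\<parallel>x\<parallel> / 3\<close>.  If \<open>K\<close> is large, then the induction hypothesis
  makes the second contribution at most half of the claimed bound.\<close>

lemma tau_full_le_far:
  obtains C where "0 < C" "\<And>\<beta> x. 0 < \<beta> \<Longrightarrow> \<beta> < b \<Longrightarrow> xi \<beta> \<le> len x \<Longrightarrow>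
    tau (full \<beta>) x \<le> C * (xi \<beta> powr (2 * \<alpha>) * len x powr (- d - \<alpha>))"
proof -
  have p0: "0 < d + \<alpha>" using d_ge_1 \<alpha> by simp
  obtain A where A: "0 < A" "\<And>r. 1 / 3 \<le> r \<Longrightarrow> J r \<le> A * r powr (- d - \<alpha>)" by (rule J_le[of "1 / 3"]) auto
  obtain A2 where A2: "0 < A2" "\<And>r G. 1 \<le> r \<Longrightarrow> finite G \<Longrightarrow> 0 \<notin> G \<Longrightarrow>
    (\<Sum>v\<in>G. min (J (len v)) (J r)) \<le> A2 * r powr (- \<alpha>)" by (rule sum_truncated_kernel) blast
  obtain C1 where C1: "0 < C1" "\<And>r x. 1 \<le> r \<Longrightarrow> x \<noteq> 0 \<Longrightarrow>
    tau (cut b r) x \<le> C1 * r powr (2 * \<alpha> + 1) * len x powr (- d - \<alpha> - 1)" by (rule tau_cut_le) blast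
  obtain C2 where C2: "0 < C2" "\<And>\<beta> x. 0 < \<beta> \<Longrightarrow> \<beta> < b \<Longrightarrow> tau (full \<beta>) x \<le> tau (cut b (xi \<beta>)) x + C2 * xi \<beta> powr (\<alpha> - d)"
    by (rule tau_full_le_one_jump) blast
  obtain M where M: "0 < M" "\<And>r. 1 \<le> r \<Longrightarrow> X r \<le> M * r powr \<alpha>" by (rule X_le_powr) blast
  obtain T where T: "0 < T" "\<And>r s G. 1 \<le> r \<Longrightarrow> 0 < s \<Longrightarrow> finite G \<Longrightarrow> (\<And>x. x \<in> G \<Longrightarrow> s \<le> len x) \<Longrightarrow>
      (\<Sum>x\<in>G. tau (cut b r) x) \<le> T * (r / s) powr (d + \<alpha>) * X r"
    by (rule cut_tailE[OF p0]; rule that; blast)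
  let ?E = "3 powr (d + \<alpha>) :: real"
  have E: "1 \<le> ?E" using p0 by (simp add: ge_one_powr_ge_zero)
  \<comment> \<open>Makes the feedback factor of the induction, removed weight per vertex times the
    susceptibility times the loss \<open>?E\<close> per scale, at most 1/2.\<close>
  define K where "K = max 1 ((2 * b * A2 * ?E) powr (1 / \<alpha>))"
  have K1: "1 \<le> K" by (simp add: K_def)
  have K: "b * A2 * K powr (- \<alpha>) * ?E \<le> 1 / 2"
  proof -
    have pos: "0 < 2 * b * A2 * ?E" using b A2 by simp
    have "((2 * b * A2 * ?E) powr (1 / \<alpha>)) powr \<alpha> \<le> K powr \<alpha>" using \<alpha> by (intro powr_mono2) (auto simp: K_def)
    then have "2 * b * A2 * ?E \<le> K powr \<alpha>" using pos \<alpha> by (simp add: powr_powr)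
    then show ?thesis using K1 by (simp add: powr_minus field_simps)
  qed
  \<comment> \<open>The three summands belong to the cut-off two-point function at \<open>x\<close>,
    to a long first piece, and to a long edge.\<close>
  define D where "D = C1 * K powr (2 * \<alpha> + 1) + b * A * K powr (- d - \<alpha>) * (T * (3 * K) powr (d + \<alpha>) * M * K powr \<alpha>) + b * A * ?E"
  have D: "0 < D" unfolding D_def using b A C1 T M K1 by (intro add_pos_pos mult_pos_pos) auto
  define C where "C = max (2 * D) (C1 + C2)"
  have C0: "0 < C" "2 * D \<le> C" "C1 + C2 \<le> C" using D by (auto simp: C_def)
  have claim: "\<forall>x. 3 ^ n * xi \<beta> \<le> len x \<longrightarrow> tau (full \<beta>) x \<le> C * (xi \<beta> powr (2 * \<alpha>) * (3 ^ n * xi \<beta>) powr (- d - \<alpha>))"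
    if \<beta>: "0 < \<beta>" "\<beta> < b" for n \<beta>
  proof (induction n)
    case 0
    show ?case
    proof (intro allI impI)
      fix x assume x: "3 ^ 0 * xi \<beta> \<le> len x"
      have \<xi>: "1 \<le> xi \<beta>" by (rule xi_ge_1[OF \<beta>])
      have x0: "x \<noteq> 0" "xi \<beta> \<le> len x" using x \<xi> by auto
      have e1: "xi \<beta> powr (2 * \<alpha> + 1) * xi \<beta> powr (- d - \<alpha> - 1) = xi \<beta> powr (\<alpha> - d)" by (simp add: powr_add[symmetric])
      have e2: "xi \<beta> powr (2 * \<alpha>) * xi \<beta> powr (- d - \<alpha>) = xi \<beta> powr (\<alpha> - d)" by (simp add: powr_add[symmetric])
      have "tau (cut b (xi \<beta>)) x \<le> C1 * xi \<beta> powr (2 * \<alpha> + 1) * len x powr (- d - \<alpha> - 1)" by (rule C1(2)[OF \<xi> x0(1)])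
      also have "\<dots> \<le> C1 * xi \<beta> powr (2 * \<alpha> + 1) * xi \<beta> powr (- d - \<alpha> - 1)"
        using C1(1) x0 \<xi> p0 by (intro mult_left_mono powr_mono2') auto
      also have "\<dots> = C1 * xi \<beta> powr (\<alpha> - d)" unfolding mult.assoc e1 ..
      finally have "tau (full \<beta>) x \<le> (C1 + C2) * xi \<beta> powr (\<alpha> - d)" using C2(2)[OF \<beta>, of x] by (simp add: distrib_right)
      also have "\<dots> \<le> C * xi \<beta> powr (\<alpha> - d)" using C0(3) by (rule mult_right_mono) simp
      finally show "tau (full \<beta>) x \<le> C * (xi \<beta> powr (2 * \<alpha>) * (3 ^ 0 * xi \<beta>) powr (- d - \<alpha>))" by (simp add: e2)
    qed
  next
    case (Suc n)
    show ?case
    proof (intro allI impI)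
      fix x assume x: "3 ^ Suc n * xi \<beta> \<le> len x"
      define \<xi> where "\<xi> = xi \<beta>"
      have \<xi>: "1 \<le> \<xi>" unfolding \<xi>_def by (rule xi_ge_1[OF \<beta>])
      define r where "r = K * \<xi>"
      have r: "1 \<le> r" unfolding r_def using K1 \<xi> by (metis mult_mono' mult_1 zero_le_one)
      define R where "R = len x"
      let ?\<chi> = "chi (full \<beta>)"
      have \<chi>: "1 \<le> ?\<chi>" "?\<chi> = \<xi> powr \<alpha>" using chi_full_ge_1[OF \<beta>] xi_powr[OF \<beta>] by (auto simp: \<xi>_def)
      have "(3 :: real) * 1 \<le> 3 * 3 ^ n" by (intro mult_left_mono) auto
      then have "3 * \<xi> \<le> 3 ^ Suc n * \<xi>" using \<xi> by (intro mult_right_mono) auto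
      moreover have R1: "3 ^ Suc n * \<xi> \<le> R" unfolding R_def \<xi>_def by (rule x)
      ultimately have R: "3 ^ Suc n * \<xi> \<le> R" "\<xi> \<le> R" "1 / 3 \<le> R / 3" "0 < R" using \<xi> by linarith+
      have x0: "x \<noteq> 0" using R by (auto simp: R_def)
      define q where "q = C * (\<xi> powr (2 * \<alpha>) * (3 ^ n * \<xi>) powr (- d - \<alpha>))"
      have q0: "0 \<le> q" unfolding q_def using C0 by simp
      have IH: "tau (full \<beta>) y \<le> q" if "3 ^ n * \<xi> \<le> len y" for y using Suc that unfolding q_def \<xi>_def by blast
      let ?f = "tau (cut \<beta> r)" and ?g = "\<lambda>v. tau (full \<beta>) (x - v)"
      let ?P = "\<lambda>u. R / 3 \<le> len u" and ?Q = "\<lambda>v. R / 3 \<le> len (x - v)"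
      define c1 where "c1 = b * (A * r powr (- d - \<alpha>))"
      define c2 where "c2 = b * (A * (R / 3) powr (- d - \<alpha>))"
      have c0: "0 \<le> c1" "0 \<le> c2" unfolding c1_def c2_def using b A by auto
      have nn: "nn (cut \<beta> r)" "nn (full \<beta>)" "nn (rem \<beta> r)" using \<beta> r by (auto intro: nn_cut nn_full nn_rem)
      have rem_le: "rem \<beta> r t \<le> b * J t" "rem \<beta> r t \<le> b * J r" if "0 < t" for t
        unfolding rem_def using that \<beta> b r J_pos[of t] J_pos[of r] by (auto intro!: mult_mono)
      have k0: "0 \<le> rem \<beta> r (len (v - u))" "rem \<beta> r (len (v - u)) \<le> c1" if "u \<noteq> v" for u v :: "int ^ 'n"
      proof -
        have l: "0 < len (v - u)" using that by (intro len_pos) auto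
        then show "0 \<le> rem \<beta> r (len (v - u))" using nn(3) unfolding nn_def by auto
        have "rem \<beta> r (len (v - u)) \<le> b * J r" using rem_le l by blast
        also have "\<dots> \<le> c1" unfolding c1_def using b r A(2)[of r] by (intro mult_left_mono) auto
        finally show "rem \<beta> r (len (v - u)) \<le> c1" .
      qed
      have k2: "rem \<beta> r (len (v - u)) \<le> c2" if "u \<noteq> v" "\<not> ?P u" "\<not> ?Q v" for u v
      proof -
        have l: "0 < len (v - u)" using that by (intro len_pos) auto
        have "R \<le> len (x - v) + len (v - u) + len u"
          using len_triangle3[of x 0 v] len_triangle3[of v 0 u] by (simp add: R_def)
        then have "R / 3 \<le> len (v - u)" using that by linarith
        then have "J (len (v - u)) \<le> J (R / 3)" using R by (intro J_anti) auto
        also have "\<dots> \<le> A * (R / 3) powr (- d - \<alpha>)" using R by (intro A(2)) auto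
        finally have "b * J (len (v - u)) \<le> c2" unfolding c2_def using b by (intro mult_left_mono) auto
        then show ?thesis using rem_le(1)[OF l] by linarith
      qed
      have f0: "0 \<le> ?f v" and g0: "0 \<le> ?g v" for v by (auto intro: tau_nonneg nn)
      \<comment> \<open>Passing from \<open>3 ^ n\<close> to \<open>3 ^ Suc n\<close> divides the
        power by \<open>?E\<close>, so \<open>q / ?E\<close> is the claimed bound at the new scale.
        The other term is at most half of it because \<open>2 * D \<le> C\<close>.\<close>
      have "tau (full \<beta>) x \<le> D * (\<xi> powr (2 * \<alpha>) * R powr (- d - \<alpha>)) + 1 / 2 * (q / ?E)"
      proof (rule tau_le_of_link_prob[OF _ nn(2)])
        fix F :: "(int ^ 'n) set" assume F: "finite F"
        have sf: "sum ?f F \<le> ?\<chi>" using sum_tau_le_chi[OF fin_chi_cut_sub F, of \<beta> r] chi_cut_le_full[OF \<beta>, of r] \<beta> r by simp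
        have sg: "sum ?g F \<le> ?\<chi>" by (rule sum_tau_reflect_le_chi[OF nn(2) subcritical[OF \<beta>] F])
        have s0: "0 \<le> sum ?f F" "0 \<le> sum ?g F" using f0 g0 by (auto intro: sum_nonneg)
        have link: "link_prob F (radial (full \<beta>)) 0 x \<le> ?f x +
          (\<Sum>u\<in>F. \<Sum>v\<in>F - {u}. ?f u * rem \<beta> r (len (v - u)) * ?g v)"
          using link_prob_superpose[OF nn(1,3) F, of x] unfolding full_eq_cut_plus_rem[symmetric] .
        have split: "(\<Sum>u\<in>F. \<Sum>v\<in>F - {u}. ?f u * rem \<beta> r (len (v - u)) * ?g v)
          \<le> c1 * (sum ?f {u \<in> F. ?P u} * sum ?g F) + c2 * (sum ?f F * sum ?g F)
            + (\<Sum>u\<in>F. ?f u * (\<Sum>v\<in>{v \<in> F - {u}. ?Q v}. rem \<beta> r (len (v - u)) * ?g v))"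
          by (rule sum_split_bound[OF F f0 g0 k0 k2 c0])
        have t0: "?f x \<le> C1 * K powr (2 * \<alpha> + 1) * (\<xi> powr (2 * \<alpha>) * R powr (- d - \<alpha>))"
        proof -
          have "?f x \<le> tau (cut b r) x" using \<beta> r by (intro tau_cut_le_b) auto
          also have "\<dots> \<le> C1 * r powr (2 * \<alpha> + 1) * R powr (- d - \<alpha> - 1)" unfolding R_def by (rule C1(2)[OF r x0])
          also have "\<dots> = C1 * K powr (2 * \<alpha> + 1) * (\<xi> powr (2 * \<alpha>) * R powr (- d - \<alpha>)) * (\<xi> / R)"
            unfolding r_def using K1 \<xi> R by (simp add: powr_mult powr_add powr_diff field_simps)
          also have "\<dots> \<le> C1 * K powr (2 * \<alpha> + 1) * (\<xi> powr (2 * \<alpha>) * R powr (- d - \<alpha>)) * 1"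
            using R C1(1) by (intro mult_left_mono mult_nonneg_nonneg) auto
          finally show ?thesis by simp
        qed
        have t1: "c1 * (sum ?f {u \<in> F. ?P u} * sum ?g F)
            \<le> b * A * K powr (- d - \<alpha>) * (T * (3 * K) powr (d + \<alpha>) * M * K powr \<alpha>) * (\<xi> powr (2 * \<alpha>) * R powr (- d - \<alpha>))"
        proof -
          have "sum ?f {u \<in> F. ?P u} \<le> sum (tau (cut b r)) {u \<in> F. ?P u}"
            using \<beta> r by (intro sum_mono tau_cut_le_b) auto
          also have "\<dots> \<le> T * (r / (R / 3)) powr (d + \<alpha>) * X r" using F R r by (intro T(2)) auto
          also have "\<dots> \<le> T * (r / (R / 3)) powr (d + \<alpha>) * (M * r powr \<alpha>)"
            using T(1) M(2)[OF r] by (intro mult_left_mono) auto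
          finally have "c1 * (sum ?f {u \<in> F. ?P u} * sum ?g F) \<le> c1 * ((T * (r / (R / 3)) powr (d + \<alpha>) * (M * r powr \<alpha>)) * ?\<chi>)"
            using sg s0 c0 T M by (intro mult_left_mono mult_mono) auto
          also have "r / (R / 3) = (3 * K) * (\<xi> / R)" by (simp add: r_def)
          also have "c1 * ((T * ((3 * K) * (\<xi> / R)) powr (d + \<alpha>) * (M * r powr \<alpha>)) * ?\<chi>)
              = b * A * K powr (- d - \<alpha>) * (T * (3 * K) powr (d + \<alpha>) * M * K powr \<alpha>) *
                ((\<xi> powr (- d - \<alpha>) * \<xi> powr (d + \<alpha>) * \<xi> powr \<alpha> * \<xi> powr \<alpha>) * R powr (- d - \<alpha>))"
          proof -
            have "((3 * K) * (\<xi> / R)) powr (d + \<alpha>) = (3 * K) powr (d + \<alpha>) * (\<xi> powr (d + \<alpha>) * R powr (- d - \<alpha>))"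
            proof -
              have "0 \<le> 3 * K" "0 \<le> \<xi>" "0 \<le> R" "0 \<le> \<xi> / R" using K1 \<xi> R by auto
              then have "((3 * K) * (\<xi> / R)) powr (d + \<alpha>) = (3 * K) powr (d + \<alpha>) * (\<xi> powr (d + \<alpha>) / R powr (d + \<alpha>))"
                by (simp only: powr_mult[of "3 * K" "\<xi> / R"] powr_divide[of \<xi> R])
              then show ?thesis by (simp only: powr_neg_eq divide_inverse)
            qed
            moreover have "r powr t = K powr t * \<xi> powr t" for t unfolding r_def using K1 \<xi> by (simp add: powr_mult)
            moreover have "b * (A * (k1 * x1)) * (T * (k2 * (x2 * R')) * (M * (k3 * x3)) * x3) =
              b * A * k1 * (T * k2 * M * k3) * (x1 * x2 * x3 * x3 * R')" for k1 k2 k3 x1 x2 x3 R' :: real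
              by (simp add: mult_ac)
            ultimately show ?thesis unfolding c1_def \<chi>(2) by presburger
          qed
          also have "\<xi> powr (- d - \<alpha>) * \<xi> powr (d + \<alpha>) * \<xi> powr \<alpha> * \<xi> powr \<alpha> = \<xi> powr (2 * \<alpha>)"
            by (simp add: powr_add[symmetric])
          finally show ?thesis .
        qed
        have t2: "c2 * (sum ?f F * sum ?g F) \<le> b * A * ?E * (\<xi> powr (2 * \<alpha>) * R powr (- d - \<alpha>))"
        proof -
          have "c2 * (sum ?f F * sum ?g F) \<le> c2 * (?\<chi> * ?\<chi>)" using sf sg s0 c0 \<chi> by (intro mult_left_mono mult_mono) auto
          also have "\<dots> = b * A * ?E * (\<xi> powr (2 * \<alpha>) * R powr (- d - \<alpha>))"
          proof -
            have "(R / 3) powr (- d - \<alpha>) = R powr (- d - \<alpha>) * ?E"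
              using R by (simp add: third_powr)
            moreover have "?\<chi> * ?\<chi> = \<xi> powr (2 * \<alpha>)" unfolding \<chi>(2) by (simp add: powr_add[symmetric])
            ultimately show ?thesis unfolding c2_def by (simp only: mult_ac)
          qed
          finally show ?thesis .
        qed
        have t3: "(\<Sum>u\<in>F. ?f u * (\<Sum>v\<in>{v \<in> F - {u}. ?Q v}. rem \<beta> r (len (v - u)) * ?g v)) \<le> 1 / 2 * (q / ?E)"
        proof -
          have inner: "(\<Sum>v\<in>{v \<in> F - {u}. ?Q v}. rem \<beta> r (len (v - u)) * ?g v) \<le> b * (A2 * r powr (- \<alpha>)) * q" for u
          proof -
            have "(\<Sum>v\<in>{v \<in> F - {u}. ?Q v}. rem \<beta> r (len (v - u)) * ?g v) \<le> (\<Sum>v\<in>{v \<in> F - {u}. ?Q v}. rem \<beta> r (len (v - u)) * q)"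
            proof (intro sum_mono mult_left_mono)
              fix v assume v: "v \<in> {v \<in> F - {u}. ?Q v}"
              have "3 ^ n * \<xi> \<le> R / 3" using R(1) by simp
              then show "?g v \<le> q" using v by (intro IH) auto
              show "0 \<le> rem \<beta> r (len (v - u))" using v k0(1)[of u v] by auto
            qed
            also have "\<dots> = (\<Sum>y\<in>(\<lambda>v. v - u) ` {v \<in> F - {u}. ?Q v}. rem \<beta> r (len y)) * q"
              unfolding sum_distrib_right[symmetric] by (subst sum.reindex) (auto simp: inj_on_def)
            also have "\<dots> \<le> b * (A2 * r powr (- \<alpha>)) * q"
            proof (rule mult_right_mono[OF _ q0])
              let ?G = "(\<lambda>v. v - u) ` {v \<in> F - {u}. ?Q v}"
              have G: "finite ?G" "0 \<notin> ?G" using F by auto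
              have "(\<Sum>y\<in>?G. rem \<beta> r (len y)) \<le> (\<Sum>y\<in>?G. b * min (J (len y)) (J r))"
              proof (rule sum_mono)
                fix y assume "y \<in> ?G"
                then have "0 < len y" using G(2) by (intro len_pos) auto
                then show "rem \<beta> r (len y) \<le> b * min (J (len y)) (J r)"
                  unfolding rem_def using \<beta> r J_pos[of "len y"] J_pos[of r] by (intro mult_right_mono) auto
              qed
              also have "\<dots> \<le> b * (A2 * r powr (- \<alpha>))"
                unfolding sum_distrib_left[symmetric] using b by (intro mult_left_mono A2(2)[OF r G]) auto
              finally show "(\<Sum>y\<in>?G. rem \<beta> r (len y)) \<le> b * (A2 * r powr (- \<alpha>))" .
            qed
            finally show ?thesis .
          qed
          have "(\<Sum>u\<in>F. ?f u * (\<Sum>v\<in>{v \<in> F - {u}. ?Q v}. rem \<beta> r (len (v - u)) * ?g v))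
              \<le> (\<Sum>u\<in>F. ?f u * (b * (A2 * r powr (- \<alpha>)) * q))"
            using inner f0 by (intro sum_mono mult_left_mono) auto
          also have "\<dots> = sum ?f F * (b * (A2 * r powr (- \<alpha>)) * q)" by (rule sum_distrib_right[symmetric])
          also have "\<dots> \<le> ?\<chi> * (b * (A2 * r powr (- \<alpha>)) * q)" using sf b A2 q0 by (intro mult_right_mono) auto
          also have "\<dots> = (b * A2 * K powr (- \<alpha>) * ?E) * (q / ?E)"
            unfolding \<chi>(2) r_def using K1 \<xi> by (simp add: powr_mult powr_minus field_simps)
          also have "\<dots> \<le> 1 / 2 * (q / ?E)" using K q0 by (intro mult_right_mono) auto
          finally show ?thesis .
        qed
        show "link_prob F (radial (full \<beta>)) 0 x \<le> D * (\<xi> powr (2 * \<alpha>) * R powr (- d - \<alpha>)) + 1 / 2 * (q / ?E)"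
          using link split t0 t1 t2 t3 unfolding D_def by (simp only: distrib_right)
      qed
      moreover have "q / ?E = C * (\<xi> powr (2 * \<alpha>) * (3 ^ Suc n * \<xi>) powr (- d - \<alpha>))"
      proof -
        have "(3 ^ Suc n * \<xi>) powr (- d - \<alpha>) = 3 powr (- d - \<alpha>) * (3 ^ n * \<xi>) powr (- d - \<alpha>)"
          using \<xi> by (simp add: powr_mult)
        also have "3 powr (- d - \<alpha>) = 1 / ?E" using powr_minus[of 3 "d + \<alpha>"] by (simp add: inverse_eq_divide)
        finally show ?thesis unfolding q_def by simp
      qed
      moreover have "D * (\<xi> powr (2 * \<alpha>) * R powr (- d - \<alpha>)) \<le> C / 2 * (\<xi> powr (2 * \<alpha>) * (3 ^ Suc n * \<xi>) powr (- d - \<alpha>))"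
      proof -
        have "R powr (- d - \<alpha>) \<le> (3 ^ Suc n * \<xi>) powr (- d - \<alpha>)"
          by (rule powr_mono2') (use R(1) \<xi> p0 in auto)
        moreover have "D \<le> C / 2" using C0(2) by simp
        ultimately show ?thesis using C0(1) by (intro mult_mono) auto
      qed
      ultimately have "tau (full \<beta>) x \<le> C / 2 * (\<xi> powr (2 * \<alpha>) * (3 ^ Suc n * \<xi>) powr (- d - \<alpha>)) +
          1 / 2 * (C * (\<xi> powr (2 * \<alpha>) * (3 ^ Suc n * \<xi>) powr (- d - \<alpha>)))"
        by (simp only:)
      then show "tau (full \<beta>) x \<le> C * (xi \<beta> powr (2 * \<alpha>) * (3 ^ Suc n * xi \<beta>) powr (- d - \<alpha>))"
        unfolding \<xi>_def by simp
    qed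
  qed
  have "tau (full \<beta>) x \<le> C * ?E * (xi \<beta> powr (2 * \<alpha>) * len x powr (- d - \<alpha>))"
    if \<beta>: "0 < \<beta>" "\<beta> < b" and x: "xi \<beta> \<le> len x" for \<beta> x
  proof -
    have \<xi>: "1 \<le> xi \<beta>" by (rule xi_ge_1[OF \<beta>])
    \<comment> \<open>The scale with
      \<open>3 ^ n * xi \<beta> \<le> len x < 3 ^ Suc n * xi \<beta>\<close>; replacing the scale by
      \<open>len x\<close> costs a factor \<open>?E\<close>.\<close>
    define n where "n = (LEAST n. len x < 3 ^ Suc n * xi \<beta>)"
    obtain m where "len x < 3 ^ m" using real_arch_pow[of 3 "len x"] by auto
    also have "(3 :: real) ^ m * 1 \<le> 3 ^ Suc m * xi \<beta>" using \<xi> by (intro mult_mono power_increasing) auto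
    finally have up: "len x < 3 ^ Suc n * xi \<beta>" unfolding n_def by (intro LeastI) simp
    have low: "3 ^ n * xi \<beta> \<le> len x"
    proof (cases n)
      case (Suc k)
      then have "k < n" by simp
      then have "\<not> len x < 3 ^ Suc k * xi \<beta>" unfolding n_def by (rule not_less_Least)
      then show ?thesis using Suc by simp
    qed (use x in simp)
    have "tau (full \<beta>) x \<le> C * (xi \<beta> powr (2 * \<alpha>) * (3 ^ n * xi \<beta>) powr (- d - \<alpha>))" using claim[OF \<beta>] low by blast
    also have "\<dots> \<le> C * (xi \<beta> powr (2 * \<alpha>) * (len x / 3) powr (- d - \<alpha>))"
      using up \<xi> x p0 C0(1) by (intro mult_left_mono powr_mono2') auto
    also have "(len x / 3) powr (- d - \<alpha>) = ?E * len x powr (- d - \<alpha>)"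
      using \<xi> x by (simp add: third_powr)
    finally show ?thesis by (simp only: mult_ac)
  qed
  moreover have "0 < C * ?E" using C0(1) by simp
  ultimately show ?thesis using that by blast
qed

end

section \<open>Lower bounds on the two-point function\<close>

context lrp_critical
begin

text \<open>For \<open>r\<close> up to the correlation length the cut-off susceptibility is of order
  at least \<open>r powr \<alpha>\<close>. The mass outside a ball is compared with the critical
  cut-off measure, whose tail is at most \<open>T * M / \<Gamma> * r powr \<alpha>\<close>, a small
  multiple of the same power.\<close>

lemma sub_mass: obtains \<eta> \<Gamma> where "0 < \<eta>" "1 \<le> \<Gamma>"
  "\<And>\<beta> r. 0 < \<beta> \<Longrightarrow> \<beta> < b \<Longrightarrow> 1 \<le> r \<Longrightarrow> r \<le> xi \<beta> \<Longrightarrow> \<eta> * r powr \<alpha> \<le> (\<Sum>y\<in>ball_at 0 (\<Gamma> * r). tau (cut \<beta> r) y)"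
proof -
  obtain c where c: "0 < c"
    "\<And>\<beta> r. 0 < \<beta> \<Longrightarrow> \<beta> < b \<Longrightarrow> 1 \<le> r \<Longrightarrow> c * min (chi (full \<beta>)) (r powr \<alpha>) \<le> chi (cut \<beta> r)" by (rule chi_cut_ge) blast
  obtain M where M: "0 < M" "\<And>r. 1 \<le> r \<Longrightarrow> X r \<le> M * r powr \<alpha>" by (rule X_le_powr) blast
  obtain T where T: "0 < T" "\<And>r s G. 1 \<le> r \<Longrightarrow> 0 < s \<Longrightarrow> finite G \<Longrightarrow> (\<And>x. x \<in> G \<Longrightarrow> s \<le> len x) \<Longrightarrow>
      (\<Sum>x\<in>G. tau (cut b r) x) \<le> T * (r / s) powr 1 * X r"
    by (rule cut_tailE[OF zero_less_one]; rule that; blast)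
  define \<Gamma> where "\<Gamma> = max 1 (4 * T * M / c)"
  have \<Gamma>: "1 \<le> \<Gamma>" "T * M / \<Gamma> \<le> c / 4"
  proof -
    show g1: "1 \<le> \<Gamma>" by (simp add: \<Gamma>_def)
    have "4 * T * M / c \<le> \<Gamma>" by (simp add: \<Gamma>_def)
    then show "T * M / \<Gamma> \<le> c / 4" using c(1) g1 by (simp add: field_simps)
  qed
  have "c / 4 * r powr \<alpha> \<le> (\<Sum>y\<in>ball_at 0 (\<Gamma> * r). tau (cut \<beta> r) y)"
    if \<beta>: "0 < \<beta>" "\<beta> < b" and r: "1 \<le> r" "r \<le> xi \<beta>" for \<beta> r
  proof -
    have pos: "0 < r powr \<alpha>" using r by simp
    have "r powr \<alpha> \<le> xi \<beta> powr \<alpha>" using r \<alpha> by (intro powr_mono2) auto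
    then have "min (chi (full \<beta>)) (r powr \<alpha>) = r powr \<alpha>" unfolding xi_powr[OF \<beta>] by simp
    then have "c * r powr \<alpha> \<le> chi (cut \<beta> r)" using c(2)[OF \<beta> r(1)] by simp
    moreover have "c / 2 * r powr \<alpha> < c * r powr \<alpha>" using c(1) pos by simp
    ultimately have lt: "c / 2 * r powr \<alpha> < chi (cut \<beta> r)" by linarith
    obtain G where G: "finite G" "c / 2 * r powr \<alpha> < (\<Sum>x\<in>G. tau (cut \<beta> r) x)"
      by (rule chi_approx[OF fin_chi_cut_sub lt]) (use \<beta> r in auto)
    have nn: "nn (cut \<beta> r)" using \<beta> by (simp add: nn_cut)
    let ?A = "ball_at 0 (\<Gamma> * r)"
    have "(\<Sum>x\<in>G. tau (cut \<beta> r) x) \<le> (\<Sum>x\<in>?A \<union> (G - ?A). tau (cut \<beta> r) x)"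
      using G(1) nn by (intro sum_mono2 finite_UnI finite_ball_at) (auto intro: tau_nonneg)
    also have "\<dots> = (\<Sum>x\<in>?A. tau (cut \<beta> r) x) + (\<Sum>x\<in>G - ?A. tau (cut \<beta> r) x)"
      using G(1) by (intro sum.union_disjoint finite_ball_at) auto
    also have "(\<Sum>x\<in>G - ?A. tau (cut \<beta> r) x) \<le> (\<Sum>x\<in>G - ?A. tau (cut b r) x)"
      using \<beta> r by (intro sum_mono tau_cut_le_b) auto
    also have "(\<Sum>x\<in>G - ?A. tau (cut b r) x) \<le> T * (r / (\<Gamma> * r)) powr 1 * X r"
      using G(1) r \<Gamma> by (intro T(2)) auto
    also have "T * (r / (\<Gamma> * r)) powr 1 * X r = T / \<Gamma> * X r" using r \<Gamma> by simp
    also have "T / \<Gamma> * X r \<le> T / \<Gamma> * (M * r powr \<alpha>)" using T(1) \<Gamma> M(2)[OF r(1)] by (intro mult_left_mono) auto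
    also have "T / \<Gamma> * (M * r powr \<alpha>) = T * M / \<Gamma> * r powr \<alpha>" by simp
    also have "T * M / \<Gamma> * r powr \<alpha> \<le> c / 4 * r powr \<alpha>" using \<Gamma>(2) by (intro mult_right_mono) auto
    finally show ?thesis using G(2) by simp
  qed
  then show ?thesis using that[of "c / 4" \<Gamma>] c(1) \<Gamma>(1) by simp
qed

text \<open>The clusters of 0 and \<open>x\<close> at cut-off \<open>r\<close> are glued in one
  window of radius \<open>\<Lambda> * len x\<close>, which contains the balls carrying their mass.
  The squared typical size is at most of order \<open>len x powr (d + \<alpha>)\<close>, so the cap
  in \<open>link_prob_glue\<close> is comparable with the weight of an edge of length
  \<open>len x\<close>. Keeping \<open>r\<close> free covers both regimes: \<open>r = len x\<close>
  below the correlation length and \<open>r = xi \<beta>\<close> above it.\<close>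

lemma tau_full_ge_large:
  obtains c R0 where "0 < c" "1 \<le> R0" "\<And>\<beta> r x. b / 2 \<le> \<beta> \<Longrightarrow> \<beta> < b \<Longrightarrow> 1 \<le> r \<Longrightarrow> r \<le> xi \<beta> \<Longrightarrow> r \<le> len x \<Longrightarrow> R0 \<le> len x \<Longrightarrow>
    c * (r powr (2 * \<alpha>) * len x powr (- d - \<alpha>)) \<le> tau (full \<beta>) x"
proof -
  obtain \<eta> \<Gamma> where \<eta>: "0 < \<eta>" and \<Gamma>: "1 \<le> \<Gamma>" and mass: "\<And>\<beta> r. 0 < \<beta> \<Longrightarrow> \<beta> < b \<Longrightarrow> 1 \<le> r \<Longrightarrow> r \<le> xi \<beta> \<Longrightarrow>
      \<eta> * r powr \<alpha> \<le> (\<Sum>y\<in>ball_at 0 (\<Gamma> * r). tau (cut \<beta> r) y)" by (rule sub_mass) blast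
  obtain M where M: "0 < M" "\<And>r. 1 \<le> r \<Longrightarrow> X r \<le> M * r powr \<alpha>" by (rule X_le_powr) blast
  obtain v V where V: "0 < v" "0 < V" "\<And>z s. 0 \<le> s \<Longrightarrow> v * s ^ CARD('n) \<le> real (card (ball_at z s))"
    "\<And>z s. 1 \<le> s \<Longrightarrow> real (card (ball_at z s)) \<le> V * s ^ CARD('n)" by (rule card_ball) blast
  obtain a R0 where a: "0 < a" "1 \<le> R0" "\<And>r. R0 \<le> r \<Longrightarrow> a * r powr (- d - \<alpha>) \<le> J r - J (2 * r)" by (rule J_diff_ge) blast
  define \<Lambda> where "\<Lambda> = 1 + \<Gamma>"
  have \<Lambda>: "1 \<le> \<Lambda>" using \<Gamma> by (simp add: \<Lambda>_def)
  define \<kappa>0 where "\<kappa>0 = b / 2 * a * (2 * \<Lambda>) powr (- d - \<alpha>)"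
  define m0 where "m0 = 2 * V * \<Lambda> powr d * M"
  define c0 where "c0 = min \<kappa>0 (1 / m0)"
  have pos: "0 < \<kappa>0" "0 < m0" "0 < c0" unfolding c0_def \<kappa>0_def m0_def using b a V M \<Lambda> by auto
  define c where "c = c0 * (\<eta> / 162)\<^sup>2 / 2"
  have c: "0 < c" unfolding c_def using pos \<eta> by simp
  have "c * (r powr (2 * \<alpha>) * len x powr (- d - \<alpha>)) \<le> tau (full \<beta>) x"
    if \<beta>: "b / 2 \<le> \<beta>" "\<beta> < b" and r: "1 \<le> r" "r \<le> xi \<beta>" "r \<le> len x" and x: "R0 \<le> len x" for \<beta> r x
  proof -
    have \<beta>0: "0 < \<beta>" using \<beta> b by simp
    define R where "R = len x"
    have R: "1 \<le> R" "r \<le> R" "R0 \<le> R" using r x by (auto simp: R_def)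
    define \<kappa> where "\<kappa> = \<kappa>0 * R powr (- d - \<alpha>)"
    have \<kappa>: "0 < \<kappa>" unfolding \<kappa>_def using pos R by simp
    let ?\<phi> = "cut \<beta> r" and ?\<psi> = "rem \<beta> r"
    have nn: "nn ?\<phi>" "nn ?\<psi>" using \<beta>0 r by (auto intro: nn_cut nn_rem)
    have fin: "fin_chi ?\<phi>" using \<beta>0 \<beta> r by (intro fin_chi_cut_sub) auto
    define B where "B = ball_at 0 (\<Lambda> * R)"
    have finB: "finite B" unfolding B_def by (rule finite_ball_at)
    have "1 * R \<le> \<Lambda> * R" using \<Lambda> R by (intro mult_right_mono) auto
    then have \<Lambda>R: "R \<le> \<Lambda> * R" "1 \<le> \<Lambda> * R" using R by linarith+
    have inB: "0 \<in> B" "x \<in> B" unfolding B_def using \<Lambda>R R by (auto simp: R_def)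
    define h where "h = \<eta> * r powr \<alpha>"
    have h: "0 < h" unfolding h_def using \<eta> r by simp
    have massx: "h \<le> (\<Sum>y\<in>B. tau ?\<phi> (y - z))" if z: "len z \<le> R" for z
    proof -
      have "h \<le> (\<Sum>y\<in>ball_at 0 (\<Gamma> * r). tau ?\<phi> y)" unfolding h_def by (rule mass[OF \<beta>0 \<beta>(2) r(1,2)])
      also have "\<dots> = (\<Sum>y\<in>(+) z ` ball_at 0 (\<Gamma> * r). tau ?\<phi> (y - z))"
        by (subst sum.reindex) (auto simp: inj_on_def)
      also have "\<dots> \<le> (\<Sum>y\<in>B. tau ?\<phi> (y - z))"
      proof (rule sum_mono2[OF finB])
        show "(+) z ` ball_at 0 (\<Gamma> * r) \<subseteq> B"
        proof
          fix y assume "y \<in> (+) z ` ball_at 0 (\<Gamma> * r)"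
          then have "len (y - z) \<le> \<Gamma> * r" by auto
          moreover have "\<Gamma> * r \<le> \<Gamma> * R" using \<Gamma> R by (intro mult_left_mono) auto
          moreover have "\<Lambda> * R = R + \<Gamma> * R" by (simp add: \<Lambda>_def distrib_right)
          moreover have "len y \<le> len (y - z) + len z" using len_triangle3[of y 0 z] by simp
          ultimately have "len y \<le> \<Lambda> * R" using z by linarith
          then show "y \<in> B" unfolding B_def by simp
        qed
      qed (auto intro: tau_nonneg nn)
      finally show ?thesis .
    qed
    \<comment> \<open>With a single window, probability 1/2 is enough. The choice
      \<open>k = 2\<close> gives 1/16, below 1/9, and the constant
      \<open>162 = 2 * 3 ^ 4\<close>.\<close>
    have q: "(0 :: real) < 1 / 2" "(1 / 2 :: real) ^ (2 ^ 2) \<le> 1 / 9" by (auto simp: power_divide)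
    have neB: "B \<noteq> {}" using inB by auto
    obtain F and m' :: "nat \<Rightarrow> nat" where F: "finite F" "\<And>i. i \<le> (0::nat) \<Longrightarrow> B \<subseteq> F" "\<And>i. i \<le> 0 \<Longrightarrow> 1 \<le> m' i"
      "\<And>i. i \<le> 0 \<Longrightarrow> 1 / 2 \<le> pprob (edges_in F) (radial ?\<phi>) (\<lambda>S. \<exists>u. m' i \<le> hits B S u)"
      "\<And>i. i \<le> 0 \<Longrightarrow> 1 / 2 * (real (m' i))\<^sup>2 \<le> real (card B) * chi ?\<phi>"
      "\<And>i x. i \<le> 0 \<Longrightarrow> x \<in> B \<Longrightarrow> h \<le> (\<Sum>y\<in>B. tau ?\<phi> (y - x)) \<Longrightarrow>
        h / (2 * 3 ^ (2 + 2)) \<le> pmean (edges_in F) (radial ?\<phi>) (\<lambda>S. real (min (hits B S x) (m' i)))"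
      by (rule finite_window[where b = "\<lambda>_. B" and L = 0 and k = 2, OF nn(1) fin finB neB q h]) blast
    define m where "m = m' 0"
    have m1: "1 \<le> m" unfolding m_def by (rule F(3)) simp
    let ?M = "pmean (edges_in F) (radial ?\<phi>)"
    have hx: "h / 162 \<le> ?M (\<lambda>S. real (min (hits B S z) m))" if "z \<in> B" "len z \<le> R" for z
      using F(6)[of 0 z] massx that by (simp add: m_def)
    have m2: "(real m)\<^sup>2 \<le> m0 * R powr (d + \<alpha>)"
    proof -
      have "chi ?\<phi> \<le> X r" using \<beta>0 \<beta> r cut_mono[of r r \<beta> b]
        by (intro fin_chi_mono(2) nn nn_cut_b fin_cut) auto
      also have "\<dots> \<le> M * R powr \<alpha>"
      proof -
        have "r powr \<alpha> \<le> R powr \<alpha>" using r R \<alpha> by (intro powr_mono2) auto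
        then have "M * r powr \<alpha> \<le> M * R powr \<alpha>" using M(1) by (intro mult_left_mono) auto
        then show ?thesis using M(2)[OF r(1)] by linarith
      qed
      finally have le: "chi ?\<phi> \<le> M * R powr \<alpha>" .
      have "real (card B) \<le> V * (\<Lambda> * R) ^ CARD('n)" unfolding B_def by (rule V(4)[OF \<Lambda>R(2)])
      also have "(\<Lambda> * R) ^ CARD('n) = \<Lambda> powr d * R powr d"
        using \<Lambda> R by (simp add: d_def powr_realpow power_mult_distrib)
      finally have "real (card B) * chi ?\<phi> \<le> (V * (\<Lambda> powr d * R powr d)) * (M * R powr \<alpha>)"
        using le chi_ge_1[OF nn(1) fin] V by (intro mult_mono) auto
      also have "\<dots> = m0 / 2 * R powr (d + \<alpha>)" unfolding m0_def powr_add by simp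
      finally show ?thesis using F(5)[of 0] unfolding m_def by simp
    qed
    have min: "c0 * R powr (- d - \<alpha>) \<le> min \<kappa> (1 / (real m)\<^sup>2)"
    proof -
      have "c0 * R powr (- d - \<alpha>) \<le> \<kappa>" unfolding \<kappa>_def c0_def by (intro mult_right_mono) auto
      moreover have "c0 * R powr (- d - \<alpha>) \<le> 1 / (real m)\<^sup>2"
      proof -
        have "c0 * R powr (- d - \<alpha>) \<le> 1 / m0 * R powr (- d - \<alpha>)" unfolding c0_def by (intro mult_right_mono) auto
        also have "\<dots> = 1 / (m0 * R powr (d + \<alpha>))" unfolding powr_neg_eq by (simp add: divide_inverse)
        also have "\<dots> \<le> 1 / (real m)\<^sup>2" using m2 m1 pos R by (intro divide_left_mono mult_pos_pos) auto
        finally show ?thesis .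
      qed
      ultimately show ?thesis by simp
    qed
    have \<psi>: "\<kappa> \<le> radial ?\<psi> {u, w}" if "u \<in> B" "w \<in> B" "u \<noteq> w" for u w
    proof -
      let ?t = "len (u - w)"
      have t: "0 < ?t" using that by (intro len_pos) auto
      have "?t \<le> len u + len w" using len_triangle3[of u w 0] len_minus[of w] by simp
      then have t2: "?t \<le> 2 * \<Lambda> * R" using that unfolding B_def by simp
      have big: "R0 \<le> 2 * \<Lambda> * R" "r \<le> 2 * \<Lambda> * R" using R \<Lambda>R by linarith+
      have "a * (2 * \<Lambda> * R) powr (- d - \<alpha>) \<le> J (2 * \<Lambda> * R)"
        using a(3)[OF big(1)] J_pos[of "2 * (2 * \<Lambda> * R)"] big a(2) by auto
      also have "\<dots> \<le> min (J ?t) (J r)" using t t2 big r by (intro min.boundedI J_anti) auto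
      finally have "b / 2 * (a * (2 * \<Lambda> * R) powr (- d - \<alpha>)) \<le> \<beta> * min (J ?t) (J r)"
        using \<beta> b a(1) by (intro mult_mono) auto
      moreover have "\<kappa> = b / 2 * (a * (2 * \<Lambda> * R) powr (- d - \<alpha>))"
        unfolding \<kappa>_def \<kappa>0_def powr_mult by simp
      ultimately show ?thesis using that by (simp add: rem_def)
    qed
    have r\<phi>: "0 \<le> radial ?\<phi> e" "0 \<le> radial ?\<psi> e" for e using nn_radial nn by auto
    have "c * (r powr (2 * \<alpha>) * R powr (- d - \<alpha>)) = c0 * R powr (- d - \<alpha>) * (h / 162 * (h / 162)) / 2"
    proof -
      have "h / 162 * (h / 162) = (\<eta> / 162)\<^sup>2 * r powr (2 * \<alpha>)"
        unfolding h_def power2_eq_square mult_2 powr_add by simp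
      then show ?thesis unfolding c_def by simp
    qed
    also have "\<dots> \<le> min \<kappa> (1 / (real m)\<^sup>2) *
        (?M (\<lambda>S. real (min (hits B S 0) m)) * ?M (\<lambda>S. real (min (hits B S x) m))) / 2"
      using h \<kappa> hx[OF inB(1)] hx[OF inB(2)] R
      by (intro divide_right_mono mult_mono min mult_nonneg_nonneg) (auto simp: R_def)
    also have "\<dots> \<le> link_prob F (\<lambda>e. radial ?\<phi> e + radial ?\<psi> e) 0 x"
      using F(1) F(2)[of 0] r\<phi> \<kappa> \<psi> m1 by (intro link_prob_glue) auto
    also have "\<dots> \<le> tau (full \<beta>) x"
      unfolding radial_add[symmetric] full_eq_cut_plus_rem[symmetric]
      using link_prob_le_tau[OF nn_full F(1), of \<beta> 0 x] \<beta>0 by simp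
    finally show ?thesis unfolding R_def .
  qed
  then show ?thesis using that c a(2) by blast
qed

text \<open>The edge between 0 and \<open>x\<close> alone is open with a probability bounded below.
  This covers distances below the range in which the asymptotics of the kernel hold.\<close>

lemma tau_full_ge_small:
  assumes "0 < R"
  obtains c where "0 < c" "\<And>\<beta> x. b / 2 \<le> \<beta> \<Longrightarrow> \<beta> < b \<Longrightarrow> x \<noteq> 0 \<Longrightarrow> len x \<le> R \<Longrightarrow> c \<le> tau (full \<beta>) x"
proof (rule that[of "1 - exp (- (b / 2 * J R))"])
  show "0 < 1 - exp (- (b / 2 * J R))" using b J_pos[OF assms] by simp
  fix \<beta> x assume \<beta>: "b / 2 \<le> \<beta>" "\<beta> < b" and x: "x \<noteq> 0" "len x \<le> R"
  have nn: "nn (full \<beta>)" using \<beta> b by (intro nn_full) simp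
  let ?E = "edges_in {0, x}"
  have "b / 2 * J R \<le> \<beta> * J (len x)"
    using \<beta> b J_anti[of "len x" R] x len_pos[OF x(1)] J_pos[OF assms] by (intro mult_mono) auto
  then have "1 - exp (- (b / 2 * J R)) \<le> 1 - exp (- radial (full \<beta>) {0, x})"
    using x by (simp add: full_def len_minus)
  also have "\<dots> = pprob ?E (radial (full \<beta>)) (\<lambda>S. {0, x} \<in> S)" using x by (intro pprob_edge[symmetric]) auto
  also have "\<dots> \<le> link_prob {0, x} (radial (full \<beta>)) 0 x"
    unfolding link_prob_def using nn_radial[OF nn] by (intro pmean_mono) (auto simp: of_bool_def intro: linked_edge)
  also have "\<dots> \<le> tau (full \<beta>) x" using link_prob_le_tau[OF nn, of "{0, x}" 0 x] by simp
  finally show "1 - exp (- (b / 2 * J R)) \<le> tau (full \<beta>) x" .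
qed

lemma tau_full_ge_near:
  obtains c where "0 < c" "\<And>\<beta> x. b / 2 \<le> \<beta> \<Longrightarrow> \<beta> < b \<Longrightarrow> x \<noteq> 0 \<Longrightarrow> len x \<le> xi \<beta> \<Longrightarrow>
    c * len x powr (\<alpha> - d) \<le> tau (full \<beta>) x"
proof -
  obtain c1 R where c1: "0 < c1" "1 \<le> R" "\<And>\<beta> r x. b / 2 \<le> \<beta> \<Longrightarrow> \<beta> < b \<Longrightarrow> 1 \<le> r \<Longrightarrow> r \<le> xi \<beta> \<Longrightarrow> r \<le> len x \<Longrightarrow> R \<le> len x \<Longrightarrow>
    c1 * (r powr (2 * \<alpha>) * len x powr (- d - \<alpha>)) \<le> tau (full \<beta>) x" by (rule tau_full_ge_large) blast
  have "0 < R" using c1 by simp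
  then obtain c2 where c2: "0 < c2" "\<And>\<beta> x. b / 2 \<le> \<beta> \<Longrightarrow> \<beta> < b \<Longrightarrow> x \<noteq> 0 \<Longrightarrow> len x \<le> R \<Longrightarrow> c2 \<le> tau (full \<beta>) x"
    by (rule tau_full_ge_small) blast
  obtain s where s: "0 < s" "\<And>x. x \<noteq> 0 \<Longrightarrow> s \<le> len x" by (rule min_len) blast
  \<comment> \<open>The sign of \<open>\<alpha> - d\<close> is not fixed, so on the range from
    \<open>s\<close> to \<open>R\<close> the power is bounded by its larger end value.\<close>
  define P where "P = max (s powr (\<alpha> - d)) (R powr (\<alpha> - d))"
  have P: "0 < P" unfolding P_def using s by (simp add: less_max_iff_disj)
  have "min c1 (c2 / P) * len x powr (\<alpha> - d) \<le> tau (full \<beta>) x"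
    if \<beta>: "b / 2 \<le> \<beta>" "\<beta> < b" and x: "x \<noteq> 0" "len x \<le> xi \<beta>" for \<beta> x
  proof (cases "R \<le> len x")
    case True
    have "len x powr (2 * \<alpha>) * len x powr (- d - \<alpha>) = len x powr (\<alpha> - d)" by (simp add: powr_add[symmetric])
    then have "c1 * len x powr (\<alpha> - d) \<le> tau (full \<beta>) x" using c1(3)[OF \<beta> _ x(2) order.refl True] True c1(2) by simp
    moreover have "min c1 (c2 / P) * len x powr (\<alpha> - d) \<le> c1 * len x powr (\<alpha> - d)" by (intro mult_right_mono) auto
    ultimately show ?thesis by linarith
  next
    case False
    have "len x powr (\<alpha> - d) \<le> P"
    proof (cases "d \<le> \<alpha>")
      case True
      then have "len x powr (\<alpha> - d) \<le> R powr (\<alpha> - d)" using False by (intro powr_mono2) auto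
      then show ?thesis unfolding P_def by simp
    next
      case d: False
      then have "len x powr (\<alpha> - d) \<le> s powr (\<alpha> - d)" using s(1) s(2)[OF x(1)] by (intro powr_mono2') auto
      then show ?thesis unfolding P_def by simp
    qed
    then have "min c1 (c2 / P) * len x powr (\<alpha> - d) \<le> c2 / P * P" using P c2(1) by (intro mult_mono) auto
    also have "\<dots> = c2" using P by simp
    also have "\<dots> \<le> tau (full \<beta>) x" using False by (intro c2(2)[OF \<beta> x(1)]) simp
    finally show ?thesis .
  qed
  moreover have "0 < min c1 (c2 / P)" using c1(1) c2(1) P by simp
  ultimately show ?thesis using that by blast
qed

lemma tau_full_ge_far:
  obtains c where "0 < c" "\<And>\<beta> x. b / 2 \<le> \<beta> \<Longrightarrow> \<beta> < b \<Longrightarrow> xi \<beta> \<le> len x \<Longrightarrow>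
    c * (xi \<beta> powr (2 * \<alpha>) * len x powr (- d - \<alpha>)) \<le> tau (full \<beta>) x"
proof -
  obtain c1 R where c1: "0 < c1" "1 \<le> R" "\<And>\<beta> r x. b / 2 \<le> \<beta> \<Longrightarrow> \<beta> < b \<Longrightarrow> 1 \<le> r \<Longrightarrow> r \<le> xi \<beta> \<Longrightarrow> r \<le> len x \<Longrightarrow> R \<le> len x \<Longrightarrow>
    c1 * (r powr (2 * \<alpha>) * len x powr (- d - \<alpha>)) \<le> tau (full \<beta>) x" by (rule tau_full_ge_large) blast
  have R0: "0 < R" using c1 by simp
  then obtain c2 where c2: "0 < c2" "\<And>\<beta> x. b / 2 \<le> \<beta> \<Longrightarrow> \<beta> < b \<Longrightarrow> x \<noteq> 0 \<Longrightarrow> len x \<le> R \<Longrightarrow> c2 \<le> tau (full \<beta>) x"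
    by (rule tau_full_ge_small) blast
  define P where "P = R powr (2 * \<alpha>)"
  have P: "0 < P" unfolding P_def using R0 by simp
  have "min c1 (c2 / P) * (xi \<beta> powr (2 * \<alpha>) * len x powr (- d - \<alpha>)) \<le> tau (full \<beta>) x"
    if \<beta>: "b / 2 \<le> \<beta>" "\<beta> < b" and x: "xi \<beta> \<le> len x" for \<beta> x
  proof -
    have \<xi>: "1 \<le> xi \<beta>" using \<beta> b by (intro xi_ge_1) auto
    have x0: "x \<noteq> 0" using x \<xi> by auto
    let ?p = "xi \<beta> powr (2 * \<alpha>) * len x powr (- d - \<alpha>)"
    show ?thesis
    proof (cases "R \<le> len x")
      case True
      have "min c1 (c2 / P) * ?p \<le> c1 * ?p" by (intro mult_right_mono) auto
      then show ?thesis using c1(3)[OF \<beta> \<xi> order.refl x True] by linarith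
    next
      case False
      have "xi \<beta> powr (2 * \<alpha>) \<le> P" unfolding P_def using False x \<xi> \<alpha> by (intro powr_mono2) auto
      moreover have "len x powr (- d - \<alpha>) \<le> 1" unfolding powr_neg_eq
        using x \<xi> d_ge_1 \<alpha> by (intro inverse_le_1_iff[THEN iffD2] disjI2 ge_one_powr_ge_zero) auto
      ultimately have "?p \<le> P * 1" using P by (intro mult_mono) auto
      then have "min c1 (c2 / P) * ?p \<le> c2 / P * P" using P c2(1) by (intro mult_mono) auto
      also have "\<dots> = c2" using P by simp
      also have "\<dots> \<le> tau (full \<beta>) x" using False by (intro c2(2)[OF \<beta> x0]) simp
      finally show ?thesis .
    qed
  qed
  moreover have "0 < min c1 (c2 / P)" using c1(1) c2(1) P by simp
  ultimately show ?thesis using that by blast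
qed

end

section \<open>The radius of gyration\<close>

context lrp_critical
begin

definition profile_at :: "real \<Rightarrow> real \<Rightarrow> real" where
  "profile_at \<xi> t = t powr (- d + \<alpha>) * max 1 (t / \<xi>) powr (- 2 * \<alpha>)"

lemma profile_near: "0 < t \<Longrightarrow> t \<le> \<xi> \<Longrightarrow> profile_at \<xi> t = t powr (\<alpha> - d)"
  unfolding profile_at_def by (simp add: max_def field_simps)

lemma profile_far:
  assumes "0 < \<xi>" "\<xi> \<le> t"
  shows "profile_at \<xi> t = \<xi> powr (2 * \<alpha>) * t powr (- d - \<alpha>)"
proof -
  have "max 1 (t / \<xi>) = t / \<xi>" using assms by (simp add: field_simps)
  moreover have "(t / \<xi>) powr (- 2 * \<alpha>) = t powr (- 2 * \<alpha>) * \<xi> powr (2 * \<alpha>)"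
    using powr_minus[of \<xi> "2 * \<alpha>"] by (simp only: powr_divide) (simp add: divide_inverse)
  moreover have "t powr (- d + \<alpha>) * t powr (- 2 * \<alpha>) = t powr (- d - \<alpha>)"
  proof -
    have "- d + \<alpha> + - 2 * \<alpha> = - d - \<alpha>" by simp
    then show ?thesis by (simp only: powr_add[symmetric])
  qed
  ultimately show ?thesis unfolding profile_at_def by (simp only: ac_simps)
qed

lemma tau_full_bounds:
  obtains c C where "0 < c" "0 < C"
    "\<And>\<beta> x. b / 2 \<le> \<beta> \<Longrightarrow> \<beta> < b \<Longrightarrow> x \<noteq> 0 \<Longrightarrow> c * profile_at (xi \<beta>) (len x) \<le> tau (full \<beta>) x"
    "\<And>\<beta> x. b / 2 \<le> \<beta> \<Longrightarrow> \<beta> < b \<Longrightarrow> x \<noteq> 0 \<Longrightarrow> tau (full \<beta>) x \<le> C * profile_at (xi \<beta>) (len x)"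
proof -
  obtain c1 where c1: "0 < c1" "\<And>\<beta> x. b / 2 \<le> \<beta> \<Longrightarrow> \<beta> < b \<Longrightarrow> x \<noteq> 0 \<Longrightarrow> len x \<le> xi \<beta> \<Longrightarrow>
    c1 * len x powr (\<alpha> - d) \<le> tau (full \<beta>) x" by (rule tau_full_ge_near) blast
  obtain c2 where c2: "0 < c2" "\<And>\<beta> x. b / 2 \<le> \<beta> \<Longrightarrow> \<beta> < b \<Longrightarrow> xi \<beta> \<le> len x \<Longrightarrow>
    c2 * (xi \<beta> powr (2 * \<alpha>) * len x powr (- d - \<alpha>)) \<le> tau (full \<beta>) x" by (rule tau_full_ge_far) blast
  obtain C1 where C1: "0 < C1" "\<And>\<beta> x. 0 < \<beta> \<Longrightarrow> \<beta> < b \<Longrightarrow> x \<noteq> 0 \<Longrightarrow> len x \<le> xi \<beta> \<Longrightarrow>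
    tau (full \<beta>) x \<le> C1 * len x powr (\<alpha> - d)" by (rule tau_full_le_near) blast
  obtain C2 where C2: "0 < C2" "\<And>\<beta> x. 0 < \<beta> \<Longrightarrow> \<beta> < b \<Longrightarrow> xi \<beta> \<le> len x \<Longrightarrow>
    tau (full \<beta>) x \<le> C2 * (xi \<beta> powr (2 * \<alpha>) * len x powr (- d - \<alpha>))" by (rule tau_full_le_far) blast
  have "min c1 c2 * profile_at (xi \<beta>) (len x) \<le> tau (full \<beta>) x \<and>
      tau (full \<beta>) x \<le> max C1 C2 * profile_at (xi \<beta>) (len x)"
    if \<beta>: "b / 2 \<le> \<beta>" "\<beta> < b" and x: "x \<noteq> 0" for \<beta> x
  proof -
    have \<beta>0: "0 < \<beta>" using \<beta> b by simp
    have \<xi>: "0 < xi \<beta>" using xi_ge_1[OF \<beta>0 \<beta>(2)] by simp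
    let ?p = "profile_at (xi \<beta>) (len x)"
    have p: "0 \<le> ?p" unfolding profile_at_def by simp
    then have le: "min c1 c2 * ?p \<le> c1 * ?p" "min c1 c2 * ?p \<le> c2 * ?p" "C1 * ?p \<le> max C1 C2 * ?p" "C2 * ?p \<le> max C1 C2 * ?p"
      by (auto intro: mult_right_mono)
    show ?thesis
    proof (cases "len x \<le> xi \<beta>")
      case True
      have "?p = len x powr (\<alpha> - d)" using profile_near[OF len_pos[OF x] True] .
      then have "c1 * ?p \<le> tau (full \<beta>) x" "tau (full \<beta>) x \<le> C1 * ?p"
        using c1(2)[OF \<beta> x True] C1(2)[OF \<beta>0 \<beta>(2) x True] by simp_all
      then show ?thesis using le by linarith
    next
      case False
      then have f: "xi \<beta> \<le> len x" by simp
      have "c2 * ?p \<le> tau (full \<beta>) x" "tau (full \<beta>) x \<le> C2 * ?p"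
        using c2(2)[OF \<beta> f] C2(2)[OF \<beta>0 \<beta>(2) f] unfolding profile_far[OF \<xi> f] .
      then show ?thesis using le by linarith
    qed
  qed
  moreover have "0 < min c1 c2" "0 < max C1 C2" using c1(1) c2(1) C1(1) by (simp_all add: less_max_iff_disj)
  ultimately show ?thesis using that by blast
qed

text \<open>Within the correlation length the power is at most \<open>xi \<beta> powr p\<close>, and
  the two-point functions sum to at most the susceptibility. Beyond it the summand decays like
  \<open>len x powr (- (d + \<alpha> - p))\<close>, which is summable exactly because
  \<open>p < \<alpha>\<close>.\<close>

lemma moment_upper:
  assumes p: "0 < p" "p < \<alpha>"
  obtains C where "0 < C" "\<And>\<beta> G. 0 < \<beta> \<Longrightarrow> \<beta> < b \<Longrightarrow> finite G \<Longrightarrow>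
    (\<Sum>x\<in>G. norm (of_lattice x) powr p * tau (full \<beta>) x) \<le> C * (xi \<beta> powr p * chi (full \<beta>))"
proof -
  obtain c0 where c0: "0 < c0" "\<And>v. c0 * norm v \<le> N v" by (rule norm_equiv) blast
  obtain A where A: "0 < A" "\<And>\<beta> x. 0 < \<beta> \<Longrightarrow> \<beta> < b \<Longrightarrow> xi \<beta> \<le> len x \<Longrightarrow>
    tau (full \<beta>) x \<le> A * (xi \<beta> powr (2 * \<alpha>) * len x powr (- d - \<alpha>))" by (rule tau_full_le_far) blast
  have "d < d + \<alpha> - p" using p by simp
  then obtain B where B: "0 < B" "\<And>s G. 1 \<le> s \<Longrightarrow> finite G \<Longrightarrow> (\<And>v. v \<in> G \<Longrightarrow> s < len v) \<Longrightarrow>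
    (\<Sum>v\<in>G. len v powr (- (d + \<alpha> - p))) \<le> B * s powr (d - (d + \<alpha> - p))" by (rule sum_len_powr) (rule that; blast)
  define q where "q = (1 / c0) powr p"
  have q: "0 < q" unfolding q_def using c0 by simp
  have "(\<Sum>x\<in>G. norm (of_lattice x) powr p * tau (full \<beta>) x) \<le> q * (1 + A * B) * (xi \<beta> powr p * chi (full \<beta>))"
    if \<beta>: "0 < \<beta>" "\<beta> < b" and G: "finite G" for \<beta> G
  proof -
    define \<xi> where "\<xi> = xi \<beta>"
    have \<xi>: "1 \<le> \<xi>" unfolding \<xi>_def by (rule xi_ge_1[OF \<beta>])
    have \<chi>: "chi (full \<beta>) = \<xi> powr \<alpha>" unfolding \<xi>_def by (rule xi_powr[OF \<beta>, symmetric])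
    have nn: "nn (full \<beta>)" using \<beta> by (intro nn_full) simp
    let ?t = "tau (full \<beta>)"
    let ?N = "{x \<in> G. len x \<le> \<xi>}" and ?F = "{x \<in> G. \<xi> < len x}"
    have norm: "norm (of_lattice x) powr p \<le> q * len x powr p" for x
    proof -
      have "norm (of_lattice x) \<le> 1 / c0 * len x" using c0(2)[of "of_lattice x"] c0(1) by (simp add: len_def field_simps)
      then have "norm (of_lattice x) powr p \<le> (1 / c0 * len x) powr p" using p by (intro powr_mono2) auto
      then show ?thesis by (simp only: powr_mult q_def)
    qed
    have "(\<Sum>x\<in>G. norm (of_lattice x) powr p * ?t x) \<le> (\<Sum>x\<in>G. q * (len x powr p * ?t x))"
      using norm tau_nonneg[OF nn] unfolding mult.assoc[symmetric] by (intro sum_mono mult_right_mono) auto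
    also have "\<dots> = q * (\<Sum>x\<in>G. len x powr p * ?t x)" by (rule sum_distrib_left[symmetric])
    also have "(\<Sum>x\<in>G. len x powr p * ?t x) \<le> (1 + A * B) * (\<xi> powr p * chi (full \<beta>))"
    proof -
      have near: "(\<Sum>x\<in>?N. len x powr p * ?t x) \<le> \<xi> powr p * chi (full \<beta>)"
      proof -
        have "(\<Sum>x\<in>?N. len x powr p * ?t x) \<le> (\<Sum>x\<in>?N. \<xi> powr p * ?t x)"
          using tau_nonneg[OF nn] p by (intro sum_mono mult_right_mono powr_mono2) auto
        also have "\<dots> = \<xi> powr p * (\<Sum>x\<in>?N. ?t x)" by (rule sum_distrib_left[symmetric])
        also have "\<dots> \<le> \<xi> powr p * chi (full \<beta>)"
          using G by (intro mult_left_mono sum_tau_le_chi subcritical \<beta>) auto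
        finally show ?thesis .
      qed
      have far: "(\<Sum>x\<in>?F. len x powr p * ?t x) \<le> A * B * (\<xi> powr p * chi (full \<beta>))"
      proof -
        have "len x powr p * ?t x \<le> A * \<xi> powr (2 * \<alpha>) * len x powr (- (d + \<alpha> - p))" if x: "x \<in> ?F" for x
        proof -
          have "len x powr p * ?t x \<le> len x powr p * (A * (\<xi> powr (2 * \<alpha>) * len x powr (- d - \<alpha>)))"
            using A(2)[OF \<beta>, of x] x unfolding \<xi>_def by (intro mult_left_mono) auto
          also have "\<dots> = A * \<xi> powr (2 * \<alpha>) * (len x powr p * len x powr (- d - \<alpha>))" by simp
          also have "len x powr p * len x powr (- d - \<alpha>) = len x powr (- (d + \<alpha> - p))"
            by (simp add: powr_add[symmetric] algebra_simps)
          finally show ?thesis .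
        qed
        then have "(\<Sum>x\<in>?F. len x powr p * ?t x) \<le> A * \<xi> powr (2 * \<alpha>) * (\<Sum>x\<in>?F. len x powr (- (d + \<alpha> - p)))"
          unfolding sum_distrib_left by (rule sum_mono)
        also have "\<dots> \<le> A * \<xi> powr (2 * \<alpha>) * (B * \<xi> powr (d - (d + \<alpha> - p)))"
          using A(1) G \<xi> by (intro mult_left_mono B(2)) auto
        also have "\<dots> = A * B * (\<xi> powr (2 * \<alpha>) * \<xi> powr (d - (d + \<alpha> - p)))" by simp
        also have "\<xi> powr (2 * \<alpha>) * \<xi> powr (d - (d + \<alpha> - p)) = \<xi> powr p * chi (full \<beta>)"
          unfolding \<chi> by (simp add: powr_add[symmetric] add.commute)
        finally show ?thesis .
      qed
      have "G = ?N \<union> ?F" by auto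
      then have "(\<Sum>x\<in>G. len x powr p * ?t x) = (\<Sum>x\<in>?N \<union> ?F. len x powr p * ?t x)" by simp
      also have "\<dots> = (\<Sum>x\<in>?N. len x powr p * ?t x) + (\<Sum>x\<in>?F. len x powr p * ?t x)"
        using G by (intro sum.union_disjoint) auto
      finally show ?thesis using near far by (simp add: distrib_right)
    qed
    finally show ?thesis using q unfolding \<xi>_def by (simp add: mult.assoc)
  qed
  moreover have "0 < q * (1 + A * B)" using q A B by (intro mult_pos_pos add_pos_pos) auto
  ultimately show ?thesis using that by blast
qed

text \<open>An annulus at distance of order \<open>xi \<beta>\<close> already has the right moment:
  it contains of order \<open>xi \<beta> powr d\<close> points, each with two-point function of
  order at least \<open>xi \<beta> powr (\<alpha> - d)\<close>.\<close>

lemma moment_lower: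
  assumes p: "0 < p"
  obtains c where "0 < c" "\<And>\<beta>. b / 2 \<le> \<beta> \<Longrightarrow> \<beta> < b \<Longrightarrow> \<exists>G. finite G \<and>
    c * (xi \<beta> powr p * chi (full \<beta>)) \<le> (\<Sum>x\<in>G. norm (of_lattice x) powr p * tau (full \<beta>) x)"
proof -
  obtain c0 where c0: "0 < c0" "\<And>v. N v \<le> c0 * norm v" by (rule norm_equiv) blast
  obtain a where a: "0 < a" "\<And>\<beta> x. b / 2 \<le> \<beta> \<Longrightarrow> \<beta> < b \<Longrightarrow> xi \<beta> \<le> len x \<Longrightarrow>
    a * (xi \<beta> powr (2 * \<alpha>) * len x powr (- d - \<alpha>)) \<le> tau (full \<beta>) x" by (rule tau_full_ge_far) blast
  obtain v V where V: "0 < v" "0 < V" "\<And>z s. 0 \<le> s \<Longrightarrow> v * s ^ CARD('n) \<le> real (card (ball_at z s))"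
    "\<And>z s. 1 \<le> s \<Longrightarrow> real (card (ball_at z s)) \<le> V * s ^ CARD('n)" by (rule card_ball) blast
  \<comment> \<open>Large enough for the outer ball to have at least twice as many points as the
    upper bound for the inner one.\<close>
  define L where "L = max 1 (2 * V / v)"
  have L: "1 \<le> L" by (simp add: L_def)
  have vL: "2 * V \<le> v * L ^ CARD('n)"
  proof -
    have "2 * V / v \<le> L" by (simp add: L_def)
    also have "L \<le> L ^ CARD('n)" using L by (intro self_le_power) auto
    finally show ?thesis using V by (simp add: field_simps)
  qed
  define c where "c = V * ((1 / c0) powr p * (a * L powr (- d - \<alpha>)))"
  have c: "0 < c" unfolding c_def using V c0 a L by (intro mult_pos_pos) auto
  have "\<exists>G. finite G \<and> c * (xi \<beta> powr p * chi (full \<beta>)) \<le> (\<Sum>x\<in>G. norm (of_lattice x) powr p * tau (full \<beta>) x)"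
    if \<beta>: "b / 2 \<le> \<beta>" "\<beta> < b" for \<beta>
  proof -
    define \<xi> where "\<xi> = xi \<beta>"
    have \<beta>0: "0 < \<beta>" using \<beta> b by simp
    have \<xi>: "1 \<le> \<xi>" unfolding \<xi>_def by (rule xi_ge_1[OF \<beta>0 \<beta>(2)])
    have \<chi>: "chi (full \<beta>) = \<xi> powr \<alpha>" unfolding \<xi>_def by (rule xi_powr[OF \<beta>0 \<beta>(2), symmetric])
    let ?G = "ball_at 0 (L * \<xi>) - ball_at 0 \<xi>"
    have fin: "finite ?G" by (intro finite_Diff finite_ball_at)
    have L\<xi>: "1 * \<xi> \<le> L * \<xi>" using L \<xi> by (intro mult_right_mono) auto
    have card: "V * \<xi> powr d \<le> real (card ?G)"
    proof -
      have "2 * V * \<xi> ^ CARD('n) \<le> v * L ^ CARD('n) * \<xi> ^ CARD('n)" using vL \<xi> by (intro mult_right_mono) auto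
      also have "\<dots> = v * (L * \<xi>) ^ CARD('n)" by (simp add: power_mult_distrib)
      also have "\<dots> \<le> real (card (ball_at 0 (L * \<xi>)))" using L \<xi> by (intro V(3)) auto
      finally have "2 * V * \<xi> ^ CARD('n) \<le> real (card (ball_at 0 (L * \<xi>)))" .
      moreover have "real (card (ball_at 0 \<xi>)) \<le> V * \<xi> ^ CARD('n)" by (rule V(4)[OF \<xi>])
      moreover have "real (card (ball_at 0 (L * \<xi>))) - real (card (ball_at 0 \<xi>)) \<le> real (card ?G)"
        using diff_card_le_card_Diff[OF finite_ball_at[of 0 \<xi>], of "ball_at 0 (L * \<xi>)"] by linarith
      ultimately have "V * \<xi> ^ CARD('n) \<le> real (card ?G)" by linarith
      then show ?thesis using \<xi> by (simp add: d_def powr_realpow)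
    qed
    define t where "t = (1 / c0) powr p * \<xi> powr p * (a * (\<xi> powr (2 * \<alpha>) * (L * \<xi>) powr (- d - \<alpha>)))"
    have t0: "0 \<le> t" unfolding t_def using a(1) by simp
    have t: "t \<le> norm (of_lattice x) powr p * tau (full \<beta>) x" if x: "x \<in> ?G" for x
    proof -
      have l: "\<xi> \<le> len x" "len x \<le> L * \<xi>" using x by auto
      have "1 / c0 * \<xi> \<le> norm (of_lattice x)" using c0(2)[of "of_lattice x"] c0(1) l(1) by (simp add: len_def field_simps)
      then have "(1 / c0 * \<xi>) powr p \<le> norm (of_lattice x) powr p" using p c0 \<xi> by (intro powr_mono2) auto
      moreover have "a * (\<xi> powr (2 * \<alpha>) * (L * \<xi>) powr (- d - \<alpha>)) \<le> tau (full \<beta>) x"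
      proof -
        have "(L * \<xi>) powr (- d - \<alpha>) \<le> len x powr (- d - \<alpha>)" using l \<xi> d_ge_1 \<alpha> by (intro powr_mono2') auto
        then have "a * (\<xi> powr (2 * \<alpha>) * (L * \<xi>) powr (- d - \<alpha>)) \<le> a * (\<xi> powr (2 * \<alpha>) * len x powr (- d - \<alpha>))"
          using a(1) by (intro mult_left_mono) auto
        then show ?thesis using a(2)[OF \<beta>, of x] l(1) unfolding \<xi>_def by linarith
      qed
      ultimately show ?thesis unfolding t_def powr_mult[symmetric, of "1 / c0"]
        using a(1) by (intro mult_mono) auto
    qed
    have "c * (\<xi> powr p * chi (full \<beta>)) = V * \<xi> powr d * t"
    proof -
      have "\<xi> powr d * (\<xi> powr (2 * \<alpha>) * \<xi> powr (- d - \<alpha>)) = \<xi> powr \<alpha>" by (simp add: powr_add[symmetric])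
      then have "V * ((1 / c0) powr p * (a * L powr (- d - \<alpha>))) * (\<xi> powr p * \<xi> powr \<alpha>) =
        V * ((1 / c0) powr p * (a * L powr (- d - \<alpha>))) * (\<xi> powr p * (\<xi> powr d * (\<xi> powr (2 * \<alpha>) * \<xi> powr (- d - \<alpha>))))"
        by (simp only:)
      also have "\<dots> = V * \<xi> powr d * t" unfolding t_def powr_mult[of L] by (simp only: ac_simps)
      finally show ?thesis unfolding c_def \<chi> .
    qed
    also have "\<dots> \<le> real (card ?G) * t" using card t0 by (rule mult_right_mono)
    also have "\<dots> = (\<Sum>x\<in>?G. t)" by simp
    also have "\<dots> \<le> (\<Sum>x\<in>?G. norm (of_lattice x) powr p * tau (full \<beta>) x)" using t by (rule sum_mono)
    finally show ?thesis using fin unfolding \<xi>_def by blast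
  qed
  then show ?thesis using that c by blast
qed

section \<open>Translation into extended nonnegative reals\<close>

lemma xi_star_eq:
  assumes "0 < \<beta>" "\<beta> < b"
  shows "xi_star \<alpha> \<beta> (lrp_kernel N J) = ennreal (xi \<beta>)"
  using susceptibility_fin[OF edge_product_full nn_full subcritical] assms chi_full_ge_1[OF assms]
  by (simp add: xi_star_def ennreal_power_def xi_def)

lemma two_point_profile_eq:
  assumes "0 < \<beta>" "\<beta> < b"
  shows "two_point_profile N J \<alpha> \<beta> x y = profile_at (xi \<beta>) (len (x - y))"
proof -
  have "ennreal (len (x - y)) / ennreal (xi \<beta>) = ennreal (len (x - y) / xi \<beta>)"
    using xi_ge_1[OF assms] by (intro divide_ennreal) auto
  moreover have "max 1 (ennreal t) = ennreal (max 1 t)" for t by (simp add: ennreal_1[symmetric] max_def ennreal_le_iff2 del: ennreal_1)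
  ultimately show ?thesis
    unfolding two_point_profile_def profile_at_def xi_star_eq[OF assms] lattice_dist_eq d_def by simp
qed

lemma gyration_radius_le_iff:
  assumes "0 < \<beta>" "\<beta> < b" "0 < p" "0 \<le> c"
  defines "I \<equiv> \<integral>\<^sup>+ x. ennreal (norm (of_lattice x) powr p) * ennreal (tau (full \<beta>) x) \<partial>count_space UNIV"
  shows "gyration_radius p \<beta> (lrp_kernel N J) \<le> ennreal c \<longleftrightarrow> I \<le> ennreal (c powr p * chi (full \<beta>))"
    and "ennreal c \<le> gyration_radius p \<beta> (lrp_kernel N J) \<longleftrightarrow> ennreal (c powr p * chi (full \<beta>)) \<le> I"
proof -
  have \<chi>: "0 < chi (full \<beta>)" using chi_full_ge_1[OF assms(1,2)] by simp
  have eq: "gyration_radius p \<beta> (lrp_kernel N J) = ennreal_power (I / ennreal (chi (full \<beta>))) (1 / p)"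
    unfolding I_def using assms by (intro gyration_radius_eq edge_product_full nn_full subcritical) auto
  show "gyration_radius p \<beta> (lrp_kernel N J) \<le> ennreal c \<longleftrightarrow> I \<le> ennreal (c powr p * chi (full \<beta>))"
    unfolding eq ennreal_power_le_iff[OF assms(3,4)] using \<chi>
    by (cases I) (auto simp: divide_ennreal ennreal_top_divide top_unique field_simps)
  show "ennreal c \<le> gyration_radius p \<beta> (lrp_kernel N J) \<longleftrightarrow> ennreal (c powr p * chi (full \<beta>)) \<le> I"
    unfolding eq ennreal_power_ge_iff[OF assms(3,4)] using \<chi>
    by (cases I) (auto simp: divide_ennreal ennreal_top_divide field_simps)
qed

end

theorem mainTheorem10:
  fixes N :: "real ^ 'n \<Rightarrow> real" and J :: "real \<Rightarrow> real" and \<alpha> :: real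
  defines "\<beta>c \<equiv> enn2real (critical_point (lrp_kernel N J))"
  assumes "\<alpha> > 0"
    and "is_norm N"
    and "regular_profile CARD('n) \<alpha> J"
    and "CL N J"
  shows "(\<exists>c C. 0 < c \<and> 0 < C \<and>
            (\<forall>\<beta> x y. \<beta>c / 2 \<le> \<beta> \<and> \<beta> < \<beta>c \<and> x \<noteq> y \<longrightarrow>
               c * two_point_profile N J \<alpha> \<beta> x y \<le> two_point \<beta> (lrp_kernel N J) x y \<and>
               two_point \<beta> (lrp_kernel N J) x y \<le> C * two_point_profile N J \<alpha> \<beta> x y))
       \<and> (\<forall>p. 0 < p \<and> p < \<alpha> \<longrightarrow>
            (\<exists>c C. 0 < c \<and> 0 < C \<and>
              (\<forall>\<beta>. \<beta>c / 2 \<le> \<beta> \<and> \<beta> < \<beta>c \<longrightarrow>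
                 ennreal c * xi_star \<alpha> \<beta> (lrp_kernel N J) \<le> gyration_radius p \<beta> (lrp_kernel N J) \<and>
                 gyration_radius p \<beta> (lrp_kernel N J) \<le> ennreal C * xi_star \<alpha> \<beta> (lrp_kernel N J))))"
proof (cases "0 < \<beta>c")
  case False
  \<comment> \<open>The range of \<beta> is empty if the critical value is not positive.\<close>
  then have "\<not> (\<beta>c / 2 \<le> \<beta> \<and> \<beta> < \<beta>c)" for \<beta> by linarith
  then show ?thesis by (intro conjI allI impI exI[of _ "1 :: real"]) auto
next
  case True
  interpret lrp N J \<alpha> using assms by unfold_locales auto
  interpret lrp_critical N J \<alpha> \<beta>c by (rule lrp_critical_of_CL[OF \<open>CL N J\<close> _ True]) (simp add: \<beta>c_def)
  have pos: "0 < \<beta>" if "\<beta>c / 2 \<le> \<beta>" for \<beta> using that True by simp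
  show ?thesis
  proof (rule conjI)
    obtain c C where c: "0 < c" "0 < C"
      "\<And>\<beta> x. \<beta>c / 2 \<le> \<beta> \<Longrightarrow> \<beta> < \<beta>c \<Longrightarrow> x \<noteq> 0 \<Longrightarrow> c * profile_at (xi \<beta>) (len x) \<le> tau (full \<beta>) x"
      "\<And>\<beta> x. \<beta>c / 2 \<le> \<beta> \<Longrightarrow> \<beta> < \<beta>c \<Longrightarrow> x \<noteq> 0 \<Longrightarrow> tau (full \<beta>) x \<le> C * profile_at (xi \<beta>) (len x)"
      by (rule tau_full_bounds) blast
    have "c * two_point_profile N J \<alpha> \<beta> x y \<le> two_point \<beta> (lrp_kernel N J) x y \<and>
        two_point \<beta> (lrp_kernel N J) x y \<le> C * two_point_profile N J \<alpha> \<beta> x y"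
      if \<beta>: "\<beta>c / 2 \<le> \<beta>" "\<beta> < \<beta>c" and xy: "x \<noteq> y" for \<beta> x y
    proof -
      have "two_point \<beta> (lrp_kernel N J) x y = tau (full \<beta>) (y - x)"
        using pos[OF \<beta>(1)] by (intro two_point_tau edge_product_full nn_full) auto
      moreover have "y - x \<noteq> 0" using xy by simp
      ultimately show ?thesis
        unfolding two_point_profile_eq[OF pos[OF \<beta>(1)] \<beta>(2)] len_minus_commute[of x y] using c(3,4)[OF \<beta>] by simp
    qed
    then show "\<exists>c C. 0 < c \<and> 0 < C \<and> (\<forall>\<beta> x y. \<beta>c / 2 \<le> \<beta> \<and> \<beta> < \<beta>c \<and> x \<noteq> y \<longrightarrow>
      c * two_point_profile N J \<alpha> \<beta> x y \<le> two_point \<beta> (lrp_kernel N J) x y \<and>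
      two_point \<beta> (lrp_kernel N J) x y \<le> C * two_point_profile N J \<alpha> \<beta> x y)" using c(1,2) by blast
  next
    show "\<forall>p. 0 < p \<and> p < \<alpha> \<longrightarrow> (\<exists>c C. 0 < c \<and> 0 < C \<and> (\<forall>\<beta>. \<beta>c / 2 \<le> \<beta> \<and> \<beta> < \<beta>c \<longrightarrow>
        ennreal c * xi_star \<alpha> \<beta> (lrp_kernel N J) \<le> gyration_radius p \<beta> (lrp_kernel N J) \<and>
        gyration_radius p \<beta> (lrp_kernel N J) \<le> ennreal C * xi_star \<alpha> \<beta> (lrp_kernel N J)))"
    proof (intro allI impI)
      fix p assume "0 < p \<and> p < \<alpha>"
      then have p: "0 < p" "p < \<alpha>" by auto
      obtain C where C: "0 < C" "\<And>\<beta> G. 0 < \<beta> \<Longrightarrow> \<beta> < \<beta>c \<Longrightarrow> finite G \<Longrightarrow>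
        (\<Sum>x\<in>G. norm (of_lattice x) powr p * tau (full \<beta>) x) \<le> C * (xi \<beta> powr p * chi (full \<beta>))"
        by (rule moment_upper[OF p]; rule that; blast)
      obtain c where c: "0 < c" "\<And>\<beta>. \<beta>c / 2 \<le> \<beta> \<Longrightarrow> \<beta> < \<beta>c \<Longrightarrow> \<exists>G. finite G \<and>
        c * (xi \<beta> powr p * chi (full \<beta>)) \<le> (\<Sum>x\<in>G. norm (of_lattice x) powr p * tau (full \<beta>) x)"
        by (rule moment_lower[OF p(1)]; rule that; blast)
      \<comment> \<open>Constants for moments become constants for radii of gyration after taking
        the \<open>p\<close>-th root.\<close>
      have root: "(k powr (1 / p) * xi \<beta>) powr p * chi (full \<beta>) = k * (xi \<beta> powr p * chi (full \<beta>))" if "0 < k" for k \<beta>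
        using that p by (simp add: powr_mult powr_powr)
      have "ennreal (c powr (1 / p)) * xi_star \<alpha> \<beta> (lrp_kernel N J) \<le> gyration_radius p \<beta> (lrp_kernel N J) \<and>
          gyration_radius p \<beta> (lrp_kernel N J) \<le> ennreal (C powr (1 / p)) * xi_star \<alpha> \<beta> (lrp_kernel N J)"
        if \<beta>: "\<beta>c / 2 \<le> \<beta>" "\<beta> < \<beta>c" for \<beta>
      proof -
        have \<beta>0: "0 < \<beta>" by (rule pos[OF \<beta>(1)])
        have nn: "nn (full \<beta>)" using \<beta>0 by (intro nn_full) simp
        have \<xi>: "0 \<le> xi \<beta>" using xi_ge_1[OF \<beta>0 \<beta>(2)] by simp
        let ?I = "\<integral>\<^sup>+ x. ennreal (norm (of_lattice x) powr p) * ennreal (tau (full \<beta>) x) \<partial>count_space UNIV"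
        have "?I \<le> ennreal (C * (xi \<beta> powr p * chi (full \<beta>)))"
          using C(2)[OF \<beta>0 \<beta>(2)] by (intro nn_integral_tau_le[OF nn]) auto
        moreover have "ennreal (c * (xi \<beta> powr p * chi (full \<beta>))) \<le> ?I"
        proof -
          obtain G where G: "finite G"
            "c * (xi \<beta> powr p * chi (full \<beta>)) \<le> (\<Sum>x\<in>G. norm (of_lattice x) powr p * tau (full \<beta>) x)" using c(2)[OF \<beta>] by blast
          have "ennreal (c * (xi \<beta> powr p * chi (full \<beta>))) \<le> ennreal (\<Sum>x\<in>G. norm (of_lattice x) powr p * tau (full \<beta>) x)"
            by (rule ennreal_leI[OF G(2)])
          also have "\<dots> \<le> ?I" by (rule nn_integral_tau_ge[OF nn _ G(1)]) simp
          finally show ?thesis .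
        qed
        ultimately show ?thesis
          unfolding xi_star_eq[OF \<beta>0 \<beta>(2)] using \<xi>
          by (simp add: ennreal_mult[symmetric] gyration_radius_le_iff[OF \<beta>0 \<beta>(2) p(1)] root c(1) C(1))
      qed
      moreover have "0 < c powr (1 / p)" "0 < C powr (1 / p)" using c(1) C(1) by simp_all
      ultimately show "\<exists>c C. 0 < c \<and> 0 < C \<and> (\<forall>\<beta>. \<beta>c / 2 \<le> \<beta> \<and> \<beta> < \<beta>c \<longrightarrow>
        ennreal c * xi_star \<alpha> \<beta> (lrp_kernel N J) \<le> gyration_radius p \<beta> (lrp_kernel N J) \<and>
        gyration_radius p \<beta> (lrp_kernel N J) \<le> ennreal C * xi_star \<alpha> \<beta> (lrp_kernel N J))" by blast
    qed
  qed
qed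

end
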